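(* Let $\beta\in(0,\alpha_{GW})$. Set $\tau:=1-\beta/\alpha_{GW}$ and $C:=2187\pi/(2\alpha_{GW}^2\tau^3)$. There exists a randomized polynomial-time algorithm that, given a graph $G=(V,E)$ on $n$ vertices and a nonzero $w\in\mathbb{R}_+^E$, computes with probability at least $1-2/n$ a nonzero vector $z\in\mathbb{R}_+^E$ and a $\beta$-certificate $(\rho,\mu,S,y,x)$ for $(w,z)$ such that the support of the fractional cut cover $y$ has size at most $\lceil C\ln(n)\rceil$.
   Context: Graphs are finite and simple. For $S\subseteq V$, $\delta(S)\subseteq E$ is the set of edges with exactly one endpoint in $S$, $\chi^{\delta(S)}\in\{0,1\}^E$ its incidence vector, $\mathbf 1$ the all-ones vector, $\mathcal P(V)$ the power set. $A\succeq B$ means $A-B$ is positive semidefinite, $\mathcal L_G(w):=\sum_{ij\in E}w_{ij}(e_i-e_j)(e_i-e_j)^T$, and $\mathrm{Diag}(x)$ is the diagonal matrix with diagonal $x$. The constant is $\alpha_{GW}:=\min_{0<\vartheta\le\pi}\frac{2}{\pi}\frac{\vartheta}{1-\cos\vartheta}\approx0.878$. For $\beta\in(0,1]$, a $\beta$-certificate for $(w,z)\in\mathbb{R}_+^E\times\mathbb{R}_+^E$ is a tuple $(\rho,\mu,S,y,x)$ such that $\rho=0=\mu$ if and only if $w=0=z$, and: (i) $\rho,\mu\in\mathbb{R}_+$ and $\rho\mu=w^Tz$; (ii) $S\subseteq V$ and $w^T\chi^{\delta(S)}\ge\beta\rho$; (iii) $y\in\mathbb{R}_+^{\mathcal P(V)}$,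 $\sum_{U\subseteq V}y_U\chi^{\delta(U)}\ge z$ and $\mathbf 1^Ty\le\frac1\beta\mu$; (iv) $x\in\mathbb{R}^V$, $\rho\ge\mathbf 1^Tx$ and $\mathrm{Diag}(x)\succeq\tfrac14\mathcal L_G(w)$. Algorithms run in polynomial time in the real-number (Blum–Shub–Smale) machine model with access to two additional oracles: one computing Cholesky factorizations and one sampling from a standard normal distribution. *)

theory Defs
  imports
    "HOL-Probability.Probability"
    "HOL-Computational_Algebra.Polynomial"
    "Jordan_Normal_Form.Matrix"
begin

definition alpha_GW :: real where
  "alpha_GW = (INF \<theta>\<in>{0<..pi}. (2 / pi) * (\<theta> / (1 - cos \<theta>)))"

lemma alpha_GW_attained:
  obtains \<theta> where "0 < \<theta>" "\<theta> \<le> pi" "alpha_GW = (2 / pi) * (\<theta> / (1 - cos \<theta>))"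
    "\<And>t. 0 < t \<Longrightarrow> t \<le> pi \<Longrightarrow> alpha_GW \<le> (2 / pi) * (t / (1 - cos t))"
proof -
  define f where "f t = (2 / pi) * (t / (1 - cos t))" for t :: real
  have pos: "0 < 1 - cos t" if "0 < t" "t \<le> pi" for t :: real
    using cos_monotone_0_pi[of 0 t] that by simp
  have "1 - cos t \<noteq> 0" if "t \<in> {1..pi}" for t
    using pos[of t] that by simp
  then have "continuous_on {1..pi} f"
    unfolding f_def by (intro continuous_intros) blast
  moreover have "{1..pi} \<noteq> {}" using pi_gt3 by auto
  ultimately obtain \<theta> where \<theta>: "\<theta> \<in> {1..pi}" "\<And>t. t \<in> {1..pi} \<Longrightarrow> f \<theta> \<le> f t"
    using continuous_attains_inf[of "{1..pi}" f] by auto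
  have small: "f pi \<le> f t" if t: "0 < t" "t < 1" for t
  proof -
    have "1 - cos t = 2 * (sin (t / 2))\<^sup>2"
      using cos_double_sin[of "t / 2"] by simp
    also have "\<dots> \<le> 2 * (t / 2)\<^sup>2"
      using abs_sin_le_one abs_sin_x_le_abs_x[of "t / 2"] by (simp add: abs_le_square_iff[symmetric])
    also have "\<dots> = t * t / 2" by (simp add: power2_eq_square)
    also have "\<dots> \<le> t / 2" using t by (simp add: mult_left_le)
    finally have "1 - cos t \<le> t / 2" .
    then have "2 \<le> t / (1 - cos t)" using pos[of t] t pi_gt3 by (simp add: field_simps)
    then have "(2 / pi) * 2 \<le> f t"
      unfolding f_def by (intro mult_left_mono) auto
    moreover have "1 \<le> (2 / pi) * 2" using pi_less_4 by (simp add: field_simps)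
    moreover have "f pi = 1" by (simp add: f_def)
    ultimately show ?thesis by linarith
  qed
  have min: "f \<theta> \<le> f t" if "0 < t" "t \<le> pi" for t
    using \<theta>(2)[of t] \<theta>(2)[of pi] small[of t] that pi_gt3 by (cases "t < 1") auto
  have "alpha_GW = f \<theta>"
    unfolding alpha_GW_def f_def[symmetric]
    by (rule cInf_eq_minimum) (use \<theta>(1) min in auto)
  then show ?thesis using \<theta>(1) min by (intro that[of \<theta>]) (auto simp: f_def)
qed

definition psd :: "real mat \<Rightarrow> bool" where
  "psd A \<longleftrightarrow> square_mat A \<and> transpose_mat A = A \<and>
     (\<forall>v \<in> carrier_vec (dim_row A). 0 \<le> v \<bullet> (A *\<^sub>v v))"

definition loewner_ge :: "real mat \<Rightarrow> real mat \<Rightarrow> bool" (infix "\<succeq>" 50) where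
  "A \<succeq> B \<longleftrightarrow> psd (A - B)"

definition cholesky_factor :: "real mat \<Rightarrow> real mat \<Rightarrow> bool" where
  "cholesky_factor A L \<longleftrightarrow>
     L \<in> carrier_mat (dim_row A) (dim_row A) \<and> upper_triangular (transpose_mat L) \<and>
     (\<forall>i < dim_row A. 0 \<le> L $$ (i, i)) \<and> L * transpose_mat L = A"

text \<open>An oracle may answer arbitrarily on matrices that are not positive semidefinite, and may
  choose any factor of a singular matrix.\<close>

definition cholesky_oracle :: "(real mat \<Rightarrow> real mat) \<Rightarrow> bool" where
  "cholesky_oracle chol \<longleftrightarrow> (\<forall>A. psd A \<longrightarrow> cholesky_factor A (chol A))"

lemma cholesky_exists:
  fixes a :: "nat \<Rightarrow> nat \<Rightarrow> real"
  assumes "\<And>i j. i < n \<Longrightarrow> j < n \<Longrightarrow> a i j = a j i"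
    and "\<And>h. 0 \<le> (\<Sum>i<n. \<Sum>j<n. h i * a i j * h j)"
  shows "\<exists>L. (\<forall>i j. i < j \<longrightarrow> L i j = 0) \<and> (\<forall>i. 0 \<le> L i i) \<and>
    (\<forall>i<n. \<forall>j<n. (\<Sum>k<n. L i k * L j k) = a i j)"
  using assms
proof (induction n arbitrary: a)
  case 0
  show ?case by (rule exI[of _ "\<lambda>_ _. 0"]) auto
next
  case (Suc n)
  define d where "d = a 0 0"
  define c where "c i = (if d = 0 then 0 else a i 0 / sqrt d)" for i
  define b where "b i j = a (Suc i) (Suc j) - c (Suc i) * c (Suc j)" for i j
  note sym = Suc.prems(1) note psd = Suc.prems(2)
  have expand: "(\<Sum>i<Suc n. \<Sum>j<Suc n. h i * a i j * h j) =
      h 0 * h 0 * d + 2 * h 0 * (\<Sum>i<n. a (Suc i) 0 * h (Suc i)) +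
      (\<Sum>i<n. \<Sum>j<n. h (Suc i) * a (Suc i) (Suc j) * h (Suc j))" for h
  proof -
    have "(\<Sum>j<n. h 0 * a 0 (Suc j) * h (Suc j)) = h 0 * (\<Sum>i<n. a (Suc i) 0 * h (Suc i))"
      using sym by (auto simp: sum_distrib_left intro!: sum.cong)
    moreover have "(\<Sum>j<n. h (Suc j) * a (Suc j) 0 * h 0) = h 0 * (\<Sum>i<n. a (Suc i) 0 * h (Suc i))"
      by (auto simp: sum_distrib_left intro!: sum.cong)
    ultimately show ?thesis
      by (simp only: sum.lessThan_Suc_shift sum.distrib d_def) (simp add: algebra_simps)
  qed
  have d0: "0 \<le> d"
    using psd[of "\<lambda>i. if i = 0 then 1 else 0"] unfolding expand by simp
  have col0: "a (Suc i) 0 = 0" if "d = 0" "i < n" for i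
  proof (rule ccontr)
    assume nz: "a (Suc i) 0 \<noteq> 0"
    define t where "t = - (a (Suc i) (Suc i) + 1) / (2 * a (Suc i) 0)"
    define h where "h k = (case k of 0 \<Rightarrow> t | Suc k' \<Rightarrow> if k' = i then 1 else 0)" for k
    have lin: "(\<Sum>k<n. a (Suc k) 0 * h (Suc k)) = a (Suc i) 0"
    proof -
      have "(\<Sum>k<n. a (Suc k) 0 * h (Suc k)) = (\<Sum>k<n. if k = i then a (Suc k) 0 else 0)"
        by (intro sum.cong) (auto simp: h_def)
      then show ?thesis using that by simp
    qed
    have quad: "(\<Sum>k<n. \<Sum>j<n. h (Suc k) * a (Suc k) (Suc j) * h (Suc j)) = a (Suc i) (Suc i)"
    proof -
      have "(\<Sum>j<n. h (Suc k) * a (Suc k) (Suc j) * h (Suc j)) =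
          (if k = i then a (Suc i) (Suc i) else 0)" for k
      proof -
        have "(\<Sum>j<n. h (Suc k) * a (Suc k) (Suc j) * h (Suc j)) =
            (\<Sum>j<n. if j = i then h (Suc k) * a (Suc k) (Suc j) else 0)"
          by (intro sum.cong) (auto simp: h_def)
        then show ?thesis using that by (simp add: h_def)
      qed
      then show ?thesis using that by simp
    qed
    have "0 \<le> (\<Sum>i<Suc n. \<Sum>j<Suc n. h i * a i j * h j)" by (rule psd)
    also have "\<dots> = 2 * t * a (Suc i) 0 + a (Suc i) (Suc i)"
      unfolding expand lin quad using that by (simp add: h_def)
    also have "\<dots> = -1" using nz by (simp add: t_def field_simps)
    finally show False by simp
  qed
  have cc: "c i * sqrt d = a i 0" if "i < Suc n" for i
    using that col0[of "i - 1"] d0 by (cases i) (auto simp: c_def d_def)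
  have psd': "0 \<le> (\<Sum>i<n. \<Sum>j<n. h i * b i j * h j)" for h
  proof -
    define s where "s = (\<Sum>i<n. c (Suc i) * h i)"
    define g where "g k = (case k of 0 \<Rightarrow> (if d = 0 then 0 else - s / sqrt d) | Suc i \<Rightarrow> h i)" for k
    have s: "(\<Sum>i<n. a (Suc i) 0 * h i) = sqrt d * s"
      unfolding s_def sum_distrib_left using cc by (intro sum.cong) (auto simp: algebra_simps cc[symmetric])
    have "s * s = (\<Sum>i<n. \<Sum>j<n. h i * (c (Suc i) * c (Suc j)) * h j)"
      unfolding s_def sum_product by (intro sum.cong) auto
    then have e: "(\<Sum>i<n. \<Sum>j<n. h i * b i j * h j) =
        (\<Sum>i<n. \<Sum>j<n. h i * a (Suc i) (Suc j) * h j) - s * s"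
      by (simp add: b_def algebra_simps sum_subtractf)
    have "0 \<le> (\<Sum>i<Suc n. \<Sum>j<Suc n. g i * a i j * g j)" by (rule psd)
    also have "\<dots> = (\<Sum>i<n. \<Sum>j<n. h i * a (Suc i) (Suc j) * h j) - s * s"
    proof (cases "d = 0")
      case True
      then have "s = 0" by (simp add: s_def c_def)
      then show ?thesis unfolding expand using True by (simp add: g_def)
    next
      case False
      then have "0 < sqrt d" "sqrt d * sqrt d = d" using d0 by auto
      then show ?thesis unfolding expand g_def using False s
        by (simp add: field_simps)
    qed
    finally show ?thesis using e by simp
  qed
  have symb: "b i j = b j i" if "i < n" "j < n" for i j
    using sym[of "Suc i" "Suc j"] that by (simp add: b_def)
  obtain M where M: "\<And>i j. i < j \<Longrightarrow> M i j = 0" "\<And>i. 0 \<le> M i i"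
    "\<And>i j. i < n \<Longrightarrow> j < n \<Longrightarrow> (\<Sum>k<n. M i k * M j k) = b i j"
    using Suc.IH[of b, OF symb psd'] by blast
  define L where "L i j = (case j of 0 \<Rightarrow> c i | Suc j' \<Rightarrow> (case i of 0 \<Rightarrow> 0 | Suc i' \<Rightarrow> M i' j'))" for i j
  have c0: "c 0 * c 0 = d" "0 \<le> c 0" using d0 by (auto simp: c_def d_def[symmetric] real_div_sqrt)
  have c0i: "c 0 * c i = a i 0" if "i < Suc n" for i
    using cc[OF that] d0 by (simp add: c_def d_def[symmetric] real_div_sqrt split: if_splits)
  have "(\<Sum>k<Suc n. L i k * L j k) = a i j" if "i < Suc n" "j < Suc n" for i j
  proof -
    have "(\<Sum>k<Suc n. L i k * L j k) = c i * c j + (\<Sum>k<n. L i (Suc k) * L j (Suc k))"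
      by (simp only: sum.lessThan_Suc_shift) (simp add: L_def)
    also have "\<dots> = a i j"
    proof (cases i)
      case 0 then show ?thesis using c0i[of j] that sym[of 0 j] by (simp add: L_def)
    next
      case i: (Suc i')
      show ?thesis
      proof (cases j)
        case 0 then show ?thesis using c0i[of i] that by (simp add: L_def mult.commute)
      next
        case (Suc j') then show ?thesis using i that M(3)[of i' j'] by (simp add: L_def b_def)
      qed
    qed
    finally show ?thesis .
  qed
  moreover have "L i j = 0" if "i < j" for i j
    using that M(1) by (auto simp: L_def split: nat.splits)
  moreover have "0 \<le> L i i" for i
    using M(2) c0(2) by (auto simp: L_def split: nat.splits)
  ultimately show ?case by (intro exI[of _ L]) auto
qed

lemma cholesky_oracle_exists: "\<exists>chol. cholesky_oracle chol"
proof -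
  have "\<exists>L. cholesky_factor A L" if A: "psd A" for A
  proof -
    define n where "n = dim_row A"
    have dim: "dim_col A = n" "dim_row A = n"
      using A by (auto simp: psd_def n_def)
    have sym: "A $$ (i, j) = A $$ (j, i)" if "i < n" "j < n" for i j
      using A that dim unfolding psd_def by (metis index_transpose_mat(1))
    have quad: "0 \<le> (\<Sum>i<n. \<Sum>j<n. h i * A $$ (i, j) * h j)" for h
    proof -
      have "0 \<le> vec n h \<bullet> (A *\<^sub>v vec n h)"
        using A dim unfolding psd_def by auto
      also have "\<dots> = (\<Sum>i<n. \<Sum>j<n. h i * A $$ (i, j) * h j)"
        using dim by (simp add: scalar_prod_def sum_distrib_left mult.assoc lessThan_atLeast0)
      finally show ?thesis .
    qed
    obtain M where M: "\<And>i j. i < j \<Longrightarrow> M i j = 0" "\<And>i. 0 \<le> M i i"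
      "\<And>i j. i < n \<Longrightarrow> j < n \<Longrightarrow> (\<Sum>k<n. M i k * M j k) = A $$ (i, j)"
      using cholesky_exists[of n "\<lambda>i j. A $$ (i, j)", OF sym quad] by blast
    have "mat n n (\<lambda>(i, j). M i j) * transpose_mat (mat n n (\<lambda>(i, j). M i j)) = A"
      using dim M(3) by (intro eq_matI) (auto simp: scalar_prod_def lessThan_atLeast0)
    then have "cholesky_factor A (mat n n (\<lambda>(i, j). M i j))"
      using dim M(1,2) by (auto simp: cholesky_factor_def upper_triangular_def)
    then show ?thesis ..
  qed
  then show ?thesis unfolding cholesky_oracle_def by metis
qed

text \<open>Graphs have vertex set \<open>{..<n}\<close>; an edge is a two-element set of vertices. Vectors indexed by
  edges, vertices or vertex sets are functions, of which only the values on \<open>E\<close>, \<open>{..<n}\<close> and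
  \<open>Pow {..<n}\<close> respectively matter.\<close>

definition simple_graph :: "nat \<Rightarrow> nat set set \<Rightarrow> bool" where
  "simple_graph n E \<longleftrightarrow> E \<subseteq> {e. e \<subseteq> {..<n} \<and> card e = 2}"

definition cut :: "nat set set \<Rightarrow> nat set \<Rightarrow> nat set set" where
  "cut E S = {e \<in> E. card (e \<inter> S) = 1}"

definition cut_vec :: "nat set set \<Rightarrow> nat set \<Rightarrow> nat set \<Rightarrow> real" where
  "cut_vec E S = indicator (cut E S)"

text \<open>The orientation chosen by \<open>Min\<close> and \<open>Max\<close> is immaterial for the Laplacian.\<close>

definition edge_vec :: "nat \<Rightarrow> nat set \<Rightarrow> real vec" where
  "edge_vec n e = unit_vec n (Min e) - unit_vec n (Max e)"

definition laplacian :: "nat \<Rightarrow> nat set set \<Rightarrow> (nat set \<Rightarrow> real) \<Rightarrow> real mat" where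
  "laplacian n E w = mat n n (\<lambda>(a, b). \<Sum>e\<in>E. w e * (edge_vec n e $ a * edge_vec n e $ b))"

definition beta_certificate ::
  "real \<Rightarrow> nat \<Rightarrow> nat set set \<Rightarrow> (nat set \<Rightarrow> real) \<Rightarrow> (nat set \<Rightarrow> real) \<Rightarrow>
   real \<Rightarrow> real \<Rightarrow> nat set \<Rightarrow> (nat set \<Rightarrow> real) \<Rightarrow> (nat \<Rightarrow> real) \<Rightarrow> bool" where
  "beta_certificate \<beta> n E w z \<rho> \<mu> S y x \<longleftrightarrow>
     0 < \<beta> \<and> \<beta> \<le> 1 \<and> (\<forall>e\<in>E. 0 \<le> w e) \<and> (\<forall>e\<in>E. 0 \<le> z e) \<and>
     ((\<rho> = 0 \<and> \<mu> = 0) \<longleftrightarrow> (\<forall>e\<in>E. w e = 0 \<and> z e = 0)) \<and>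
     (0 \<le> \<rho> \<and> 0 \<le> \<mu> \<and> \<rho> * \<mu> = (\<Sum>e\<in>E. w e * z e)) \<and>
     (S \<subseteq> {..<n} \<and> (\<Sum>e\<in>E. w e * cut_vec E S e) \<ge> \<beta> * \<rho>) \<and>
     ((\<forall>U\<subseteq>{..<n}. 0 \<le> y U) \<and>
      (\<forall>e\<in>E. (\<Sum>U\<in>Pow {..<n}. y U * cut_vec E U e) \<ge> z e) \<and>
      (\<Sum>U\<in>Pow {..<n}. y U) \<le> 1 / \<beta> * \<mu>) \<and>
     (\<rho> \<ge> (\<Sum>i<n. x i) \<and> mat_diag n x \<succeq> (1 / 4) \<cdot>\<^sub>m laplacian n E w)"

definition cover_support :: "nat \<Rightarrow> (nat set \<Rightarrow> real) \<Rightarrow> nat set set" where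
  "cover_support n y = {U. U \<subseteq> {..<n} \<and> y U \<noteq> 0}"

text \<open>A program is a finite flowchart in the sense of Blum, Shub and Smale: exact rational
  operations on real cells at unit cost, arbitrary real constants, and branching on the sign of a
  cell. As in their uniform model, cells at unbounded addresses are reached through index
  registers, which can only be reset and incremented; hence a program running for \<open>t\<close> steps
  addresses cells polynomially far in \<open>t\<close> only.

  \<open>Cholesky k a b\<close> reads a matrix stored row by row from cell \<open>idx a\<close> on, its order being the content
  of index register \<open>k\<close>, and writes the factor row by row from cell \<open>idx b\<close> on. The order is at most
  the running time, so that charging one step for a call affects running times only polynomially.
  \<open>Sample d\<close> stores the next unused entry of the random sequence \<open>\<omega>\<close> in cell \<open>d\<close>.\<close>

datatype instr =
    Const nat real
  | Add nat nat nat
  | Sub nat nat nat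
  | Mul nat nat nat
  | Div nat nat nat
  | Branch nat nat
  | Reset nat
  | Incr nat
  | Load nat nat
  | Store nat nat
  | Cholesky nat nat nat
  | Sample nat

type_synonym program = "instr list"

record config =
  pc :: nat
  mem :: "nat \<Rightarrow> real"
  idx :: "nat \<Rightarrow> nat"
  used :: nat

definition read_mat :: "(nat \<Rightarrow> real) \<Rightarrow> nat \<Rightarrow> nat \<Rightarrow> real mat" where
  "read_mat m k a = mat k k (\<lambda>(i, j). m (a + i * k + j))"

definition write_mat :: "(nat \<Rightarrow> real) \<Rightarrow> nat \<Rightarrow> nat \<Rightarrow> real mat \<Rightarrow> (nat \<Rightarrow> real)" where
  "write_mat m k b L =
     (\<lambda>c. if b \<le> c \<and> c < b + k * k then L $$ ((c - b) div k, (c - b) mod k) else m c)"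

fun exec :: "(real mat \<Rightarrow> real mat) \<Rightarrow> (nat \<Rightarrow> real) \<Rightarrow> instr \<Rightarrow> config \<Rightarrow> config" where
  "exec chol \<omega> (Const d c) s = s\<lparr>pc := Suc (pc s), mem := (mem s)(d := c)\<rparr>"
| "exec chol \<omega> (Add d a b) s = s\<lparr>pc := Suc (pc s), mem := (mem s)(d := mem s a + mem s b)\<rparr>"
| "exec chol \<omega> (Sub d a b) s = s\<lparr>pc := Suc (pc s), mem := (mem s)(d := mem s a - mem s b)\<rparr>"
| "exec chol \<omega> (Mul d a b) s = s\<lparr>pc := Suc (pc s), mem := (mem s)(d := mem s a * mem s b)\<rparr>"
| "exec chol \<omega> (Div d a b) s = s\<lparr>pc := Suc (pc s), mem := (mem s)(d := mem s a / mem s b)\<rparr>"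
| "exec chol \<omega> (Branch a l) s = s\<lparr>pc := (if 0 \<le> mem s a then l else Suc (pc s))\<rparr>"
| "exec chol \<omega> (Reset p) s = s\<lparr>pc := Suc (pc s), idx := (idx s)(p := 0)\<rparr>"
| "exec chol \<omega> (Incr p) s = s\<lparr>pc := Suc (pc s), idx := (idx s)(p := Suc (idx s p))\<rparr>"
| "exec chol \<omega> (Load d p) s = s\<lparr>pc := Suc (pc s), mem := (mem s)(d := mem s (idx s p))\<rparr>"
| "exec chol \<omega> (Store p a) s = s\<lparr>pc := Suc (pc s), mem := (mem s)(idx s p := mem s a)\<rparr>"
| "exec chol \<omega> (Cholesky k a b) s = s\<lparr>pc := Suc (pc s),
     mem := write_mat (mem s) (idx s k) (idx s b)
              (chol (read_mat (mem s) (idx s k) (idx s a)))\<rparr>"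
| "exec chol \<omega> (Sample d) s =
     s\<lparr>pc := Suc (pc s), mem := (mem s)(d := \<omega> (used s)), used := Suc (used s)\<rparr>"

definition halted :: "program \<Rightarrow> config \<Rightarrow> bool" where
  "halted P s \<longleftrightarrow> length P \<le> pc s"

definition step :: "(real mat \<Rightarrow> real mat) \<Rightarrow> (nat \<Rightarrow> real) \<Rightarrow> program \<Rightarrow> config \<Rightarrow> config" where
  "step chol \<omega> P s = (if halted P s then s else exec chol \<omega> (P ! pc s) s)"

text \<open>Words in \<open>\<real>\<^sup>\<infinity>\<close> are passed with their length in cell \<open>0\<close> and their entries in the
  cells from \<open>1\<close> on.\<close>

definition init_config :: "real list \<Rightarrow> config" where
  "init_config u =
     \<lparr>pc = 0,
      mem = (\<lambda>c. if c = 0 then real (length u) else if c \<le> length u then u ! (c - 1) else 0),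
      idx = (\<lambda>_. 0), used = 0\<rparr>"

definition holds_word :: "(nat \<Rightarrow> real) \<Rightarrow> real list \<Rightarrow> bool" where
  "holds_word m v \<longleftrightarrow> m 0 = real (length v) \<and> (\<forall>i < length v. m (Suc i) = v ! i)"

definition run ::
  "(real mat \<Rightarrow> real mat) \<Rightarrow> (nat \<Rightarrow> real) \<Rightarrow> program \<Rightarrow> real list \<Rightarrow> nat \<Rightarrow> config" where
  "run chol \<omega> P u t = (step chol \<omega> P ^^ t) (init_config u)"

definition outputs ::
  "(real mat \<Rightarrow> real mat) \<Rightarrow> (nat \<Rightarrow> real) \<Rightarrow> program \<Rightarrow> real list \<Rightarrow> real list \<Rightarrow> bool" where
  "outputs chol \<omega> P u v \<longleftrightarrow>
     (\<exists>t. halted P (run chol \<omega> P u t) \<and> holds_word (mem (run chol \<omega> P u t)) v)"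

text \<open>The bound is on the worst case, over all inputs, oracles and random sequences.\<close>

definition polynomial_time_on :: "real list set \<Rightarrow> program \<Rightarrow> bool" where
  "polynomial_time_on I P \<longleftrightarrow>
     (\<exists>q :: nat poly. \<forall>chol \<omega>. \<forall>u\<in>I. cholesky_oracle chol \<longrightarrow>
        halted P (run chol \<omega> P u (poly q (length u))))"

definition gaussian_sequences :: "(nat \<Rightarrow> real) measure" where
  "gaussian_sequences = (\<Pi>\<^sub>M i\<in>(UNIV :: nat set). density lborel std_normal_density)"

definition outputs_with_prob ::
  "(real mat \<Rightarrow> real mat) \<Rightarrow> program \<Rightarrow> real list \<Rightarrow> real list set \<Rightarrow> real \<Rightarrow> bool" where
  "outputs_with_prob chol P u R p \<longleftrightarrow>
     (let A = {\<omega> \<in> space gaussian_sequences. \<exists>v\<in>R. outputs chol \<omega> P u v}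
      in A \<in> sets gaussian_sequences \<and> measure gaussian_sequences A \<ge> p)"

definition set_word :: "nat \<Rightarrow> nat set \<Rightarrow> real list" where
  "set_word n S = map (\<lambda>i. of_bool (i \<in> S)) [0..<n]"

definition edge_word :: "nat \<Rightarrow> nat set set \<Rightarrow> (nat set \<Rightarrow> real) \<Rightarrow> real list" where
  "edge_word n E f =
     concat (map (\<lambda>i. map (\<lambda>j. if {i, j} \<in> E then f {i, j} else 0) [0..<n]) [0..<n])"

text \<open>The adjacency matrix is part of the input because edges may have weight \<open>0\<close>.\<close>

definition instance_word :: "nat \<Rightarrow> nat set set \<Rightarrow> (nat set \<Rightarrow> real) \<Rightarrow> real list" where
  "instance_word n E w = real n # edge_word n E (\<lambda>_. 1) @ edge_word n E w"

text \<open>The fractional cut cover is written sparsely, as the list of its support together with the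
  values there.\<close>

definition certificate_words ::
  "nat \<Rightarrow> nat set set \<Rightarrow> (nat set \<Rightarrow> real) \<Rightarrow>
   real \<Rightarrow> real \<Rightarrow> nat set \<Rightarrow> (nat set \<Rightarrow> real) \<Rightarrow> (nat \<Rightarrow> real) \<Rightarrow> real list set" where
  "certificate_words n E z \<rho> \<mu> S y x =
     {edge_word n E z @ [\<rho>, \<mu>] @ set_word n S @ map x [0..<n] @
        real (length Us) # concat (map (\<lambda>U. y U # set_word n U) Us)
      | Us. distinct Us \<and> set Us = cover_support n y}"

definition nonzero_instance :: "nat \<Rightarrow> nat set set \<Rightarrow> (nat set \<Rightarrow> real) \<Rightarrow> bool" where
  "nonzero_instance n E w \<longleftrightarrow>
     simple_graph n E \<and> (\<forall>e\<in>E. 0 \<le> w e) \<and> (\<exists>e\<in>E. w e \<noteq> 0)"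

end

theory Submission
  imports Defs "Jordan_Normal_Form.Determinant" "HOL-Real_Asymp.Real_Asymp"
begin

text \<open>Since \<open>z\<close> is part of the output, a single good cut suffices: if \<open>Diag(x) \<succeq> L(w)/4\<close>,
  \<open>\<rho> = 1\<^sup>T x\<close> and \<open>w(\<delta>(S)) \<ge> \<beta> \<rho>\<close>, then \<open>y = 1\<close> on \<open>S\<close> alone, \<open>z = \<chi>(\<delta>(S))\<close> and
  \<open>\<mu> = w(\<delta>(S)) / \<rho>\<close> complete a certificate.

  The vector \<open>x\<close> comes from exact coordinate minimisation of the potential
  \<open>1\<^sup>T x - \<mu>\<^sub>0 ln det (Diag(x) - L(w)/4)\<close> with \<open>\<mu>\<^sub>0 = \<epsilon> W / n\<close>, where \<open>W\<close> is twice the total weight. The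
  inverse \<open>G\<close> of the slack matrix is maintained by rank-one updates. As long as some \<open>\<mu>\<^sub>0 G\<^sub>i\<^sub>i\<close> is not
  within \<open>\<epsilon>\<close> of \<open>1\<close>, a step lowers the potential by a fixed multiple of \<open>\<mu>\<^sub>0\<close>, so a constant times \<open>n\<^sup>2\<close> sweeps
  suffice. In the end \<open>G\<close>, rescaled to unit diagonal, is a solution of the Goemans-Williamson relaxation of
  value at least \<open>(1 - 7 \<epsilon>) \<rho>\<close>, and hyperplane rounding of a Cholesky factor of \<open>G\<close> yields a cut of expected
  weight at least \<open>(\<alpha> + \<beta>) \<rho> / 2\<close>, where \<open>\<alpha>\<close> is the Goemans-Williamson constant. No cut weighs more than
  \<open>2 \<rho>\<close>, so each of a constant times \<open>n\<close> independent rounds succeeds with probability at least \<open>(\<alpha> - \<beta>) / 4\<close>.\<close>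

section \<open>Signs of correlated Gaussians\<close>

abbreviation gauss :: "real measure" where
  "gauss \<equiv> density lborel std_normal_density"

lemma prob_space_gauss: "prob_space gauss"
  using prob_space_normal_density[of 1 0] by simp

lemma emeasure_gauss_UNIV [simp]: "emeasure gauss UNIV = 1"
  using prob_space.emeasure_space_1[OF prob_space_gauss] by simp

lemma nn_integral_lborel_linear:
  fixes F :: "real \<times> real \<Rightarrow> ennreal"
  assumes [measurable]: "F \<in> borel_measurable (borel \<Otimes>\<^sub>M borel)" and cs: "c\<^sup>2 + s\<^sup>2 = 1"
  shows "(\<integral>\<^sup>+x. \<integral>\<^sup>+y. F (c * x - s * y, s * x + c * y) \<partial>lborel \<partial>lborel)
       = (\<integral>\<^sup>+x. \<integral>\<^sup>+y. F (x, y) \<partial>lborel \<partial>lborel)"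
proof (cases "s = 0")
  case True
  then have c: "c \<noteq> 0" "\<bar>c\<bar> = 1" using cs by (auto simp: power2_eq_1_iff)
  have "(\<integral>\<^sup>+x. \<integral>\<^sup>+y. F (x, y) \<partial>lborel \<partial>lborel) =
      ennreal \<bar>c\<bar> * (\<integral>\<^sup>+x. \<integral>\<^sup>+y. F (0 + c * x, y) \<partial>lborel \<partial>lborel)"
    by (rule nn_integral_real_affine) (use c in auto)
  then have 1: "(\<integral>\<^sup>+x. \<integral>\<^sup>+y. F (x, y) \<partial>lborel \<partial>lborel) = (\<integral>\<^sup>+x. \<integral>\<^sup>+y. F (c * x, y) \<partial>lborel \<partial>lborel)"
    using c by simp
  have "(\<integral>\<^sup>+y. F (c * x, y) \<partial>lborel) = ennreal \<bar>c\<bar> * (\<integral>\<^sup>+y. F (c * x, 0 + c * y) \<partial>lborel)" for x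
    by (rule nn_integral_real_affine) (use c in auto)
  then show ?thesis using True c 1 by simp
next
  case False
  have "(\<integral>\<^sup>+y. F (u, y) \<partial>lborel) = ennreal \<bar>1/s\<bar> * (\<integral>\<^sup>+x. F (u, (- c * u / s) + (1/s) * x) \<partial>lborel)" for u
    by (rule nn_integral_real_affine) (use False in auto)
  then have "(\<integral>\<^sup>+u. \<integral>\<^sup>+y. F (u, y) \<partial>lborel \<partial>lborel) =
     (\<integral>\<^sup>+u. \<integral>\<^sup>+x. ennreal \<bar>1/s\<bar> * F (u, (- c * u / s) + (1/s) * x) \<partial>lborel \<partial>lborel)"
    by (simp add: nn_integral_cmult)
  also have "\<dots> = (\<integral>\<^sup>+x. \<integral>\<^sup>+u. ennreal \<bar>1/s\<bar> * F (u, (- c * u / s) + (1/s) * x) \<partial>lborel \<partial>lborel)"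
    by (rule lborel_pair.Fubini') measurable
  also have "\<dots> = (\<integral>\<^sup>+x. \<integral>\<^sup>+y. F (c * x - s * y, s * x + c * y) \<partial>lborel \<partial>lborel)"
  proof (rule nn_integral_cong)
    fix x :: real
    have "(\<integral>\<^sup>+u. ennreal \<bar>1/s\<bar> * F (u, (- c * u / s) + (1/s) * x) \<partial>lborel) =
       ennreal \<bar>-s\<bar> * (\<integral>\<^sup>+y. ennreal \<bar>1/s\<bar> * F (c * x + (-s) * y, (- c * (c * x + (-s) * y) / s) + (1/s) * x) \<partial>lborel)"
      by (rule nn_integral_real_affine) (use False in auto)
    also have "\<dots> = (\<integral>\<^sup>+y. ennreal \<bar>-s\<bar> * (ennreal \<bar>1/s\<bar> * F (c * x + (-s) * y, (- c * (c * x + (-s) * y) / s) + (1/s) * x)) \<partial>lborel)"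
      by (rule nn_integral_cmult[symmetric]) measurable
    also have "\<dots> = (\<integral>\<^sup>+y. F (c * x - s * y, s * x + c * y) \<partial>lborel)"
    proof (rule nn_integral_cong)
      fix y :: real
      have "(- c * (c * x + (-s) * y) / s) + (1/s) * x = ((1 - c\<^sup>2) * x + c * s * y) / s"
        using False by (simp add: field_simps power2_eq_square)
      also have "1 - c\<^sup>2 = s\<^sup>2" using cs by simp
      also have "(s\<^sup>2 * x + c * s * y) / s = s * x + c * y"
        using False by (simp add: field_simps power2_eq_square)
      finally have e: "(- c * (c * x + (-s) * y) / s) + (1/s) * x = s * x + c * y" .
      have "ennreal \<bar>-s\<bar> * ennreal \<bar>1/s\<bar> = 1"
        using False by (simp add: ennreal_mult[symmetric])
      then show "ennreal \<bar>-s\<bar> * (ennreal \<bar>1/s\<bar> * F (c * x + (-s) * y, (- c * (c * x + (-s) * y) / s) + (1/s) * x)) = F (c * x - s * y, s * x + c * y)"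
        unfolding e by (simp add: mult.assoc[symmetric])
    qed
    finally show "(\<integral>\<^sup>+u. ennreal \<bar>1/s\<bar> * F (u, (- c * u / s) + (1/s) * x) \<partial>lborel) = (\<integral>\<^sup>+y. F (c * x - s * y, s * x + c * y) \<partial>lborel)" .
  qed
  finally show ?thesis by simp
qed

lemma nn_integral_gauss_pair:
  assumes [measurable]: "f \<in> borel_measurable (borel \<Otimes>\<^sub>M borel)"
  shows "(\<integral>\<^sup>+x. \<integral>\<^sup>+y. f (x, y) \<partial>gauss \<partial>gauss) =
    (\<integral>\<^sup>+x. \<integral>\<^sup>+y. ennreal (exp (- (x\<^sup>2 + y\<^sup>2) / 2) / (2 * pi)) * f (x, y) \<partial>lborel \<partial>lborel)"
proof -
  have "std_normal_density x * std_normal_density y = exp (- (x\<^sup>2 + y\<^sup>2) / 2) / (2 * pi)" for x y :: real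
    by (simp add: std_normal_density_def mult_exp_exp add_divide_distrib)
  then have *: "ennreal (std_normal_density x) * (ennreal (std_normal_density y) * z) =
     ennreal (exp (- (x\<^sup>2 + y\<^sup>2) / 2) / (2 * pi)) * z" for x y z
    by (simp add: mult.assoc[symmetric] ennreal_mult[symmetric])
  show ?thesis
    by (simp add: nn_integral_density nn_integral_cmult[symmetric] *)
qed

lemma gauss_rotation_invariant:
  assumes [measurable]: "f \<in> borel_measurable (borel \<Otimes>\<^sub>M borel)" and cs: "c\<^sup>2 + s\<^sup>2 = 1"
  shows "(\<integral>\<^sup>+x. \<integral>\<^sup>+y. f (c * x - s * y, s * x + c * y) \<partial>gauss \<partial>gauss)
       = (\<integral>\<^sup>+x. \<integral>\<^sup>+y. f (x, y) \<partial>gauss \<partial>gauss)"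
proof -
  define F where "F = (\<lambda>(x, y). ennreal (exp (- (x\<^sup>2 + y\<^sup>2) / 2) / (2 * pi)) * f (x, y))"
  have [measurable]: "F \<in> borel_measurable (borel \<Otimes>\<^sub>M borel)"
    unfolding F_def by measurable
  have "(c * x - s * y)\<^sup>2 + (s * x + c * y)\<^sup>2 = (c\<^sup>2 + s\<^sup>2) * (x\<^sup>2 + y\<^sup>2)" for x y
    by (simp add: power2_eq_square algebra_simps)
  then have r: "(c * x - s * y)\<^sup>2 + (s * x + c * y)\<^sup>2 = x\<^sup>2 + y\<^sup>2" for x y
    using cs by simp
  have "(\<integral>\<^sup>+x. \<integral>\<^sup>+y. f (c * x - s * y, s * x + c * y) \<partial>gauss \<partial>gauss) =
    (\<integral>\<^sup>+x. \<integral>\<^sup>+y. F (c * x - s * y, s * x + c * y) \<partial>lborel \<partial>lborel)"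
    using nn_integral_gauss_pair[of "\<lambda>(x, y). f (c * x - s * y, s * x + c * y)"]
    by (simp add: F_def r split_beta' del: minus_add_distrib)
  also have "\<dots> = (\<integral>\<^sup>+x. \<integral>\<^sup>+y. F (x, y) \<partial>lborel \<partial>lborel)"
    by (rule nn_integral_lborel_linear) (use cs in auto)
  also have "\<dots> = (\<integral>\<^sup>+x. \<integral>\<^sup>+y. f (x, y) \<partial>gauss \<partial>gauss)"
    using nn_integral_gauss_pair[of f] by (simp add: F_def)
  finally show ?thesis .
qed

lemma unit_direction:
  fixes p a :: real
  obtains c s where "c\<^sup>2 + s\<^sup>2 = 1" "p = sqrt (p\<^sup>2 + a\<^sup>2) * c" "a = sqrt (p\<^sup>2 + a\<^sup>2) * s"
proof (cases "p\<^sup>2 + a\<^sup>2 = 0")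
  case True
  then have "p = 0" "a = 0" by (auto simp: sum_power2_eq_zero_iff)
  then show ?thesis using that[of 1 0] by simp
next
  case False
  show ?thesis
  proof (rule that[of "p / sqrt (p\<^sup>2 + a\<^sup>2)" "a / sqrt (p\<^sup>2 + a\<^sup>2)"])
    show "(p / sqrt (p\<^sup>2 + a\<^sup>2))\<^sup>2 + (a / sqrt (p\<^sup>2 + a\<^sup>2))\<^sup>2 = 1"
      using False by (simp add: power_divide add_divide_distrib[symmetric])
  qed (use False in auto)
qed

lemma gauss_combine_pair:
  assumes [measurable]: "f \<in> borel_measurable borel"
  shows "(\<integral>\<^sup>+y. \<integral>\<^sup>+k. f (e * y + r * k) \<partial>gauss \<partial>gauss) = (\<integral>\<^sup>+k. f (sqrt (e\<^sup>2 + r\<^sup>2) * k) \<partial>gauss)"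
proof -
  interpret prob_space gauss by (rule prob_space_gauss)
  obtain c s where cs: "c\<^sup>2 + s\<^sup>2 = 1" "e = sqrt (e\<^sup>2 + r\<^sup>2) * c" "r = sqrt (e\<^sup>2 + r\<^sup>2) * s"
    by (rule unit_direction)
  let ?R = "sqrt (e\<^sup>2 + r\<^sup>2)"
  have "e * (c * x - s * y) + r * (s * x + c * y) = ?R * ((c\<^sup>2 + s\<^sup>2) * x)" for x y
  proof -
    have "e * (c * x - s * y) + r * (s * x + c * y) = (?R * c) * (c * x - s * y) + (?R * s) * (s * x + c * y)"
      using cs(2,3) by presburger
    also have "\<dots> = ?R * ((c\<^sup>2 + s\<^sup>2) * x)" by (simp add: power2_eq_square algebra_simps)
    finally show ?thesis .
  qed
  then have *: "e * (c * x - s * y) + r * (s * x + c * y) = ?R * x" for x y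
    using cs(1) by simp
  have "(\<integral>\<^sup>+y. \<integral>\<^sup>+k. f (e * y + r * k) \<partial>gauss \<partial>gauss) = (\<integral>\<^sup>+y. \<integral>\<^sup>+k. f (?R * y) \<partial>gauss \<partial>gauss)"
    using gauss_rotation_invariant[of "\<lambda>(y, k). f (e * y + r * k)" c s] cs(1) by (simp add: *)
  then show ?thesis by simp
qed

lemma gauss_joint_law:
  fixes a b :: "nat \<Rightarrow> real"
  assumes "finite I"
  shows "\<exists>p q r. p\<^sup>2 = (\<Sum>i\<in>I. (a i)\<^sup>2) \<and> p * q = (\<Sum>i\<in>I. a i * b i) \<and> q\<^sup>2 + r\<^sup>2 = (\<Sum>i\<in>I. (b i)\<^sup>2) \<and>
    (\<forall>f \<in> borel_measurable (borel \<Otimes>\<^sub>M borel).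
      (\<integral>\<^sup>+x. f (\<Sum>i\<in>I. a i * x i, \<Sum>i\<in>I. b i * x i) \<partial>(\<Pi>\<^sub>M i\<in>I. gauss)) =
      (\<integral>\<^sup>+h. \<integral>\<^sup>+k. f (p * h, q * h + r * k) \<partial>gauss \<partial>gauss))"
  using assms
proof (induction I rule: finite_induct)
  case empty
  interpret prob_space gauss by (rule prob_space_gauss)
  interpret E: prob_space "\<Pi>\<^sub>M i\<in>{}::nat set. gauss" by (rule prob_space_PiM) (rule prob_space_gauss)
  show ?case
    apply (rule exI[of _ 0], rule exI[of _ 0], rule exI[of _ 0])
    by (auto simp: E.emeasure_space_1[simplified])
next
  case (insert j I)
  interpret prob_space gauss by (rule prob_space_gauss)
  interpret pair_prob_space gauss gauss ..
  interpret product_sigma_finite "\<lambda>_::nat. gauss" ..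
  obtain p q r where pqr: "p\<^sup>2 = (\<Sum>i\<in>I. (a i)\<^sup>2)" "p * q = (\<Sum>i\<in>I. a i * b i)" "q\<^sup>2 + r\<^sup>2 = (\<Sum>i\<in>I. (b i)\<^sup>2)"
    and IH: "\<And>f. f \<in> borel_measurable (borel \<Otimes>\<^sub>M borel) \<Longrightarrow>
      (\<integral>\<^sup>+x. f (\<Sum>i\<in>I. a i * x i, \<Sum>i\<in>I. b i * x i) \<partial>(\<Pi>\<^sub>M i\<in>I. gauss)) =
      (\<integral>\<^sup>+h. \<integral>\<^sup>+k. f (p * h, q * h + r * k) \<partial>gauss \<partial>gauss)"
    using insert.IH by blast
  define P where "P = sqrt (p\<^sup>2 + (a j)\<^sup>2)"
  obtain c s where cs: "c\<^sup>2 + s\<^sup>2 = 1" "p = P * c" "a j = P * s"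
    unfolding P_def by (rule unit_direction)
  define q' where "q' = q * c + b j * s"
  define e where "e = b j * c - q * s"
  define r' where "r' = sqrt (e\<^sup>2 + r\<^sup>2)"
  have "q'\<^sup>2 + r'\<^sup>2 = (c\<^sup>2 + s\<^sup>2) * (q\<^sup>2 + (b j)\<^sup>2) + r\<^sup>2"
    unfolding q'_def r'_def e_def by simp (simp add: power2_eq_square algebra_simps)
  then have g3: "q'\<^sup>2 + r'\<^sup>2 = q\<^sup>2 + (b j)\<^sup>2 + r\<^sup>2" using cs by simp
  have g2: "P * q' = p * q + a j * b j" unfolding q'_def cs(2,3) by (simp add: algebra_simps)
  have g1: "P\<^sup>2 = p\<^sup>2 + (a j)\<^sup>2" by (simp add: P_def)
  have "(\<integral>\<^sup>+x. f (\<Sum>i\<in>insert j I. a i * x i, \<Sum>i\<in>insert j I. b i * x i) \<partial>(\<Pi>\<^sub>M i\<in>insert j I. gauss)) =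
      (\<integral>\<^sup>+h. \<integral>\<^sup>+k. f (P * h, q' * h + r' * k) \<partial>gauss \<partial>gauss)"
    if [measurable]: "f \<in> borel_measurable (borel \<Otimes>\<^sub>M borel)" for f
  proof -
    have u: "(\<Sum>i\<in>I. d i * (x(j := y)) i) = (\<Sum>i\<in>I. d i * x i)" for d x and y :: real
      using insert.hyps by (intro sum.cong) auto
    have "(\<integral>\<^sup>+x. f (\<Sum>i\<in>insert j I. a i * x i, \<Sum>i\<in>insert j I. b i * x i) \<partial>(\<Pi>\<^sub>M i\<in>insert j I. gauss)) =
       (\<integral>\<^sup>+y. \<integral>\<^sup>+x. f (a j * y + (\<Sum>i\<in>I. a i * x i), b j * y + (\<Sum>i\<in>I. b i * x i)) \<partial>(\<Pi>\<^sub>M i\<in>I. gauss) \<partial>gauss)"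
      using insert.hyps by (subst product_nn_integral_insert_rev) (auto simp: u simp del: fun_upd_apply simp: fun_upd_same)
    also have "\<dots> = (\<integral>\<^sup>+y. \<integral>\<^sup>+h. \<integral>\<^sup>+k. f (a j * y + p * h, b j * y + (q * h + r * k)) \<partial>gauss \<partial>gauss \<partial>gauss)"
    proof (rule nn_integral_cong)
      fix y
      show "(\<integral>\<^sup>+x. f (a j * y + (\<Sum>i\<in>I. a i * x i), b j * y + (\<Sum>i\<in>I. b i * x i)) \<partial>(\<Pi>\<^sub>M i\<in>I. gauss)) =
        (\<integral>\<^sup>+h. \<integral>\<^sup>+k. f (a j * y + p * h, b j * y + (q * h + r * k)) \<partial>gauss \<partial>gauss)"
        using IH[of "\<lambda>(u, v). f (a j * y + u, b j * y + v)"] by simp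
    qed
    also have "\<dots> = (\<integral>\<^sup>+h. \<integral>\<^sup>+y. \<integral>\<^sup>+k. f (a j * y + p * h, b j * y + (q * h + r * k)) \<partial>gauss \<partial>gauss \<partial>gauss)"
      by (rule Fubini'[symmetric]) measurable
    also have "\<dots> = (\<integral>\<^sup>+h. \<integral>\<^sup>+y. \<integral>\<^sup>+k. f (P * h, q' * h + (e * y + r * k)) \<partial>gauss \<partial>gauss \<partial>gauss)"
    proof -
      define F where "F = (\<lambda>(h, y). \<integral>\<^sup>+k. f (a j * y + p * h, b j * y + (q * h + r * k)) \<partial>gauss)"
      have [measurable]: "F \<in> borel_measurable (borel \<Otimes>\<^sub>M borel)" unfolding F_def by measurable
      have "a j * (s * h + c * y) + p * (c * h - s * y) = P * ((c\<^sup>2 + s\<^sup>2) * h)" for h y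
        unfolding cs(2,3) by (simp add: power2_eq_square algebra_simps)
      then have 1: "a j * (s * h + c * y) + p * (c * h - s * y) = P * h" for h y using cs(1) by simp
      have 2: "b j * (s * h + c * y) + (q * (c * h - s * y) + r * k) = q' * h + (e * y + r * k)" for h y k
        by (simp add: q'_def e_def algebra_simps)
      show ?thesis
        using gauss_rotation_invariant[of F c s] cs(1) by (simp add: F_def 1 2)
    qed
    also have "\<dots> = (\<integral>\<^sup>+h. \<integral>\<^sup>+k. f (P * h, q' * h + r' * k) \<partial>gauss \<partial>gauss)"
    proof (rule nn_integral_cong)
      fix h
      show "(\<integral>\<^sup>+y. \<integral>\<^sup>+k. f (P * h, q' * h + (e * y + r * k)) \<partial>gauss \<partial>gauss) = (\<integral>\<^sup>+k. f (P * h, q' * h + r' * k) \<partial>gauss)"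
        using gauss_combine_pair[of "\<lambda>z. f (P * h, q' * h + z)" e r] by (simp add: r'_def)
    qed
    finally show ?thesis .
  qed
  then show ?case
    using insert.hyps pqr g1 g2 g3 by (intro exI[of _ P] exI[of _ q'] exI[of _ r']) auto
qed

lemma nn_integral_cauchy:
  "(\<integral>\<^sup>+s. ennreal (1 / (pi * (1 + s\<^sup>2))) * indicator {t<..} s \<partial>lborel) = ennreal ((pi / 2 - arctan t) / pi)"
proof -
  have "(\<integral>\<^sup>+s. ennreal (1 / (pi * (1 + s\<^sup>2))) * indicator {t..} s \<partial>lborel) = ennreal (1/2 - arctan t / pi)"
  proof (rule nn_integral_FTC_atLeast)
    show "((\<lambda>s. arctan s / pi) has_real_derivative 1 / (pi * (1 + s\<^sup>2))) (at s)" for s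
    proof -
      have "1 + s\<^sup>2 \<noteq> 0" by (metis add_pos_nonneg less_numeral_extra(1,3) zero_le_power2)
      then show ?thesis
        by (auto intro!: derivative_eq_intros simp: divide_simps)
    qed
    show "((\<lambda>s. arctan s / pi) \<longlongrightarrow> 1 / 2) at_top"
      using tendsto_divide[OF tendsto_arctan_at_top tendsto_const[of pi]] by simp
  qed auto
  moreover have "(\<integral>\<^sup>+s. ennreal (1 / (pi * (1 + s\<^sup>2))) * indicator {t<..} s \<partial>lborel) =
    (\<integral>\<^sup>+s. ennreal (1 / (pi * (1 + s\<^sup>2))) * indicator {t..} s \<partial>lborel)"
    by (rule nn_integral_cong_AE, rule AE_mp[OF AE_lborel_singleton[of t]]) (auto simp: indicator_def)
  ultimately show ?thesis by (simp add: diff_divide_distrib)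
qed

lemma nn_integral_abs_exp:
  assumes "k > 0"
  shows "(\<integral>\<^sup>+h. ennreal (\<bar>h\<bar> * exp (- (k * h\<^sup>2) / 2) / (2 * pi)) \<partial>lborel) = ennreal (1 / (pi * k))"
proof -
  let ?f = "\<lambda>h. h * exp (- (k * h\<^sup>2) / 2) / (2 * pi)"
  have "(\<integral>\<^sup>+h. ennreal (?f h) * indicator {0..} h \<partial>lborel) = ennreal (0 - (- exp (- (k * 0\<^sup>2) / 2) / (2 * pi * k)))"
  proof (rule nn_integral_FTC_atLeast)
    show "((\<lambda>h. - exp (- (k * h\<^sup>2) / 2) / (2 * pi * k)) has_real_derivative ?f h) (at h)" for h
      using assms by (auto intro!: derivative_eq_intros simp: field_simps)
    have "filterlim (\<lambda>h. k * h\<^sup>2 / 2) at_top at_top" using assms by real_asymp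
    then have "((\<lambda>h. exp (- (k * h\<^sup>2 / 2))) \<longlongrightarrow> 0) at_top"
      by (intro filterlim_compose[OF exp_at_bot]) (simp add: filterlim_uminus_at_bot)
    then have "((\<lambda>h. - exp (- (k * h\<^sup>2 / 2)) / (2 * pi * k)) \<longlongrightarrow> - 0 / (2 * pi * k)) at_top"
      using assms by (intro tendsto_intros) auto
    then show "((\<lambda>h. - exp (- (k * h\<^sup>2) / 2) / (2 * pi * k)) \<longlongrightarrow> 0) at_top" by simp
  qed auto
  moreover have "(\<integral>\<^sup>+h. ennreal (\<bar>h\<bar> * exp (- (k * h\<^sup>2) / 2) / (2 * pi)) \<partial>lborel) =
     2 * (\<integral>\<^sup>+h. ennreal (\<bar>h\<bar> * exp (- (k * h\<^sup>2) / 2) / (2 * pi)) * indicator {0..} h \<partial>lborel)"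
  proof -
    let ?g = "\<lambda>h. ennreal (\<bar>h\<bar> * exp (- (k * h\<^sup>2) / 2) / (2 * pi))"
    have "(\<integral>\<^sup>+h. ?g h \<partial>lborel) = (\<integral>\<^sup>+h. ?g h * indicator {0..} h + ?g h * indicator {..<0} h \<partial>lborel)"
      by (rule nn_integral_cong) (auto simp: indicator_def)
    also have "\<dots> = (\<integral>\<^sup>+h. ?g h * indicator {0..} h \<partial>lborel) + (\<integral>\<^sup>+h. ?g h * indicator {..<0} h \<partial>lborel)"
      by (rule nn_integral_add) auto
    also have "(\<integral>\<^sup>+h. ?g h * indicator {..<0} h \<partial>lborel) =
        ennreal \<bar>-1\<bar> * (\<integral>\<^sup>+h. ?g (0 + (-1) * h) * indicator {..<0} (0 + (-1) * h) \<partial>lborel)"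
      by (rule nn_integral_real_affine) auto
    also have "\<dots> = (\<integral>\<^sup>+h. ?g h * indicator {0<..} h \<partial>lborel)"
      by (simp, rule nn_integral_cong) (auto simp: indicator_def)
    also have "\<dots> = (\<integral>\<^sup>+h. ?g h * indicator {0..} h \<partial>lborel)"
      by (rule nn_integral_cong) (auto simp: indicator_def)
    finally show ?thesis unfolding mult_2 .
  qed
  moreover have "(\<integral>\<^sup>+h. ennreal (\<bar>h\<bar> * exp (- (k * h\<^sup>2) / 2) / (2 * pi)) * indicator {0..} h \<partial>lborel) =
      (\<integral>\<^sup>+h. ennreal (?f h) * indicator {0..} h \<partial>lborel)"
    by (rule nn_integral_cong) (auto simp: indicator_def)
  moreover have "2 * ennreal (1 / (2 * pi * k)) = ennreal (1 / (pi * k))"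
    using assms by (simp add: ennreal_mult'[symmetric] flip: ennreal_numeral)
  ultimately show ?thesis by simp
qed

lemma sign_disagreement_sets:
  "{(h, k). (0 \<le> h) \<noteq> (0 \<le> t * h + k)} \<in> sets (borel \<Otimes>\<^sub>M (borel :: real measure))"
proof -
  have "{z \<in> space (borel \<Otimes>\<^sub>M (borel :: real measure)). (0 \<le> fst z) \<noteq> (0 \<le> t * fst z + snd z)}
    \<in> sets (borel \<Otimes>\<^sub>M borel)"
    by measurable
  then show ?thesis by (simp add: space_pair_measure split_beta')
qed

lemma sign_pair_sets:
  "{(u :: real, v). (0 \<le> u) \<noteq> (0 \<le> v)} \<in> sets (borel \<Otimes>\<^sub>M (borel :: real measure))"
proof -
  have "{z \<in> space (borel \<Otimes>\<^sub>M (borel :: real measure)). (0 \<le> (fst z :: real)) \<noteq> (0 \<le> snd z)}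
    \<in> sets (borel \<Otimes>\<^sub>M borel)"
    by measurable
  then show ?thesis by (simp add: space_pair_measure split_beta')
qed

lemma gauss_disagreement_arctan:
  fixes t :: real
  shows "ennreal ((pi / 2 - arctan t) / pi) \<le>
    (\<integral>\<^sup>+h. \<integral>\<^sup>+k. indicator {(h, k). (0 \<le> h) \<noteq> (0 \<le> t * h + k)} (h, k) \<partial>gauss \<partial>gauss)"
proof -
  have [measurable]: "{(h, k). (0 \<le> h) \<noteq> (0 \<le> t * h + k)} \<in> sets (borel \<Otimes>\<^sub>M (borel :: real measure))"
    by (rule sign_disagreement_sets)
  let ?d = "\<lambda>h s. ennreal (\<bar>h\<bar> * exp (- ((1 + s\<^sup>2) * h\<^sup>2) / 2) / (2 * pi))"
  have pos: "1 + s\<^sup>2 > 0" for s :: real by (simp add: add_pos_nonneg)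
  have "ennreal ((pi / 2 - arctan t) / pi) =
      (\<integral>\<^sup>+s. (\<integral>\<^sup>+h. ?d h s \<partial>lborel) * indicator {t<..} s \<partial>lborel)"
    by (subst nn_integral_abs_exp[OF pos]) (simp only: nn_integral_cauchy)
  also have "\<dots> = (\<integral>\<^sup>+s. \<integral>\<^sup>+h. ?d h s * indicator {t<..} s \<partial>lborel \<partial>lborel)"
    by (rule nn_integral_cong, rule nn_integral_multc[symmetric]) measurable
  also have "\<dots> = (\<integral>\<^sup>+h. \<integral>\<^sup>+s. ?d h s * indicator {t<..} s \<partial>lborel \<partial>lborel)"
    by (rule lborel_pair.Fubini') measurable
  also have "\<dots> \<le> (\<integral>\<^sup>+h. \<integral>\<^sup>+k. ennreal (exp (- (h\<^sup>2 + k\<^sup>2) / 2) / (2 * pi)) *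
      indicator {(h, k). (0 \<le> h) \<noteq> (0 \<le> t * h + k)} (h, k) \<partial>lborel \<partial>lborel)"
  proof (rule nn_integral_mono)
    fix h :: real
    show "(\<integral>\<^sup>+s. ?d h s * indicator {t<..} s \<partial>lborel) \<le>
      (\<integral>\<^sup>+k. ennreal (exp (- (h\<^sup>2 + k\<^sup>2) / 2) / (2 * pi)) *
        indicator {(h, k). (0 \<le> h) \<noteq> (0 \<le> t * h + k)} (h, k) \<partial>lborel)"
    proof (cases "h = 0")
      case False
      have "(\<integral>\<^sup>+k. ennreal (exp (- (h\<^sup>2 + k\<^sup>2) / 2) / (2 * pi)) *
        indicator {(h, k). (0 \<le> h) \<noteq> (0 \<le> t * h + k)} (h, k) \<partial>lborel) =
        ennreal \<bar>-h\<bar> * (\<integral>\<^sup>+s. ennreal (exp (- (h\<^sup>2 + (0 + (-h) * s)\<^sup>2) / 2) / (2 * pi)) *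
        indicator {(h, k). (0 \<le> h) \<noteq> (0 \<le> t * h + k)} (h, 0 + (-h) * s) \<partial>lborel)"
        by (rule nn_integral_real_affine) (use False in auto)
      also have "\<dots> = (\<integral>\<^sup>+s. ennreal \<bar>-h\<bar> * (ennreal (exp (- (h\<^sup>2 + (0 + (-h) * s)\<^sup>2) / 2) / (2 * pi)) *
        indicator {(h, k). (0 \<le> h) \<noteq> (0 \<le> t * h + k)} (h, 0 + (-h) * s)) \<partial>lborel)"
        by (rule nn_integral_cmult[symmetric]) measurable
      also have "\<dots> \<ge> (\<integral>\<^sup>+s. ?d h s * indicator {t<..} s \<partial>lborel)"
      proof (rule nn_integral_mono)
        fix s :: real
        have 1: "(0 \<le> h) \<noteq> (0 \<le> t * h + - (h * s))" if "t < s"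
        proof -
          have e: "t * h + - (h * s) = h * (t - s)" by (simp add: algebra_simps)
          show ?thesis unfolding e using that False by (auto simp: zero_le_mult_iff)
        qed
        have 2: "h\<^sup>2 + (0 + (-h) * s)\<^sup>2 = (1 + s\<^sup>2) * h\<^sup>2" by (simp add: power2_eq_square algebra_simps)
        show "?d h s * indicator {t<..} s \<le> ennreal \<bar>-h\<bar> * (ennreal (exp (- (h\<^sup>2 + (0 + (-h) * s)\<^sup>2) / 2) / (2 * pi)) *
          indicator {(h, k). (0 \<le> h) \<noteq> (0 \<le> t * h + k)} (h, 0 + (-h) * s))"
          unfolding 2 using 1 by (cases "t < s") (auto simp: ennreal_mult'[symmetric])
      qed
      finally show ?thesis .
    qed simp
  qed
  also have "\<dots> = (\<integral>\<^sup>+h. \<integral>\<^sup>+k. indicator {(h, k). (0 \<le> h) \<noteq> (0 \<le> t * h + k)} (h, k) \<partial>gauss \<partial>gauss)"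
    by (rule nn_integral_gauss_pair[symmetric]) measurable
  finally show ?thesis .
qed

lemma nn_integral_gauss_sgn:
  assumes [measurable]: "f \<in> borel_measurable borel" and "\<bar>c\<bar> = 1"
  shows "(\<integral>\<^sup>+x. f (c * x) \<partial>gauss) = (\<integral>\<^sup>+x. f x \<partial>gauss)"
proof -
  have "c = 1 \<or> c = -1" using assms(2) by linarith
  then have c: "c \<noteq> 0" "c\<^sup>2 = 1" by auto
  have d: "std_normal_density (c * x) = std_normal_density x" for x
    using c by (simp add: std_normal_density_def power_mult_distrib)
  have "(\<integral>\<^sup>+x. f x \<partial>gauss) = (\<integral>\<^sup>+x. ennreal (std_normal_density x) * f x \<partial>lborel)"
    by (simp add: nn_integral_density)
  also have "\<dots> = ennreal \<bar>c\<bar> * (\<integral>\<^sup>+x. ennreal (std_normal_density (0 + c * x)) * f (0 + c * x) \<partial>lborel)"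
    by (rule nn_integral_real_affine) (use c in auto)
  also have "\<dots> = (\<integral>\<^sup>+x. f (c * x) \<partial>gauss)"
    using assms(2) by (simp add: nn_integral_density d)
  finally show ?thesis by simp
qed

lemma alpha_GW_le:
  assumes "0 < t" "t \<le> pi"
  shows "alpha_GW * (1 - cos t) / 2 \<le> t / pi"
proof (rule alpha_GW_attained)
  assume a: "\<And>t. 0 < t \<Longrightarrow> t \<le> pi \<Longrightarrow> alpha_GW \<le> (2 / pi) * (t / (1 - cos t))"
  from a[OF assms] have "alpha_GW \<le> (2 / pi) * (t / (1 - cos t))" .
  moreover have "cos t < 1" using cos_monotone_0_pi[of 0 t] assms by simp
  ultimately show ?thesis by (simp add: field_simps)
qed

lemma alpha_GW_bounds: "0 < alpha_GW" "alpha_GW \<le> 1"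
proof -
  show "0 < alpha_GW"
  proof (rule alpha_GW_attained)
    fix \<theta> :: real
    assume t: "0 < \<theta>" "\<theta> \<le> pi" "alpha_GW = (2 / pi) * (\<theta> / (1 - cos \<theta>))"
    have "cos \<theta> < 1" using cos_monotone_0_pi[of 0 \<theta>] t(1,2) by simp
    then have "0 < (2 / pi) * (\<theta> / (1 - cos \<theta>))" using t(1) by (intro mult_pos_pos divide_pos_pos) auto
    then show ?thesis using t(3) by simp
  qed
  show "alpha_GW \<le> 1" using alpha_GW_le[of pi] by simp
qed

lemma gauss_sign_disagreement:
  fixes p q r :: real
  assumes p: "p \<noteq> 0" and r: "r \<noteq> 0"
  shows "ennreal (alpha_GW * (1 - p * q / (\<bar>p\<bar> * sqrt (q\<^sup>2 + r\<^sup>2))) / 2) \<le>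
    (\<integral>\<^sup>+h. \<integral>\<^sup>+k. indicator {(u, v). (0 \<le> u) \<noteq> (0 \<le> v)} (p * h, q * h + r * k) \<partial>gauss \<partial>gauss)"
proof -
  interpret prob_space gauss by (rule prob_space_gauss)
  define f :: "real \<times> real \<Rightarrow> ennreal" where "f = indicator {(u, v). (0 \<le> u) \<noteq> (0 \<le> v)}"
  have [measurable]: "f \<in> borel_measurable (borel \<Otimes>\<^sub>M borel)"
    unfolding f_def by (rule borel_measurable_indicator[OF sign_pair_sets])
  define t where "t = sgn p * q / \<bar>r\<bar>"
  have sg: "\<bar>sgn p\<bar> = 1" "\<bar>sgn r\<bar> = 1" using p r by (auto simp: sgn_if)
  have "(\<integral>\<^sup>+h. \<integral>\<^sup>+k. f (p * h, q * h + r * k) \<partial>gauss \<partial>gauss) =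
     (\<integral>\<^sup>+h. \<integral>\<^sup>+k. f (p * (sgn p * h), q * (sgn p * h) + r * k) \<partial>gauss \<partial>gauss)"
    by (rule nn_integral_gauss_sgn[where f="\<lambda>h. \<integral>\<^sup>+k. f (p * h, q * h + r * k) \<partial>gauss", OF _ sg(1), symmetric])
      measurable
  also have "\<dots> = (\<integral>\<^sup>+h. \<integral>\<^sup>+k. f (p * (sgn p * h), q * (sgn p * h) + r * (sgn r * k)) \<partial>gauss \<partial>gauss)"
  proof (rule nn_integral_cong)
    fix h
    show "(\<integral>\<^sup>+k. f (p * (sgn p * h), q * (sgn p * h) + r * k) \<partial>gauss) =
        (\<integral>\<^sup>+k. f (p * (sgn p * h), q * (sgn p * h) + r * (sgn r * k)) \<partial>gauss)"
      by (rule nn_integral_gauss_sgn[where f="\<lambda>k. f (p * (sgn p * h), q * (sgn p * h) + r * k)", OF _ sg(2), symmetric])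
        measurable
  qed
  also have "\<dots> = (\<integral>\<^sup>+h. \<integral>\<^sup>+k. indicator {(h, k). (0 \<le> h) \<noteq> (0 \<le> t * h + k)} (h, k) \<partial>gauss \<partial>gauss)"
  proof (intro nn_integral_cong)
    fix h k :: real
    have 1: "p * (sgn p * h) = \<bar>p\<bar> * h" by (simp add: sgn_if)
    have 2: "r * (sgn r * k) = \<bar>r\<bar> * k" by (simp add: sgn_if)
    have 3: "q * (sgn p * h) + r * (sgn r * k) = \<bar>r\<bar> * (t * h + k)"
      unfolding 2 using r by (simp add: t_def algebra_simps)
    show "f (p * (sgn p * h), q * (sgn p * h) + r * (sgn r * k)) =
       indicator {(h, k). (0 \<le> h) \<noteq> (0 \<le> t * h + k)} (h, k)"
      unfolding 1 3 f_def using p r by (simp add: indicator_def zero_le_mult_iff)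
  qed
  finally have eq: "(\<integral>\<^sup>+h. \<integral>\<^sup>+k. f (p * h, q * h + r * k) \<partial>gauss \<partial>gauss) =
    (\<integral>\<^sup>+h. \<integral>\<^sup>+k. indicator {(h, k). (0 \<le> h) \<noteq> (0 \<le> t * h + k)} (h, k) \<partial>gauss \<partial>gauss)" .
  define \<theta> where "\<theta> = pi / 2 - arctan t"
  have th: "0 < \<theta>" "\<theta> \<le> pi"
    using arctan_bounded[of t] by (auto simp: \<theta>_def)
  have "cos \<theta> = sin (arctan t)" unfolding \<theta>_def by (simp add: cos_diff)
  also have "\<dots> = t / sqrt (1 + t\<^sup>2)" by (simp add: sin_arctan)
  also have "1 + t\<^sup>2 = (q\<^sup>2 + r\<^sup>2) / r\<^sup>2"
    using r p by (simp add: t_def power_divide power_mult_distrib sgn_if field_simps)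
  also have "sqrt \<dots> = sqrt (q\<^sup>2 + r\<^sup>2) / \<bar>r\<bar>" by (simp add: real_sqrt_divide)
  also have "t / \<dots> = sgn p * q / sqrt (q\<^sup>2 + r\<^sup>2)" using r by (simp add: t_def)
  also have "\<dots> = p * q / (\<bar>p\<bar> * sqrt (q\<^sup>2 + r\<^sup>2))" using p by (simp add: sgn_if)
  finally have c: "cos \<theta> = p * q / (\<bar>p\<bar> * sqrt (q\<^sup>2 + r\<^sup>2))" .
  have "alpha_GW * (1 - cos \<theta>) / 2 \<le> \<theta> / pi" using th by (rule alpha_GW_le)
  then have "ennreal (alpha_GW * (1 - cos \<theta>) / 2) \<le> ennreal ((pi / 2 - arctan t) / pi)"
    by (intro ennreal_leI) (simp add: \<theta>_def)
  also note gauss_disagreement_arctan[of t]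
  finally show ?thesis unfolding f_def[symmetric] eq c .
qed

interpretation gauss_space: product_prob_space "\<lambda>_::nat. gauss" UNIV
  by (intro product_prob_spaceI prob_space_gauss)

lemma prob_space_gaussian_sequences: "prob_space gaussian_sequences"
  unfolding gaussian_sequences_def by (rule gauss_space.prob_space_axioms)

lemma space_gaussian_sequences [simp]: "space gaussian_sequences = UNIV"
  by (simp add: gaussian_sequences_def space_PiM)

lemma measurable_gaussian_sequences: "(\<lambda>\<omega>. \<omega> i) \<in> borel_measurable gaussian_sequences"
proof -
  have "(\<lambda>\<omega>. \<omega> i) \<in> measurable (\<Pi>\<^sub>M i\<in>(UNIV :: nat set). gauss) gauss"
    by (rule measurable_component_singleton) simp
  then show ?thesis by (simp add: gaussian_sequences_def)
qed

lemma nn_integral_gaussian_sequences_restrict: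
  assumes "finite I" and [measurable]: "f \<in> borel_measurable (\<Pi>\<^sub>M i\<in>I. gauss)"
  shows "(\<integral>\<^sup>+\<omega>. f (restrict \<omega> I) \<partial>gaussian_sequences) = (\<integral>\<^sup>+x. f x \<partial>(\<Pi>\<^sub>M i\<in>I. gauss))"
proof -
  have "(\<integral>\<^sup>+x. f x \<partial>(\<Pi>\<^sub>M i\<in>I. gauss)) =
     (\<integral>\<^sup>+x. f x \<partial>(distr (\<Pi>\<^sub>M i\<in>UNIV. gauss) (\<Pi>\<^sub>M i\<in>I. gauss) (\<lambda>x. restrict x I)))"
    using gauss_space.distr_PiM_restrict_finite[of I] assms(1) by simp
  also have "\<dots> = (\<integral>\<^sup>+\<omega>. f (restrict \<omega> I) \<partial>gaussian_sequences)"
    unfolding gaussian_sequences_def by (rule nn_integral_distr) (auto intro!: measurable_restrict_subset)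
  finally show ?thesis ..
qed

lemma sign_disagreement_prob:
  fixes a b :: "nat \<Rightarrow> real"
  assumes I: "finite I" and indep: "(\<Sum>i\<in>I. a i * b i)\<^sup>2 < (\<Sum>i\<in>I. (a i)\<^sup>2) * (\<Sum>i\<in>I. (b i)\<^sup>2)"
  shows "alpha_GW * (1 - (\<Sum>i\<in>I. a i * b i) / sqrt ((\<Sum>i\<in>I. (a i)\<^sup>2) * (\<Sum>i\<in>I. (b i)\<^sup>2))) / 2 \<le>
    measure gaussian_sequences {\<omega>. (0 \<le> (\<Sum>i\<in>I. a i * \<omega> i)) \<noteq> (0 \<le> (\<Sum>i\<in>I. b i * \<omega> i))}"
    (is "?L \<le> measure _ ?A")
proof -
  interpret prob_space gaussian_sequences by (rule prob_space_gaussian_sequences)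
  let ?f = "indicator {(u, v). (0 \<le> u) \<noteq> (0 \<le> v)} :: real \<times> real \<Rightarrow> ennreal"
  have [measurable]: "{(u :: real, v). (0 \<le> u) \<noteq> (0 \<le> v)} \<in> sets (borel \<Otimes>\<^sub>M (borel :: real measure))"
    by (rule sign_pair_sets)
  obtain p q r where pqr: "p\<^sup>2 = (\<Sum>i\<in>I. (a i)\<^sup>2)" "p * q = (\<Sum>i\<in>I. a i * b i)" "q\<^sup>2 + r\<^sup>2 = (\<Sum>i\<in>I. (b i)\<^sup>2)"
    and law: "\<And>f. f \<in> borel_measurable (borel \<Otimes>\<^sub>M borel) \<Longrightarrow>
      (\<integral>\<^sup>+x. f (\<Sum>i\<in>I. a i * x i, \<Sum>i\<in>I. b i * x i) \<partial>(\<Pi>\<^sub>M i\<in>I. gauss)) =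
      (\<integral>\<^sup>+h. \<integral>\<^sup>+k. f (p * h, q * h + r * k) \<partial>gauss \<partial>gauss)"
    using gauss_joint_law[OF I, of a b] by blast
  have "(p * q)\<^sup>2 < p\<^sup>2 * (q\<^sup>2 + r\<^sup>2)" using indep by (simp add: pqr)
  then have nz: "p \<noteq> 0" "r \<noteq> 0" by (auto simp: power_mult_distrib)
  have "{\<omega> \<in> space gaussian_sequences. (0 \<le> (\<Sum>i\<in>I. a i * \<omega> i)) \<noteq> (0 \<le> (\<Sum>i\<in>I. b i * \<omega> i))} \<in> sets gaussian_sequences"
    using measurable_gaussian_sequences[measurable] by measurable
  then have A: "?A \<in> sets gaussian_sequences" by simp
  have "ennreal ?L \<le> (\<integral>\<^sup>+h. \<integral>\<^sup>+k. ?f (p * h, q * h + r * k) \<partial>gauss \<partial>gauss)"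
    using gauss_sign_disagreement[OF nz, of q] by (simp add: pqr[symmetric] real_sqrt_mult)
  also have "\<dots> = (\<integral>\<^sup>+x. ?f (\<Sum>i\<in>I. a i * x i, \<Sum>i\<in>I. b i * x i) \<partial>(\<Pi>\<^sub>M i\<in>I. gauss))"
    by (rule law[symmetric]) measurable
  also have "\<dots> = (\<integral>\<^sup>+\<omega>. ?f (\<Sum>i\<in>I. a i * restrict \<omega> I i, \<Sum>i\<in>I. b i * restrict \<omega> I i) \<partial>gaussian_sequences)"
    by (rule nn_integral_gaussian_sequences_restrict[OF I, symmetric,
          where f="\<lambda>x. ?f (\<Sum>i\<in>I. a i * x i, \<Sum>i\<in>I. b i * x i)"]) measurable
  also have "\<dots> = (\<integral>\<^sup>+\<omega>. indicator ?A \<omega> \<partial>gaussian_sequences)"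
    by (rule nn_integral_cong) (simp add: indicator_def)
  also have "\<dots> = ennreal (measure gaussian_sequences ?A)"
    using A by (simp add: emeasure_eq_measure)
  finally show ?thesis by simp
qed

lemma indep_blocks:
  fixes Q :: "nat \<Rightarrow> (nat \<Rightarrow> real) \<Rightarrow> bool"
  assumes fin: "\<And>k. k < R \<Longrightarrow> finite (J k)" and disj: "disjoint_family_on J {..<R}"
    and meas: "\<And>k. k < R \<Longrightarrow> {\<omega>. Q k \<omega>} \<in> sets gaussian_sequences"
    and dep: "\<And>k \<omega> \<omega>'. k < R \<Longrightarrow> (\<forall>i\<in>J k. \<omega> i = \<omega>' i) \<Longrightarrow> Q k \<omega> = Q k \<omega>'"
    and p: "\<And>k. k < R \<Longrightarrow> measure gaussian_sequences {\<omega>. Q k \<omega>} \<le> c"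
  shows "measure gaussian_sequences {\<omega>. \<forall>k<R. Q k \<omega>} \<le> c ^ R"
proof (cases "R = 0")
  case True
  then show ?thesis using prob_space.prob_le_1[OF prob_space_gaussian_sequences] by simp
next
  case False
  interpret prob_space gaussian_sequences by (rule prob_space_gaussian_sequences)
  have rv: "random_variable gauss (\<lambda>\<omega>. \<omega> i)" for i
    using measurable_gaussian_sequences[of i] by simp
  have d: "distr gaussian_sequences gauss (\<lambda>\<omega>. \<omega> i) = gauss" for i
    unfolding gaussian_sequences_def by (rule distr_PiM_component) (auto intro: prob_space_gauss)
  have "indep_vars (\<lambda>_. gauss) (\<lambda>i \<omega>. \<omega> i) UNIV"
  proof (subst indep_vars_iff_distr_eq_PiM)
    show "distr gaussian_sequences (\<Pi>\<^sub>M i\<in>UNIV. gauss) (\<lambda>x. \<lambda>i\<in>UNIV. x i) =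
        (\<Pi>\<^sub>M i\<in>UNIV. distr gaussian_sequences gauss (\<lambda>\<omega>. \<omega> i))"
      unfolding d by (simp add: gaussian_sequences_def restrict_UNIV distr_id)
  qed (use rv in auto)
  then have iv: "indep_vars (\<lambda>k. \<Pi>\<^sub>M i\<in>J k. gauss) (\<lambda>k \<omega>. restrict \<omega> (J k)) {..<R}"
    by (rule indep_vars_restrict) (use disj in auto)
  define ext where "ext k x = (\<lambda>i. if i \<in> J k then x i else 0 :: real)" for k and x :: "nat \<Rightarrow> real"
  have "(\<lambda>x. Q k (ext k x)) \<in> measurable (\<Pi>\<^sub>M i\<in>J k. gauss) (count_space UNIV)" if "k < R" for k
  proof -
    have "(\<lambda>x. ext k x i) \<in> measurable (\<Pi>\<^sub>M i\<in>J k. gauss) gauss" for i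
      by (cases "i \<in> J k") (auto simp: ext_def)
    then have e: "ext k \<in> measurable (\<Pi>\<^sub>M i\<in>J k. gauss) gaussian_sequences"
      unfolding gaussian_sequences_def by (intro measurable_PiM_single') auto
    have "(\<lambda>\<omega>. Q k \<omega>) \<in> measurable gaussian_sequences (count_space UNIV)"
      using meas[OF that] by (simp add: pred_def)
    from measurable_compose[OF e this] show ?thesis .
  qed
  with iv have iv2: "indep_vars (\<lambda>_. count_space UNIV) (\<lambda>k \<omega>. Q k (ext k (restrict \<omega> (J k)))) {..<R}"
    by (intro indep_vars_compose2[where Y="\<lambda>k x. Q k (ext k x)" and X="\<lambda>k \<omega>. restrict \<omega> (J k)"]) auto
  have Q_ext: "Q k (ext k (restrict \<omega> (J k))) = Q k \<omega>" if "k < R" for k \<omega>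
    by (rule dep[OF that]) (simp add: ext_def)
  have "indep_vars (\<lambda>_. count_space UNIV) (\<lambda>k \<omega>. Q k \<omega>) {..<R}"
    by (rule iffD1[OF indep_vars_cong[OF refl _ refl] iv2]) (use Q_ext in auto)
  then have "prob (\<Inter>k\<in>{..<R}. (\<lambda>\<omega>. Q k \<omega>) -` {True} \<inter> space gaussian_sequences) =
      (\<Prod>k\<in>{..<R}. prob ((\<lambda>\<omega>. Q k \<omega>) -` {True} \<inter> space gaussian_sequences))"
    by (rule indep_varsD) (use False in auto)
  moreover have "(\<Inter>k\<in>{..<R}. (\<lambda>\<omega>. Q k \<omega>) -` {True} \<inter> space gaussian_sequences) = {\<omega>. \<forall>k<R. Q k \<omega>}"
    using False by auto
  moreover have "(\<lambda>\<omega>. Q k \<omega>) -` {True} \<inter> space gaussian_sequences = {\<omega>. Q k \<omega>}" for k by auto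
  ultimately have "prob {\<omega>. \<forall>k<R. Q k \<omega>} = (\<Prod>k<R. prob {\<omega>. Q k \<omega>})" by simp
  also have "\<dots> \<le> (\<Prod>k<R. c)" by (rule prod_mono) (use p in auto)
  finally show ?thesis by simp
qed

section \<open>Coordinate descent for the semidefinite relaxation\<close>

definition qform :: "nat \<Rightarrow> (nat \<Rightarrow> nat \<Rightarrow> real) \<Rightarrow> (nat \<Rightarrow> real) \<Rightarrow> real" where
  "qform n S v = (\<Sum>i<n. \<Sum>j<n. v i * S i j * v j)"

definition posdef :: "nat \<Rightarrow> (nat \<Rightarrow> nat \<Rightarrow> real) \<Rightarrow> bool" where
  "posdef n S \<longleftrightarrow> (\<forall>i<n. \<forall>j<n. S i j = S j i) \<and> (\<forall>v. (\<exists>i<n. v i \<noteq> 0) \<longrightarrow> 0 < qform n S v)"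

lemma posdefD:
  assumes "posdef n S" "i < n" "v i \<noteq> 0"
  shows "0 < qform n S v"
  using assms unfolding posdef_def by blast

definition inverse_pair :: "nat \<Rightarrow> (nat \<Rightarrow> nat \<Rightarrow> real) \<Rightarrow> (nat \<Rightarrow> nat \<Rightarrow> real) \<Rightarrow> bool" where
  "inverse_pair n S G \<longleftrightarrow> (\<forall>i<n. \<forall>j<n. (\<Sum>k<n. S i k * G k j) = of_bool (i = j)) \<and>
     (\<forall>i<n. \<forall>j<n. G i j = G j i)"

lemma sum_of_bool [simp]:
  fixes f :: "nat \<Rightarrow> real"
  shows "(\<Sum>j<n. f j * of_bool (j = i)) = (if i < n then f i else 0)"
    "(\<Sum>j<n. f j * of_bool (i = j)) = (if i < n then f i else 0)"
    "(\<Sum>j<n. of_bool (j = i) * f j) = (if i < n then f i else 0)"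
    "(\<Sum>j<n. of_bool (i = j) * f j) = (if i < n then f i else 0)"
proof -
  show 1: "(\<Sum>j<n. f j * of_bool (j = i)) = (if i < n then f i else 0)"
    by (simp add: of_bool_def if_distrib[of "\<lambda>x. _ * x"] cong: if_cong)
  then show "(\<Sum>j<n. f j * of_bool (i = j)) = (if i < n then f i else 0)"
    by (simp only: eq_commute[of i])
  show "(\<Sum>j<n. of_bool (j = i) * f j) = (if i < n then f i else 0)"
    unfolding 1[symmetric] by (simp only: mult.commute)
  then show "(\<Sum>j<n. of_bool (i = j) * f j) = (if i < n then f i else 0)"
    by (simp only: eq_commute[of i])
qed

lemma inverse_pair_apply:
  assumes "inverse_pair n S G" "i < n"
  shows "(\<Sum>k<n. S i k * (\<Sum>l<n. G k l * u l)) = u i"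
proof -
  have "(\<Sum>k<n. S i k * (\<Sum>l<n. G k l * u l)) = (\<Sum>k<n. \<Sum>l<n. (S i k * G k l) * u l)"
    by (simp add: sum_distrib_left mult.assoc)
  also have "\<dots> = (\<Sum>l<n. (\<Sum>k<n. S i k * G k l) * u l)"
    by (subst sum.swap) (simp add: sum_distrib_right)
  also have "\<dots> = (\<Sum>l<n. of_bool (i = l) * u l)"
    using assms by (intro sum.cong) (auto simp: inverse_pair_def)
  finally show ?thesis using assms by simp
qed

lemma qform_inverse:
  assumes "inverse_pair n S G"
  shows "qform n S (\<lambda>k. \<Sum>l<n. G k l * u l) = (\<Sum>i<n. u i * (\<Sum>l<n. G i l * u l))"
proof -
  have "qform n S (\<lambda>k. \<Sum>l<n. G k l * u l) = (\<Sum>i<n. (\<Sum>l<n. G i l * u l) * (\<Sum>k<n. S i k * (\<Sum>l<n. G k l * u l)))"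
    unfolding qform_def by (simp add: sum_distrib_left mult.assoc)
  also have "\<dots> = (\<Sum>i<n. (\<Sum>l<n. G i l * u l) * u i)"
    using inverse_pair_apply[OF assms] by (intro sum.cong) auto
  finally show ?thesis by (simp add: mult.commute)
qed

lemma inverse_nonzero:
  assumes "inverse_pair n S G" "i < n" "u i \<noteq> 0"
  shows "\<exists>k<n. (\<Sum>l<n. G k l * u l) \<noteq> 0"
proof (rule ccontr)
  assume "\<not> ?thesis"
  then have "(\<Sum>k<n. S i k * (\<Sum>l<n. G k l * u l)) = 0" by (intro sum.neutral) simp
  then show False using inverse_pair_apply[OF assms(1,2), of u] assms(3) by simp
qed

lemma posdef_inverse:
  assumes "inverse_pair n S G" "posdef n S"
  shows "posdef n G"
  unfolding posdef_def
proof (intro conjI allI impI)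
  show "G i j = G j i" if "i < n" "j < n" for i j using assms(1) that by (simp add: inverse_pair_def)
  fix u :: "nat \<Rightarrow> real" assume "\<exists>i<n. u i \<noteq> 0"
  then obtain i where i: "i < n" "u i \<noteq> 0" by blast
  obtain k where "k < n" "(\<Sum>l<n. G k l * u l) \<noteq> 0"
    using inverse_nonzero[of n S G i u, OF assms(1) i] by blast
  then have "0 < qform n S (\<lambda>k. \<Sum>l<n. G k l * u l)" by (rule posdefD[OF assms(2)])
  also have "\<dots> = qform n G u"
    unfolding qform_inverse[OF assms(1)] by (simp add: qform_def sum_distrib_left mult.assoc)
  finally show "0 < qform n G u" .
qed

lemma qform_two:
  assumes "i < n" "j < n" "S i j = S j i"
  shows "qform n S (\<lambda>a. p * of_bool (a = i) + q * of_bool (a = j)) = p\<^sup>2 * S i i + 2 * p * q * S i j + q\<^sup>2 * S j j"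
proof -
  have r: "c * s * (p * x + q * y) = (c * p * s) * x + (c * q * s) * y" for c s x y :: real
    by (simp add: algebra_simps)
  have l: "(p * x + q * y) * c = (p * c) * x + (q * c) * y" for c x y :: real
    by (simp add: algebra_simps)
  have "qform n S (\<lambda>a. p * of_bool (a = i) + q * of_bool (a = j)) =
     (\<Sum>a<n. (p * of_bool (a = i) + q * of_bool (a = j)) * (p * S a i + q * S a j))"
    unfolding qform_def r sum.distrib sum_of_bool using assms
    by (simp only: if_True sum.distrib[symmetric]) (simp only: distrib_left mult.assoc)
  also have "\<dots> = p * (p * S i i + q * S i j) + q * (p * S j i + q * S j j)"
    unfolding l sum.distrib sum_of_bool using assms by simp
  finally show ?thesis using assms(3) by (simp add: power2_eq_square algebra_simps)
qed

lemma posdef_diag: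
  assumes "posdef n S" "i < n"
  shows "0 < S i i"
proof -
  have "0 < qform n S (\<lambda>a. 1 * of_bool (a = i) + 0 * of_bool (a = i))"
    by (rule posdefD[OF assms]) simp
  then show ?thesis using qform_two[of i n i S 1 0] assms by simp
qed

lemma posdef_minor:
  assumes "posdef n S" "i < n" "j < n" "i \<noteq> j"
  shows "(S i j)\<^sup>2 < S i i * S j j"
proof -
  have s: "S i j = S j i" using assms by (auto simp: posdef_def)
  note d = posdef_diag[OF assms(1)]
  let ?v = "\<lambda>a. S j j * of_bool (a = i) + (- S i j) * of_bool (a = j)"
  have "?v i \<noteq> 0" using assms d[of j] by simp
  then have "0 < qform n S ?v" by (rule posdefD[OF assms(1,2)])
  also have "\<dots> = S j j * (S i i * S j j - (S i j)\<^sup>2)"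
    unfolding qform_two[OF assms(2,3) s] by (simp add: power2_eq_square algebra_simps)
  finally show ?thesis using d[of j] assms by (simp add: zero_less_mult_iff)
qed

lemma rank_one_inverse:
  assumes inv: "inverse_pair n S G" and f: "f * (1 + c * (\<Sum>i<n. u i * h i)) = c"
    and h: "\<And>i. i < n \<Longrightarrow> h i = (\<Sum>k<n. G i k * u k)"
    and S': "\<And>i j. i < n \<Longrightarrow> j < n \<Longrightarrow> S' i j = S i j + c * u i * u j"
    and G': "\<And>i j. i < n \<Longrightarrow> j < n \<Longrightarrow> G' i j = G i j - f * h i * h j"
  shows "inverse_pair n S' G'"
  unfolding inverse_pair_def
proof (intro conjI allI impI)
  have Gs: "G i j = G j i" if "i < n" "j < n" for i j using inv that by (simp add: inverse_pair_def)
  show "G' i j = G' j i" if "i < n" "j < n" for i j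
    using that Gs[OF that] by (simp add: G')
  define \<gamma> where "\<gamma> = (\<Sum>i<n. u i * h i)"
  fix i j assume ij: "i < n" "j < n"
  have Sh: "(\<Sum>k<n. S i k * h k) = u i"
    using inverse_pair_apply[OF inv ij(1), of u] h by simp
  have uG: "(\<Sum>k<n. u k * G k j) = h j"
    unfolding h[OF ij(2)] using Gs ij by (intro sum.cong) (auto simp: mult.commute)
  have "(\<Sum>k<n. S' i k * G' k j) = (\<Sum>k<n. S i k * G k j - (f * h j) * (S i k * h k) + (c * u i) * (u k * G k j) - (c * u i * f * h j) * (u k * h k))"
    using ij by (intro sum.cong) (auto simp: S' G' algebra_simps)
  also have "\<dots> = (\<Sum>k<n. S i k * G k j) - (f * h j) * (\<Sum>k<n. S i k * h k) + (c * u i) * (\<Sum>k<n. u k * G k j) - (c * u i * f * h j) * (\<Sum>k<n. u k * h k)"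
    by (simp add: sum.distrib sum_subtractf sum_distrib_left)
  also have "\<dots> = of_bool (i = j) + u i * h j * (c - f * (1 + c * \<gamma>))"
    using inv ij unfolding Sh uG \<gamma>_def by (simp add: inverse_pair_def algebra_simps)
  also have "\<dots> = of_bool (i = j)" using f by (simp add: \<gamma>_def)
  finally show "(\<Sum>k<n. S' i k * G' k j) = of_bool (i = j)" .
qed

lemma qform_coordinate:
  assumes "i < n" "\<And>a b. a < n \<Longrightarrow> b < n \<Longrightarrow> S' a b = S a b + t * of_bool (a = i) * of_bool (b = i)"
  shows "qform n S' v = qform n S v + t * (v i)\<^sup>2"
proof -
  have "qform n S' v = (\<Sum>a<n. (\<Sum>b<n. v a * S a b * v b) + (\<Sum>b<n. (v a * t * of_bool (a = i) * v b) * of_bool (b = i)))"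
    unfolding qform_def sum.distrib[symmetric] using assms(2) by (intro sum.cong refl) (auto simp: algebra_simps)
  also have "\<dots> = qform n S v + (\<Sum>a<n. v a * t * of_bool (a = i) * v i)"
    unfolding qform_def sum.distrib sum_of_bool if_P[OF assms(1)] ..
  also have "(\<Sum>a<n. v a * t * of_bool (a = i) * v i) = (\<Sum>a<n. (v a * t * v i) * of_bool (a = i))"
    by (intro sum.cong refl) (simp only: mult_ac)
  finally show ?thesis unfolding sum_of_bool if_P[OF assms(1)] by (simp only: power2_eq_square mult_ac)
qed

lemma inverse_cauchy_schwarz:
  assumes inv: "inverse_pair n S G" and pd: "posdef n S" and i: "i < n"
  shows "(v i)\<^sup>2 \<le> G i i * qform n S v"
proof -
  define g where "g = G i i"
  have g: "0 < g" using posdef_diag[OF posdef_inverse[OF inv pd] i] by (simp add: g_def)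
  define l where "l = v i / g"
  have Sh: "(\<Sum>b<n. S a b * G b i) = of_bool (a = i)" if "a < n" for a
    using inv that i by (simp add: inverse_pair_def)
  have Ss: "S a b = S b a" if "a < n" "b < n" for a b using pd that by (simp add: posdef_def)
  have 1: "(\<Sum>a<n. \<Sum>b<n. v a * S a b * G b i) = v i"
  proof -
    have "(\<Sum>a<n. \<Sum>b<n. v a * S a b * G b i) = (\<Sum>a<n. v a * of_bool (a = i))"
      by (intro sum.cong refl) (simp add: Sh[symmetric] sum_distrib_left mult.assoc)
    then show ?thesis using i by simp
  qed
  have 2: "(\<Sum>a<n. \<Sum>b<n. G a i * S a b * v b) = v i"
  proof -
    have "(\<Sum>a<n. \<Sum>b<n. G a i * S a b * v b) = (\<Sum>b<n. \<Sum>a<n. v b * S b a * G a i)"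
      by (subst sum.swap) (intro sum.cong refl, simp add: Ss mult_ac)
    then show ?thesis using 1 by simp
  qed
  have 3: "(\<Sum>a<n. \<Sum>b<n. G a i * S a b * G b i) = g"
  proof -
    have "(\<Sum>a<n. \<Sum>b<n. G a i * S a b * G b i) = (\<Sum>a<n. G a i * of_bool (a = i))"
      by (intro sum.cong refl) (simp add: Sh[symmetric] sum_distrib_left mult.assoc)
    then show ?thesis using i by (simp add: g_def)
  qed
  have nonneg: "0 \<le> qform n S v" for v
  proof (cases "\<exists>i<n. v i \<noteq> 0")
    case False then show ?thesis by (simp add: qform_def)
  qed (use pd in \<open>auto simp: posdef_def less_imp_le\<close>)
  have "0 \<le> qform n S (\<lambda>a. v a - l * G a i)" by (rule nonneg)
  also have "\<dots> = qform n S v - l * (\<Sum>a<n. \<Sum>b<n. v a * S a b * G b i)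
      - l * (\<Sum>a<n. \<Sum>b<n. G a i * S a b * v b) + l\<^sup>2 * (\<Sum>a<n. \<Sum>b<n. G a i * S a b * G b i)"
    unfolding qform_def sum_distrib_left sum_subtractf[symmetric] sum.distrib[symmetric]
    by (intro sum.cong refl) (simp add: power2_eq_square algebra_simps)
  also have "\<dots> = qform n S v - (v i)\<^sup>2 / g"
    unfolding 1 2 3 l_def using g by (simp add: power2_eq_square field_simps)
  finally show ?thesis using g by (simp add: g_def field_simps)
qed

lemma posdef_coordinate:
  assumes inv: "inverse_pair n S G" and pd: "posdef n S" and i: "i < n" and t: "0 < 1 + t * G i i"
    and S': "\<And>a b. a < n \<Longrightarrow> b < n \<Longrightarrow> S' a b = S a b + t * of_bool (a = i) * of_bool (b = i)"
  shows "posdef n S'"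
  unfolding posdef_def
proof (intro conjI allI impI)
  show "S' a b = S' b a" if "a < n" "b < n" for a b using pd that by (simp add: S' posdef_def)
  fix v :: "nat \<Rightarrow> real" assume "\<exists>i<n. v i \<noteq> 0"
  then have q: "0 < qform n S v" using pd by (simp add: posdef_def)
  have "qform n S' v = qform n S v + t * (v i)\<^sup>2" by (rule qform_coordinate[OF i S'])
  also have "\<dots> > 0"
  proof (cases "t \<ge> 0")
    case False
    then have "t * (G i i * qform n S v) \<le> t * (v i)\<^sup>2"
      using inverse_cauchy_schwarz[OF inv pd i] by (simp add: mult_left_mono_neg)
    moreover have "0 < (1 + t * G i i) * qform n S v" using t q by simp
    ultimately show ?thesis by (simp add: algebra_simps)
  qed (use q in \<open>simp add: add_pos_nonneg\<close>)
  finally show "0 < qform n S' v" .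
qed

abbreviation fmat :: "nat \<Rightarrow> (nat \<Rightarrow> nat \<Rightarrow> real) \<Rightarrow> real mat" where
  "fmat n S \<equiv> mat n n (\<lambda>(i, j). S i j)"

lemma det_coordinate:
  assumes inv: "inverse_pair n S G" and i: "i < n"
    and S': "\<And>a b. a < n \<Longrightarrow> b < n \<Longrightarrow> S' a b = S a b + t * of_bool (a = i) * of_bool (b = i)"
  shows "det (fmat n S') = det (fmat n S) * (1 + t * G i i)"
proof -
  let ?M = "fmat n S" and ?M' = "fmat n S'"
  have "mat_delete ?M' i j = mat_delete ?M i j" if "j < n" for j
    unfolding mat_delete_def using i that by (intro eq_matI) (auto simp: S')
  then have cof: "cofactor ?M' i j = cofactor ?M i j" if "j < n" for j
    using that by (simp add: cofactor_def)
  have "det ?M' = (\<Sum>j<n. ?M' $$ (i, j) * cofactor ?M' i j)"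
    by (rule laplace_expansion_row) (use i in auto)
  also have "\<dots> = (\<Sum>j<n. ?M $$ (i, j) * cofactor ?M i j + (t * cofactor ?M i j) * of_bool (j = i))"
    using i by (intro sum.cong refl) (auto simp: cof S' algebra_simps)
  also have "\<dots> = (\<Sum>j<n. ?M $$ (i, j) * cofactor ?M i j) + t * cofactor ?M i i"
    using i by (simp only: sum.distrib sum_of_bool) simp
  also have "(\<Sum>j<n. ?M $$ (i, j) * cofactor ?M i j) = det ?M"
    by (rule laplace_expansion_row[symmetric]) (use i in auto)
  also have "cofactor ?M i i = det ?M * G i i"
  proof -
    have adj: "(\<Sum>k<n. cofactor ?M k i * S k j) = det ?M * of_bool (j = i)" if "j < n" for j
    proof -
      have "(adj_mat ?M * ?M) $$ (i, j) = (det ?M \<cdot>\<^sub>m 1\<^sub>m n) $$ (i, j)"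
        by (subst adj_mat(3)) auto
      then show ?thesis using i that by (auto simp: scalar_prod_def adj_mat_def lessThan_atLeast0)
    qed
    have "det ?M * G i i = (\<Sum>j<n. (det ?M * G j i) * of_bool (j = i))" using i by simp
    also have "\<dots> = (\<Sum>j<n. (\<Sum>k<n. cofactor ?M k i * S k j) * G j i)"
      using adj by (intro sum.cong) auto
    also have "\<dots> = (\<Sum>k<n. cofactor ?M k i * (\<Sum>j<n. S k j * G j i))"
      unfolding sum_distrib_left sum_distrib_right by (subst sum.swap) (simp add: mult.assoc)
    also have "\<dots> = (\<Sum>k<n. cofactor ?M k i * of_bool (k = i))"
      using inv i by (intro sum.cong refl) (auto simp: inverse_pair_def)
    finally show ?thesis using i by simp
  qed
  finally show ?thesis by (simp add: algebra_simps)
qed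

lemma det_inverse_pair:
  assumes "inverse_pair n S G"
  shows "det (fmat n S) * det (fmat n G) = 1"
proof -
  have "fmat n S * fmat n G = 1\<^sub>m n"
    using assms by (intro eq_matI) (auto simp: scalar_prod_def lessThan_atLeast0[symmetric] inverse_pair_def)
  then have "det (fmat n S * fmat n G) = 1" by simp
  then show ?thesis by (subst (asm) det_mult) auto
qed

text \<open>Both bounds are read off a Cholesky factor.\<close>

lemma det_le_prod_diag:
  assumes pd: "posdef n S" and inv: "inverse_pair n S G"
  shows "0 < det (fmat n S)" "det (fmat n S) \<le> (\<Prod>i<n. S i i)"
proof -
  have "0 \<le> qform n S v" for v
  proof (cases "\<exists>i<n. v i \<noteq> 0")
    case False then show ?thesis by (simp add: qform_def)
  qed (use pd in \<open>auto simp: posdef_def less_imp_le\<close>)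
  then have "\<exists>L. (\<forall>i j. i < j \<longrightarrow> L i j = 0) \<and> (\<forall>i. 0 \<le> L i i) \<and> (\<forall>i<n. \<forall>j<n. (\<Sum>k<n. L i k * L j k) = S i j)"
    using pd unfolding posdef_def qform_def by (intro cholesky_exists) auto
  then obtain L where L0: "\<forall>i j. i < j \<longrightarrow> L i j = 0" "\<forall>i<n. \<forall>j<n. (\<Sum>k<n. L i k * L j k) = S i j"
    by blast
  then have L: "i < j \<Longrightarrow> L i j = 0" "i < n \<Longrightarrow> j < n \<Longrightarrow> (\<Sum>k<n. L i k * L j k) = S i j" for i j
    by auto
  have "fmat n L * transpose_mat (fmat n L) = fmat n S"
    using L(2) by (intro eq_matI) (auto simp: scalar_prod_def lessThan_atLeast0)
  then have "det (fmat n S) = det (fmat n L) * det (transpose_mat (fmat n L))"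
    using det_mult[of "fmat n L" n "transpose_mat (fmat n L)"] by simp
  also have "det (transpose_mat (fmat n L)) = det (fmat n L)" by (rule det_transpose) auto
  also have "det (fmat n L) = (\<Prod>i<n. L i i)"
    by (subst det_lower_triangular[of n])
      (auto simp: L(1) prod_list_diag_prod lessThan_atLeast0)
  finally have d: "det (fmat n S) = (\<Prod>i<n. (L i i)\<^sup>2)"
    by (simp add: power2_eq_square prod.distrib)
  moreover have "det (fmat n S) \<noteq> 0" using det_inverse_pair[OF inv] by auto
  moreover have "0 \<le> (\<Prod>i<n. (L i i)\<^sup>2)" by (simp add: prod_nonneg)
  ultimately show "0 < det (fmat n S)" by linarith
  show "det (fmat n S) \<le> (\<Prod>i<n. S i i)"
    unfolding d
  proof (rule prod_mono, safe)
    fix i assume i: "i < n"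
    have "(L i i)\<^sup>2 \<le> (\<Sum>k<n. L i k * L i k)"
      using i member_le_sum[of i "{..<n}" "\<lambda>k. L i k * L i k"] by (simp add: power2_eq_square)
    then show "(L i i)\<^sup>2 \<le> S i i" using L(2)[OF i i] by simp
  qed simp
qed

lemma inverse_pair_swap:
  assumes "inverse_pair n S G" "posdef n S"
  shows "inverse_pair n G S"
proof -
  have SG1: "(\<Sum>k<n. S i k * G k j) = of_bool (i = j)" if "i < n" "j < n" for i j
    using assms(1) that unfolding inverse_pair_def by blast
  have SG: "S i j = S j i" "G i j = G j i" if "i < n" "j < n" for i j
    using assms that unfolding inverse_pair_def posdef_def by blast+
  have "(\<Sum>k<n. G i k * S k j) = of_bool (i = j)" if "i < n" "j < n" for i j
  proof -
    have "(\<Sum>k<n. G i k * S k j) = (\<Sum>k<n. S j k * G k i)"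
    proof (rule sum.cong)
      fix k assume "k \<in> {..<n}"
      then have "S k j = S j k" "G i k = G k i" using that SG by blast+
      then show "G i k * S k j = S j k * G k i" by simp
    qed simp
    then show ?thesis using SG1[OF that(2,1)] by auto
  qed
  then show ?thesis using SG(1) unfolding inverse_pair_def by blast
qed

definition pair_diff :: "nat \<Rightarrow> nat \<Rightarrow> nat \<Rightarrow> real" where
  "pair_diff i j a = of_bool (a = i) - of_bool (a = j)"

lemma sum_pair_diff:
  assumes "i < n" "j < n"
  shows "(\<Sum>a<n. f a * pair_diff i j a) = f i - f j" "(\<Sum>a<n. pair_diff i j a * f a) = f i - f j"
proof -
  show 1: "(\<Sum>a<n. f a * pair_diff i j a) = f i - f j"
    unfolding pair_diff_def right_diff_distrib sum_subtractf using assms by simp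
  then show  "(\<Sum>a<n. pair_diff i j a * f a) = f i - f j" by (simp only: mult.commute)
qed

text \<open>The matrix reached after the pairs in \<open>P\<close> have been processed; with all pairs it is
  \<open>Diag(x) - L/4\<close>, each edge being counted in both directions.\<close>

definition shifted_laplacian :: "(nat \<Rightarrow> nat \<Rightarrow> real) \<Rightarrow> (nat \<times> nat) set \<Rightarrow> (nat \<Rightarrow> real) \<Rightarrow> nat \<Rightarrow> nat \<Rightarrow> real" where
  "shifted_laplacian w P x a b = x a * of_bool (a = b) - (\<Sum>(i, j)\<in>P. w i j / 8 * (pair_diff i j a * pair_diff i j b))"

abbreviation pairs :: "nat \<Rightarrow> (nat \<times> nat) set" where
  "pairs n \<equiv> {..<n} \<times> {..<n}"

lemma qform_shifted_laplacian:
  assumes "P \<subseteq> pairs n"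
  shows "qform n (shifted_laplacian w P x) v = (\<Sum>a<n. x a * (v a)\<^sup>2) - (\<Sum>(i, j)\<in>P. w i j / 8 * (v i - v j)\<^sup>2)"
proof -
  have "(\<Sum>a<n. \<Sum>b<n. v a * (x a * of_bool (a = b)) * v b) = (\<Sum>a<n. x a * (v a)\<^sup>2)"
  proof (rule sum.cong)
    fix a assume "a \<in> {..<n}"
    have "(\<Sum>b<n. v a * (x a * of_bool (a = b)) * v b) = (\<Sum>b<n. (v a * x a * v b) * of_bool (a = b))"
      by (intro sum.cong refl) (simp only: mult_ac)
    also have "\<dots> = x a * (v a)\<^sup>2" using \<open>a \<in> {..<n}\<close> unfolding sum_of_bool by (simp add: power2_eq_square)
    finally show "(\<Sum>b<n. v a * (x a * of_bool (a = b)) * v b) = x a * (v a)\<^sup>2" .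
  qed simp
  moreover have "(\<Sum>a<n. \<Sum>b<n. v a * (\<Sum>(i, j)\<in>P. w i j / 8 * (pair_diff i j a * pair_diff i j b)) * v b) =
      (\<Sum>(i, j)\<in>P. w i j / 8 * (v i - v j)\<^sup>2)"
  proof -
    have "(\<Sum>a<n. \<Sum>b<n. v a * (\<Sum>(i, j)\<in>P. w i j / 8 * (pair_diff i j a * pair_diff i j b)) * v b) =
      (\<Sum>a<n. \<Sum>b<n. \<Sum>(i, j)\<in>P. w i j / 8 * ((v a * pair_diff i j a) * (v b * pair_diff i j b)))"
      unfolding sum_distrib_left sum_distrib_right by (intro sum.cong refl) (auto simp: mult_ac)
    also have "\<dots> = (\<Sum>a<n. \<Sum>p\<in>P. \<Sum>b<n. case p of (i, j) \<Rightarrow> w i j / 8 * ((v a * pair_diff i j a) * (v b * pair_diff i j b)))"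
      by (intro sum.cong refl sum.swap)
    also have "\<dots> = (\<Sum>p\<in>P. \<Sum>a<n. \<Sum>b<n. case p of (i, j) \<Rightarrow> w i j / 8 * ((v a * pair_diff i j a) * (v b * pair_diff i j b)))"
      by (rule sum.swap)
    also have "\<dots> = (\<Sum>(i, j)\<in>P. w i j / 8 * (v i - v j)\<^sup>2)"
    proof (intro sum.cong refl, safe)
      fix i j assume "(i, j) \<in> P"
      then have ij: "i < n" "j < n" using assms by auto
      have "(\<Sum>a<n. \<Sum>b<n. w i j / 8 * ((v a * pair_diff i j a) * (v b * pair_diff i j b))) =
        w i j / 8 * ((\<Sum>a<n. v a * pair_diff i j a) * (\<Sum>b<n. v b * pair_diff i j b))"
        unfolding sum_product by (simp only: sum_distrib_left)
      then show "(\<Sum>a<n. \<Sum>b<n. w i j / 8 * ((v a * pair_diff i j a) * (v b * pair_diff i j b))) = w i j / 8 * (v i - v j)\<^sup>2"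
        unfolding sum_pair_diff[OF ij] by (simp only: power2_eq_square)
    qed
    finally show ?thesis .
  qed
  ultimately show ?thesis
    unfolding qform_def shifted_laplacian_def left_diff_distrib right_diff_distrib sum_subtractf by simp
qed

lemma sum_sq_two_le:
  fixes v :: "nat \<Rightarrow> real"
  assumes "i < n" "j < n"
  shows "(v i - v j)\<^sup>2 \<le> 4 * (\<Sum>a<n. (v a)\<^sup>2)"
proof -
  have 1: "(v i)\<^sup>2 \<le> (\<Sum>a<n. (v a)\<^sup>2)" if "i < n" for i
    using that member_le_sum[of i "{..<n}" "\<lambda>a. (v a)\<^sup>2"] by simp
  have "(v i - v j)\<^sup>2 + (v i + v j)\<^sup>2 = 2 * (v i)\<^sup>2 + 2 * (v j)\<^sup>2"
    by (simp add: power2_eq_square algebra_simps)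
  moreover have "0 \<le> (v i + v j)\<^sup>2" by simp
  ultimately show ?thesis using 1[OF assms(1)] 1[OF assms(2)] by linarith
qed

lemma duality_gap_arith:
  fixes e W r q :: real
  assumes 1: "(1 - e) * r \<le> 5 / 4 * (e * W) + (1 + e) * q" and "W \<le> 4 * r" "0 < W" "0 < e"
  shows "(1 - 7 * e) * r \<le> q"
proof -
  have "e * W \<le> e * (4 * r)" using assms by simp
  with 1 have 2: "(1 - 6 * e) * r \<le> (1 + e) * q" by (simp add: algebra_simps)
  have "0 \<le> 7 * e\<^sup>2 * r" using assms by simp
  with 2 have "(1 + e) * ((1 - 7 * e) * r) \<le> (1 + e) * q"
    by (simp add: algebra_simps power2_eq_square)
  then show ?thesis using assms by simp
qed

locale weights =
  fixes n :: nat and w :: "nat \<Rightarrow> nat \<Rightarrow> real" and W :: real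
  assumes w_nonneg: "\<And>i j. 0 \<le> w i j" and w_sym: "\<And>i j. w i j = w j i" and w_diag: "\<And>i. w i i = 0"
    and W_def: "W = (\<Sum>(i, j)\<in>pairs n. w i j)" and W_pos: "0 < W"
begin

lemma n_pos: "0 < n"
proof (rule ccontr)
  assume "\<not> 0 < n"
  then have "W = 0" unfolding W_def by simp
  then show False using W_pos by simp
qed

lemma qform_start_ge:
  assumes "P \<subseteq> pairs n"
  shows "W / 2 * (\<Sum>a<n. (v a)\<^sup>2) \<le> qform n (shifted_laplacian w P (\<lambda>_. W)) v"
proof -
  let ?N = "\<Sum>a<n. (v a)\<^sup>2"
  have "finite P" using assms by (rule finite_subset) simp
  have "(\<Sum>(i, j)\<in>P. w i j / 8 * (v i - v j)\<^sup>2) \<le> (\<Sum>(i, j)\<in>P. w i j / 2 * ?N)"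
  proof (rule sum_mono, safe)
    fix i j assume "(i, j) \<in> P"
    then have "(v i - v j)\<^sup>2 \<le> 4 * ?N" using assms by (intro sum_sq_two_le) auto
    then have "w i j / 8 * (v i - v j)\<^sup>2 \<le> w i j / 8 * (4 * ?N)"
      by (rule mult_left_mono) (simp add: w_nonneg)
    then show "w i j / 8 * (v i - v j)\<^sup>2 \<le> w i j / 2 * ?N" by simp
  qed
  also have "\<dots> \<le> (\<Sum>(i, j)\<in>pairs n. w i j / 2 * ?N)"
    by (rule sum_mono2) (use assms in \<open>auto intro!: mult_nonneg_nonneg sum_nonneg simp: w_nonneg\<close>)
  also have "\<dots> = W / 2 * ?N"
    unfolding W_def sum_divide_distrib sum_distrib_right by (intro sum.cong refl) auto
  finally have "(\<Sum>(i, j)\<in>P. w i j / 8 * (v i - v j)\<^sup>2) \<le> W / 2 * ?N" .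
  then show ?thesis
    unfolding qform_shifted_laplacian[OF assms] sum_distrib_left[symmetric] by (simp add: field_simps)
qed

lemma shifted_laplacian_sym: "shifted_laplacian w P x a b = shifted_laplacian w P x b a"
proof -
  have 1: "x a * of_bool (a = b) = x b * of_bool (b = a)" by (cases "a = b") simp_all
  have 2: "(\<Sum>(i, j)\<in>P. w i j / 8 * (pair_diff i j a * pair_diff i j b)) = (\<Sum>(i, j)\<in>P. w i j / 8 * (pair_diff i j b * pair_diff i j a))"
    by (intro sum.cong refl) (simp only: split_beta mult_ac)
  show ?thesis unfolding shifted_laplacian_def 1 2 ..
qed

lemma posdef_start:
  assumes "P \<subseteq> pairs n"
  shows "posdef n (shifted_laplacian w P (\<lambda>_. W))"
  unfolding posdef_def
proof (intro conjI allI impI)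
  fix v :: "nat \<Rightarrow> real" assume "\<exists>i<n. v i \<noteq> 0"
  then obtain i where "i < n" "v i \<noteq> 0" by blast
  then have "0 < (\<Sum>a<n. (v a)\<^sup>2)" by (intro sum_pos2[of _ i]) auto
  then have "0 < W / 2 * (\<Sum>a<n. (v a)\<^sup>2)" using W_pos by simp
  also note qform_start_ge[OF assms]
  finally show "0 < qform n (shifted_laplacian w P (\<lambda>_. W)) v" .
qed (rule shifted_laplacian_sym)

lemma inverse_start: "inverse_pair n (shifted_laplacian w {} (\<lambda>_. W)) (\<lambda>a b. of_bool (a = b) * (1 / W))"
proof -
  have "(\<Sum>k<n. W * of_bool (i = k) * (of_bool (k = j) * (1 / W))) = of_bool (i = j)" if "i < n" for i j
  proof -
    have "(\<Sum>k<n. W * of_bool (i = k) * (of_bool (k = j) * (1 / W))) = (\<Sum>k<n. of_bool (k = j) * of_bool (i = k))"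
      using W_pos by (intro sum.cong refl) (simp only: mult_ac, simp)
    then show ?thesis using that unfolding sum_of_bool(2) by simp
  qed
  then show ?thesis by (auto simp: inverse_pair_def shifted_laplacian_def)
qed

lemma inverse_add_pair:
  assumes inv: "inverse_pair n (shifted_laplacian w P (\<lambda>_. W)) G" and P: "insert (i, j) P \<subseteq> pairs n" "(i, j) \<notin> P"
    and f: "f = w i j / 8 / (1 - w i j / 8 * (G i i - G j i - (G i j - G j j)))"
    and G': "\<And>a b. a < n \<Longrightarrow> b < n \<Longrightarrow> G' a b = G a b + f * (G a i - G a j) * (G b i - G b j)"
  shows "inverse_pair n (shifted_laplacian w (insert (i, j) P) (\<lambda>_. W)) G'"
proof -
  let ?S = "shifted_laplacian w P (\<lambda>_. W)" and ?S' = "shifted_laplacian w (insert (i, j) P) (\<lambda>_. W)"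
  define c where "c = - (w i j / 8)"
  define h where "h a = (\<Sum>k<n. G a k * pair_diff i j k)" for a
  define \<gamma> where "\<gamma> = (\<Sum>a<n. pair_diff i j a * h a)"
  have ij: "i < n" "j < n" "P \<subseteq> pairs n" "finite P" using P finite_subset[of P "pairs n"] by auto
  have h: "h a = G a i - G a j" for a unfolding h_def by (rule sum_pair_diff[OF ij(1,2)])
  have \<gamma>: "\<gamma> = G i i - G i j - (G j i - G j j)" unfolding \<gamma>_def sum_pair_diff[OF ij(1,2)] h ..
  have Gs: "G i j = G j i" using inv ij by (simp add: inverse_pair_def)
  have S': "?S' a b = ?S a b + c * pair_diff i j a * pair_diff i j b" for a b
    using P ij unfolding shifted_laplacian_def c_def by simp
  have q': "qform n ?S' h = qform n ?S h + c * \<gamma>\<^sup>2"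
    unfolding qform_shifted_laplacian[OF ij(3)] qform_shifted_laplacian[OF P(1)]
    using P ij by (simp add: c_def \<gamma>_def sum_pair_diff)
  have q: "qform n ?S h = \<gamma>"
    unfolding h_def qform_inverse[OF inv] \<gamma>_def by simp
  have nz: "1 + c * \<gamma> \<noteq> 0"
  proof (cases "\<exists>k<n. h k \<noteq> 0")
    case True
    then obtain k where "k < n" "h k \<noteq> 0" by blast
    then have "0 < qform n ?S' h" by (rule posdefD[OF posdef_start[OF P(1)]])
    then have "0 < \<gamma> * (1 + c * \<gamma>)" unfolding q' q by (simp add: power2_eq_square algebra_simps)
    then show ?thesis by auto
  next
    case False
    then show ?thesis by (simp add: \<gamma>_def)
  qed
  have "inverse_pair n ?S' G'"
  proof (rule rank_one_inverse[OF inv, where f="- f" and c=c and u="pair_diff i j" and h=h])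
    have "f = - c / (1 + c * \<gamma>)" unfolding f \<gamma> c_def using Gs by (simp add: algebra_simps)
    then show "(- f) * (1 + c * (\<Sum>a<n. pair_diff i j a * h a)) = c"
      using nz by (simp add: \<gamma>_def[symmetric])
  qed (use G' in \<open>auto simp: S' h_def[symmetric] h\<close>)
  then show ?thesis .
qed

abbreviation S_of :: "(nat \<Rightarrow> real) \<Rightarrow> nat \<Rightarrow> nat \<Rightarrow> real" where
  "S_of x \<equiv> shifted_laplacian w (pairs n) x"

definition potential :: "real \<Rightarrow> (nat \<Rightarrow> real) \<Rightarrow> real" where
  "potential \<mu> x = (\<Sum>i<n. x i) - \<mu> * ln (det (fmat n (S_of x)))"

definition feasible :: "(nat \<Rightarrow> real) \<Rightarrow> (nat \<Rightarrow> nat \<Rightarrow> real) \<Rightarrow> bool" where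
  "feasible x G \<longleftrightarrow> posdef n (S_of x) \<and> inverse_pair n (S_of x) G"

lemma feasible_diag_pos: "feasible x G \<Longrightarrow> i < n \<Longrightarrow> 0 < G i i"
  by (rule posdef_diag[OF posdef_inverse[of n "S_of x" G]]) (auto simp: feasible_def)

lemma coordinate_step:
  assumes fe: "feasible x G" and i: "i < n" and \<mu>: "0 < \<mu>"
    and x': "\<And>a. a < n \<Longrightarrow> x' a = (if a = i then x i + (\<mu> - 1 / G i i) else x a)"
    and G': "\<And>a b. a < n \<Longrightarrow> b < n \<Longrightarrow> G' a b = G a b - (\<mu> - 1 / G i i) / (\<mu> * G i i) * G a i * G b i"
  shows "feasible x' G'"
    "potential \<mu> x' = potential \<mu> x - \<mu> * (ln (\<mu> * G i i) - 1 + 1 / (\<mu> * G i i))"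
proof -
  have inv: "inverse_pair n (S_of x) G" and pd: "posdef n (S_of x)" using fe by (auto simp: feasible_def)
  define g where "g = G i i"
  have g: "0 < g" using feasible_diag_pos[OF fe i] by (simp add: g_def)
  define t where "t = \<mu> - 1 / g"
  have t: "1 + t * g = \<mu> * g" using g by (simp add: t_def field_simps)
  have S': "S_of x' a b = S_of x a b + t * of_bool (a = i) * of_bool (b = i)" if "a < n" "b < n" for a b
    using that by (auto simp: shifted_laplacian_def x' t_def g_def)
  have "inverse_pair n (S_of x') G'"
  proof (rule rank_one_inverse[OF inv, where c=t and f="t / (\<mu> * g)" and u="\<lambda>a. of_bool (a = i)" and h="\<lambda>a. G a i"])
    show "t / (\<mu> * g) * (1 + t * (\<Sum>a<n. of_bool (a = i) * G a i)) = t"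
      using i \<mu> g by (simp add: g_def[symmetric] t)
  qed (use i S' G' in \<open>auto simp: t_def g_def\<close>)
  moreover have "posdef n (S_of x')"
    by (rule posdef_coordinate[OF inv pd i _ S']) (use t g \<mu> in \<open>auto simp: g_def\<close>)
  ultimately show "feasible x' G'" by (simp add: feasible_def)
  have "det (fmat n (S_of x')) = det (fmat n (S_of x)) * (\<mu> * g)"
    using det_coordinate[OF inv i S'] t by (simp add: g_def)
  then have ln: "ln (det (fmat n (S_of x'))) = ln (det (fmat n (S_of x))) + ln (\<mu> * g)"
    using det_le_prod_diag(1)[OF pd inv] g \<mu> by (simp add: ln_mult)
  have "(\<Sum>a<n. x' a) = (\<Sum>a<n. x a + t * of_bool (a = i))"
    by (intro sum.cong refl) (auto simp: x' t_def g_def)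
  also have "\<dots> = (\<Sum>a<n. x a) + t" unfolding sum.distrib sum_of_bool using i by simp
  finally have "potential \<mu> x' = potential \<mu> x + (t - \<mu> * ln (\<mu> * g))"
    unfolding potential_def ln by (simp add: algebra_simps)
  also have "t = - \<mu> * (- 1 + 1 / (\<mu> * g))" using \<mu> g by (simp add: t_def field_simps)
  finally show "potential \<mu> x' = potential \<mu> x - \<mu> * (ln (\<mu> * G i i) - 1 + 1 / (\<mu> * G i i))"
    unfolding g_def[symmetric] by (simp add: algebra_simps)
qed

lemma S_of_diag_le: "S_of x i i \<le> x i"
proof -
  have "0 \<le> (\<Sum>(k, l)\<in>pairs n. w k l / 8 * (pair_diff k l i * pair_diff k l i))"
    by (intro sum_nonneg) (auto intro!: mult_nonneg_nonneg simp: w_nonneg)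
  then show ?thesis by (simp add: shifted_laplacian_def)
qed

lemma potential_lower:
  assumes fe: "feasible x G" and \<mu>: "0 < \<mu>"
  shows "- (real n * \<mu> * ln \<mu>) \<le> potential \<mu> x"
proof -
  have inv: "inverse_pair n (S_of x) G" and pd: "posdef n (S_of x)" using fe by (auto simp: feasible_def)
  note d = posdef_diag[OF pd]
  have "ln (det (fmat n (S_of x))) \<le> ln (\<Prod>i<n. S_of x i i)"
    using det_le_prod_diag[OF pd inv] by simp
  also have "\<dots> = (\<Sum>i<n. ln (S_of x i i))" using d by (intro ln_prod) (simp_all add: less_imp_neq[symmetric])
  also have "\<dots> \<le> (\<Sum>i<n. x i / \<mu> + ln \<mu>)"
  proof (rule sum_mono)
    fix i assume "i \<in> {..<n}"
    then have "0 < S_of x i i" using d by simp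
    then have "ln (S_of x i i) = ln (S_of x i i / \<mu>) + ln \<mu>" using \<mu> by (simp add: ln_div)
    also have "ln (S_of x i i / \<mu>) \<le> S_of x i i / \<mu> - 1" by (rule ln_le_minus_one) (use \<mu> \<open>0 < S_of x i i\<close> in simp)
    also have "S_of x i i / \<mu> \<le> x i / \<mu>" using S_of_diag_le \<mu> by (simp add: divide_right_mono)
    finally show "ln (S_of x i i) \<le> x i / \<mu> + ln \<mu>" by simp
  qed
  also have "\<dots> = (\<Sum>i<n. x i) / \<mu> + n * ln \<mu>" by (simp add: sum.distrib sum_divide_distrib)
  finally have "\<mu> * ln (det (fmat n (S_of x))) \<le> \<mu> * ((\<Sum>i<n. x i) / \<mu> + n * ln \<mu>)"
    using \<mu> by (intro mult_left_mono) auto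
  also have "\<dots> = (\<Sum>i<n. x i) + real n * \<mu> * ln \<mu>" using \<mu> by (simp add: field_simps)
  finally show ?thesis by (simp add: potential_def)
qed

lemma potential_start:
  assumes inv: "inverse_pair n (S_of (\<lambda>_. W)) G" and \<mu>: "0 < \<mu>"
  shows "feasible (\<lambda>_. W) G" "potential \<mu> (\<lambda>_. W) \<le> real n * W + real n * \<mu> * ln (2 / W)"
proof -
  have pd: "posdef n (S_of (\<lambda>_. W))" by (rule posdef_start) simp
  show "feasible (\<lambda>_. W) G" using pd inv by (simp add: feasible_def)
  have pdG: "posdef n G" by (rule posdef_inverse[OF inv pd])
  note invG = inverse_pair_swap[OF inv pd]
  have Gd: "G i i \<le> 2 / W" if i: "i < n" for i
  proof -
    have g: "0 < G i i" using posdef_diag[OF pdG i] .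
    have "(G i i)\<^sup>2 \<le> (\<Sum>a<n. (G a i)\<^sup>2)" using i member_le_sum[of i "{..<n}" "\<lambda>a. (G a i)\<^sup>2"] by simp
    then have "W / 2 * (G i i)\<^sup>2 \<le> W / 2 * (\<Sum>a<n. (G a i)\<^sup>2)" using W_pos by simp
    also have "\<dots> \<le> qform n (S_of (\<lambda>_. W)) (\<lambda>a. G a i)" by (rule qform_start_ge) simp
    also have "\<dots> = G i i"
      using qform_inverse[OF inv, of "\<lambda>l. of_bool (l = i)"] i by simp
    finally show ?thesis using g W_pos by (simp add: field_simps power2_eq_square)
  qed
  have "det (fmat n (S_of (\<lambda>_. W))) = 1 / det (fmat n G)"
    using det_inverse_pair[OF inv] by (metis nonzero_eq_divide_eq mult_zero_right zero_neq_one)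
  then have "- ln (det (fmat n (S_of (\<lambda>_. W)))) = ln (det (fmat n G))"
    using det_le_prod_diag(1)[OF pdG invG] by (simp add: ln_div)
  also have "\<dots> \<le> ln (\<Prod>i<n. G i i)" using det_le_prod_diag[OF pdG invG] by simp
  also have "\<dots> = (\<Sum>i<n. ln (G i i))" using posdef_diag[OF pdG] by (intro ln_prod) (simp_all add: less_imp_neq[symmetric])
  also have "\<dots> \<le> (\<Sum>i<n. ln (2 / W))"
  proof (rule sum_mono)
    fix i assume "i \<in> {..<n}"
    then have "0 < G i i" "G i i \<le> 2 / W" using Gd posdef_diag[OF pdG] by auto
    then show "ln (G i i) \<le> ln (2 / W)" using W_pos by (subst ln_le_cancel_iff) auto
  qed
  finally have "\<mu> * (- ln (det (fmat n (S_of (\<lambda>_. W))))) \<le> \<mu> * (n * ln (2 / W))"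
    using \<mu> by (intro mult_left_mono) auto
  then show "potential \<mu> (\<lambda>_. W) \<le> real n * W + real n * \<mu> * ln (2 / W)"
    by (simp add: potential_def algebra_simps)
qed

lemma sum_S_of_diag: "(\<Sum>i<n. S_of (\<lambda>_. 0) i i) = - W / 4"
proof -
  have "(\<Sum>i<n. S_of (\<lambda>_. 0) i i) = - (\<Sum>a<n. \<Sum>p\<in>pairs n. case p of (i, j) \<Rightarrow> w i j / 8 * (pair_diff i j a * pair_diff i j a))"
    by (simp add: shifted_laplacian_def sum_negf)
  also have "\<dots> = - (\<Sum>p\<in>pairs n. \<Sum>a<n. case p of (i, j) \<Rightarrow> w i j / 8 * (pair_diff i j a * pair_diff i j a))"
    by (subst sum.swap) simp
  also have "(\<Sum>p\<in>pairs n. \<Sum>a<n. case p of (i, j) \<Rightarrow> w i j / 8 * (pair_diff i j a * pair_diff i j a)) = (\<Sum>(i, j)\<in>pairs n. w i j / 4)"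
  proof (intro sum.cong refl, safe)
    fix i j assume ij: "i < n" "j < n"
    have "(\<Sum>a<n. w i j / 8 * (pair_diff i j a * pair_diff i j a)) = w i j / 8 * (pair_diff i j i - pair_diff i j j)"
      unfolding sum_distrib_left[symmetric] sum_pair_diff[OF ij] ..
    also have "\<dots> = w i j / 4" by (cases "i = j") (auto simp: w_diag pair_diff_def)
    finally show "(\<Sum>a<n. w i j / 8 * (pair_diff i j a * pair_diff i j a)) = w i j / 4" .
  qed
  also have "\<dots> = W / 4" unfolding W_def sum_divide_distrib by (intro sum.cong) auto
  finally show ?thesis by simp
qed

lemma S_of_decomp: "S_of x a b = x a * of_bool (a = b) + S_of (\<lambda>_. 0) a b"
  unfolding shifted_laplacian_def by (simp only: mult_zero_left)

lemma trace_identity: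
  assumes fe: "feasible x G"
  shows "(\<Sum>i<n. x i * G i i) = n + (\<Sum>(i, j)\<in>pairs n. w i j / 8 * (G i i + G j j - 2 * G i j))"
proof -
  have inv: "inverse_pair n (S_of x) G" using fe by (simp add: feasible_def)
  have Gs: "G i j = G j i" if "i < n" "j < n" for i j using inv that unfolding inverse_pair_def by blast
  have SG: "(\<Sum>k<n. S_of x i k * G k j) = of_bool (i = j)" if "i < n" "j < n" for i j
    using inv that unfolding inverse_pair_def by blast
  have "real n = (\<Sum>i<n. \<Sum>k<n. S_of x i k * G k i)" by (simp add: SG)
  also have "\<dots> = (\<Sum>i<n. (\<Sum>k<n. (x i * G k i) * of_bool (i = k)) - (\<Sum>k<n. \<Sum>p\<in>pairs n. case p of (a, b) \<Rightarrow> w a b / 8 * (pair_diff a b i * (pair_diff a b k * G k i))))"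
  proof (rule sum.cong[OF refl])
    fix i
    have "S_of x i k * G k i = (x i * G k i) * of_bool (i = k) -
        (\<Sum>p\<in>pairs n. case p of (a, b) \<Rightarrow> w a b / 8 * (pair_diff a b i * (pair_diff a b k * G k i)))" for k
      unfolding shifted_laplacian_def left_diff_distrib sum_distrib_right
      by (intro arg_cong2[of _ _ _ _ "(-)"] sum.cong refl) (simp_all add: mult.assoc mult.commute mult.left_commute split_beta)
    then show "(\<Sum>k<n. S_of x i k * G k i) = (\<Sum>k<n. (x i * G k i) * of_bool (i = k)) -
       (\<Sum>k<n. \<Sum>p\<in>pairs n. case p of (a, b) \<Rightarrow> w a b / 8 * (pair_diff a b i * (pair_diff a b k * G k i)))"
      by (simp only: sum_subtractf)
  qed
  also have "\<dots> = (\<Sum>i<n. x i * G i i) - (\<Sum>i<n. \<Sum>k<n. \<Sum>p\<in>pairs n. case p of (a, b) \<Rightarrow> w a b / 8 * (pair_diff a b i * (pair_diff a b k * G k i)))"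
    unfolding sum_subtractf sum_of_bool by simp
  also have "(\<Sum>i<n. \<Sum>k<n. \<Sum>p\<in>pairs n. case p of (a, b) \<Rightarrow> w a b / 8 * (pair_diff a b i * (pair_diff a b k * G k i))) =
      (\<Sum>p\<in>pairs n. \<Sum>i<n. \<Sum>k<n. case p of (a, b) \<Rightarrow> w a b / 8 * (pair_diff a b i * (pair_diff a b k * G k i)))"
    by (subst sum.swap[of _ "{..<n}" "pairs n"], rule sum.cong[OF refl], rule sum.swap)
  also have "\<dots> = (\<Sum>(i, j)\<in>pairs n. w i j / 8 * (G i i + G j j - 2 * G i j))"
  proof (intro sum.cong refl, safe)
    fix a b assume ab: "a < n" "b < n"
    have "(\<Sum>i<n. \<Sum>k<n. w a b / 8 * (pair_diff a b i * (pair_diff a b k * G k i))) =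
        w a b / 8 * ((G a a - G b a) - (G a b - G b b))"
      unfolding sum_distrib_left[symmetric] sum_pair_diff[OF ab] ..
    then show "(\<Sum>i<n. \<Sum>k<n. w a b / 8 * (pair_diff a b i * (pair_diff a b k * G k i))) = w a b / 8 * (G a a + G b b - 2 * G a b)"
      using Gs[OF ab] by (simp add: algebra_simps)
  qed
  finally show ?thesis by simp
qed

lemma feasible_bounds:
  assumes fe: "feasible x G"
  shows "i < n \<Longrightarrow> 0 \<le> x i" "W \<le> 4 * (\<Sum>i<n. x i)"
proof -
  have d: "0 < S_of x i i" if "i < n" for i using fe posdef_diag that by (auto simp: feasible_def)
  show "0 \<le> x i" if "i < n" using d[OF that] S_of_diag_le[of x i] by linarith
  have "0 \<le> (\<Sum>i<n. S_of x i i)" using d by (intro sum_nonneg) (auto simp: less_imp_le)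
  also have "\<dots> = (\<Sum>i<n. x i) + (\<Sum>i<n. S_of (\<lambda>_. 0) i i)"
    by (subst S_of_decomp) (simp add: sum.distrib)
  finally show "W \<le> 4 * (\<Sum>i<n. x i)" unfolding sum_S_of_diag by simp
qed

definition cosine :: "(nat \<Rightarrow> nat \<Rightarrow> real) \<Rightarrow> nat \<Rightarrow> nat \<Rightarrow> real" where
  "cosine G i j = G i j / sqrt (G i i * G j j)"

lemma sqrt_diff_sq_le:
  assumes "0 \<le> a" "0 \<le> b"
  shows "(sqrt a - sqrt b)\<^sup>2 \<le> \<bar>a - b\<bar>"
proof -
  have "(sqrt a - sqrt b)\<^sup>2 = \<bar>sqrt a - sqrt b\<bar> * \<bar>sqrt a - sqrt b\<bar>" by (simp add: power2_eq_square)
  also have "\<dots> \<le> \<bar>sqrt a - sqrt b\<bar> * (sqrt a + sqrt b)"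
    by (rule mult_left_mono) (use assms in \<open>auto simp: abs_le_iff\<close>)
  also have "\<dots> = \<bar>(sqrt a - sqrt b) * (sqrt a + sqrt b)\<bar>" using assms by (simp add: abs_mult)
  also have "(sqrt a - sqrt b) * (sqrt a + sqrt b) = a - b" using assms by (simp add: algebra_simps)
  finally show ?thesis .
qed

lemma near_optimal:
  assumes fe: "feasible x G" and \<epsilon>: "0 < \<epsilon>" "\<epsilon> < 1" and \<mu>: "\<mu> = \<epsilon> * W / n"
    and good: "\<And>i. i < n \<Longrightarrow> \<bar>\<mu> * G i i - 1\<bar> \<le> \<epsilon>"
  shows "(1 - 7 * \<epsilon>) * (\<Sum>i<n. x i) \<le> (\<Sum>(i, j)\<in>pairs n. w i j * (1 - cosine G i j) / 4)" (is "_ * ?\<rho> \<le> ?Q")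
proof -
  have pdG: "posdef n G" using fe posdef_inverse by (auto simp: feasible_def)
  have \<mu>0: "0 < \<mu>" using \<mu> \<epsilon> W_pos n_pos by simp
  define d where "d i = \<mu> * G i i" for i
  have d: "1 - \<epsilon> \<le> d i" "d i \<le> 1 + \<epsilon>" "0 < d i" if "i < n" for i
    using good[OF that] feasible_diag_pos[OF fe that] \<mu>0 by (auto simp: d_def)
  have pr: "w i j / 8 * (\<mu> * (G i i + G j j - 2 * G i j)) \<le> w i j * \<epsilon> / 4 + (1 + \<epsilon>) * (w i j * (1 - cosine G i j) / 4)"
    if ij: "i < n" "j < n" for i j
  proof -
    let ?c = "cosine G i j"
    note di = d[OF ij(1)] and dj = d[OF ij(2)] and Gi = feasible_diag_pos[OF fe ij(1)] and Gj = feasible_diag_pos[OF fe ij(2)]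
    define s where "s = sqrt (d i) * sqrt (d j)"
    have "\<mu> * G i j = s * ?c"
      using Gi Gj \<mu>0 by (simp add: s_def d_def cosine_def real_sqrt_mult)
    then have "\<mu> * (G i i + G j j - 2 * G i j) = d i + d j - 2 * s * ?c"
      by (simp add: d_def algebra_simps)
    also have "\<dots> = (sqrt (d i) - sqrt (d j))\<^sup>2 + 2 * s * (1 - ?c)"
      using di dj by (simp add: power2_diff s_def algebra_simps)
    also have "(sqrt (d i) - sqrt (d j))\<^sup>2 \<le> \<bar>d i - d j\<bar>"
      using di dj by (intro sqrt_diff_sq_le) auto
    also have "\<dots> \<le> 2 * \<epsilon>" using di dj by linarith
    also have "2 * s * (1 - ?c) \<le> 2 * (1 + \<epsilon>) * (1 - ?c)"
    proof (rule mult_right_mono)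
      have "s \<le> sqrt (1 + \<epsilon>) * sqrt (1 + \<epsilon>)"
        unfolding s_def using di dj by (intro mult_mono) auto
      then show "2 * s \<le> 2 * (1 + \<epsilon>)" using \<epsilon> by simp
      have "(G i j)\<^sup>2 \<le> G i i * G j j"
        using posdef_minor[OF pdG ij] by (cases "i = j") (auto simp: power2_eq_square less_imp_le)
      then have "\<bar>G i j\<bar> \<le> sqrt (G i i * G j j)" by (intro real_le_rsqrt) simp
      moreover have "0 < sqrt (G i i * G j j)" using Gi Gj by simp
      ultimately show "0 \<le> 1 - ?c" by (simp add: cosine_def abs_le_iff)
    qed
    finally have "\<mu> * (G i i + G j j - 2 * G i j) \<le> 2 * \<epsilon> + 2 * (1 + \<epsilon>) * (1 - ?c)" by simp
    then have "w i j / 8 * (\<mu> * (G i i + G j j - 2 * G i j)) \<le> w i j / 8 * (2 * \<epsilon> + 2 * (1 + \<epsilon>) * (1 - ?c))"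
      by (rule mult_left_mono) (simp add: w_nonneg)
    then show ?thesis by (simp add: field_simps)
  qed
  have "(1 - \<epsilon>) * ?\<rho> \<le> (\<Sum>i<n. x i * d i)"
    unfolding sum_distrib_left 
  proof (rule sum_mono)
    fix i assume "i \<in> {..<n}"
    then have "(1 - \<epsilon>) * x i \<le> d i * x i"
      using d(1)[of i] feasible_bounds(1)[OF fe, of i] by (intro mult_right_mono) auto
    then show "(1 - \<epsilon>) * x i \<le> x i * d i" by (simp only: mult.commute)
  qed
  also have "\<dots> = \<mu> * (\<Sum>i<n. x i * G i i)"
    unfolding sum_distrib_left d_def by (simp add: mult_ac)
  also have "\<dots> = \<epsilon> * W + (\<Sum>(i, j)\<in>pairs n. w i j / 8 * (\<mu> * (G i i + G j j - 2 * G i j)))"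
    unfolding trace_identity[OF fe] distrib_left sum_distrib_left using n_pos
    by (intro arg_cong2[of _ _ _ _ "(+)"] sum.cong) (auto simp: \<mu> mult_ac)
  also have "\<dots> \<le> \<epsilon> * W + (\<Sum>(i, j)\<in>pairs n. w i j * \<epsilon> / 4 + (1 + \<epsilon>) * (w i j * (1 - cosine G i j) / 4))"
    by (intro add_left_mono sum_mono) (use pr in auto)
  also have "\<dots> = \<epsilon> * W + (W * \<epsilon> / 4 + (1 + \<epsilon>) * ?Q)"
    unfolding W_def sum_distrib_left sum_divide_distrib sum_distrib_right sum.distrib[symmetric]
    by (intro arg_cong2[of _ _ _ _ "(+)"] sum.cong refl) auto
  finally have 1: "(1 - \<epsilon>) * ?\<rho> \<le> 5 / 4 * (\<epsilon> * W) + (1 + \<epsilon>) * ?Q" by (simp add: mult.commute)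
  show ?thesis
    by (rule duality_gap_arith[OF 1 feasible_bounds(2)[OF fe] W_pos \<epsilon>(1)])
qed

end

text \<open>An update by a factor outside \<open>[1 - \<epsilon>, 1 + \<epsilon>]\<close> lowers the potential by at least \<open>\<mu>\<close> times this.\<close>

definition progress :: "real \<Rightarrow> real" where
  "progress \<epsilon> = min (ln (1 - \<epsilon>) - 1 + 1 / (1 - \<epsilon>)) (ln (1 + \<epsilon>) - 1 + 1 / (1 + \<epsilon>))"

lemma ln_plus_inverse_pos:
  assumes "0 < r" "r \<noteq> 1"
  shows "0 < ln r - 1 + 1 / (r :: real)"
proof -
  have "ln (1 / r) \<noteq> 1 / r - 1"
  proof
    assume "ln (1 / r) = 1 / r - 1"
    moreover have "0 < 1 / r" using assms(1) by simp
    ultimately have "1 / r = 1" by (intro ln_eq_minus_one)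
    then have "r * (1 / r) = r" by simp
    then show False using assms by simp
  qed
  moreover have "ln (1 / r) \<le> 1 / r - 1" using assms(1) by (intro ln_le_minus_one) simp
  moreover have "ln (1 / r) = - ln r" using assms(1) by (subst ln_div) auto
  ultimately show ?thesis by linarith
qed

lemma progress_pos: "0 < \<epsilon> \<Longrightarrow> \<epsilon> < 1 \<Longrightarrow> 0 < progress \<epsilon>"
  unfolding progress_def min_less_iff_conj
  by (intro conjI ln_plus_inverse_pos) auto

lemma ln_plus_inverse_deriv:
  assumes "0 < r"
  shows "((\<lambda>r. ln r - 1 + 1 / r) has_real_derivative (r - 1) / r\<^sup>2) (at r)"
proof -
  have "((\<lambda>r. ln r - 1 + inverse r) has_real_derivative (1 / r - 0 + - (inverse r * 1 * inverse r))) (at r)"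
    using assms by (intro derivative_intros DERIV_inverse' DERIV_ident DERIV_ln_divide) auto
  moreover have "1 / r - 0 + - (inverse r * 1 * inverse r) = (r - 1) / r\<^sup>2"
    using assms by (simp add: divide_simps power2_eq_square)
  ultimately show ?thesis by (simp only: inverse_eq_divide)
qed

lemma progress_le:
  assumes r: "0 < r" and \<epsilon>: "0 < \<epsilon>" "\<epsilon> < 1" and far: "\<epsilon>\<^sup>2 \<le> (r - 1)\<^sup>2"
  shows "progress \<epsilon> \<le> ln r - 1 + 1 / r"
proof -
  have "\<epsilon> \<le> \<bar>r - 1\<bar>" using far \<epsilon> by (simp add: abs_le_square_iff[symmetric])
  then consider "r \<le> 1 - \<epsilon>" | "1 + \<epsilon> \<le> r" by linarith
  then show ?thesis
  proof cases
    case 1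
    have "ln (1 - \<epsilon>) - 1 + 1 / (1 - \<epsilon>) \<le> ln r - 1 + 1 / r"
    proof (rule DERIV_nonpos_imp_nonincreasing[OF 1])
      fix t assume t: "r \<le> t" "t \<le> 1 - \<epsilon>"
      then show "\<exists>y. ((\<lambda>r. ln r - 1 + 1 / r) has_real_derivative y) (at t) \<and> y \<le> 0"
        using r \<epsilon> by (intro exI[of _ "(t - 1) / t\<^sup>2"] conjI ln_plus_inverse_deriv) (auto simp: divide_nonpos_nonneg)
    qed
    then show ?thesis by (simp add: progress_def)
  next
    case 2
    have "ln (1 + \<epsilon>) - 1 + 1 / (1 + \<epsilon>) \<le> ln r - 1 + 1 / r"
    proof (rule DERIV_nonneg_imp_nondecreasing[OF 2])
      fix t assume t: "1 + \<epsilon> \<le> t" "t \<le> r"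
      then show "\<exists>y. ((\<lambda>r. ln r - 1 + 1 / r) has_real_derivative y) (at t) \<and> 0 \<le> y"
        using r \<epsilon> by (intro exI[of _ "(t - 1) / t\<^sup>2"] conjI ln_plus_inverse_deriv) auto
    qed
    then show ?thesis by (simp add: progress_def)
  qed
qed

context weights
begin

text \<open>After \<open>k\<close> complete sweeps and the coordinates \<open>< i\<close> of the next one: either all coordinates are good,
  or the current sweep has already made progress, or its first \<open>i\<close> coordinates are good.\<close>

definition sweep_inv :: "real \<Rightarrow> real \<Rightarrow> nat \<Rightarrow> nat \<Rightarrow> (nat \<Rightarrow> real) \<Rightarrow> (nat \<Rightarrow> nat \<Rightarrow> real) \<Rightarrow> bool" where
  "sweep_inv \<epsilon> \<mu> k i x G \<longleftrightarrow> feasible x G \<and>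
     (let good = (\<lambda>j. (\<mu> * G j j - 1)\<^sup>2 < \<epsilon>\<^sup>2); \<phi> = real n * W + real n * \<mu> * ln (2 / W) in
       (\<forall>j<n. good j) \<or> potential \<mu> x \<le> \<phi> - (real k + 1) * \<mu> * progress \<epsilon> \<or>
       (potential \<mu> x \<le> \<phi> - real k * \<mu> * progress \<epsilon> \<and> (\<forall>j<i. good j)))"

lemma sweep_inv_start:
  assumes "inverse_pair n (S_of (\<lambda>_. W)) G" "0 < \<mu>"
  shows "sweep_inv \<epsilon> \<mu> 0 0 (\<lambda>_. W) G"
proof -
  have "potential \<mu> (\<lambda>_. W) \<le> real n * W + real n * \<mu> * ln (2 / W) - real 0 * \<mu> * progress \<epsilon>"
    using potential_start(2)[OF assms] by (simp only: of_nat_0 mult_zero_left diff_0_right)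
  then show ?thesis using potential_start(1)[OF assms] unfolding sweep_inv_def Let_def by blast
qed

lemma sweep_inv_next:
  assumes "sweep_inv \<epsilon> \<mu> k n x G"
  shows "sweep_inv \<epsilon> \<mu> (Suc k) 0 x G"
proof -
  have k: "real (Suc k) = real k + 1" by simp
  show ?thesis using assms unfolding sweep_inv_def Let_def k by blast
qed

lemma sweep_inv_skip:
  assumes "sweep_inv \<epsilon> \<mu> k i x G" "(\<mu> * G i i - 1)\<^sup>2 < \<epsilon>\<^sup>2"
  shows "sweep_inv \<epsilon> \<mu> k (Suc i) x G"
proof -
  have "(\<forall>j<Suc i. (\<mu> * G j j - 1)\<^sup>2 < \<epsilon>\<^sup>2) = (\<forall>j<i. (\<mu> * G j j - 1)\<^sup>2 < \<epsilon>\<^sup>2)"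
    using assms(2) by (auto simp: less_Suc_eq)
  then show ?thesis using assms(1) unfolding sweep_inv_def Let_def by blast
qed

lemma sweep_inv_update:
  assumes inv: "sweep_inv \<epsilon> \<mu> k i x G" and i: "i < n" and \<mu>: "0 < \<mu>" and \<epsilon>: "0 < \<epsilon>" "\<epsilon> < 1"
    and far: "\<epsilon>\<^sup>2 \<le> (\<mu> * G i i - 1)\<^sup>2"
    and x': "\<And>a. a < n \<Longrightarrow> x' a = (if a = i then x i + (\<mu> - 1 / G i i) else x a)"
    and G': "\<And>a b. a < n \<Longrightarrow> b < n \<Longrightarrow> G' a b = G a b - (\<mu> - 1 / G i i) / (\<mu> * G i i) * G a i * G b i"
  shows "sweep_inv \<epsilon> \<mu> k (Suc i) x' G'"
proof -
  have fe: "feasible x G" using inv by (simp add: sweep_inv_def)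
  have "\<mu> * progress \<epsilon> \<le> \<mu> * (ln (\<mu> * G i i) - 1 + 1 / (\<mu> * G i i))"
    using progress_le[OF _ \<epsilon> far] feasible_diag_pos[OF fe i] \<mu> by (intro mult_left_mono) auto
  then have p: "potential \<mu> x' \<le> potential \<mu> x - \<mu> * progress \<epsilon>"
    using coordinate_step(2)[OF fe i \<mu> x' G'] by simp
  have pos: "0 < \<mu> * progress \<epsilon>" using \<mu> progress_pos[OF \<epsilon>] by simp
  have e: "(real k + 1) * \<mu> * progress \<epsilon> = real k * \<mu> * progress \<epsilon> + \<mu> * progress \<epsilon>"
    by (simp only: distrib_right mult_1)
  have "\<not> (\<forall>j<n. (\<mu> * G j j - 1)\<^sup>2 < \<epsilon>\<^sup>2)" using far i by (auto simp: not_less)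
  then have "potential \<mu> x \<le> real n * W + real n * \<mu> * ln (2 / W) - (real k + 1) * \<mu> * progress \<epsilon> \<or>
      potential \<mu> x \<le> real n * W + real n * \<mu> * ln (2 / W) - real k * \<mu> * progress \<epsilon>"
    using inv unfolding sweep_inv_def Let_def by blast
  then have "potential \<mu> x' \<le> real n * W + real n * \<mu> * ln (2 / W) - (real k + 1) * \<mu> * progress \<epsilon>"
    unfolding e using p pos by linarith
  moreover have "feasible x' G'" by (rule coordinate_step(1)[OF fe i \<mu> x' G'])
  ultimately show ?thesis unfolding sweep_inv_def Let_def by blast
qed

lemma sweep_inv_done:
  assumes inv: "sweep_inv \<epsilon> \<mu> k 0 x G" and \<epsilon>: "0 < \<epsilon>" "\<epsilon> \<le> 1 / 2" and \<mu>: "\<mu> = \<epsilon> * W / n"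
    and k: "n\<^sup>2 < real k * \<epsilon> * progress \<epsilon>"
  shows "feasible x G" "i < n \<Longrightarrow> (\<mu> * G i i - 1)\<^sup>2 < \<epsilon>\<^sup>2"
proof -
  show fe: "feasible x G" using inv by (simp add: sweep_inv_def)
  have \<mu>0: "0 < \<mu>" using \<mu> \<epsilon> W_pos n_pos by simp
  have pos: "0 < \<mu> * progress \<epsilon>" using \<mu>0 progress_pos[of \<epsilon>] \<epsilon> by simp
  have "ln (2 / W) + ln \<mu> = ln (2 / W * \<mu>)" using \<mu>0 W_pos by (subst ln_mult) auto
  also have "2 / W * \<mu> = 2 * \<epsilon> / n" using W_pos by (simp add: \<mu>)
  also have "ln (2 * \<epsilon> / n) \<le> 0"
  proof -
    have "2 * \<epsilon> \<le> 1 * real n" using \<epsilon> n_pos by simp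
    then have "0 < 2 * \<epsilon> / n" "2 * \<epsilon> / n \<le> 1" using \<epsilon> n_pos by (simp_all add: divide_le_eq)
    then show ?thesis using ln_le_cancel_iff[of "2 * \<epsilon> / n" 1] by simp
  qed
  finally have "real n * \<mu> * (ln (2 / W) + ln \<mu>) \<le> 0" using \<mu>0 by (simp add: mult_nonneg_nonpos)
  then have "n * W + real n * \<mu> * ln (2 / W) \<le> real n * W - real n * \<mu> * ln \<mu>" by (simp add: algebra_simps)
  also have "n * W < real k * \<mu> * progress \<epsilon>"
  proof -
    have "n * W = W / n * n\<^sup>2" using n_pos by (simp add: power2_eq_square)
    also have "\<dots> < W / n * (k * \<epsilon> * progress \<epsilon>)" using k W_pos n_pos by (intro mult_strict_left_mono) auto
    finally show ?thesis by (simp add: \<mu> mult_ac)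
  qed
  finally have "n * W + real n * \<mu> * ln (2 / W) - real k * \<mu> * progress \<epsilon> < - (real n * \<mu> * ln \<mu>)" by simp
  also have "\<dots> \<le> potential \<mu> x" by (rule potential_lower[OF fe \<mu>0])
  finally have 1: "n * W + real n * \<mu> * ln (2 / W) - real k * \<mu> * progress \<epsilon> < potential \<mu> x" .
  moreover have "(real k + 1) * \<mu> * progress \<epsilon> = real k * \<mu> * progress \<epsilon> + \<mu> * progress \<epsilon>" by (simp add: algebra_simps)
  ultimately have 2: "\<not> potential \<mu> x \<le> real n * W + real n * \<mu> * ln (2 / W) - (real k + 1) * \<mu> * progress \<epsilon>"
    using pos by linarith
  have "\<not> potential \<mu> x \<le> real n * W + real n * \<mu> * ln (2 / W) - real k * \<mu> * progress \<epsilon>"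
    using 1 by (simp only: not_le)
  with 2 have "\<forall>j<n. (\<mu> * G j j - 1)\<^sup>2 < \<epsilon>\<^sup>2"
    using inv[unfolded sweep_inv_def Let_def, THEN conjunct2] by (elim disjE conjE) (erule (1) notE | assumption)+
  then show "i < n \<Longrightarrow> (\<mu> * G i i - 1)\<^sup>2 < \<epsilon>\<^sup>2" by blast
qed

end

section \<open>A structured language and its compilation\<close>

datatype binop = Plus | Minus | Times | Divide

datatype expr = Lit real | Var nat | Bin binop expr expr | Arr nat expr

datatype com =
    Assign nat expr
  | Put nat expr expr
  | Seq com com  (infixr ";;" 60)
  | IfNonneg expr com
  | For nat expr com
  | Draw nat
  | Factor nat nat nat

record store =
  vars :: "nat \<Rightarrow> real"
  arr :: "nat \<Rightarrow> nat \<Rightarrow> real"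
  cnt :: nat

primrec bop :: "binop \<Rightarrow> real \<Rightarrow> real \<Rightarrow> real" where
  "bop Plus x y = x + y"
| "bop Minus x y = x - y"
| "bop Times x y = x * y"
| "bop Divide x y = x / y"

primrec ev :: "expr \<Rightarrow> store \<Rightarrow> real" where
  "ev (Lit r) \<sigma> = r"
| "ev (Var v) \<sigma> = vars \<sigma> v"
| "ev (Bin b e1 e2) \<sigma> = bop b (ev e1 \<sigma>) (ev e2 \<sigma>)"
| "ev (Arr a e) \<sigma> = arr \<sigma> a (nat \<lfloor>ev e \<sigma>\<rfloor>)"

definition setv :: "nat \<Rightarrow> real \<Rightarrow> store \<Rightarrow> store" where
  "setv v r \<sigma> = \<sigma>\<lparr>vars := (vars \<sigma>)(v := r)\<rparr>"

definition seta :: "nat \<Rightarrow> nat \<Rightarrow> real \<Rightarrow> store \<Rightarrow> store" where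
  "seta a k r \<sigma> = \<sigma>\<lparr>arr := (arr \<sigma>)(a := (arr \<sigma> a)(k := r))\<rparr>"

primrec sem :: "(real mat \<Rightarrow> real mat) \<Rightarrow> (nat \<Rightarrow> real) \<Rightarrow> com \<Rightarrow> store \<Rightarrow> store" where
  "sem chol \<omega> (Assign v e) = (\<lambda>\<sigma>. setv v (ev e \<sigma>) \<sigma>)"
| "sem chol \<omega> (Put a i e) = (\<lambda>\<sigma>. seta a (nat \<lfloor>ev i \<sigma>\<rfloor>) (ev e \<sigma>) \<sigma>)"
| "sem chol \<omega> (Seq c1 c2) = (\<lambda>\<sigma>. sem chol \<omega> c2 (sem chol \<omega> c1 \<sigma>))"
| "sem chol \<omega> (IfNonneg e c) = (\<lambda>\<sigma>. if 0 \<le> ev e \<sigma> then sem chol \<omega> c \<sigma> else \<sigma>)"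
| "sem chol \<omega> (For v e c) = (\<lambda>\<sigma>. fold (\<lambda>i \<tau>. sem chol \<omega> c (setv v (real i) \<tau>)) [0..<nat \<lfloor>ev e \<sigma>\<rfloor>] \<sigma>)"
| "sem chol \<omega> (Draw v) = (\<lambda>\<sigma>. (setv v (\<omega> (cnt \<sigma>)) \<sigma>)\<lparr>cnt := Suc (cnt \<sigma>)\<rparr>)"
| "sem chol \<omega> (Factor v a b) = (\<lambda>\<sigma>. let k = nat \<lfloor>vars \<sigma> v\<rfloor>; L = chol (mat k k (\<lambda>(i, j). arr \<sigma> a (i * k + j))) in
     \<sigma>\<lparr>arr := (arr \<sigma>)(b := (\<lambda>c. if c < k * k then L $$ (c div k, c mod k) else arr \<sigma> b c))\<rparr>)"

definition index_ok :: "nat \<Rightarrow> real \<Rightarrow> bool" where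
  "index_ok N r \<longleftrightarrow> (\<exists>k<N. r = real k)"

primrec okE :: "nat \<Rightarrow> expr \<Rightarrow> store \<Rightarrow> bool" where
  "okE N (Lit r) \<sigma> = True"
| "okE N (Var v) \<sigma> = True"
| "okE N (Bin b e1 e2) \<sigma> = (okE N e1 \<sigma> \<and> okE N e2 \<sigma>)"
| "okE N (Arr a e) \<sigma> = (okE N e \<sigma> \<and> index_ok N (ev e \<sigma>))"

primrec ok :: "(real mat \<Rightarrow> real mat) \<Rightarrow> (nat \<Rightarrow> real) \<Rightarrow> nat \<Rightarrow> com \<Rightarrow> store \<Rightarrow> bool" where
  "ok chol \<omega> N (Assign v e) = (\<lambda>\<sigma>. okE N e \<sigma>)"
| "ok chol \<omega> N (Put a i e) = (\<lambda>\<sigma>. okE N i \<sigma> \<and> okE N e \<sigma> \<and> index_ok N (ev i \<sigma>))"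
| "ok chol \<omega> N (Seq c1 c2) = (\<lambda>\<sigma>. ok chol \<omega> N c1 \<sigma> \<and> ok chol \<omega> N c2 (sem chol \<omega> c1 \<sigma>))"
| "ok chol \<omega> N (IfNonneg e c) = (\<lambda>\<sigma>. okE N e \<sigma> \<and> (0 \<le> ev e \<sigma> \<longrightarrow> ok chol \<omega> N c \<sigma>))"
| "ok chol \<omega> N (For v e c) = (\<lambda>\<sigma>. okE N e \<sigma> \<and> index_ok N (ev e \<sigma>) \<and>
     (\<forall>i<nat \<lfloor>ev e \<sigma>\<rfloor>. ok chol \<omega> N c
        (setv v (real i) (fold (\<lambda>i \<tau>. sem chol \<omega> c (setv v (real i) \<tau>)) [0..<i] \<sigma>))))"
| "ok chol \<omega> N (Draw v) = (\<lambda>\<sigma>. True)"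
| "ok chol \<omega> N (Factor v a b) = (\<lambda>\<sigma>. \<exists>k. vars \<sigma> v = real k \<and> 0 < k \<and> k * k < N)"

text \<open>Cells below \<open>30\<close> hold the variables, \<open>ONE\<close> and \<open>NN\<close> the numbers \<open>1\<close> and \<open>N\<close>, and the cells from \<open>32\<close>
  to \<open>63\<close> form a stack of temporaries. Entry \<open>k < N\<close> of array \<open>a\<close> is cell \<open>64 + a * N + k\<close>.\<close>

abbreviation "ONE \<equiv> 30 :: nat"
abbreviation "NN \<equiv> 31 :: nat"
abbreviation tmp :: "nat \<Rightarrow> nat" where "tmp d \<equiv> 32 + d"
abbreviation "HEAP \<equiv> 64 :: nat"

primrec bop_instr :: "binop \<Rightarrow> nat \<Rightarrow> nat \<Rightarrow> nat \<Rightarrow> instr" where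
  "bop_instr Plus = Add"
| "bop_instr Minus = Sub"
| "bop_instr Times = Mul"
| "bop_instr Divide = Div"

text \<open>Leaves \<open>1\<close> plus the content of the temporary in the index register, which is why \<open>address\<close> adds \<open>63\<close>
  and not \<open>64\<close>.\<close>

definition set_index :: "nat \<Rightarrow> nat \<Rightarrow> nat \<Rightarrow> program" where
  "set_index p t l = [Reset p, Incr p, Sub t t ONE, Branch t (l + 1)]"

definition address :: "nat \<Rightarrow> nat \<Rightarrow> nat \<Rightarrow> nat \<Rightarrow> program" where
  "address p a d l = replicate a (Add (tmp d) (tmp d) NN) @
     [Const (tmp (Suc d)) 63, Add (tmp d) (tmp d) (tmp (Suc d))] @ set_index p (tmp d) (l + a + 2)"

primrec lenE :: "expr \<Rightarrow> nat" where
  "lenE (Lit r) = 1"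
| "lenE (Var v) = 2"
| "lenE (Bin b e1 e2) = lenE e1 + lenE e2 + 1"
| "lenE (Arr a e) = lenE e + (a + 6) + 1"

primrec len :: "com \<Rightarrow> nat" where
  "len (Assign v e) = lenE e + 2"
| "len (Put a i e) = lenE e + lenE i + (a + 6) + 1"
| "len (Seq c1 c2) = len c1 + len c2"
| "len (IfNonneg e c) = lenE e + 2 + len c"
| "len (For v e c) = lenE e + 1 + 5 + len c + 2"
| "len (Draw v) = 1"
| "len (Factor v a b) = 7 + (a + 7) + (b + 7) + 1"

primrec compileE :: "expr \<Rightarrow> nat \<Rightarrow> nat \<Rightarrow> program" where
  "compileE (Lit r) = (\<lambda>d l. [Const (tmp d) r])"
| "compileE (Var v) = (\<lambda>d l. [Const (tmp d) 0, Add (tmp d) (tmp d) v])"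
| "compileE (Bin b e1 e2) = (\<lambda>d l. compileE e1 d l @ compileE e2 (Suc d) (l + lenE e1) @
     [bop_instr b (tmp d) (tmp d) (tmp (Suc d))])"
| "compileE (Arr a e) = (\<lambda>d l. compileE e d l @ address 0 a d (l + lenE e) @ [Load (tmp d) 0])"

primrec compile :: "com \<Rightarrow> nat \<Rightarrow> nat \<Rightarrow> program" where
  "compile (Assign v e) = (\<lambda>d l. compileE e d l @ [Const v 0, Add v v (tmp d)])"
| "compile (Put a i e) = (\<lambda>d l. compileE e d l @ compileE i (Suc d) (l + lenE e) @
     address 0 a (Suc d) (l + lenE e + lenE i) @ [Store 0 (tmp d)])"
| "compile (Seq c1 c2) = (\<lambda>d l. compile c1 d l @ compile c2 d (l + len c1))"
| "compile (IfNonneg e c) = (\<lambda>d l. compileE e d l @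
     [Branch (tmp d) (l + lenE e + 2), Branch ONE (l + lenE e + 2 + len c)] @ compile c d (l + lenE e + 2))"
| "compile (For v e c) = (\<lambda>d l. compileE e d l @ [Const (tmp (Suc d)) 0] @
     (let h = l + lenE e + 1 in
       [Sub (tmp d) (tmp d) ONE, Branch (tmp d) (h + 3), Branch ONE (h + 7 + len c),
        Const v 0, Add v v (tmp (Suc d))] @
       compile c (d + 2) (h + 5) @
       [Add (tmp (Suc d)) (tmp (Suc d)) ONE, Branch ONE h]))"
| "compile (Draw v) = (\<lambda>d l. [Sample v])"
| "compile (Factor v a b) = (\<lambda>d l.
     ([Const (tmp d) 0, Add (tmp d) (tmp d) v, Sub (tmp d) (tmp d) ONE] @ set_index 1 (tmp d) (l + 3)) @
     ([Const (tmp d) 0] @ address 2 a d (l + 8)) @ ([Const (tmp d) 0] @ address 3 b d (l + 8 + (a + 6) + 1)) @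
     [Cholesky 1 2 3])"

lemma length_set_index [simp]: "length (set_index p t l) = 4"
  by (simp add: set_index_def)

lemma length_address [simp]: "length (address p a d l) = a + 6"
  by (simp add: address_def)

lemma length_compileE [simp]: "length (compileE e d l) = lenE e"
  by (induction e arbitrary: d l) simp_all

lemma length_compile [simp]: "length (compile c d l) = len c"
  by (induction c arbitrary: d l) (simp_all add: Let_def)

primrec wfE :: "expr \<Rightarrow> nat \<Rightarrow> bool" where
  "wfE (Lit r) d = (d < 31)"
| "wfE (Var v) d = (v < 30 \<and> d < 31)"
| "wfE (Bin b e1 e2) d = (wfE e1 d \<and> wfE e2 (Suc d))"
| "wfE (Arr a e) d = (wfE e d \<and> d < 31)"

primrec wf_com :: "com \<Rightarrow> nat \<Rightarrow> bool" where
  "wf_com (Assign v e) d = (v < 30 \<and> wfE e d)"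
| "wf_com (Put a i e) d = (wfE e d \<and> wfE i (Suc d))"
| "wf_com (Seq c1 c2) d = (wf_com c1 d \<and> wf_com c2 d)"
| "wf_com (IfNonneg e c) d = (wfE e d \<and> wf_com c d)"
| "wf_com (For v e c) d = (v < 30 \<and> wfE e d \<and> wf_com c (d + 2) \<and> d < 31)"
| "wf_com (Draw v) d = (v < 30)"
| "wf_com (Factor v a b) d = (v < 30 \<and> d < 31)"

definition addr_time :: "nat \<Rightarrow> nat poly" where
  "addr_time a = [:a + 201, 3 * (a + 1):]"

primrec timeE :: "expr \<Rightarrow> nat poly" where
  "timeE (Lit r) = [:1:]"
| "timeE (Var v) = [:2:]"
| "timeE (Bin b e1 e2) = timeE e1 + timeE e2 + [:1:]"
| "timeE (Arr a e) = timeE e + addr_time a + [:1:]"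

primrec time_com :: "com \<Rightarrow> nat poly" where
  "time_com (Assign v e) = timeE e + [:2:]"
| "time_com (Put a i e) = timeE e + timeE i + addr_time a + [:1:]"
| "time_com (Seq c1 c2) = time_com c1 + time_com c2"
| "time_com (IfNonneg e c) = timeE e + [:2:] + time_com c"
| "time_com (For v e c) = timeE e + [:1:] + [:0, 1:] * (time_com c + [:6:]) + [:3:]"
| "time_com (Draw v) = [:1:]"
| "time_com (Factor v a b) = [:10, 3:] + (addr_time a + [:1:]) + (addr_time b + [:1:]) + [:1:]"

definition code_at :: "program \<Rightarrow> nat \<Rightarrow> program \<Rightarrow> bool" where
  "code_at P l xs \<longleftrightarrow> (\<forall>i<length xs. l + i < length P \<and> P ! (l + i) = xs ! i)"

lemma code_at_Nil [simp]: "code_at P l []"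
  by (simp add: code_at_def)

lemma code_at_append [simp]: "code_at P l (xs @ ys) \<longleftrightarrow> code_at P l xs \<and> code_at P (l + length xs) ys"
proof
  assume a: "code_at P l (xs @ ys)"
  have "l + length xs + i < length P \<and> P ! (l + length xs + i) = ys ! i" if "i < length ys" for i
    using a[unfolded code_at_def, rule_format, of "length xs + i"] that by (simp add: nth_append add.assoc)
  moreover have "l + i < length P \<and> P ! (l + i) = xs ! i" if "i < length xs" for i
    using a[unfolded code_at_def, rule_format, of i] that by (simp add: nth_append)
  ultimately show "code_at P l xs \<and> code_at P (l + length xs) ys" by (simp add: code_at_def)
next
  assume a: "code_at P l xs \<and> code_at P (l + length xs) ys"
  show "code_at P l (xs @ ys)"
    unfolding code_at_def
  proof (intro allI impI)
    fix i assume i: "i < length (xs @ ys)"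
    show "l + i < length P \<and> P ! (l + i) = (xs @ ys) ! i"
    proof (cases "i < length xs")
      case True
      then show ?thesis using a by (simp add: code_at_def nth_append)
    next
      case False
      then have "i = length xs + (i - length xs)" "i - length xs < length ys" using i by auto
      then show ?thesis using a False by (metis code_at_def add.assoc nth_append_length_plus)
    qed
  qed
qed

lemma code_at_Cons [simp]: "code_at P l (x # xs) \<longleftrightarrow> l < length P \<and> P ! l = x \<and> code_at P (Suc l) xs"
proof -
  have "code_at P l ([x] @ xs) \<longleftrightarrow> code_at P l [x] \<and> code_at P (l + 1) xs"
    by (subst code_at_append) simp
  moreover have "code_at P l [x] \<longleftrightarrow> l < length P \<and> P ! l = x" by (auto simp: code_at_def)
  ultimately show ?thesis by simp
qed

lemma code_at_middle: "code_at (xs @ ys @ zs) (length xs) ys"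
  by (simp add: code_at_def nth_append)

text \<open>The input word must not be overwritten before it has been moved, so only cells \<open>0\<close> and \<open>1\<close> are used: the
  latter counts down from \<open>n\<close> in steps of \<open>1 / n\<close>, that is, for \<open>n\<^sup>2 + 1\<close> rounds, while index register \<open>0\<close>
  advances to \<open>64 + N\<close> for \<open>N = c0 * (n\<^sup>2 + 1)\<close>.\<close>

definition count_code :: "nat \<Rightarrow> nat \<Rightarrow> program" where
  "count_code c0 l = replicate c0 (Incr 0) @ [Sub 1 1 0, Branch 1 l]"

definition copy_code :: "nat \<Rightarrow> program" where
  "copy_code h = [Sub 4 4 ONE, Branch 4 (h + 3), Branch ONE (h + 8), Load 5 1, Store 0 5, Incr 0, Incr 1, Branch ONE h]"

definition prologue :: "nat \<Rightarrow> program" where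
  "prologue c0 = ([Div 0 1 1, Div 0 0 1] @ replicate 64 (Incr 0)) @
     count_code c0 66 @
     (concat (map (\<lambda>c. [Store 0 c, Incr 0]) [2..<64]) @ replicate 64 (Incr 1) @
      [Const ONE 1, Div 2 ONE 0, Const 3 (real c0), Mul 4 2 2, Add 4 4 ONE, Mul NN 4 3, Mul 4 2 2, Add 4 4 4]) @
     copy_code (264 + c0)"

definition epilogue :: "nat \<Rightarrow> nat \<Rightarrow> program" where
  "epilogue a l = [Const 32 0] @ address 0 a 0 (l + 1) @ concat (map (\<lambda>c. [Load c 0, Incr 0]) [0..<64])"

lemma heap_injective:
  fixes a b j k N :: nat
  assumes "j < N" "k < N" "a * N + j = b * N + k"
  shows "a = b \<and> j = k"
proof -
  have "a = (a * N + j) div N" using assms(1) by simp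
  also have "\<dots> = (b * N + k) div N" using assms(3) by simp
  also have "\<dots> = b" using assms(2) by simp
  finally show ?thesis using assms(3) by simp
qed

locale machine =
  fixes chol :: "real mat \<Rightarrow> real mat" and \<omega> :: "nat \<Rightarrow> real"
begin

definition runs :: "program \<Rightarrow> config \<Rightarrow> nat \<Rightarrow> config \<Rightarrow> bool" where
  "runs P s T s' \<longleftrightarrow> (\<exists>t\<le>T. (step chol \<omega> P ^^ t) s = s')"

lemma runs_refl: "runs P s 0 s"
  by (simp add: runs_def)

lemma runs_trans:
  assumes "runs P s T1 s'" "runs P s' T2 s''"
  shows "runs P s (T1 + T2) s''"
proof -
  obtain t1 t2 where t: "t1 \<le> T1" "(step chol \<omega> P ^^ t1) s = s'" "t2 \<le> T2" "(step chol \<omega> P ^^ t2) s' = s''"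
    using assms by (auto simp: runs_def)
  have "(step chol \<omega> P ^^ (t2 + t1)) s = s''" using t by (simp add: funpow_add)
  then show ?thesis unfolding runs_def using t by (intro exI[of _ "t2 + t1"]) auto
qed

lemma runs_mono: "runs P s T s' \<Longrightarrow> T \<le> T' \<Longrightarrow> runs P s T' s'"
  by (auto simp: runs_def intro: le_trans)

lemma runs_eqI: "runs P s T s1 \<Longrightarrow> s1 = s2 \<Longrightarrow> T \<le> T' \<Longrightarrow> runs P s T' s2"
  using runs_mono by blast

lemma runs_instr:
  assumes "code_at P (pc s) (x # xs)"
  shows "runs P s 1 (exec chol \<omega> x s)"
proof -
  have "(step chol \<omega> P ^^ 1) s = exec chol \<omega> x s"
    using assms by (simp add: step_def halted_def)
  then show ?thesis unfolding runs_def by blast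
qed

definition straight :: "instr \<Rightarrow> bool" where
  "straight x \<longleftrightarrow> (\<forall>a l. x \<noteq> Branch a l)"

lemma pc_exec: "straight x \<Longrightarrow> pc (exec chol \<omega> x s) = Suc (pc s)"
  by (cases x) (auto simp: straight_def)

lemma runs_block:
  assumes "code_at P (pc s) xs" "\<forall>x\<in>set xs. straight x"
  shows "runs P s (length xs) (fold (exec chol \<omega>) xs s) \<and> pc (fold (exec chol \<omega>) xs s) = pc s + length xs"
  using assms
proof (induction xs arbitrary: s)
  case Nil
  then show ?case by (simp add: runs_refl)
next
  case (Cons x xs)
  have p: "pc (exec chol \<omega> x s) = Suc (pc s)" using Cons.prems by (simp add: pc_exec)
  have "runs P s 1 (exec chol \<omega> x s)" using Cons.prems by (intro runs_instr[of _ _ _ xs]) auto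
  moreover have "runs P (exec chol \<omega> x s) (length xs) (fold (exec chol \<omega>) xs (exec chol \<omega> x s)) \<and>
     pc (fold (exec chol \<omega>) xs (exec chol \<omega> x s)) = pc (exec chol \<omega> x s) + length xs"
    using Cons.prems p by (intro Cons.IH) auto
  ultimately show ?case using runs_trans[of P s 1 _ "length xs"] p by auto
qed

lemma straight_simps [simp]:
  "straight (Const d c)" "straight (Add d a b)" "straight (Sub d a b)" "straight (Mul d a b)" "straight (Div d a b)"
  "straight (Reset p)" "straight (Incr p)" "straight (Load d p)" "straight (Store p a)" "straight (Cholesky p a b)"
  "straight (Sample d)"
  by (simp_all add: straight_def)

lemma set_index_loop:
  assumes c: "code_at P l (set_index p t l)" and t: "t \<noteq> ONE"
  shows "pc s = l + 1 \<Longrightarrow> mem s t = real m \<Longrightarrow> mem s ONE = 1 \<Longrightarrow>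
    runs P s (3 * m + 3) (s\<lparr>pc := l + 4, mem := (mem s)(t := -1), idx := (idx s)(p := idx s p + m + 1)\<rparr>)"
proof (induction m arbitrary: s)
  case (0 s)
  let ?b = "[Incr p, Sub t t ONE]"
  let ?s = "fold (exec chol \<omega>) ?b s"
  have 1: "runs P s 2 ?s" "pc ?s = l + 3"
    using runs_block[of P s ?b] c 0 by (auto simp: set_index_def numeral_2_eq_2)
  have "runs P ?s 1 (exec chol \<omega> (Branch t (l + 1)) ?s)"
    by (rule runs_instr[of _ _ _ "[]"]) (use c 1 in \<open>simp add: set_index_def del: fold_simps\<close>)
  from runs_trans[OF 1(1) this] show ?case
    by (rule runs_eqI) (use 0 in \<open>auto intro!: config.equality\<close>)
next
  case (Suc m s)
  let ?b = "[Incr p, Sub t t ONE]"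
  let ?s = "fold (exec chol \<omega>) ?b s"
  define s1 where "s1 = s\<lparr>mem := (mem s)(t := real m), idx := (idx s)(p := Suc (idx s p))\<rparr>"
  have 1: "runs P s 2 ?s" "pc ?s = l + 3"
    using runs_block[of P s ?b] c Suc.prems by (auto simp: set_index_def numeral_2_eq_2)
  have "runs P ?s 1 (exec chol \<omega> (Branch t (l + 1)) ?s)"
    by (rule runs_instr[of _ _ _ "[]"]) (use c 1 in \<open>simp add: set_index_def del: fold_simps\<close>)
  moreover have "exec chol \<omega> (Branch t (l + 1)) ?s = s1"
    using Suc.prems by (simp add: s1_def)
  ultimately have "runs P ?s 1 s1" by simp
  from runs_trans[OF 1(1) this] have "runs P s 3 s1" by simp
  moreover have "runs P s1 (3 * m + 3) (s1\<lparr>pc := l + 4, mem := (mem s1)(t := -1), idx := (idx s1)(p := idx s1 p + m + 1)\<rparr>)"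
    by (rule Suc.IH) (use Suc.prems t in \<open>auto simp: s1_def\<close>)
  ultimately have "runs P s (3 + (3 * m + 3)) (s1\<lparr>pc := l + 4, mem := (mem s1)(t := -1), idx := (idx s1)(p := idx s1 p + m + 1)\<rparr>)"
    by (rule runs_trans)
  then show ?case by (rule runs_eqI) (auto simp: s1_def intro!: config.equality)
qed

lemma runs_set_index:
  assumes c: "code_at P (pc s) (set_index p t (pc s))" and t: "t \<noteq> ONE" "mem s t = real m" "mem s ONE = 1"
  shows "runs P s (3 * m + 4) (s\<lparr>pc := pc s + 4, mem := (mem s)(t := -1), idx := (idx s)(p := m + 1)\<rparr>)"
proof -
  let ?s = "exec chol \<omega> (Reset p) s"
  have "runs P s 1 ?s"
    by (rule runs_instr[of _ _ _ "[Incr p, Sub t t ONE, Branch t (pc s + 1)]"]) (use c in \<open>simp add: set_index_def\<close>)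
  moreover have "runs P ?s (3 * m + 3) (?s\<lparr>pc := pc s + 4, mem := (mem ?s)(t := -1), idx := (idx ?s)(p := idx ?s p + m + 1)\<rparr>)"
    by (rule set_index_loop[OF c t(1)]) (use t in auto)
  ultimately have "runs P s (1 + (3 * m + 3)) (?s\<lparr>pc := pc s + 4, mem := (mem ?s)(t := -1), idx := (idx ?s)(p := idx ?s p + m + 1)\<rparr>)"
    by (rule runs_trans)
  then show ?thesis by (rule runs_eqI) (auto intro: config.equality)
qed

lemma fold_replicate_add:
  "mem s NN = real N \<Longrightarrow> mem s t = r \<Longrightarrow> t \<noteq> NN \<Longrightarrow>
   fold (exec chol \<omega>) (replicate a (Add t t NN)) s = s\<lparr>pc := pc s + a, mem := (mem s)(t := r + real (a * N))\<rparr>"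
  by (induction a arbitrary: s r) (auto simp: algebra_simps)

lemma runs_address:
  assumes c: "code_at P (pc s) (address p a d (pc s))" and d: "d < 31"
    and m: "mem s (tmp d) = real k" "mem s ONE = 1" "mem s NN = real N" and k: "k < N"
  shows "\<exists>s'. runs P s (poly (addr_time a) N) s' \<and> pc s' = pc s + (a + 6) \<and> used s' = used s \<and>
    idx s' = (idx s)(p := 64 + a * N + k) \<and> (\<forall>c. c \<noteq> tmp d \<longrightarrow> c \<noteq> tmp (Suc d) \<longrightarrow> mem s' c = mem s c)"
proof -
  let ?b = "replicate a (Add (tmp d) (tmp d) NN) @ [Const (tmp (Suc d)) 63, Add (tmp d) (tmp d) (tmp (Suc d))]"
  define s1 where "s1 = fold (exec chol \<omega>) ?b s"
  have 1: "runs P s (a + 2) s1" "pc s1 = pc s + (a + 2)"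
    using runs_block[of P s ?b] c by (auto simp: address_def s1_def)
  have s1: "s1 = s\<lparr>pc := pc s + (a + 2), mem := (mem s)(tmp d := real (k + a * N + 63), tmp (Suc d) := 63)\<rparr>"
    unfolding s1_def fold_append o_apply using m
    by (subst fold_replicate_add[where N=N and r="real k"]) (auto simp: fun_eq_iff)
  have "runs P s1 (3 * (k + a * N + 63) + 4) (s1\<lparr>pc := pc s1 + 4, mem := (mem s1)(tmp d := -1), idx := (idx s1)(p := k + a * N + 63 + 1)\<rparr>)"
    by (rule runs_set_index) (use c d m 1 in \<open>auto simp: address_def s1 add.assoc\<close>)
  note r = runs_trans[OF 1(1) this]
  have "a + 2 + (3 * (k + a * N + 63) + 4) \<le> poly (addr_time a) N"
    using k by (simp add: addr_time_def algebra_simps)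
  with r have "runs P s (poly (addr_time a) N) (s1\<lparr>pc := pc s1 + 4, mem := (mem s1)(tmp d := -1), idx := (idx s1)(p := k + a * N + 63 + 1)\<rparr>)"
    by (rule runs_mono)
  then show ?thesis
    by (intro exI[of _ "s1\<lparr>pc := pc s1 + 4, mem := (mem s1)(tmp d := -1), idx := (idx s1)(p := k + a * N + 63 + 1)\<rparr>"])
      (auto simp: s1 add_ac)
qed

definition sim :: "nat \<Rightarrow> store \<Rightarrow> config \<Rightarrow> bool" where
  "sim N \<sigma> s \<longleftrightarrow> (\<forall>v<30. mem s v = vars \<sigma> v) \<and> mem s ONE = 1 \<and> mem s NN = real N \<and>
     (\<forall>a. \<forall>k<N. mem s (HEAP + a * N + k) = arr \<sigma> a k) \<and> used s = cnt \<sigma>"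

lemma sim_temps:
  assumes "sim N \<sigma> s" "\<And>c. c \<notin> {32..<64} \<Longrightarrow> mem s' c = mem s c" "used s' = used s"
  shows "sim N \<sigma> s'"
  using assms unfolding sim_def by auto

lemma runs_compileE:
  assumes "code_at P (pc s) (compileE e d (pc s))" "sim N \<sigma> s" "okE N e \<sigma>" "wfE e d"
  shows "\<exists>s'. runs P s (poly (timeE e) N) s' \<and> pc s' = pc s + lenE e \<and> used s' = used s \<and>
    mem s' (tmp d) = ev e \<sigma> \<and> (\<forall>c. c \<notin> {tmp d..<64} \<longrightarrow> mem s' c = mem s c)"
  using assms
proof (induction e arbitrary: d s)
  case (Lit r)
  show ?case
    using runs_block[of P s "[Const (tmp d) r]"] Lit
    by (intro exI[of _ "fold (exec chol \<omega>) [Const (tmp d) r] s"]) auto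
next
  case (Var v)
  show ?case
    using runs_block[of P s "[Const (tmp d) 0, Add (tmp d) (tmp d) v]"] Var
    by (intro exI[of _ "fold (exec chol \<omega>) [Const (tmp d) 0, Add (tmp d) (tmp d) v] s"]) (auto simp: sim_def numeral_2_eq_2)
next
  case (Bin b e1 e2)
  obtain s1 where 1: "runs P s (poly (timeE e1) N) s1" "pc s1 = pc s + lenE e1" "used s1 = used s"
    "mem s1 (tmp d) = ev e1 \<sigma>" "\<And>c. c \<notin> {tmp d..<64} \<Longrightarrow> mem s1 c = mem s c"
    using Bin.IH(1)[of s d] Bin.prems by auto
  have sim1: "sim N \<sigma> s1" by (rule sim_temps[OF Bin.prems(2)]) (use 1 in auto)
  obtain s2 where 2: "runs P s1 (poly (timeE e2) N) s2" "pc s2 = pc s1 + lenE e2" "used s2 = used s1"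
    "mem s2 (tmp (Suc d)) = ev e2 \<sigma>" "\<And>c. c \<notin> {tmp (Suc d)..<64} \<Longrightarrow> mem s2 c = mem s1 c"
    using Bin.IH(2)[of s1 "Suc d"] Bin.prems 1(2) sim1 by auto
  have d: "d < 31" using Bin.prems(4) by (induction e1) auto
  let ?s = "exec chol \<omega> (bop_instr b (tmp d) (tmp d) (tmp (Suc d))) s2"
  have 3: "runs P s2 1 ?s"
    by (rule runs_instr[of _ _ _ "[]"]) (use Bin.prems 1 2 in \<open>simp add: add.assoc\<close>)
  show ?case
    by (rule exI[of _ ?s]) (use runs_trans[OF runs_trans[OF 1(1) 2(1)] 3] 1 2 d in \<open>cases b; simp\<close>)
next
  case (Arr a e)
  obtain s1 where 1: "runs P s (poly (timeE e) N) s1" "pc s1 = pc s + lenE e" "used s1 = used s"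
    "mem s1 (tmp d) = ev e \<sigma>" "\<And>c. c \<notin> {tmp d..<64} \<Longrightarrow> mem s1 c = mem s c"
    using Arr.IH[of s d] Arr.prems by auto
  obtain k where k: "k < N" "ev e \<sigma> = real k" using Arr.prems(3) by (auto simp: index_ok_def)
  obtain s2 where 2: "runs P s1 (poly (addr_time a) N) s2" "pc s2 = pc s1 + (a + 6)" "used s2 = used s1"
    "idx s2 = (idx s1)(0 := 64 + a * N + k)" "\<And>c. c \<noteq> tmp d \<Longrightarrow> c \<noteq> tmp (Suc d) \<Longrightarrow> mem s2 c = mem s1 c"
    using runs_address[of P s1 0 a d k N] Arr.prems 1 k by (auto simp: sim_def)
  let ?s = "exec chol \<omega> (Load (tmp d) 0) s2"
  have 3: "runs P s2 1 ?s"
    by (rule runs_instr[of _ _ _ "[]"]) (use Arr.prems 1 2 in \<open>simp add: add.assoc\<close>)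
  have d: "d < 31" using Arr.prems by simp
  have "mem s2 (64 + a * N + k) = mem s (64 + a * N + k)" using 1(5) 2(5) d by simp
  then have "mem s2 (64 + a * N + k) = arr \<sigma> a k" using Arr.prems(2) k by (simp add: sim_def)
  moreover have "mem s2 c = mem s c" if "c \<notin> {tmp d..<64}" for c using 1(5) 2(5) that d by auto
  ultimately show ?case
    by (intro exI[of _ ?s]) (use runs_trans[OF runs_trans[OF 1(1) 2(1)] 3] 1(2,3) 2(2-4) d k in auto)
qed

lemma runs_branch:
  assumes "code_at P (pc s) (Branch a m # xs)"
  shows "runs P s 1 (s\<lparr>pc := if 0 \<le> mem s a then m else Suc (pc s)\<rparr>)"
  using runs_instr[OF assms] by simp

lemma length_three: "length [a, b, c] = 3"
  by simp

lemma length_one: "length [a] = 1" and length_five: "length [a, b, c, d, e] = 5"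
  by simp_all

lemma wfE_depth: "wfE e d \<Longrightarrow> d < 31"
  by (induction e arbitrary: d) auto

lemma sim_seta:
  assumes s: "sim N \<sigma> s" and k: "k < N"
    and m: "\<And>c. c \<notin> {32..<64} \<Longrightarrow> c \<noteq> HEAP + a * N + k \<Longrightarrow> mem s' c = mem s c"
      "mem s' (HEAP + a * N + k) = r" and u: "used s' = used s"
  shows "sim N (seta a k r \<sigma>) s'"
proof -
  have "mem s' (HEAP + b * N + j) = arr (seta a k r \<sigma>) b j" if "j < N" for b j
  proof (cases "b = a \<and> j = k")
    case True
    then show ?thesis using m by (simp add: seta_def)
  next
    case False
    then have "HEAP + b * N + j \<noteq> HEAP + a * N + k" using heap_injective[OF that k] by auto
    then have "mem s' (HEAP + b * N + j) = mem s (HEAP + b * N + j)" by (intro m) auto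
    then show ?thesis using s False that by (auto simp: sim_def seta_def)
  qed
  then show ?thesis using s u m(1) unfolding sim_def by (auto simp: seta_def)
qed

lemma runs_For:
  assumes IH: "\<And>s \<sigma>. code_at P (pc s) (compile c (d + 2) (pc s)) \<Longrightarrow> sim N \<sigma> s \<Longrightarrow> ok chol \<omega> N c \<sigma> \<Longrightarrow>
      wf_com c (d + 2) \<Longrightarrow>
      \<exists>s'. runs P s (poly (time_com c) N) s' \<and> pc s' = pc s + len c \<and> sim N (sem chol \<omega> c \<sigma>) s' \<and>
        (\<forall>c. 32 \<le> c \<longrightarrow> c < tmp (d + 2) \<longrightarrow> mem s' c = mem s c)"
    and prems: "code_at P (pc s) (compile (For v e c) d (pc s))" "sim N \<sigma> s" "ok chol \<omega> N (For v e c) \<sigma>"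
      "wf_com (For v e c) d"
  shows "\<exists>s'. runs P s (poly (time_com (For v e c)) N) s' \<and> pc s' = pc s + len (For v e c) \<and>
    sim N (sem chol \<omega> (For v e c) \<sigma>) s' \<and> (\<forall>c. 32 \<le> c \<longrightarrow> c < tmp d \<longrightarrow> mem s' c = mem s c)"
proof -
  obtain s1 where 1: "runs P s (poly (timeE e) N) s1" "pc s1 = pc s + lenE e" "used s1 = used s"
    "mem s1 (tmp d) = ev e \<sigma>" "\<And>c. c \<notin> {tmp d..<64} \<Longrightarrow> mem s1 c = mem s c"
    using runs_compileE[of P s e d N \<sigma>] prems by auto
  have d: "d < 31" "v < 30" using prems by auto
  obtain m where m: "m < N" "ev e \<sigma> = real m" using prems(3) by (auto simp: index_ok_def)
  define h where "h = pc s + lenE e + 1"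
  define st where "st i = fold (\<lambda>i \<tau>. sem chol \<omega> c (setv v (real i) \<tau>)) [0..<i] \<sigma>" for i
  have st_Suc: "st (Suc i) = sem chol \<omega> c (setv v (real i) (st i))" for i by (simp add: st_def)
  have okc: "ok chol \<omega> N c (setv v (real i) (st i))" if "i < m" for i
    using prems(3) m that by (simp add: st_def)
  define R where "R i s' \<longleftrightarrow> pc s' = h \<and> sim N (st i) s' \<and> mem s' (tmp d) = real (m - i) \<and> mem s' (tmp (Suc d)) = real i \<and>
    (\<forall>c. 32 \<le> c \<longrightarrow> c < tmp d \<longrightarrow> mem s' c = mem s c)" for i s'
  have code: "code_at P h [Sub (tmp d) (tmp d) ONE, Branch (tmp d) (h + 3), Branch ONE (h + 7 + len c),
        Const v 0, Add v v (tmp (Suc d))]" "code_at P (h + 5) (compile c (d + 2) (h + 5))"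
      "code_at P (h + 5 + len c) [Add (tmp (Suc d)) (tmp (Suc d)) ONE, Branch ONE h]"
      "code_at P (pc s1) [Const (tmp (Suc d)) 0]"
    using prems(1)
    unfolding 1(2) compile.simps Let_def code_at_append length_compileE length_compile length_one length_five h_def[symmetric]
    by - (elim conjE, assumption)+
  have head: "\<exists>s''. runs P s' 2 s'' \<and> pc s'' = (if i < m then h + 3 else h + 2) \<and>
      mem s'' = (mem s')(tmp d := real (m - i) - 1) \<and> used s'' = used s'" if "R i s'" "i \<le> m" for i s'
  proof -
    let ?s = "exec chol \<omega> (Sub (tmp d) (tmp d) ONE) s'"
    have a: "runs P s' 1 ?s"
      by (rule runs_instr[of _ _ _ "tl [Sub (tmp d) (tmp d) ONE, Branch (tmp d) (h + 3), Branch ONE (h + 7 + len c),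
        Const v 0, Add v v (tmp (Suc d))]"]) (use code(1) that in \<open>simp add: R_def\<close>)
    have "code_at P (pc ?s) (Branch (tmp d) (h + 3) # [])" using code(1) that by (simp add: R_def)
    from runs_branch[OF this] have b: "runs P ?s 1 (?s\<lparr>pc := if 0 \<le> mem ?s (tmp d) then h + 3 else Suc (pc ?s)\<rparr>)" .
    have "(0 \<le> mem ?s (tmp d)) = (i < m)" using that by (auto simp: R_def sim_def of_nat_diff)
    then show ?thesis
      using runs_trans[OF a b] that by (intro exI[of _ "?s\<lparr>pc := if 0 \<le> mem ?s (tmp d) then h + 3 else Suc (pc ?s)\<rparr>"])
        (auto simp: R_def sim_def numeral_2_eq_2)
  qed
  have iter: "\<exists>s'. runs P s (poly (timeE e) N + 1 + i * (poly (time_com c) N + 6)) s' \<and> R i s'" if "i \<le> m" for i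
    using that
  proof (induction i)
    case 0
    let ?s = "exec chol \<omega> (Const (tmp (Suc d)) 0) s1"
    have "runs P s1 1 ?s" by (rule runs_instr[OF code(4)])
    moreover have "R 0 ?s"
      unfolding R_def using 1 m d by (auto simp: st_def h_def intro!: sim_temps[OF prems(2)])
    ultimately show ?case using runs_trans[OF 1(1), of 1 ?s] by (intro exI[of _ ?s]) simp
  next
    case (Suc i)
    then have i: "i < m" by simp
    obtain s2 where 2: "runs P s (poly (timeE e) N + 1 + i * (poly (time_com c) N + 6)) s2" "R i s2"
      using Suc by auto
    obtain s3 where 3: "runs P s2 2 s3" "pc s3 = h + 3" "mem s3 = (mem s2)(tmp d := real (m - i) - 1)" "used s3 = used s2"
      using head[OF 2(2)] i by auto
    let ?b = "[Const v 0, Add v v (tmp (Suc d))]"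
    let ?s = "fold (exec chol \<omega>) ?b s3"
    have 4: "runs P s3 2 ?s" "pc ?s = h + 5"
      using runs_block[of P s3 ?b] code(1) 3(2) by (auto simp: numeral_2_eq_2 numeral_3_eq_3)
    have sim4: "sim N (setv v (real i) (st i)) ?s"
      using 2(2) 3 d unfolding R_def sim_def by (auto simp: setv_def)
    have code5: "code_at P (pc ?s) (compile c (d + 2) (pc ?s))" unfolding 4(2) by (rule code(2))
    have wf5: "wf_com c (d + 2)" using prems(4) by simp
    obtain s5 where 5: "runs P ?s (poly (time_com c) N) s5" "pc s5 = h + 5 + len c"
      "sim N (st (Suc i)) s5" "\<And>c. 32 \<le> c \<Longrightarrow> c < tmp (d + 2) \<Longrightarrow> mem s5 c = mem ?s c"
      using IH[OF code5 sim4 okc[OF i] wf5] unfolding st_Suc 4(2) by blast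
    let ?s6 = "exec chol \<omega> (Add (tmp (Suc d)) (tmp (Suc d)) ONE) s5"
    have 6: "runs P s5 1 ?s6" by (rule runs_instr[OF code(3)[folded 5(2)]])
    have "code_at P (pc ?s6) (Branch ONE h # [])" using code(3) 5(2) by simp
    from runs_branch[OF this] have 7: "runs P ?s6 1 (?s6\<lparr>pc := h\<rparr>)" using 5(3) by (simp add: sim_def)
    have r: "runs P s (poly (timeE e) N + 1 + i * (poly (time_com c) N + 6) + 2 + 2 + poly (time_com c) N + 1 + 1) (?s6\<lparr>pc := h\<rparr>)"
      by (rule runs_trans[OF runs_trans[OF runs_trans[OF runs_trans[OF runs_trans[OF 2(1) 3(1)] 4(1)] 5(1)] 6] 7])
    have sim7: "sim N (st (Suc i)) (?s6\<lparr>pc := h\<rparr>)" by (rule sim_temps[OF 5(3)]) (use d in auto)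
    have "mem s5 (tmp d) = real (m - Suc i)" "mem s5 (tmp (Suc d)) = real i"
      using 5(4)[of "tmp d"] 5(4)[of "tmp (Suc d)"] 2(2) 3(3) d i by (auto simp: R_def of_nat_diff)
    moreover have "mem s5 c = mem s c" if "32 \<le> c" "c < tmp d" for c
      using 5(4)[of c] 2(2) 3(3) d that by (auto simp: R_def)
    ultimately have "R (Suc i) (?s6\<lparr>pc := h\<rparr>)"
      using sim7 5(3) d unfolding R_def by (auto simp: sim_def)
    then show ?case using r by (intro exI[of _ "?s6\<lparr>pc := h\<rparr>"] conjI runs_eqI[OF r] refl) auto
  qed
  obtain s2 where 2: "runs P s (poly (timeE e) N + 1 + m * (poly (time_com c) N + 6)) s2" "R m s2"
    using iter[of m] by auto
  obtain s3 where 3: "runs P s2 2 s3" "pc s3 = h + 2" "mem s3 = (mem s2)(tmp d := real (m - m) - 1)" "used s3 = used s2"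
    using head[OF 2(2)] by auto
  let ?s = "s3\<lparr>pc := h + 7 + len c\<rparr>"
  have "code_at P (pc s3) (Branch ONE (h + 7 + len c) # [])" using code(1) 3(2) by (simp add: numeral_2_eq_2)
  from runs_branch[OF this] have 4: "runs P s3 1 ?s" using 2(2) 3(3) d by (simp add: R_def sim_def)
  have sim4: "sim N (st m) ?s"
    by (rule sim_temps[of _ _ s2]) (use 2(2) 3 d in \<open>auto simp: R_def\<close>)
  from runs_trans[OF runs_trans[OF 2(1) 3(1)] 4]
  have "runs P s (poly (timeE e) N + 1 + m * (poly (time_com c) N + 6) + 2 + 1) ?s" .
  moreover have "m * (poly (time_com c) N + 6) \<le> N * (poly (time_com c) N + 6)" using m by simp
  ultimately have "runs P s (poly (time_com (For v e c)) N) ?s" by (elim runs_mono) simp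
  then show ?thesis
    using sim4 2(2) 3(3) m by (intro exI[of _ ?s]) (auto simp: h_def st_def R_def)
qed

lemma runs_Factor:
  assumes prems: "code_at P (pc s) (compile (Factor v a b) d (pc s))" "sim N \<sigma> s" "ok chol \<omega> N (Factor v a b) \<sigma>"
      "wf_com (Factor v a b) d"
  shows "\<exists>s'. runs P s (poly (time_com (Factor v a b)) N) s' \<and> pc s' = pc s + len (Factor v a b) \<and>
    sim N (sem chol \<omega> (Factor v a b) \<sigma>) s' \<and> (\<forall>c. 32 \<le> c \<longrightarrow> c < tmp d \<longrightarrow> mem s' c = mem s c)"
proof -
  obtain k where k: "vars \<sigma> v = real k" "0 < k" "k * k < N" using prems(3) by auto
  have d: "v < 30" "d < 31" using prems by auto
  have v: "mem s v = real k" and c: "mem s ONE = 1" "mem s NN = real N" using prems(2) d k by (auto simp: sim_def)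
  let ?b1 = "[Const (tmp d) 0, Add (tmp d) (tmp d) v, Sub (tmp d) (tmp d) ONE]"
  let ?s1 = "fold (exec chol \<omega>) ?b1 s"
  note raw = prems(1)[unfolded compile.simps code_at_append length_append length_set_index length_address length_one length_three]
  have code: "code_at P (pc s) ?b1" "code_at P (pc s + 3) (set_index 1 (tmp d) (pc s + 3))"
    "code_at P (pc s + 7) [Const (tmp d) 0]" "code_at P (pc s + 7 + 1) (address 2 a d (pc s + 7 + 1))"
    "code_at P (pc s + (a + 14)) [Const (tmp d) 0]"
    "code_at P (pc s + (a + 14) + 1) (address 3 b d (pc s + (a + 14) + 1))"
    "code_at P (pc s + (a + 14) + (b + 7)) [Cholesky 1 2 3]"
  proof -
    have e: "pc s + (3 + 4) = pc s + 7" "pc s + 7 + (1 + (a + 6)) = pc s + (a + 14)"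
      "pc s + 8 = pc s + 7 + 1" "pc s + 7 + 1 + (a + 6) + 1 = pc s + (a + 14) + 1"
      "pc s + (a + 14) + (1 + (b + 6)) = pc s + (a + 14) + (b + 7)" by arith+
    show "code_at P (pc s) ?b1" "code_at P (pc s + 3) (set_index 1 (tmp d) (pc s + 3))"
      "code_at P (pc s + 7) [Const (tmp d) 0]" "code_at P (pc s + 7 + 1) (address 2 a d (pc s + 7 + 1))"
      "code_at P (pc s + (a + 14)) [Const (tmp d) 0]"
      "code_at P (pc s + (a + 14) + 1) (address 3 b d (pc s + (a + 14) + 1))"
      "code_at P (pc s + (a + 14) + (b + 7)) [Cholesky 1 2 3]"
      using raw[unfolded e] by - (elim conjE, assumption)+
  qed
  have "runs P s (length ?b1) ?s1 \<and> pc ?s1 = pc s + length ?b1" by (rule runs_block[OF code(1)]) simp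
  then have 1: "runs P s 3 ?s1" "pc ?s1 = pc s + 3" unfolding length_three by blast+
  have m1: "mem ?s1 = (mem s)(tmp d := real (k - 1))" "used ?s1 = used s" "idx ?s1 = idx s"
    using v c k d by (auto simp: of_nat_diff)
  obtain s2 where 2: "runs P ?s1 (3 * (k - 1) + 4) s2" "pc s2 = pc s + 7" "mem s2 = (mem s)(tmp d := -1)" "used s2 = used s"
      "idx s2 = (idx s)(1 := k)"
  proof -
    have "runs P ?s1 (3 * (k - 1) + 4) (?s1\<lparr>pc := pc ?s1 + 4, mem := (mem ?s1)(tmp d := -1), idx := (idx ?s1)(1 := (k - 1) + 1)\<rparr>)"
      by (rule runs_set_index[OF code(2)[folded 1(2)]]) (use m1 c d in auto)
    then show ?thesis using that 1(2) m1 k by fastforce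
  qed
  have step: "\<exists>s''. runs P s' (1 + poly (addr_time a) N) s'' \<and> pc s'' = pc s' + (a + 7) \<and> used s'' = used s' \<and>
      idx s'' = (idx s')(p := 64 + a * N) \<and> (\<forall>c. c \<noteq> tmp d \<longrightarrow> c \<noteq> tmp (Suc d) \<longrightarrow> mem s'' c = mem s' c)"
    if cd: "code_at P (pc s') [Const (tmp d) 0]" "code_at P (pc s' + 1) (address p a d (pc s' + 1))"
      "mem s' ONE = 1" "mem s' NN = real N" for s' p a
  proof -
    let ?s = "exec chol \<omega> (Const (tmp d) 0) s'"
    have r: "runs P s' 1 ?s" by (rule runs_instr[OF cd(1)])
    have ps: "pc ?s = pc s' + 1" by simp
    have ms: "mem ?s (tmp d) = real 0" "mem ?s ONE = 1" "mem ?s NN = real N" "0 < N" using cd(3,4) d k by auto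
    obtain s'' where "runs P ?s (poly (addr_time a) N) s''" "pc s'' = pc ?s + (a + 6)" "used s'' = used ?s"
      "idx s'' = (idx ?s)(p := 64 + a * N + 0)" "\<forall>c. c \<noteq> tmp d \<longrightarrow> c \<noteq> tmp (Suc d) \<longrightarrow> mem s'' c = mem ?s c"
      using runs_address[OF cd(2)[folded ps] d(2) ms] by blast
    then show ?thesis using runs_trans[OF r] by (intro exI[of _ s'']) auto
  qed
  obtain s3 where 3: "runs P s2 (1 + poly (addr_time a) N) s3" "pc s3 = pc s2 + (a + 7)" "used s3 = used s2"
      "idx s3 = (idx s2)(2 := 64 + a * N)" "\<And>c. c \<noteq> tmp d \<Longrightarrow> c \<noteq> tmp (Suc d) \<Longrightarrow> mem s3 c = mem s2 c"
    using step[OF code(3,4)[folded 2(2)]] 2 c d by auto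
  have pc3: "pc s3 = pc s + (a + 14)" using 3(2) 2(2) by simp
  obtain s4 where 4: "runs P s3 (1 + poly (addr_time b) N) s4" "pc s4 = pc s3 + (b + 7)" "used s4 = used s3"
      "idx s4 = (idx s3)(3 := 64 + b * N)" "\<And>c. c \<noteq> tmp d \<Longrightarrow> c \<noteq> tmp (Suc d) \<Longrightarrow> mem s4 c = mem s3 c"
    using step[OF code(5,6)[folded pc3]] 2 3 c d by auto
  have pc4: "pc s4 = pc s + (a + 14) + (b + 7)" using 4(2) pc3 by simp
  let ?s = "exec chol \<omega> (Cholesky 1 2 3) s4"
  have 5: "runs P s4 1 ?s"
    by (rule runs_instr[OF code(7)[folded pc4]])
  have r: "runs P s (poly (time_com (Factor v a b)) N) ?s"
    by (rule runs_mono[OF runs_trans[OF runs_trans[OF runs_trans[OF runs_trans[OF 1(1) 2(1)] 3(1)] 4(1)] 5]])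
      (use k in \<open>cases k; auto simp: algebra_simps intro: le_trans[OF _ less_imp_le]\<close>)
  define L where "L = chol (mat k k (\<lambda>(i, j). arr \<sigma> a (i * k + j)))"
  have lt: "i * k + j < k * k" if "i < k" "j < k" for i j
  proof -
    have "i * k + j < Suc i * k" using that by simp
    also have "\<dots> \<le> k * k" using that by (intro mult_le_mono1) simp
    finally show ?thesis .
  qed
  have m4: "mem s4 c = mem s c" if "c \<notin> {tmp d..<64}" for c using 2(3) 3(5) 4(5) that d by auto
  have i4: "idx s4 1 = k" "idx s4 2 = 64 + a * N" "idx s4 3 = 64 + b * N" using 2 3 4 by auto
  have "read_mat (mem s4) k (64 + a * N) = mat k k (\<lambda>(i, j). arr \<sigma> a (i * k + j))"
    unfolding read_mat_def
  proof (intro cong_mat refl, clarsimp)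
    fix i j assume ij: "i < k" "j < k"
    have "mem s (HEAP + a * N + (i * k + j)) = arr \<sigma> a (i * k + j)"
      using prems(2) lt[OF ij] k(3) by (simp add: sim_def)
    then show "mem s4 (64 + a * N + i * k + j) = arr \<sigma> a (i * k + j)"
      using m4[of "64 + a * N + i * k + j"] d by (simp add: add.assoc)
  qed
  then have ms: "mem ?s = write_mat (mem s4) k (64 + b * N) L"
    by (simp add: i4(2,3) i4(1)[simplified] L_def)
  have out: "mem ?s c = mem s c" if "c \<notin> {tmp d..<64}" "\<not> (64 + b * N \<le> c \<and> c < 64 + b * N + k * k)" for c
    using that m4 unfolding ms write_mat_def by auto
  have "mem ?s (HEAP + a' * N + j) = (if a' = b \<and> j < k * k then L $$ (j div k, j mod k) else arr \<sigma> a' j)" if j: "j < N" for a' j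
  proof (cases "a' = b \<and> j < k * k")
    case True
    then show ?thesis unfolding ms write_mat_def by simp
  next
    case False
    have "\<not> (64 + b * N \<le> HEAP + a' * N + j \<and> HEAP + a' * N + j < 64 + b * N + k * k)"
    proof
      assume "64 + b * N \<le> HEAP + a' * N + j \<and> HEAP + a' * N + j < 64 + b * N + k * k"
      then obtain j' where "j' < k * k" "a' * N + j = b * N + j'"
        by (metis (no_types, lifting) add.assoc add_less_cancel_left le_Suc_ex nat_add_left_cancel_le add_left_cancel)
      then show False using heap_injective[of j N j' a' b] j k False by auto
    qed
    then have "mem ?s (HEAP + a' * N + j) = mem s (HEAP + a' * N + j)" by (intro out) auto
    then show ?thesis using False prems(2) j by (auto simp: sim_def)
  qed
  moreover have "mem ?s c = mem s c" if "c < 32" for c using that by (intro out) auto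
  ultimately have "sim N (sem chol \<omega> (Factor v a b) \<sigma>) ?s"
    using prems(2) 2(4) 3(3) 4(3) k unfolding sim_def by (auto simp: Let_def L_def)
  moreover have "mem ?s c = mem s c" if "32 \<le> c" "c < tmp d" for c using that d by (intro out) auto
  ultimately show ?thesis using r 2 3 4 by (intro exI[of _ ?s]) auto
qed

lemma runs_compile:
  assumes "code_at P (pc s) (compile c d (pc s))" "sim N \<sigma> s" "ok chol \<omega> N c \<sigma>" "wf_com c d"
  shows "\<exists>s'. runs P s (poly (time_com c) N) s' \<and> pc s' = pc s + len c \<and> sim N (sem chol \<omega> c \<sigma>) s' \<and>
    (\<forall>c. 32 \<le> c \<longrightarrow> c < tmp d \<longrightarrow> mem s' c = mem s c)"
  using assms
proof (induction c arbitrary: d s \<sigma>)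
  case (Assign v e)
  obtain s1 where 1: "runs P s (poly (timeE e) N) s1" "pc s1 = pc s + lenE e" "used s1 = used s"
    "mem s1 (tmp d) = ev e \<sigma>" "\<And>c. c \<notin> {tmp d..<64} \<Longrightarrow> mem s1 c = mem s c"
    using runs_compileE[of P s e d N \<sigma>] Assign.prems by auto
  let ?b = "[Const v 0, Add v v (tmp d)]"
  let ?s = "fold (exec chol \<omega>) ?b s1"
  have 2: "runs P s1 2 ?s" "pc ?s = pc s1 + 2"
    using runs_block[of P s1 ?b] Assign.prems 1(2) by (auto simp: numeral_2_eq_2)
  have "v < 30" using Assign.prems by simp
  then have "sim N (sem chol \<omega> (Assign v e) \<sigma>) ?s"
    using Assign.prems(2) 1 unfolding sim_def by (auto simp: setv_def)
  then show ?case
    using runs_trans[OF 1(1) 2(1)] 2(2) 1 \<open>v < 30\<close> by (intro exI[of _ ?s]) auto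
next
  case (Put a i e)
  obtain s1 where 1: "runs P s (poly (timeE e) N) s1" "pc s1 = pc s + lenE e" "used s1 = used s"
    "mem s1 (tmp d) = ev e \<sigma>" "\<And>c. c \<notin> {tmp d..<64} \<Longrightarrow> mem s1 c = mem s c"
    using runs_compileE[of P s e d N \<sigma>] Put.prems by auto
  have sim1: "sim N \<sigma> s1" by (rule sim_temps[OF Put.prems(2)]) (use 1 in auto)
  obtain s2 where 2: "runs P s1 (poly (timeE i) N) s2" "pc s2 = pc s1 + lenE i" "used s2 = used s1"
    "mem s2 (tmp (Suc d)) = ev i \<sigma>" "\<And>c. c \<notin> {tmp (Suc d)..<64} \<Longrightarrow> mem s2 c = mem s1 c"
    using runs_compileE[of P s1 i "Suc d" N \<sigma>] Put.prems sim1 1(2) by auto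
  have d: "Suc d < 31" using Put.prems(4) wfE_depth[of i "Suc d"] by auto
  obtain k where k: "k < N" "ev i \<sigma> = real k" using Put.prems(3) by (auto simp: index_ok_def)
  obtain s3 where 3: "runs P s2 (poly (addr_time a) N) s3" "pc s3 = pc s2 + (a + 6)" "used s3 = used s2"
    "idx s3 = (idx s2)(0 := 64 + a * N + k)" "\<And>c. c \<noteq> tmp (Suc d) \<Longrightarrow> c \<noteq> tmp (Suc (Suc d)) \<Longrightarrow> mem s3 c = mem s2 c"
    using runs_address[of P s2 0 a "Suc d" k N] Put.prems sim1 1 2 k d by (auto simp: sim_def add.assoc)
  let ?s = "exec chol \<omega> (Store 0 (tmp d)) s3"
  have 4: "runs P s3 1 ?s"
    by (rule runs_instr[of _ _ _ "[]"]) (use Put.prems 1 2 3 in \<open>simp add: add.assoc\<close>)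
  have m3: "mem s3 c = mem s c" if "c \<notin> {tmp d..<64}" for c using 1(5) 2(5) 3(5) that d by auto
  have e3: "mem s3 (tmp d) = ev e \<sigma>" using 1(4) 2(5) 3(5) d by auto
  have "sim N (seta a k (ev e \<sigma>) \<sigma>) ?s"
    by (rule sim_seta[OF Put.prems(2) k(1)]) (use m3 e3 1 2 3 in auto)
  then show ?case
    using runs_trans[OF runs_trans[OF runs_trans[OF 1(1) 2(1)] 3(1)] 4] 1(2) 2(2) 3(2,4) m3 k d
    by (intro exI[of _ ?s]) (auto simp: add.assoc)
next
  case (Seq c1 c2)
  obtain s1 where 1: "runs P s (poly (time_com c1) N) s1" "pc s1 = pc s + len c1" "sim N (sem chol \<omega> c1 \<sigma>) s1"
    "\<And>c. 32 \<le> c \<Longrightarrow> c < tmp d \<Longrightarrow> mem s1 c = mem s c"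
    using Seq.IH(1)[of s d \<sigma>] Seq.prems by auto
  obtain s2 where 2: "runs P s1 (poly (time_com c2) N) s2" "pc s2 = pc s1 + len c2"
    "sim N (sem chol \<omega> c2 (sem chol \<omega> c1 \<sigma>)) s2" "\<And>c. 32 \<le> c \<Longrightarrow> c < tmp d \<Longrightarrow> mem s2 c = mem s1 c"
    using Seq.IH(2)[of s1 d "sem chol \<omega> c1 \<sigma>"] Seq.prems 1 by auto
  show ?case using runs_trans[OF 1(1) 2(1)] 1 2 by (intro exI[of _ s2]) auto
next
  case (IfNonneg e c)
  obtain s1 where 1: "runs P s (poly (timeE e) N) s1" "pc s1 = pc s + lenE e" "used s1 = used s"
    "mem s1 (tmp d) = ev e \<sigma>" "\<And>c. c \<notin> {tmp d..<64} \<Longrightarrow> mem s1 c = mem s c"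
    using runs_compileE[of P s e d N \<sigma>] IfNonneg.prems by auto
  have code: "code_at P (pc s1) (Branch (tmp d) (pc s + lenE e + 2) # [Branch ONE (pc s + lenE e + 2 + len c)])"
     "code_at P (Suc (pc s1)) (Branch ONE (pc s + lenE e + 2 + len c) # [])"
     "code_at P (pc s + lenE e + 2) (compile c d (pc s + lenE e + 2))"
    using IfNonneg.prems 1(2) by (auto simp: add.assoc)
  have sim1: "sim N \<sigma> (s1\<lparr>pc := q\<rparr>)" for q by (rule sim_temps[OF IfNonneg.prems(2)]) (use 1 in auto)
  note b1 = runs_branch[OF code(1)]
  show ?case
  proof (cases "0 \<le> ev e \<sigma>")
    case True
    let ?s = "s1\<lparr>pc := pc s + lenE e + 2\<rparr>"
    obtain s2 where 2: "runs P ?s (poly (time_com c) N) s2" "pc s2 = pc s + lenE e + 2 + len c"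
      "sim N (sem chol \<omega> c \<sigma>) s2" "\<And>c. 32 \<le> c \<Longrightarrow> c < tmp d \<Longrightarrow> mem s2 c = mem s1 c"
      using IfNonneg.IH[of ?s d \<sigma>] IfNonneg.prems sim1 code(3) True by auto
    have "runs P s1 1 ?s" using b1 True 1(4) by simp
    from runs_trans[OF runs_trans[OF 1(1) this] 2(1)]
    have "runs P s (poly (timeE e) N + 1 + poly (time_com c) N) s2" .
    then have "runs P s (poly (time_com (IfNonneg e c)) N) s2" by (rule runs_mono) simp
    then show ?thesis using 1 2 True by (intro exI[of _ s2]) auto
  next
    case False
    let ?s = "s1\<lparr>pc := Suc (pc s1)\<rparr>"
    have "runs P s1 1 ?s" using b1 False 1(4) by simp
    moreover have "runs P ?s 1 (?s\<lparr>pc := pc s + lenE e + 2 + len c\<rparr>)"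
      using runs_branch[of P ?s ONE _ "[]"] code(2) sim1[of "Suc (pc s1)"] by (auto simp: sim_def)
    ultimately have "runs P s (poly (timeE e) N + 1 + 1) (s1\<lparr>pc := pc s + lenE e + 2 + len c\<rparr>)"
      using runs_trans[OF runs_trans[OF 1(1)]] by fastforce
    then have "runs P s (poly (time_com (IfNonneg e c)) N) (s1\<lparr>pc := pc s + lenE e + 2 + len c\<rparr>)"
      by (rule runs_mono) simp
    then show ?thesis using 1 False sim1 by (intro exI[of _ "s1\<lparr>pc := pc s + lenE e + 2 + len c\<rparr>"]) auto
  qed
next
  case (For v e c)
  show ?case by (rule runs_For[OF For.IH For.prems])
next
  case (Draw v)
  let ?s = "exec chol \<omega> (Sample v) s"
  have "runs P s 1 ?s" by (rule runs_instr[of _ _ _ "[]"]) (use Draw.prems in simp)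
  then show ?case using Draw.prems by (intro exI[of _ ?s]) (auto simp: sim_def setv_def)
next
  case (Factor v a b)
  show ?case by (rule runs_Factor[OF Factor.prems])
qed

lemma funpow_Incr:
  "(exec chol \<omega> (Incr p) ^^ a) s = s\<lparr>pc := pc s + a, idx := (idx s)(p := idx s p + a)\<rparr>"
proof (induction a)
  case 0
  show ?case by (auto intro!: config.equality)
next
  case (Suc a)
  have "(exec chol \<omega> (Incr p) ^^ Suc a) s = exec chol \<omega> (Incr p) ((exec chol \<omega> (Incr p) ^^ a) s)"
    by (simp only: funpow.simps o_apply)
  also have "\<dots> = s\<lparr>pc := pc s + Suc a, idx := (idx s)(p := idx s p + Suc a)\<rparr>"
    unfolding Suc exec.simps by (auto intro!: config.equality)
  finally show ?case .
qed

lemma fold_stores: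
  assumes "b \<le> idx s 0" "a \<le> b"
  shows "fold (exec chol \<omega>) (concat (map (\<lambda>c. [Store 0 c, Incr 0]) [a..<b])) s =
    s\<lparr>pc := pc s + 2 * (b - a), idx := (idx s)(0 := idx s 0 + (b - a)),
      mem := (\<lambda>x. if idx s 0 \<le> x \<and> x < idx s 0 + (b - a) then mem s (a + (x - idx s 0)) else mem s x)\<rparr>"
  using assms(2,1)
proof (induction b rule: dec_induct)
  case base
  then show ?case by (auto intro!: config.equality)
next
  case (step b)
  then show ?case by (auto intro!: config.equality simp: fun_eq_iff)
qed

lemma fold_loads:
  assumes "m \<le> idx s 0"
  shows "fold (exec chol \<omega>) (concat (map (\<lambda>c. [Load c 0, Incr 0]) [0..<m])) s =
    s\<lparr>pc := pc s + 2 * m, idx := (idx s)(0 := idx s 0 + m),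
      mem := (\<lambda>x. if x < m then mem s (idx s 0 + x) else mem s x)\<rparr>"
  using assms
proof (induction m)
  case 0
  then show ?case by (auto intro!: config.equality)
next
  case (Suc m)
  then show ?case by (auto intro!: config.equality simp: fun_eq_iff less_Suc_eq)
qed

lemma runs_count:
  assumes c: "code_at P l (count_code c0 l)" and n: "0 < n"
  shows "pc s = l \<Longrightarrow> mem s 0 = 1 / real n \<Longrightarrow> mem s 1 = real r / real n \<Longrightarrow>
    \<exists>x. runs P s ((r + 1) * (c0 + 2)) (s\<lparr>pc := l + (c0 + 2), mem := (mem s)(1 := x), idx := (idx s)(0 := idx s 0 + c0 * (r + 1))\<rparr>)"
proof (induction r arbitrary: s)
  case (0 s)
  let ?b = "replicate c0 (Incr 0) @ [Sub 1 1 0]"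
  let ?s = "fold (exec chol \<omega>) ?b s"
  let ?t = "s\<lparr>pc := l + (c0 + 1), mem := (mem s)(1 := - 1 / real n), idx := (idx s)(0 := idx s 0 + c0)\<rparr>"
  have e: "?s = ?t"
    using 0 by (auto simp: funpow_Incr intro!: config.equality)
  have "runs P s (length ?b) ?s \<and> pc ?s = pc s + length ?b"
    by (rule runs_block) (use c 0 in \<open>auto simp: count_code_def\<close>)
  from this[THEN conjunct1] have 1: "runs P s (c0 + 1) ?t" by (rule runs_eqI[OF _ e]) simp
  have "code_at P (pc ?t) (Branch 1 l # [])" using c by (simp add: count_code_def)
  from runs_trans[OF 1 runs_branch[OF this]] show ?case
    by (intro exI[of _ "- 1 / real n"]) (erule runs_eqI; use n in \<open>auto intro!: config.equality\<close>)
next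
  case (Suc r s)
  let ?b = "replicate c0 (Incr 0) @ [Sub 1 1 0]"
  let ?s = "fold (exec chol \<omega>) ?b s"
  let ?t = "s\<lparr>pc := l + (c0 + 1), mem := (mem s)(1 := real r / real n), idx := (idx s)(0 := idx s 0 + c0)\<rparr>"
  have e: "?s = ?t"
    using Suc.prems n by (auto simp: funpow_Incr field_simps intro!: config.equality)
  have "runs P s (length ?b) ?s \<and> pc ?s = pc s + length ?b"
    by (rule runs_block) (use c Suc.prems in \<open>auto simp: count_code_def\<close>)
  from this[THEN conjunct1] have 1: "runs P s (c0 + 1) ?t" by (rule runs_eqI[OF _ e]) simp
  define s1 where "s1 = s\<lparr>mem := (mem s)(1 := real r / real n), idx := (idx s)(0 := idx s 0 + c0)\<rparr>"
  have "code_at P (pc ?t) (Branch 1 l # [])" using c by (simp add: count_code_def)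
  from runs_trans[OF 1 runs_branch[OF this]] have 2: "runs P s (c0 + 2) s1"
    by (rule runs_eqI) (use Suc.prems n in \<open>auto simp: s1_def intro!: config.equality\<close>)
  have s1p: "pc s1 = l" "mem s1 0 = 1 / real n" "mem s1 1 = real r / real n"
    using Suc.prems by (auto simp: s1_def)
  obtain x where 3: "runs P s1 ((r + 1) * (c0 + 2)) (s1\<lparr>pc := l + (c0 + 2), mem := (mem s1)(1 := x), idx := (idx s1)(0 := idx s1 0 + c0 * (r + 1))\<rparr>)"
    using Suc.IH[OF s1p] by blast
  from runs_trans[OF 2 3] show ?case
    by (intro exI[of _ x]) (erule runs_eqI; auto simp: s1_def intro!: config.equality)
qed

lemma runs_copy:
  assumes c: "code_at P h (copy_code h)"
  shows "pc s = h \<Longrightarrow> mem s 4 = real r \<Longrightarrow> mem s ONE = 1 \<Longrightarrow> 64 \<le> idx s 1 \<Longrightarrow> idx s 1 + r \<le> idx s 0 \<Longrightarrow>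
    \<exists>s'. runs P s (8 * r + 3) s' \<and> pc s' = h + 8 \<and> used s' = used s \<and>
      (\<forall>x. x \<noteq> 4 \<longrightarrow> x \<noteq> 5 \<longrightarrow> mem s' x = (if idx s 0 \<le> x \<and> x < idx s 0 + r then mem s (idx s 1 + (x - idx s 0)) else mem s x))"
proof (induction r arbitrary: s)
  case (0 s)
  let ?s1 = "exec chol \<omega> (Sub 4 4 ONE) s"
  have 1: "runs P s 1 ?s1" by (rule runs_instr[of _ _ _ "tl (copy_code h)"]) (use c 0 in \<open>simp add: copy_code_def\<close>)
  have "code_at P (pc ?s1) [Branch 4 (h + 3)]" using c 0 by (simp add: copy_code_def)
  from runs_trans[OF 1 runs_branch[OF this]] have 2: "runs P s 2 (s\<lparr>pc := h + 2, mem := (mem s)(4 := -1)\<rparr>)" (is "runs P s 2 ?s2")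
    by (rule runs_eqI) (use 0 in \<open>auto intro!: config.equality\<close>)
  have "code_at P (pc ?s2) [Branch ONE (h + 8)]" using c by (simp add: copy_code_def)
  from runs_trans[OF 2 runs_branch[OF this]] show ?case using 0
    by (intro exI conjI) (erule runs_eqI[OF _ refl], auto)
next
  case (Suc r s)
  let ?s1 = "exec chol \<omega> (Sub 4 4 ONE) s"
  have 1: "runs P s 1 ?s1" by (rule runs_instr[of _ _ _ "tl (copy_code h)"]) (use c Suc.prems in \<open>simp add: copy_code_def\<close>)
  have "code_at P (pc ?s1) [Branch 4 (h + 3)]" using c Suc.prems by (simp add: copy_code_def)
  from runs_trans[OF 1 runs_branch[OF this]] have 2: "runs P s 2 (s\<lparr>pc := h + 3, mem := (mem s)(4 := real r)\<rparr>)" (is "runs P s 2 ?s2")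
    by (rule runs_eqI) (use Suc.prems in \<open>auto intro!: config.equality\<close>)
  let ?b = "[Load 5 1, Store 0 5, Incr 0, Incr 1]"
  have "runs P ?s2 (length ?b) (fold (exec chol \<omega>) ?b ?s2) \<and> pc (fold (exec chol \<omega>) ?b ?s2) = pc ?s2 + length ?b"
    by (rule runs_block) (use c in \<open>auto simp: copy_code_def eval_nat_numeral\<close>)
  from this[THEN conjunct1] have 3: "runs P ?s2 4 (fold (exec chol \<omega>) ?b ?s2)"
    by (rule runs_eqI[OF _ refl]) simp
  let ?v = "mem s (idx s 1)"
  let ?s3 = "s\<lparr>pc := h + 7, mem := (mem s)(4 := real r, 5 := ?v, idx s 0 := ?v), idx := (idx s)(0 := Suc (idx s 0), 1 := Suc (idx s 1))\<rparr>"
  have e: "fold (exec chol \<omega>) ?b ?s2 = ?s3"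
    using Suc.prems by (auto intro!: config.equality simp: fun_eq_iff)
  have "code_at P (pc ?s3) [Branch ONE h]" using c by (simp add: copy_code_def eval_nat_numeral)
  from runs_trans[OF runs_trans[OF 2 3[unfolded e]] runs_branch[OF this]]
  have 4: "runs P s 7 (?s3\<lparr>pc := h\<rparr>)"
    by (rule runs_eqI) (use Suc.prems in \<open>auto intro!: config.equality\<close>)
  obtain s' where 5: "runs P (?s3\<lparr>pc := h\<rparr>) (8 * r + 3) s'" "pc s' = h + 8" "used s' = used s"
    "\<And>x. x \<noteq> 4 \<Longrightarrow> x \<noteq> 5 \<Longrightarrow> mem s' x = (if Suc (idx s 0) \<le> x \<and> x < Suc (idx s 0) + r
        then mem ?s3 (Suc (idx s 1) + (x - Suc (idx s 0))) else mem ?s3 x)"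
    using Suc.IH[of "?s3\<lparr>pc := h\<rparr>"] Suc.prems by auto
  have "mem s' x = (if idx s 0 \<le> x \<and> x < idx s 0 + Suc r then mem s (idx s 1 + (x - idx s 0)) else mem s x)"
    if "x \<noteq> 4" "x \<noteq> 5" for x
  proof (cases "Suc (idx s 0) \<le> x \<and> x < Suc (idx s 0) + r")
    case True
    then have "Suc (idx s 1) + (x - Suc (idx s 0)) = idx s 1 + (x - idx s 0)" by arith
    moreover have "idx s 1 + (x - idx s 0) < idx s 0" "64 \<le> idx s 1 + (x - idx s 0)" using True Suc.prems by auto
    ultimately show ?thesis using 5(4)[OF that] True by simp
  next
    case False
    then show ?thesis using 5(4)[OF that] that Suc.prems by (cases "x = idx s 0") auto
  qed
  then show ?case using runs_trans[OF 4 5(1)] 5(2,3) by (intro exI[of _ s'] conjI) (erule runs_eqI[OF _ refl], auto)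
qed

lemma runs_prologue:
  assumes c: "code_at P 0 (prologue c0)" and n: "0 < n" and c0: "2 \<le> c0"
    and u: "length u = 2 * n * n + 1" "u ! 0 = real n" and N: "N = c0 * (n * n + 1)"
  shows "\<exists>s. runs P (init_config u) (500 + 10 * N) s \<and> pc s = 272 + c0 \<and> mem s ONE = 1 \<and> mem s NN = real N \<and>
    mem s 2 = real n \<and> used s = 0 \<and> (\<forall>k<2 * n * n. mem s (HEAP + N + k) = u ! Suc k)"
proof -
  let ?b1 = "[Div 0 1 1, Div 0 0 1] @ replicate 64 (Incr 0)"
  let ?b3 = "concat (map (\<lambda>c. [Store 0 c, Incr 0]) [2..<64]) @ replicate 64 (Incr 1) @
      [Const ONE 1, Div 2 ONE 0, Const 3 (real c0), Mul 4 2 2, Add 4 4 ONE, Mul NN 4 3, Mul 4 2 2, Add 4 4 4]"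
  define s0 where "s0 = init_config u"
  have l1: "length ?b1 = 66" by simp
  have l2: "length (count_code c0 66) = c0 + 2" by (simp add: count_code_def)
  have "length (concat (map (\<lambda>c. [Store 0 c, Incr 0]) [2..<64])) = 124"
    by (simp add: length_concat o_def sum_list_triv)
  then have l3: "length ?b3 = 196" by simp
  have e: "0 + 66 + (c0 + 2) = 68 + c0" "68 + c0 + 196 = 264 + c0" "0 + 66 = (66 :: nat)" "66 + (c0 + 2) = 68 + c0" by simp_all
  have code: "code_at P 0 ?b1" "code_at P 66 (count_code c0 66)" "code_at P (68 + c0) ?b3"
    "code_at P (264 + c0) (copy_code (264 + c0))"
    using c[unfolded prologue_def code_at_append[of _ _ ?b1] code_at_append[of _ _ "count_code c0 66"]
      code_at_append[of _ _ ?b3] l1 l2 l3 e] unfolding e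
    by - (elim conjE, assumption)+
  have u1: "mem s0 1 = real n" "pc s0 = 0" "idx s0 = (\<lambda>_. 0)" "used s0 = 0" using u by (auto simp: s0_def init_config_def)
  have uk: "mem s0 (2 + k) = u ! Suc k" if "k < 2 * n * n" for k
    using that u by (auto simp: s0_def init_config_def)
  define s1 where "s1 = fold (exec chol \<omega>) ?b1 s0"
  have c1: "code_at P (pc s0) ?b1" unfolding u1(2) by (rule code(1))
  have st1: "\<forall>x\<in>set ?b1. straight x" by auto
  have r1: "runs P s0 66 s1"
    using runs_block[OF c1 st1] unfolding s1_def l1 by (rule conjunct1)
  have s1: "s1 = s0\<lparr>pc := 66, mem := (mem s0)(0 := 1 / real n), idx := (\<lambda>_. 0)(0 := 64)\<rparr>"
    unfolding s1_def fold_append o_apply fold_replicate funpow_Incr using u1 n by (auto intro!: config.equality)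
  have "mem s1 1 = real (n * n) / real n" using u1 n by (simp add: s1)
  then obtain x where r2: "runs P s1 ((n * n + 1) * (c0 + 2))
      (s1\<lparr>pc := 66 + (c0 + 2), mem := (mem s1)(1 := x), idx := (idx s1)(0 := idx s1 0 + c0 * (n * n + 1))\<rparr>)"
    using runs_count[OF code(2) n, of s1 "n * n"] by (auto simp: s1)
  define s2 where "s2 = s0\<lparr>pc := 68 + c0, mem := (mem s0)(0 := 1 / real n, 1 := x), idx := (\<lambda>_. 0)(0 := 64 + N)\<rparr>"
  have r2: "runs P s1 ((n * n + 1) * (c0 + 2)) s2"
    by (rule runs_eqI[OF r2]) (auto simp: s1 s2_def N intro!: config.equality)
  define s3 where "s3 = fold (exec chol \<omega>) ?b3 s2"
  have pc2: "pc s2 = 68 + c0" by (simp add: s2_def)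
  have c3: "code_at P (pc s2) ?b3" unfolding pc2 by (rule code(3))
  have st3: "\<forall>x\<in>set ?b3. straight x" by auto
  have r3: "runs P s2 196 s3" "pc s3 = 264 + c0"
    using runs_block[OF c3 st3] unfolding s3_def[symmetric] l3 by (simp_all add: s2_def)
  define sA where "sA = fold (exec chol \<omega>) (concat (map (\<lambda>c. [Store 0 c, Incr 0]) [2..<64])) s2"
  have "sA = s2\<lparr>pc := pc s2 + 2 * (64 - 2), idx := (idx s2)(0 := idx s2 0 + (64 - 2)),
      mem := (\<lambda>x. if idx s2 0 \<le> x \<and> x < idx s2 0 + (64 - 2) then mem s2 (2 + (x - idx s2 0)) else mem s2 x)\<rparr>"
    unfolding sA_def by (rule fold_stores) (simp_all add: s2_def)
  moreover have i2: "idx s2 = (\<lambda>_. 0)(0 := 64 + N)" "used s2 = 0" by (simp_all add: s2_def u1)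
  ultimately have sA: "mem sA = (\<lambda>x. if 64 + N \<le> x \<and> x < 64 + N + 62 then mem s2 (2 + (x - (64 + N))) else mem s2 x)"
    "idx sA = (\<lambda>_. 0)(0 := 126 + N)" "used sA = 0"
    by (simp_all add: i2 cong: if_cong)
  have s3: "s3 = fold (exec chol \<omega>) [Const ONE 1, Div 2 ONE 0, Const 3 (real c0), Mul 4 2 2, Add 4 4 ONE, Mul NN 4 3, Mul 4 2 2, Add 4 4 4]
      ((exec chol \<omega> (Incr 1) ^^ 64) sA)"
    unfolding s3_def sA_def fold_append o_apply fold_replicate ..
  have m0: "mem sA 0 = 1 / real n" by (simp add: sA s2_def)
  have m3: "mem s3 ONE = 1" "mem s3 NN = real N" "mem s3 2 = real n" "mem s3 4 = real (2 * n * n)" "used s3 = 0"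
     "idx s3 0 = 126 + N" "idx s3 1 = 64"
    unfolding s3 funpow_Incr using m0 by (simp_all add: sA N algebra_simps)
  have m3': "mem s3 x = mem sA x" if "64 \<le> x" for x
    unfolding s3 funpow_Incr using that by simp
  have nN: "2 * n * n \<le> N"
  proof -
    have "2 * (n * n) \<le> c0 * (n * n + 1)" using c0 by (intro mult_le_mono) auto
    then show ?thesis by (simp add: N)
  qed
  obtain s4 where r4: "runs P s3 (8 * (2 * n * n) + 3) s4" "pc s4 = 264 + c0 + 8" "used s4 = used s3"
    and m4: "\<And>x. x \<noteq> 4 \<Longrightarrow> x \<noteq> 5 \<Longrightarrow> mem s4 x = (if idx s3 0 \<le> x \<and> x < idx s3 0 + 2 * n * n then mem s3 (idx s3 1 + (x - idx s3 0)) else mem s3 x)"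
    using runs_copy[OF code(4) r3(2) m3(4,1)] m3(6,7) nN by auto
  have "mem s4 (HEAP + N + k) = u ! Suc k" if k: "k < 2 * n * n" for k
  proof (cases "k < 62")
    case True
    then have "mem s4 (HEAP + N + k) = mem s3 (HEAP + N + k)" using m3(6) by (subst m4) auto
    also have "\<dots> = mem s2 (2 + k)" using True by (subst m3') (auto simp: sA)
    also have "\<dots> = mem s0 (2 + k)" by (simp add: s2_def)
    finally show ?thesis using uk[OF k] by simp
  next
    case False
    then have "mem s4 (HEAP + N + k) = mem s3 (2 + k)" using m3(6,7) k by (subst m4) auto
    also have "\<dots> = mem s2 (2 + k)" using False k nN by (subst m3') (auto simp: sA)
    also have "\<dots> = mem s0 (2 + k)" by (simp add: s2_def)
    finally show ?thesis using uk[OF k] by simp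
  qed
  moreover have "runs P s0 (500 + 10 * N) s4"
  proof (rule runs_mono[OF runs_trans[OF runs_trans[OF runs_trans[OF r1 r2] r3(1)] r4(1)]])
    have "2 * (n * n + 1) \<le> N" unfolding N using c0 by (rule mult_le_mono1)
    then show "66 + (n * n + 1) * (c0 + 2) + 196 + (8 * (2 * n * n) + 3) \<le> 500 + 10 * N"
      by (simp add: N algebra_simps)
  qed
  ultimately show ?thesis
    using r4 m4[of ONE] m4[of NN] m4[of 2] m3 unfolding s0_def[symmetric] by (intro exI[of _ s4]) auto
qed

lemma runs_epilogue:
  assumes c: "code_at P (pc s) (epilogue a (pc s))" and s: "sim N \<sigma> s" and N: "64 \<le> N"
  shows "\<exists>s'. runs P s (200 + poly (addr_time a) N) s' \<and> pc s' = pc s + (a + 135) \<and>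
    (\<forall>c<64. mem s' c = arr \<sigma> a c) \<and> (\<forall>j<N. mem s' (64 + j) = arr \<sigma> 0 j)"
proof -
  let ?b = "concat (map (\<lambda>c. [Load c 0, Incr 0]) [0..<64])"
  have lb: "length ?b = 128" by (simp add: length_concat o_def sum_list_triv)
  have code: "code_at P (pc s) [Const 32 0]" "code_at P (pc s + 1) (address 0 a 0 (pc s + 1))" "code_at P (pc s + 1 + (a + 6)) ?b"
    using c[unfolded epilogue_def code_at_append length_address length_one] by - (elim conjE, assumption)+
  let ?s1 = "exec chol \<omega> (Const 32 0) s"
  have r1: "runs P s 1 ?s1" by (rule runs_instr[OF code(1)])
  have ps: "pc ?s1 = pc s + 1" by simp
  have m1: "mem ?s1 (tmp 0) = real 0" "mem ?s1 ONE = 1" "mem ?s1 NN = real N" "0 < N" "(0 :: nat) < 31"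
    using s N by (auto simp: sim_def)
  obtain s2 where 2: "runs P ?s1 (poly (addr_time a) N) s2" "pc s2 = pc ?s1 + (a + 6)"
    "idx s2 = (idx ?s1)(0 := 64 + a * N + 0)" "\<And>c. c \<noteq> tmp 0 \<Longrightarrow> c \<noteq> tmp (Suc 0) \<Longrightarrow> mem s2 c = mem ?s1 c"
    using runs_address[OF code(2)[folded ps] m1(5,1-4)] by blast
  have ps2: "pc s2 = pc s + 1 + (a + 6)" using 2(2) by simp
  have "\<forall>x\<in>set ?b. straight x" by auto
  then have r3: "runs P s2 128 (fold (exec chol \<omega>) ?b s2)"
    using runs_block[OF code(3)[folded ps2]] unfolding lb by blast
  have i2: "idx s2 0 = 64 + a * N" using 2(3) by simp
  have s3: "fold (exec chol \<omega>) ?b s2 = s2\<lparr>pc := pc s2 + 2 * 64, idx := (idx s2)(0 := idx s2 0 + 64),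
      mem := (\<lambda>x. if x < 64 then mem s2 (idx s2 0 + x) else mem s2 x)\<rparr>"
    by (rule fold_loads) (simp add: i2)
  have m: "mem s2 x = mem s x" if "64 \<le> x" for x using 2(4)[of x] that by simp
  have "mem s2 (idx s2 0 + x) = arr \<sigma> a x" if "x < 64" for x
    using s N that m[of "64 + a * N + x"] unfolding i2 sim_def by auto
  moreover have "mem s2 (64 + j) = arr \<sigma> 0 j" if "j < N" for j
  proof -
    have "mem s (HEAP + 0 * N + j) = arr \<sigma> 0 j" using s that unfolding sim_def by blast
    then show ?thesis using m[of "64 + j"] by simp
  qed
  moreover have "runs P s (200 + poly (addr_time a) N) (fold (exec chol \<omega>) ?b s2)"
    by (rule runs_mono[OF runs_trans[OF runs_trans[OF r1 2(1)] r3]]) simp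
  ultimately show ?thesis using ps2 by (intro exI[of _ "fold (exec chol \<omega>) ?b s2"]) (auto simp: s3)
qed

end

definition whole_program :: "nat \<Rightarrow> com \<Rightarrow> nat \<Rightarrow> program" where
  "whole_program c0 c a = prologue c0 @ compile c 0 (272 + c0) @ epilogue a (272 + c0 + len c)"

definition whole_time :: "com \<Rightarrow> nat \<Rightarrow> nat poly" where
  "whole_time c a = [:700, 10:] + time_com c + addr_time a"

lemma length_prologue: "length (prologue c0) = 272 + c0"
proof -
  have "length (concat (map (\<lambda>c. [Store 0 c, Incr 0]) [2..<64])) = 124"
    by (simp add: length_concat o_def sum_list_triv)
  then show ?thesis by (simp add: prologue_def count_code_def copy_code_def)
qed

lemma length_epilogue: "length (epilogue a l) = a + 135"
proof -
  have "length (concat (map (\<lambda>c. [Load c 0, Incr 0]) [0..<64])) = 128"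
    by (simp add: length_concat o_def sum_list_triv)
  then show ?thesis by (simp add: epilogue_def)
qed

lemma used_exec: "used s \<le> used (exec chol \<omega> x s)"
  by (cases x) auto

lemma used_funpow: "used s \<le> used ((step chol \<omega> P ^^ t) s)"
proof (induction t)
  case (Suc t)
  have "used s' \<le> used (step chol \<omega> P s')" for s' by (simp add: step_def used_exec)
  then show ?case using Suc by (simp add: le_trans)
qed simp

lemma run_independent:
  assumes "used ((step chol \<omega> P ^^ t) s) = used s"
  shows "(step chol \<omega>' P ^^ t) s = (step chol \<omega> P ^^ t) s"
  using assms
proof (induction t)
  case (Suc t)
  let ?s = "(step chol \<omega> P ^^ t) s"
  have s: "(step chol \<omega> P ^^ Suc t) s = step chol \<omega> P ?s" by simp
  have 1: "used s \<le> used ?s" by (rule used_funpow)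
  have 2: "used ?s \<le> used (step chol \<omega> P ?s)" by (simp add: step_def used_exec)
  have u: "used ?s = used s" "used (step chol \<omega> P ?s) = used ?s" using 1 2 Suc.prems[unfolded s] by simp_all
  have "step chol \<omega>' P ?s = step chol \<omega> P ?s"
  proof (cases "halted P ?s")
    case False
    then show ?thesis using u(2) by (cases "P ! pc ?s") (auto simp: step_def)
  qed (simp add: step_def)
  then show ?case using Suc.IH[OF u(1)] by simp
qed simp

text \<open>The initial store does not depend on the random sequence because the prologue draws no sample.\<close>

lemma whole_program_correct:
  assumes wf: "wf_com c 0" and n: "0 < n" and c0: "64 \<le> c0"
    and u: "length u = 2 * n * n + 1" "u ! 0 = real n" and N: "N = c0 * (n * n + 1)"
  shows "\<exists>\<sigma>. vars \<sigma> 2 = real n \<and> (\<forall>k<2 * n * n. arr \<sigma> 1 k = u ! Suc k) \<and> cnt \<sigma> = 0 \<and>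
    (\<forall>\<omega>. ok chol \<omega> N c \<sigma> \<longrightarrow> (\<exists>t s. t \<le> poly (whole_time c a) N \<and> run chol \<omega> (whole_program c0 c a) u t = s \<and>
      halted (whole_program c0 c a) s \<and> (\<forall>j<64. mem s j = arr (sem chol \<omega> c \<sigma>) a j) \<and>
      (\<forall>j<N. mem s (64 + j) = arr (sem chol \<omega> c \<sigma>) 0 j)))"
proof -
  interpret m0: machine chol "\<lambda>_. 0" .
  let ?P = "whole_program c0 c a"
  have code: "code_at ?P 0 (prologue c0)" "code_at ?P (272 + c0) (compile c 0 (272 + c0))"
     "code_at ?P (272 + c0 + len c) (epilogue a (272 + c0 + len c))"
    using code_at_middle[of "[]" "prologue c0"]
      code_at_middle[of "prologue c0" "compile c 0 (272 + c0)" "epilogue a (272 + c0 + len c)"]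
      code_at_middle[of "prologue c0 @ compile c 0 (272 + c0)" "epilogue a (272 + c0 + len c)" "[]"]
    by (simp_all add: whole_program_def length_prologue add.assoc)
  obtain s1 where 1: "m0.runs ?P (init_config u) (500 + 10 * N) s1" "pc s1 = 272 + c0" "mem s1 ONE = 1" "mem s1 NN = real N"
    "mem s1 2 = real n" "used s1 = 0" "\<And>k. k < 2 * n * n \<Longrightarrow> mem s1 (HEAP + N + k) = u ! Suc k"
    using m0.runs_prologue[OF code(1) n _ u N] c0 by auto
  define \<sigma> where "\<sigma> = \<lparr>vars = mem s1, arr = (\<lambda>a k. mem s1 (HEAP + a * N + k)), cnt = 0\<rparr>"
  have N64: "64 \<le> N" using c0 unfolding N using mult_le_mono2[of 1 "n * n + 1" c0] by simp
  have "\<exists>t s. t \<le> poly (whole_time c a) N \<and> run chol \<omega> ?P u t = s \<and>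
      halted ?P s \<and> (\<forall>j<64. mem s j = arr (sem chol \<omega> c \<sigma>) a j) \<and>
      (\<forall>j<N. mem s (64 + j) = arr (sem chol \<omega> c \<sigma>) 0 j)" if okc: "ok chol \<omega> N c \<sigma>" for \<omega>
  proof -
    interpret machine chol \<omega> .
    obtain t1 where t1: "t1 \<le> 500 + 10 * N" "(step chol (\<lambda>_. 0) ?P ^^ t1) (init_config u) = s1"
      using 1(1) by (auto simp: m0.runs_def)
    have "(step chol \<omega> ?P ^^ t1) (init_config u) = s1"
      using run_independent[where chol=chol and \<omega>="\<lambda>_. 0" and P="?P" and t=t1 and s="init_config u" and \<omega>'=\<omega>] t1(2) 1(6) by (simp add: init_config_def)
    then have r1: "runs ?P (init_config u) (500 + 10 * N) s1" using t1(1) by (auto simp: runs_def)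
    have sim1: "sim N \<sigma> s1" using 1 by (simp add: sim_def \<sigma>_def)
    obtain s2 where 2: "runs ?P s1 (poly (time_com c) N) s2" "pc s2 = pc s1 + len c" "sim N (sem chol \<omega> c \<sigma>) s2"
      using runs_compile[OF code(2)[folded 1(2)] sim1 okc wf] by blast
    have ps2: "pc s2 = 272 + c0 + len c" using 1(2) 2(2) by simp
    obtain s3 where 3: "runs ?P s2 (200 + poly (addr_time a) N) s3" "pc s3 = pc s2 + (a + 135)"
      "\<And>c'. c' < 64 \<Longrightarrow> mem s3 c' = arr (sem chol \<omega> c \<sigma>) a c'" "\<And>j. j < N \<Longrightarrow> mem s3 (64 + j) = arr (sem chol \<omega> c \<sigma>) 0 j"
      using runs_epilogue[OF code(3)[folded ps2] 2(3) N64] by blast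
    have "runs ?P (init_config u) (poly (whole_time c a) N) s3"
      by (rule runs_mono[OF runs_trans[OF runs_trans[OF r1 2(1)] 3(1)]]) (simp add: whole_time_def)
    then obtain t where "t \<le> poly (whole_time c a) N" "run chol \<omega> ?P u t = s3"
      by (auto simp: runs_def run_def)
    moreover have "halted ?P s3"
      using 3(2) ps2 by (simp add: halted_def whole_program_def length_prologue length_epilogue)
    ultimately show ?thesis using 3(3,4) by blast
  qed
  then show ?thesis using 1 by (intro exI[of _ \<sigma>]) (auto simp: \<sigma>_def)
qed

primrec draw_free :: "com \<Rightarrow> bool" where
  "draw_free (Assign v e) = True"
| "draw_free (Put a i e) = True"
| "draw_free (Seq c1 c2) = (draw_free c1 \<and> draw_free c2)"
| "draw_free (IfNonneg e c) = draw_free c"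
| "draw_free (For v e c) = draw_free c"
| "draw_free (Draw v) = False"
| "draw_free (Factor v a b) = True"

lemma sem_draw_free: "draw_free c \<Longrightarrow> sem chol \<omega> c = sem chol \<omega>' c"
  by (induction c) (simp_all add: fun_eq_iff cong: if_cong)

lemma run_halted_mono:
  assumes "halted P (run chol \<omega> P u t)" "t \<le> t'"
  shows "run chol \<omega> P u t' = run chol \<omega> P u t"
proof -
  have "(step chol \<omega> P ^^ d) s = s" if "halted P s" for d s
    using that by (induction d) (auto simp: step_def)
  moreover have "run chol \<omega> P u t' = (step chol \<omega> P ^^ (t' - t)) (run chol \<omega> P u t)"
  proof -
    have "run chol \<omega> P u t' = (step chol \<omega> P ^^ ((t' - t) + t)) (init_config u)"
      using assms(2) by (simp add: run_def)
    then show ?thesis unfolding funpow_add o_apply run_def .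
  qed
  ultimately show ?thesis using assms(1) by simp
qed

lemma poly_nat_mono: "x \<le> y \<Longrightarrow> poly (p :: nat poly) x \<le> poly p y"
  by (induction p) (simp_all add: mult_le_mono)

lemma store_upd [simp]:
  "vars (setv v r \<sigma>) = (vars \<sigma>)(v := r)" "arr (setv v r \<sigma>) = arr \<sigma>" "cnt (setv v r \<sigma>) = cnt \<sigma>"
  "vars (seta a k r \<sigma>) = vars \<sigma>" "arr (seta a k r \<sigma>) = (arr \<sigma>)(a := (arr \<sigma> a)(k := r))" "cnt (seta a k r \<sigma>) = cnt \<sigma>"
  by (simp_all add: setv_def seta_def)

definition agree :: "nat set \<Rightarrow> nat set \<Rightarrow> store \<Rightarrow> store \<Rightarrow> bool" where
  "agree V A \<sigma> \<tau> \<longleftrightarrow> (\<forall>v. v \<notin> V \<longrightarrow> vars \<tau> v = vars \<sigma> v) \<and> (\<forall>a. a \<notin> A \<longrightarrow> arr \<tau> a = arr \<sigma> a) \<and> cnt \<tau> = cnt \<sigma>"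

lemma agree_refl [simp]: "agree V A \<sigma> \<sigma>"
  by (simp add: agree_def)

lemma agreeD:
  assumes "agree V A \<sigma> \<tau>"
  shows "v \<notin> V \<Longrightarrow> vars \<tau> v = vars \<sigma> v" "a \<notin> A \<Longrightarrow> arr \<tau> a = arr \<sigma> a" "cnt \<tau> = cnt \<sigma>"
  using assms by (auto simp: agree_def)

lemma agree_trans: "agree V A \<sigma> \<tau> \<Longrightarrow> agree V' A' \<tau> \<upsilon> \<Longrightarrow> agree (V \<union> V') (A \<union> A') \<sigma> \<upsilon>"
  by (auto simp: agree_def)

lemma agree_setv: "agree V A \<sigma> \<tau> \<Longrightarrow> v \<in> V \<Longrightarrow> agree V A \<sigma> (setv v r \<tau>)"
  by (auto simp: agree_def)

lemma agree_seta: "agree V A \<sigma> \<tau> \<Longrightarrow> a \<in> A \<Longrightarrow> agree V A \<sigma> (seta a k r \<tau>)"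
  by (auto simp: agree_def)

lemma index_ok_real [simp]: "index_ok N (real k) \<longleftrightarrow> k < N"
  by (auto simp: index_ok_def)

context
  fixes chol :: "real mat \<Rightarrow> real mat" and \<omega> :: "nat \<Rightarrow> real" and N :: nat
begin

definition spec :: "com \<Rightarrow> store \<Rightarrow> (store \<Rightarrow> bool) \<Rightarrow> bool" where
  "spec c \<sigma> Q \<longleftrightarrow> ok chol \<omega> N c \<sigma> \<and> Q (sem chol \<omega> c \<sigma>)"

lemma spec_Seq: "spec c1 \<sigma> (\<lambda>\<tau>. spec c2 \<tau> Q) \<Longrightarrow> spec (c1 ;; c2) \<sigma> Q"
  by (simp add: spec_def)

lemma spec_Assign: "okE N e \<sigma> \<Longrightarrow> Q (setv v (ev e \<sigma>) \<sigma>) \<Longrightarrow> spec (Assign v e) \<sigma> Q"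
  by (simp add: spec_def)

lemma spec_Put:
  "okE N i \<sigma> \<Longrightarrow> okE N e \<sigma> \<Longrightarrow> ev i \<sigma> = real k \<Longrightarrow> k < N \<Longrightarrow> Q (seta a k (ev e \<sigma>) \<sigma>) \<Longrightarrow> spec (Put a i e) \<sigma> Q"
  by (simp add: spec_def)

lemma spec_If:
  "okE N e \<sigma> \<Longrightarrow> (0 \<le> ev e \<sigma> \<Longrightarrow> spec c \<sigma> Q) \<Longrightarrow> (\<not> 0 \<le> ev e \<sigma> \<Longrightarrow> Q \<sigma>) \<Longrightarrow> spec (IfNonneg e c) \<sigma> Q"
  by (simp add: spec_def)

lemma spec_For:
  assumes e: "okE N e \<sigma>" "ev e \<sigma> = real m" "m < N" and I0: "I 0 \<sigma>"
    and step: "\<And>i \<tau>. i < m \<Longrightarrow> I i \<tau> \<Longrightarrow> spec c (setv v (real i) \<tau>) (I (Suc i))"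
    and Q: "\<And>\<tau>. I m \<tau> \<Longrightarrow> Q \<tau>"
  shows "spec (For v e c) \<sigma> Q"
proof -
  let ?f = "\<lambda>i \<tau>. sem chol \<omega> c (setv v (real i) \<tau>)"
  have I: "I i (fold ?f [0..<i] \<sigma>)" if "i \<le> m" for i
    using that
  proof (induction i)
    case 0
    then show ?case by (simp add: I0)
  next
    case (Suc i)
    then show ?case using step[of i] by (simp add: spec_def)
  qed
  have "ok chol \<omega> N c (setv v (real i) (fold ?f [0..<i] \<sigma>))" if "i < m" for i
    using step[OF that I] that by (simp add: spec_def)
  then show ?thesis using e I[of m] Q by (simp add: spec_def)
qed

text \<open>The matrix loops below all run over the square index set, the entry \<open>(i, j)\<close> of an array living at
  \<open>off + (n * i + j)\<close>.\<close>

lemma index_less: "i < n \<Longrightarrow> j < n \<Longrightarrow> n * i + j < n * (n :: nat)"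
proof -
  assume "i < n" "j < n"
  then have "n * i + j < n * Suc i" by simp
  also have "\<dots> \<le> n * n" using \<open>i < n\<close> by (intro mult_le_mono2) simp
  finally show ?thesis .
qed

lemma index_inj: "j < n \<Longrightarrow> b < n \<Longrightarrow> n * i + j = n * a + (b :: nat) \<longleftrightarrow> i = a \<and> j = b"
  using heap_injective[of j n b i a] by (auto simp: mult.commute)

lemma spec_fill:
  fixes off :: nat
  assumes n: "vars \<sigma> 2 = real n" "n < N" "off + n \<le> N" and v: "v \<noteq> 2"
    and addr: "\<And>\<tau> i. agree {v} {A} \<sigma> \<tau> \<Longrightarrow> vars \<tau> v = real i \<Longrightarrow> i < n \<Longrightarrow> okE N p \<tau> \<and> ev p \<tau> = real (off + i)"
    and val: "\<And>\<tau> i. agree {v} {A} \<sigma> \<tau> \<Longrightarrow> vars \<tau> v = real i \<Longrightarrow> i < n \<Longrightarrow> okE N e \<tau> \<and> ev e \<tau> = F i"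
    and Q: "\<And>\<tau>. agree {v} {A} \<sigma> \<tau> \<Longrightarrow> (\<And>i. i < n \<Longrightarrow> arr \<tau> A (off + i) = F i) \<Longrightarrow>
       (\<And>k. k < off \<or> off + n \<le> k \<Longrightarrow> arr \<tau> A k = arr \<sigma> A k) \<Longrightarrow> Q \<tau>"
  shows "spec (For v (Var 2) (Put A p e)) \<sigma> Q"
proof (rule spec_For[where m=n and I="\<lambda>i \<tau>. agree {v} {A} \<sigma> \<tau> \<and> (\<forall>j<i. arr \<tau> A (off + j) = F j) \<and>
    (\<forall>k. k < off \<or> off + n \<le> k \<longrightarrow> arr \<tau> A k = arr \<sigma> A k)"])
  fix i \<tau>
  assume i: "i < n" and I: "agree {v} {A} \<sigma> \<tau> \<and> (\<forall>j<i. arr \<tau> A (off + j) = F j) \<and>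
    (\<forall>k. k < off \<or> off + n \<le> k \<longrightarrow> arr \<tau> A k = arr \<sigma> A k)"
  let ?t = "setv v (real i) \<tau>"
  have a: "agree {v} {A} \<sigma> ?t" using I by (auto intro: agree_setv)
  have p: "okE N p ?t" "ev p ?t = real (off + i)" using addr[OF a, of i] i by auto
  have e: "okE N e ?t" "ev e ?t = F i" using val[OF a, of i] i by auto
  show "spec (Put A p e) ?t (\<lambda>\<tau>. agree {v} {A} \<sigma> \<tau> \<and> (\<forall>j<Suc i. arr \<tau> A (off + j) = F j) \<and>
    (\<forall>k. k < off \<or> off + n \<le> k \<longrightarrow> arr \<tau> A k = arr \<sigma> A k))"
  proof (rule spec_Put[OF p(1) e(1) p(2)])
    show "off + i < N" using n i by linarith
    have "agree {v} {A} \<sigma> (seta A (off + i) (F i) ?t)" using a by (rule agree_seta) simp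
    then show "agree {v} {A} \<sigma> (seta A (off + i) (ev e ?t) ?t) \<and>
       (\<forall>j<Suc i. arr (seta A (off + i) (ev e ?t) ?t) A (off + j) = F j) \<and>
       (\<forall>k. k < off \<or> off + n \<le> k \<longrightarrow> arr (seta A (off + i) (ev e ?t) ?t) A k = arr \<sigma> A k)"
      using I i unfolding e(2) by (auto simp: less_Suc_eq)
  qed
qed (use n Q in auto)

lemma spec_fill_matrix:
  fixes off :: nat
  assumes n: "vars \<sigma> 2 = real n" "n < N" "off + n * n \<le> N" and v: "v \<noteq> 2" "v' \<noteq> 2" "v \<noteq> v'"
    and addr: "\<And>\<tau> i j. agree {v, v'} {A} \<sigma> \<tau> \<Longrightarrow> vars \<tau> v = real i \<Longrightarrow> vars \<tau> v' = real j \<Longrightarrow> i < n \<Longrightarrow> j < n \<Longrightarrow>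
       okE N p \<tau> \<and> ev p \<tau> = real (off + (n * i + j))"
    and val: "\<And>\<tau> i j. agree {v, v'} {A} \<sigma> \<tau> \<Longrightarrow> vars \<tau> v = real i \<Longrightarrow> vars \<tau> v' = real j \<Longrightarrow> i < n \<Longrightarrow> j < n \<Longrightarrow>
       arr \<tau> A (off + (n * i + j)) = arr \<sigma> A (off + (n * i + j)) \<Longrightarrow> okE N e \<tau> \<and> ev e \<tau> = F i j"
    and Q: "\<And>\<tau>. agree {v, v'} {A} \<sigma> \<tau> \<Longrightarrow> (\<And>i j. i < n \<Longrightarrow> j < n \<Longrightarrow> arr \<tau> A (off + (n * i + j)) = F i j) \<Longrightarrow>
       (\<And>k. k < off \<or> off + n * n \<le> k \<Longrightarrow> arr \<tau> A k = arr \<sigma> A k) \<Longrightarrow> Q \<tau>"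
  shows "spec (For v (Var 2) (For v' (Var 2) (Put A p e))) \<sigma> Q"
proof -
  define I where "I i j \<tau> \<longleftrightarrow> agree {v, v'} {A} \<sigma> \<tau> \<and>
    (\<forall>a<n. \<forall>b<n. arr \<tau> A (off + (n * a + b)) = (if a < i \<or> a = i \<and> b < j then F a b else arr \<sigma> A (off + (n * a + b)))) \<and>
    (\<forall>k. k < off \<or> off + n * n \<le> k \<longrightarrow> arr \<tau> A k = arr \<sigma> A k)" for i j :: nat and \<tau>
  show ?thesis
  proof (rule spec_For[where m=n and I="\<lambda>i. I i 0"])
    fix i \<tau> assume i: "i < n" and Ii: "I i 0 \<tau>"
    show "spec (For v' (Var 2) (Put A p e)) (setv v (real i) \<tau>) (I (Suc i) 0)"
    proof (rule spec_For[where m=n and I="\<lambda>j \<tau>. I i j \<tau> \<and> vars \<tau> v = real i"])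
      fix j \<tau>' assume j: "j < n" and Ij: "I i j \<tau>' \<and> vars \<tau>' v = real i"
      let ?t = "setv v' (real j) \<tau>'"
      have a: "agree {v, v'} {A} \<sigma> ?t" using Ij by (auto simp: I_def intro: agree_setv)
      have vt: "vars ?t v = real i" "vars ?t v' = real j" using Ij v by auto
      have old: "arr ?t A (off + (n * i + j)) = arr \<sigma> A (off + (n * i + j))" using Ij i j by (simp add: I_def)
      note p = addr[OF a vt i j] and e = val[OF a vt i j old]
      show "spec (Put A p e) ?t (\<lambda>\<tau>. I i (Suc j) \<tau> \<and> vars \<tau> v = real i)"
      proof (rule spec_Put)
        show "off + (n * i + j) < N" using n index_less[OF i j] by linarith
        have "agree {v, v'} {A} \<sigma> (seta A (off + (n * i + j)) (F i j) ?t)" using a by (rule agree_seta) simp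
        moreover have "off + (n * i + j) < off + n * n" using index_less[OF i j] by simp
        ultimately show "I i (Suc j) (seta A (off + (n * i + j)) (ev e ?t) ?t) \<and>
            vars (seta A (off + (n * i + j)) (ev e ?t) ?t) v = real i"
          using Ij i j e vt unfolding I_def by (auto simp: index_inj less_Suc_eq)
      qed (use p e in auto)
    next
      show "I i 0 (setv v (real i) \<tau>) \<and> vars (setv v (real i) \<tau>) v = real i"
        using Ii by (auto simp: I_def intro: agree_setv)
      show "ev (Var 2) (setv v (real i) \<tau>) = real n" using Ii v n by (auto simp: I_def agree_def)
      show "I (Suc i) 0 \<tau>'" if "I i n \<tau>' \<and> vars \<tau>' v = real i" for \<tau>'
        using that by (auto simp: I_def less_Suc_eq)
    qed (use n in auto)
  next
    show "Q \<tau>" if "I n 0 \<tau>" for \<tau> using that by (intro Q) (auto simp: I_def)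
  qed (use n in \<open>auto simp: I_def\<close>)
qed

lemma spec_sum:
  assumes n: "vars \<sigma> 2 = real n" "n < N" and v: "v \<noteq> 2" "acc \<noteq> 2" "v \<noteq> acc"
    and val: "\<And>\<tau> i. agree {v, acc} {} \<sigma> \<tau> \<Longrightarrow> vars \<tau> v = real i \<Longrightarrow> i < n \<Longrightarrow> okE N e \<tau> \<and> ev e \<tau> = F i"
    and Q: "\<And>\<tau>. agree {v, acc} {} \<sigma> \<tau> \<Longrightarrow> vars \<tau> acc = vars \<sigma> acc + (\<Sum>i<n. F i) \<Longrightarrow> Q \<tau>"
  shows "spec (For v (Var 2) (Assign acc (Bin Plus (Var acc) e))) \<sigma> Q"
proof (rule spec_For[where m=n and I="\<lambda>i \<tau>. agree {v, acc} {} \<sigma> \<tau> \<and> vars \<tau> acc = vars \<sigma> acc + (\<Sum>j<i. F j)"])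
  fix i \<tau> assume i: "i < n" and I: "agree {v, acc} {} \<sigma> \<tau> \<and> vars \<tau> acc = vars \<sigma> acc + (\<Sum>j<i. F j)"
  have a: "agree {v, acc} {} \<sigma> (setv v (real i) \<tau>)" using I by (auto intro: agree_setv)
  have e: "okE N e (setv v (real i) \<tau>)" "ev e (setv v (real i) \<tau>) = F i" using val[OF a, of i] i by auto
  show "spec (Assign acc (Bin Plus (Var acc) e)) (setv v (real i) \<tau>)
    (\<lambda>\<tau>. agree {v, acc} {} \<sigma> \<tau> \<and> vars \<tau> acc = vars \<sigma> acc + (\<Sum>j<Suc i. F j))"
    by (rule spec_Assign) (use a e I v in \<open>auto intro: agree_setv\<close>)
qed (use n Q in auto)

lemma spec_sum_matrix:
  assumes n: "vars \<sigma> 2 = real n" "n < N" and v: "v \<noteq> 2" "v' \<noteq> 2" "acc \<noteq> 2" "v \<noteq> acc" "v' \<noteq> acc" "v \<noteq> v'"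
    and val: "\<And>\<tau> i j. agree {v, v', acc} {} \<sigma> \<tau> \<Longrightarrow> vars \<tau> v = real i \<Longrightarrow> vars \<tau> v' = real j \<Longrightarrow> i < n \<Longrightarrow> j < n \<Longrightarrow>
      okE N e \<tau> \<and> ev e \<tau> = F i j"
    and Q: "\<And>\<tau>. agree {v, v', acc} {} \<sigma> \<tau> \<Longrightarrow> vars \<tau> acc = vars \<sigma> acc + (\<Sum>i<n. \<Sum>j<n. F i j) \<Longrightarrow> Q \<tau>"
  shows "spec (For v (Var 2) (For v' (Var 2) (Assign acc (Bin Plus (Var acc) e)))) \<sigma> Q"
proof (rule spec_For[where m=n and I="\<lambda>i \<tau>. agree {v, v', acc} {} \<sigma> \<tau> \<and> vars \<tau> acc = vars \<sigma> acc + (\<Sum>a<i. \<Sum>j<n. F a j)"])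
  fix i \<tau> assume i: "i < n" and I: "agree {v, v', acc} {} \<sigma> \<tau> \<and> vars \<tau> acc = vars \<sigma> acc + (\<Sum>a<i. \<Sum>j<n. F a j)"
  let ?t = "setv v (real i) \<tau>"
  have a: "agree {v, v', acc} {} \<sigma> ?t" using I by (auto intro: agree_setv)
  have t: "vars ?t v = real i" "vars ?t acc = vars \<tau> acc" using v by auto
  show "spec (For v' (Var 2) (Assign acc (Bin Plus (Var acc) e))) ?t
    (\<lambda>\<tau>. agree {v, v', acc} {} \<sigma> \<tau> \<and> vars \<tau> acc = vars \<sigma> acc + (\<Sum>a<Suc i. \<Sum>j<n. F a j))"
  proof (rule spec_sum[where n=n and F="F i"])
    show "vars ?t 2 = real n" using agreeD(1)[OF a, of 2] v n by simp
    show "okE N e \<upsilon> \<and> ev e \<upsilon> = F i j" if "agree {v', acc} {} ?t \<upsilon>" "vars \<upsilon> v' = real j" "j < n" for \<upsilon> j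
    proof (rule val)
      show "agree {v, v', acc} {} \<sigma> \<upsilon>" using agree_trans[OF a that(1)] by (simp add: insert_commute)
      show "vars \<upsilon> v = real i" using agreeD(1)[OF that(1), of v] v t by simp
    qed (use that i in auto)
    show "agree {v, v', acc} {} \<sigma> \<upsilon> \<and> vars \<upsilon> acc = vars \<sigma> acc + (\<Sum>a<Suc i. \<Sum>j<n. F a j)"
      if "agree {v', acc} {} ?t \<upsilon>" "vars \<upsilon> acc = vars ?t acc + (\<Sum>j<n. F i j)" for \<upsilon>
      using agree_trans[OF a that(1)] that(2) t I by (simp add: insert_commute)
  qed (use n v in auto)
qed (use n Q in auto)

end

section \<open>The algorithm and its correctness\<close>

text \<open>Variable \<open>2\<close> is \<open>n\<close>, \<open>7\<close> is \<open>W\<close>, \<open>8\<close> is \<open>\<mu>\<close>, \<open>12\<close> is \<open>\<rho>\<close>, \<open>13\<close> counts sweeps and rounds, \<open>15\<close> is the weight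
  of the current cut and \<open>17\<close> the output position. Array \<open>0\<close> is the block of cells from \<open>64\<close> on, \<open>1\<close> the
  input (adjacency matrix, then weights), \<open>2\<close> the inverse \<open>G\<close>, \<open>3\<close> the direction of a rank-one update, \<open>4\<close>
  the vector \<open>x\<close>, \<open>5\<close> the Cholesky factor, \<open>6\<close> a Gaussian vector, \<open>7\<close> the indicator of the cut and \<open>8\<close> the
  output word, preceded by its length. That length stays \<open>0\<close> until a round succeeds, so that a failing run
  outputs the empty word, which is never a certificate.\<close>

definition ix :: "nat \<Rightarrow> nat \<Rightarrow> expr" where
  "ix a b = Bin Plus (Bin Times (Var 2) (Var a)) (Var b)"

definition wgt :: "nat \<Rightarrow> nat \<Rightarrow> expr" where
  "wgt a b = Arr 1 (Bin Plus (Bin Times (Var 2) (Var 2)) (ix a b))"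

definition sq_diff :: "nat \<Rightarrow> nat \<Rightarrow> expr" where
  "sq_diff a b = Bin Times (Bin Minus (Arr 7 (Var a)) (Arr 7 (Var b))) (Bin Minus (Arr 7 (Var a)) (Arr 7 (Var b)))"

definition total_weight :: com where
  "total_weight = Assign 7 (Lit 0) ;;
     For 3 (Var 2) (For 4 (Var 2) (Assign 7 (Bin Plus (Var 7) (wgt 3 4))))"

definition init_inverse :: com where
  "init_inverse = For 3 (Var 2) (For 4 (Var 2) (Put 2 (ix 3 4) (Lit 0))) ;;
     For 3 (Var 2) (Put 2 (ix 3 3) (Bin Divide (Lit 1) (Var 7))) ;;
     For 3 (Var 2) (Put 4 (Var 3) (Var 7))"

definition rank_one :: com where
  "rank_one = For 5 (Var 2) (For 6 (Var 2) (Put 2 (ix 5 6)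
     (Bin Plus (Arr 2 (ix 5 6)) (Bin Times (Var 9) (Bin Times (Arr 3 (Var 5)) (Arr 3 (Var 6)))))))"

definition add_pair :: com where
  "add_pair = For 5 (Var 2) (Put 3 (Var 5) (Bin Minus (Arr 2 (ix 5 3)) (Arr 2 (ix 5 4)))) ;;
     Assign 10 (Bin Divide (wgt 3 4) (Lit 8)) ;;
     Assign 9 (Bin Divide (Var 10)
       (Bin Minus (Lit 1) (Bin Times (Var 10) (Bin Minus (Arr 3 (Var 3)) (Arr 3 (Var 4)))))) ;;
     rank_one"

definition coordinate_update :: com where
  "coordinate_update =
     Assign 11 (Bin Minus (Var 8) (Bin Divide (Lit 1) (Arr 2 (ix 3 3)))) ;;
     Put 4 (Var 3) (Bin Plus (Arr 4 (Var 3)) (Var 11)) ;;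
     For 5 (Var 2) (Put 3 (Var 5) (Arr 2 (ix 5 3))) ;;
     Assign 9 (Bin Minus (Lit 0) (Bin Divide (Var 11) (Var 10))) ;;
     rank_one"

definition coordinate :: "real \<Rightarrow> com" where
  "coordinate \<epsilon> = Assign 10 (Bin Times (Var 8) (Arr 2 (ix 3 3))) ;;
     IfNonneg (Bin Minus (Bin Times (Bin Minus (Var 10) (Lit 1)) (Bin Minus (Var 10) (Lit 1))) (Lit (\<epsilon>\<^sup>2)))
       coordinate_update"

definition descent :: "real \<Rightarrow> nat \<Rightarrow> com" where
  "descent \<epsilon> K = Assign 8 (Bin Divide (Bin Times (Lit \<epsilon>) (Var 7)) (Var 2)) ;;
     For 13 (Bin Times (Lit (real K)) (Bin Times (Var 2) (Var 2))) (For 3 (Var 2) (coordinate \<epsilon>))"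

definition factorize :: com where
  "factorize = Assign 12 (Lit 0) ;;
     For 3 (Var 2) (Assign 12 (Bin Plus (Var 12) (Arr 4 (Var 3)))) ;;
     Factor 2 2 5 ;; Put 8 (Lit 0) (Lit 0)"

definition prepare :: "real \<Rightarrow> nat \<Rightarrow> com" where
  "prepare \<epsilon> K = total_weight ;; init_inverse ;;
     For 3 (Var 2) (For 4 (Var 2) add_pair) ;; descent \<epsilon> K ;; factorize"

definition inp :: "nat \<Rightarrow> (nat \<Rightarrow> nat \<Rightarrow> real) \<Rightarrow> (nat \<Rightarrow> nat \<Rightarrow> real) \<Rightarrow> store \<Rightarrow> bool" where
  "inp n adj w \<sigma> \<longleftrightarrow> vars \<sigma> 2 = real n \<and>
     (\<forall>i<n. \<forall>j<n. arr \<sigma> 1 (n * i + j) = adj i j \<and> arr \<sigma> 1 (n * n + (n * i + j)) = w i j)"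

lemma inp_agree: "inp n adj w \<sigma> \<Longrightarrow> agree V A \<sigma> \<tau> \<Longrightarrow> 2 \<notin> V \<Longrightarrow> 1 \<notin> A \<Longrightarrow> inp n adj w \<tau>"
  unfolding inp_def agree_def by metis

lemma ev_ix:
  assumes "vars \<tau> 2 = real n" "vars \<tau> a = real i" "vars \<tau> b = real j"
  shows "okE N (ix a b) \<tau>" "ev (ix a b) \<tau> = real (n * i + j)"
  using assms by (simp_all add: ix_def)

lemma ev_matrix:
  assumes "vars \<tau> 2 = real n" "vars \<tau> a = real i" "vars \<tau> b = real j" "i < n" "j < n" "n * n \<le> N"
  shows "okE N (Arr A (ix a b)) \<tau>" "ev (Arr A (ix a b)) \<tau> = arr \<tau> A (n * i + j)"
proof -
  have "n * i + j < N" using index_less[OF assms(4,5)] assms(6) by linarith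
  then show "okE N (Arr A (ix a b)) \<tau>"
    unfolding okE.simps ev_ix(2)[OF assms(1-3)] index_ok_real using ev_ix(1)[OF assms(1-3)] by simp
  show "ev (Arr A (ix a b)) \<tau> = arr \<tau> A (n * i + j)"
    unfolding ev.simps(4) ev_ix(2)[OF assms(1-3)] floor_of_nat nat_int ..
qed

lemma ev_wgt:
  assumes "inp n adj w \<tau>" "vars \<tau> a = real i" "vars \<tau> b = real j" "i < n" "j < n" "2 * n * n \<le> N"
  shows "okE N (wgt a b) \<tau>" "ev (wgt a b) \<tau> = w i j"
proof -
  have n: "vars \<tau> 2 = real n" using assms by (simp add: inp_def)
  have e: "ev (Bin Plus (Bin Times (Var 2) (Var 2)) (ix a b)) \<tau> = real (n * n + (n * i + j))"
    using n by (simp add: ev_ix(2)[OF n assms(2,3)])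
  have "n * n + (n * i + j) < N" using index_less[OF assms(4,5)] assms(6) by linarith
  then show "okE N (wgt a b) \<tau>" unfolding wgt_def okE.simps(4) e index_ok_real
    using ev_ix(1)[OF n assms(2,3)] by simp
  show "ev (wgt a b) \<tau> = w i j" unfolding wgt_def ev.simps(4) e floor_of_nat nat_int using assms by (simp add: inp_def)
qed

locale program_spec = weights +
  fixes chol :: "real mat \<Rightarrow> real mat" and \<omega> :: "nat \<Rightarrow> real" and N :: nat and adj :: "nat \<Rightarrow> nat \<Rightarrow> real"
  assumes N: "2 * n * n + 10 * n + 100 \<le> N"
begin

abbreviation "spc \<equiv> spec chol \<omega> N"

lemma N_bounds: "n < N" "n * n \<le> N" "2 * n * n \<le> N" "n * n < N"
  using N by auto

lemma N_index: "i < n \<Longrightarrow> j < n \<Longrightarrow> n * i + j < N"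
  using index_less[of i n j] N_bounds by linarith

lemma total_weight_spec:
  assumes i: "inp n adj w \<sigma>"
    and Q: "\<And>\<tau>. agree {3, 4, 7} {} \<sigma> \<tau> \<Longrightarrow> vars \<tau> 7 = W \<Longrightarrow> Q \<tau>"
  shows "spc total_weight \<sigma> Q"
  unfolding total_weight_def
proof (intro spec_Seq spec_Assign)
  let ?t = "setv 7 (ev (Lit 0) \<sigma>) \<sigma>"
  have a: "agree {3, 4, 7} {} \<sigma> ?t" by (intro agree_setv) auto
  show "spc (For 3 (Var 2) (For 4 (Var 2) (Assign 7 (Bin Plus (Var 7) (wgt 3 4))))) ?t Q"
  proof (rule spec_sum_matrix[where n=n and F=w])
    show "vars ?t 2 = real n" using i by (simp add: inp_def)
    show "okE N (wgt 3 4) \<tau> \<and> ev (wgt 3 4) \<tau> = w i' j'"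
      if "agree {3, 4, 7} {} ?t \<tau>" "vars \<tau> 3 = real i'" "vars \<tau> 4 = real j'" "i' < n" "j' < n" for \<tau> i' j'
      using ev_wgt[OF inp_agree[OF i agree_trans[OF a that(1)]] that(2-5) N_bounds(3)] by simp
    show "Q \<tau>" if "agree {3, 4, 7} {} ?t \<tau>" "vars \<tau> 7 = vars ?t 7 + (\<Sum>i<n. \<Sum>j<n. w i j)" for \<tau>
    proof (rule Q)
      show "agree {3, 4, 7} {} \<sigma> \<tau>" using agree_trans[OF a that(1)] by simp
      show "vars \<tau> 7 = W" using that(2) by (simp add: W_def sum.cartesian_product)
    qed
  qed (use N_bounds in auto)
qed simp

lemma init_inverse_spec:
  assumes i: "vars \<sigma> 2 = real n" and W: "vars \<sigma> 7 = W"
    and Q: "\<And>\<tau>. agree {3, 4} {2, 4} \<sigma> \<tau> \<Longrightarrow> (\<And>a b. a < n \<Longrightarrow> b < n \<Longrightarrow> arr \<tau> 2 (n * a + b) = of_bool (a = b) * (1 / W)) \<Longrightarrow>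
      (\<And>a. a < n \<Longrightarrow> arr \<tau> 4 a = W) \<Longrightarrow> Q \<tau>"
  shows "spc init_inverse \<sigma> Q"
  unfolding init_inverse_def
proof (intro spec_Seq, rule spec_fill_matrix[where n=n and off=0 and F="\<lambda>_ _. 0"])
  fix \<tau>1 assume 1: "agree {3, 4} {2} \<sigma> \<tau>1" "\<And>i j. i < n \<Longrightarrow> j < n \<Longrightarrow> arr \<tau>1 2 (0 + (n * i + j)) = 0"
  show "spc (For 3 (Var 2) (Put 2 (ix 3 3) (Bin Divide (Lit 1) (Var 7))) ;; For 3 (Var 2) (Put 4 (Var 3) (Var 7))) \<tau>1 Q"
  proof (rule spec_Seq, rule spec_For[where m=n and I="\<lambda>i \<tau>. agree {3, 4} {2} \<sigma> \<tau> \<and>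
      (\<forall>a<n. \<forall>b<n. arr \<tau> 2 (n * a + b) = (if a = b \<and> a < i then 1 / W else 0))"])
    fix i \<tau> assume i': "i < n" and I: "agree {3, 4} {2} \<sigma> \<tau> \<and>
      (\<forall>a<n. \<forall>b<n. arr \<tau> 2 (n * a + b) = (if a = b \<and> a < i then 1 / W else 0))"
    let ?t = "setv 3 (real i) \<tau>"
    have a: "agree {3, 4} {2} \<sigma> ?t" using I by (auto intro: agree_setv)
    have v: "vars ?t 2 = real n" "vars ?t 3 = real i" "vars ?t 7 = W" using agreeD(1)[OF a] i W by auto
    show "spc (Put 2 (ix 3 3) (Bin Divide (Lit 1) (Var 7))) ?t (\<lambda>\<tau>. agree {3, 4} {2} \<sigma> \<tau> \<and>
      (\<forall>a<n. \<forall>b<n. arr \<tau> 2 (n * a + b) = (if a = b \<and> a < Suc i then 1 / W else 0)))"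
      by (rule spec_Put[OF ev_ix(1)[OF v(1,2,2)] _ ev_ix(2)[OF v(1,2,2)] N_index[OF i' i']])
        (use a v I i' in \<open>auto simp: index_inj less_Suc_eq intro: agree_seta\<close>)
  next
    fix \<tau>2 assume I: "agree {3, 4} {2} \<sigma> \<tau>2 \<and>
      (\<forall>a<n. \<forall>b<n. arr \<tau>2 2 (n * a + b) = (if a = b \<and> a < n then 1 / W else 0))"
    have v: "vars \<tau>2 2 = real n" "vars \<tau>2 7 = W" using I i W by (auto simp: agree_def)
    show "spc (For 3 (Var 2) (Put 4 (Var 3) (Var 7))) \<tau>2 Q"
    proof (rule spec_fill[where n=n and off=0 and F="\<lambda>_. W"])
      fix \<tau> assume t: "agree {3} {4} \<tau>2 \<tau>" "\<And>i. i < n \<Longrightarrow> arr \<tau> 4 (0 + i) = W"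
      have "agree {3, 4} {2, 4} \<sigma> \<tau>" using agree_trans[OF _ t(1), of "{3,4}" "{2}" \<sigma>] I by (simp add: insert_commute)
      then show "Q \<tau>" by (rule Q) (use t I agreeD(2)[OF t(1), of 2] in auto)
    qed (use v N_bounds in \<open>auto simp: agree_def\<close>)
  qed (use 1 i N_bounds in \<open>auto simp: agree_def\<close>)
next
  show "okE N (ix 3 4) \<tau> \<and> ev (ix 3 4) \<tau> = real (0 + (n * a + b))"
    if "agree {3, 4} {2} \<sigma> \<tau>" "vars \<tau> 3 = real a" "vars \<tau> 4 = real b" for \<tau> a b
    using ev_ix[of \<tau> n 3 a 4 b] that i by (auto simp: agree_def)
qed (use i N_bounds in auto)

lemma rank_one_spec:
  assumes i: "vars \<sigma> 2 = real n"
    and Q: "\<And>\<tau>. agree {5, 6} {2} \<sigma> \<tau> \<Longrightarrow>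
      (\<And>a b. a < n \<Longrightarrow> b < n \<Longrightarrow> arr \<tau> 2 (n * a + b) = arr \<sigma> 2 (n * a + b) + vars \<sigma> 9 * (arr \<sigma> 3 a * arr \<sigma> 3 b)) \<Longrightarrow> Q \<tau>"
  shows "spc rank_one \<sigma> Q"
  unfolding rank_one_def
proof (rule spec_fill_matrix[where n=n and off=0 and
    F="\<lambda>a b. arr \<sigma> 2 (n * a + b) + vars \<sigma> 9 * (arr \<sigma> 3 a * arr \<sigma> 3 b)"])
  fix \<tau> a b assume t: "agree {5, 6} {2} \<sigma> \<tau>" "vars \<tau> 5 = real a" "vars \<tau> 6 = real b" "a < n" "b < n"
  have v: "vars \<tau> 2 = real n" "vars \<tau> 9 = vars \<sigma> 9" "arr \<tau> 3 = arr \<sigma> 3" using agreeD[OF t(1)] i by auto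
  show "okE N (ix 5 6) \<tau> \<and> ev (ix 5 6) \<tau> = real (0 + (n * a + b))"
    using ev_ix[OF v(1) t(2,3)] by simp
  assume old: "arr \<tau> 2 (0 + (n * a + b)) = arr \<sigma> 2 (0 + (n * a + b))"
  show "okE N (Bin Plus (Arr 2 (ix 5 6)) (Bin Times (Var 9) (Bin Times (Arr 3 (Var 5)) (Arr 3 (Var 6))))) \<tau> \<and>
    ev (Bin Plus (Arr 2 (ix 5 6)) (Bin Times (Var 9) (Bin Times (Arr 3 (Var 5)) (Arr 3 (Var 6))))) \<tau> =
      arr \<sigma> 2 (n * a + b) + vars \<sigma> 9 * (arr \<sigma> 3 a * arr \<sigma> 3 b)"
    using ev_matrix[OF v(1) t(2-5) N_bounds(2), where A=2] t v old N_bounds by simp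
qed (use i Q N_bounds in auto)

lemma add_pair_spec:
  assumes i: "inp n adj w \<sigma>" and v: "vars \<sigma> 3 = real i" "vars \<sigma> 4 = real j" and ij: "i < n" "j < n"
    and G: "\<And>a b. a < n \<Longrightarrow> b < n \<Longrightarrow> G a b = arr \<sigma> 2 (n * a + b)"
    and f: "f = w i j / 8 / (1 - w i j / 8 * (G i i - G j i - (G i j - G j j)))"
    and Q: "\<And>\<tau>. agree {5, 6, 9, 10} {2, 3} \<sigma> \<tau> \<Longrightarrow>
      (\<And>a b. a < n \<Longrightarrow> b < n \<Longrightarrow> arr \<tau> 2 (n * a + b) = G a b + f * (G a i - G a j) * (G b i - G b j)) \<Longrightarrow> Q \<tau>"
  shows "spc add_pair \<sigma> Q"
  unfolding add_pair_def
proof (intro spec_Seq, rule spec_fill[where n=n and off=0 and F="\<lambda>a. G a i - G a j"])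
  have n: "vars \<sigma> 2 = real n" using i by (simp add: inp_def)
  fix \<tau>1 assume 1: "agree {5} {3} \<sigma> \<tau>1" "\<And>a. a < n \<Longrightarrow> arr \<tau>1 3 (0 + a) = G a i - G a j"
  define \<tau>2 where "\<tau>2 = setv 10 (w i j / 8) \<tau>1"
  define \<tau>3 where "\<tau>3 = setv 9 f \<tau>2"
  have a2: "agree {5, 10} {3} \<sigma> \<tau>2" unfolding \<tau>2_def using agree_trans[OF 1(1) agree_refl, of "{10}" "{}"]
    by (intro agree_setv) (auto simp: insert_commute)
  have a3: "agree {5, 9, 10} {3} \<sigma> \<tau>3" unfolding \<tau>3_def using agree_trans[OF a2 agree_refl, of "{9}" "{}"]
    by (intro agree_setv) (auto simp: insert_commute)
  have inp1: "inp n adj w \<tau>1" by (rule inp_agree[OF i 1(1)]) auto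
  have v1: "vars \<tau>1 3 = real i" "vars \<tau>1 4 = real j" using agreeD(1)[OF 1(1)] v by auto
  have h: "arr \<tau>2 3 a = G a i - G a j" if "a < n" for a using 1(2)[OF that] by (simp add: \<tau>2_def)
  have e1: "okE N (Bin Divide (wgt 3 4) (Lit 8)) \<tau>1" "ev (Bin Divide (wgt 3 4) (Lit 8)) \<tau>1 = w i j / 8"
    using ev_wgt[OF inp1 v1 ij N_bounds(3)] by simp_all
  have v2: "vars \<tau>2 3 = real i" "vars \<tau>2 4 = real j" "vars \<tau>2 10 = w i j / 8" using v1 by (simp_all add: \<tau>2_def)
  let ?e = "Bin Divide (Var 10) (Bin Minus (Lit 1) (Bin Times (Var 10) (Bin Minus (Arr 3 (Var 3)) (Arr 3 (Var 4)))))"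
  have "i < N" "j < N" using ij N_bounds by auto
  then have e2: "okE N ?e \<tau>2" using v2 by simp
  have "G i i - G j i - (G i j - G j j) = arr \<tau>2 3 i - arr \<tau>2 3 j" unfolding h[OF ij(1)] h[OF ij(2)] by simp
  then have f': "ev ?e \<tau>2 = f" unfolding f by (simp only: ev.simps bop.simps v2 floor_of_nat nat_int)
  show "spc (Assign 10 (Bin Divide (wgt 3 4) (Lit 8)) ;; Assign 9 ?e ;; rank_one) \<tau>1 Q"
  proof (rule spec_Seq, rule spec_Assign[OF e1(1)], unfold e1(2) \<tau>2_def[symmetric], rule spec_Seq, rule spec_Assign[OF e2], unfold f' \<tau>3_def[symmetric],
      rule rank_one_spec)
    show "vars \<tau>3 2 = real n" using agreeD(1)[OF a3, of 2] n by simp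
    fix \<tau> assume t: "agree {5, 6} {2} \<tau>3 \<tau>"
      "\<And>a b. a < n \<Longrightarrow> b < n \<Longrightarrow> arr \<tau> 2 (n * a + b) = arr \<tau>3 2 (n * a + b) + vars \<tau>3 9 * (arr \<tau>3 3 a * arr \<tau>3 3 b)"
    have g3: "arr \<tau>3 2 = arr \<sigma> 2" using agreeD(2)[OF a3, of 2] by simp
    show "Q \<tau>"
    proof (rule Q)
      show "agree {5, 6, 9, 10} {2, 3} \<sigma> \<tau>" using agree_trans[OF a3 t(1)] by (simp add: insert_commute)
      show "arr \<tau> 2 (n * a + b) = G a b + f * (G a i - G a j) * (G b i - G b j)" if "a < n" "b < n" for a b
        using t(2)[OF that] h that G[OF that] unfolding g3 by (simp add: \<tau>3_def)
    qed
  qed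
next
  have n: "vars \<sigma> 2 = real n" using i by (simp add: inp_def)
  fix \<tau> a assume t: "agree {5} {3} \<sigma> \<tau>" "vars \<tau> 5 = real a" "a < n"
  have vt: "vars \<tau> 2 = real n" "vars \<tau> 3 = real i" "vars \<tau> 4 = real j" "arr \<tau> 2 = arr \<sigma> 2" using agreeD[OF t(1)] n v by auto
  show "okE N (Bin Minus (Arr 2 (ix 5 3)) (Arr 2 (ix 5 4))) \<tau> \<and>
     ev (Bin Minus (Arr 2 (ix 5 3)) (Arr 2 (ix 5 4))) \<tau> = G a i - G a j"
    using ev_matrix[OF vt(1) t(2) vt(2) t(3) ij(1) N_bounds(2), where A=2] ev_matrix[OF vt(1) t(2) vt(3) t(3) ij(2) N_bounds(2), where A=2]
      G[OF t(3) ij(1)] G[OF t(3) ij(2)] vt by simp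
qed (use i N_bounds in \<open>auto simp: inp_def\<close>)

definition G_of :: "store \<Rightarrow> nat \<Rightarrow> nat \<Rightarrow> real" where
  "G_of \<sigma> a b = arr \<sigma> 2 (n * a + b)"

lemma G_of_setv [simp]: "G_of (setv v r \<sigma>) = G_of \<sigma>"
  by (simp add: G_of_def fun_eq_iff)

lemma inverse_pair_cong:
  assumes "inverse_pair n S G" "\<And>a b. a < n \<Longrightarrow> b < n \<Longrightarrow> S a b = S' a b" "\<And>a b. a < n \<Longrightarrow> b < n \<Longrightarrow> G a b = G' a b"
  shows "inverse_pair n S' G'"
proof -
  have "(\<Sum>k<n. S' i k * G' k j) = (\<Sum>k<n. S i k * G k j)" if "i < n" "j < n" for i j
    using assms(2,3) that by (intro sum.cong) auto
  then show ?thesis using assms unfolding inverse_pair_def by simp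
qed

lemma add_pairs_spec:
  assumes i: "inp n adj w \<sigma>" and inv: "inverse_pair n (shifted_laplacian w {} (\<lambda>_. W)) (G_of \<sigma>)"
    and Q: "\<And>\<tau>. agree {3, 4, 5, 6, 9, 10} {2, 3} \<sigma> \<tau> \<Longrightarrow> inverse_pair n (S_of (\<lambda>_. W)) (G_of \<tau>) \<Longrightarrow> Q \<tau>"
  shows "spc (For 3 (Var 2) (For 4 (Var 2) add_pair)) \<sigma> Q"
proof -
  have n: "vars \<sigma> 2 = real n" using i by (simp add: inp_def)
  define P where "P i j = {..<i} \<times> {..<n} \<union> {i} \<times> {..<j}" for i j :: nat
  define I where "I i j \<tau> \<longleftrightarrow> agree {3, 4, 5, 6, 9, 10} {2, 3} \<sigma> \<tau> \<and> inverse_pair n (shifted_laplacian w (P i j) (\<lambda>_. W)) (G_of \<tau>)" for i j \<tau>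
  have I_setv: "I i j (setv v r \<tau>)" if "I i j \<tau>" "v \<in> {3, 4, 5, 6, 9, 10}" for i j v r \<tau>
    using that unfolding I_def G_of_def by (auto intro: agree_setv)
  have Pn: "P i n = P (Suc i) 0" for i by (auto simp: P_def less_Suc_eq)
  have PS: "P i (Suc j) = insert (i, j) (P i j)" "(i, j) \<notin> P i j" for i j by (auto simp: P_def less_Suc_eq)
  show ?thesis
  proof (rule spec_For[where m=n and I="\<lambda>i. I i 0"])
    show "I 0 0 \<sigma>" using inv by (simp add: I_def P_def)
    show "Q \<tau>" if "I n 0 \<tau>" for \<tau>
    proof (rule Q)
      have "P n 0 = pairs n" by (simp add: P_def)
      then show "inverse_pair n (S_of (\<lambda>_. W)) (G_of \<tau>)" using that by (simp add: I_def)
    qed (use that in \<open>simp add: I_def\<close>)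
    fix i \<tau> assume i': "i < n" and Ii: "I i 0 \<tau>"
    let ?t = "setv 3 (real i) \<tau>"
    have It: "I i 0 ?t" by (rule I_setv[OF Ii]) simp
    show "spc (For 4 (Var 2) add_pair) ?t (I (Suc i) 0)"
    proof (rule spec_For[where m=n and I="\<lambda>j \<tau>. I i j \<tau> \<and> vars \<tau> 3 = real i"])
      show "I i 0 ?t \<and> vars ?t 3 = real i" using It by simp
      show "ev (Var 2) ?t = real n" using It n by (simp add: I_def agree_def)
      show "I (Suc i) 0 \<tau>" if "I i n \<tau> \<and> vars \<tau> 3 = real i" for \<tau> using that by (simp add: I_def Pn)
      fix j \<tau>' assume j: "j < n" and Ij: "I i j \<tau>' \<and> vars \<tau>' 3 = real i"
      let ?u = "setv 4 (real j) \<tau>'"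
      have Iu: "I i j ?u" by (rule I_setv) (use Ij in auto)
      have au: "agree {3, 4, 5, 6, 9, 10} {2, 3} \<sigma> ?u" using Iu by (simp add: I_def)
      show "spc add_pair ?u (\<lambda>\<tau>. I i (Suc j) \<tau> \<and> vars \<tau> 3 = real i)"
      proof (rule add_pair_spec[where i=i and j=j and G="G_of ?u", OF _ _ _ i' j _ refl])
        show "inp n adj w ?u" by (rule inp_agree[OF i au]) auto
        fix \<upsilon> assume t: "agree {5, 6, 9, 10} {2, 3} ?u \<upsilon>"
          "\<And>a b. a < n \<Longrightarrow> b < n \<Longrightarrow> arr \<upsilon> 2 (n * a + b) = G_of ?u a b +
            w i j / 8 / (1 - w i j / 8 * (G_of ?u i i - G_of ?u j i - (G_of ?u i j - G_of ?u j j))) *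
            (G_of ?u a i - G_of ?u a j) * (G_of ?u b i - G_of ?u b j)"
        have "agree {3, 4, 5, 6, 9, 10} {2, 3} \<sigma> \<upsilon>" using agree_trans[OF au t(1)] by (simp add: insert_commute)
        moreover have "inverse_pair n (shifted_laplacian w (insert (i, j) (P i j)) (\<lambda>_. W)) (G_of \<upsilon>)"
        proof (rule inverse_add_pair[OF _ _ PS(2) refl])
          show "inverse_pair n (shifted_laplacian w (P i j) (\<lambda>_. W)) (G_of ?u)" using Iu by (simp add: I_def)
          show "insert (i, j) (P i j) \<subseteq> pairs n" using i' j by (auto simp: P_def)
        qed (use t(2) in \<open>simp add: G_of_def\<close>)
        ultimately show "I i (Suc j) \<upsilon> \<and> vars \<upsilon> 3 = real i"
          using agreeD(1)[OF t(1), of 3] Ij by (simp add: I_def PS(1))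
      qed (use Ij in \<open>auto simp: G_of_def\<close>)
    qed (use N_bounds in auto)
  qed (use n N_bounds in auto)
qed

lemma coordinate_spec:
  assumes v: "vars \<sigma> 2 = real n" "vars \<sigma> 3 = real i" "vars \<sigma> 8 = \<mu>" and i: "i < n" and \<mu>: "0 < \<mu>" and \<epsilon>: "0 < \<epsilon>" "\<epsilon> < 1"
    and inv: "sweep_inv \<epsilon> \<mu> k i (arr \<sigma> 4) (G_of \<sigma>)"
    and Q: "\<And>\<tau>. agree {5, 6, 9, 10, 11} {2, 3, 4} \<sigma> \<tau> \<Longrightarrow> sweep_inv \<epsilon> \<mu> k (Suc i) (arr \<tau> 4) (G_of \<tau>) \<Longrightarrow> Q \<tau>"
  shows "spc (coordinate \<epsilon>) \<sigma> Q"
proof -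
  let ?g = "G_of \<sigma> i i"
  define \<tau>1 where "\<tau>1 = setv 10 (\<mu> * ?g) \<sigma>"
  have eG: "okE N (Arr 2 (ix 3 3)) \<sigma>" "ev (Arr 2 (ix 3 3)) \<sigma> = ?g"
    using ev_matrix[OF v(1,2,2) i i N_bounds(2), where A=2] by (simp_all add: G_of_def)
  have v1: "vars \<tau>1 2 = real n" "vars \<tau>1 3 = real i" "vars \<tau>1 8 = \<mu>" "vars \<tau>1 10 = \<mu> * ?g" "arr \<tau>1 = arr \<sigma>"
    using v by (simp_all add: \<tau>1_def)
  let ?c = "Bin Minus (Bin Times (Bin Minus (Var 10) (Lit 1)) (Bin Minus (Var 10) (Lit 1))) (Lit (\<epsilon>\<^sup>2))"
  have ec: "ev ?c \<tau>1 = (\<mu> * ?g - 1)\<^sup>2 - \<epsilon>\<^sup>2" using v1 by (simp add: power2_eq_square)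
  have a1: "agree {5, 6, 9, 10, 11} {2, 3, 4} \<sigma> \<tau>1" unfolding \<tau>1_def by (intro agree_setv) auto
  have iN: "i < N" using i N_bounds by simp
  show ?thesis
    unfolding coordinate_def
  proof (rule spec_Seq, rule spec_Assign)
    show "okE N (Bin Times (Var 8) (Arr 2 (ix 3 3))) \<sigma>" using eG by simp
    have e1: "ev (Bin Times (Var 8) (Arr 2 (ix 3 3))) \<sigma> = \<mu> * ?g" unfolding ev.simps(3) eG(2) using v by simp
    show "spc (IfNonneg ?c coordinate_update) (setv 10 (ev (Bin Times (Var 8) (Arr 2 (ix 3 3))) \<sigma>) \<sigma>) Q"
      unfolding e1 \<tau>1_def[symmetric]
    proof (rule spec_If)
      show "Q \<tau>1" if "\<not> 0 \<le> ev ?c \<tau>1"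
      proof (rule Q[OF a1])
        have "sweep_inv \<epsilon> \<mu> k (Suc i) (arr \<sigma> 4) (G_of \<sigma>)"
          by (rule sweep_inv_skip[OF inv]) (use that[unfolded ec] in simp)
        then show "sweep_inv \<epsilon> \<mu> k (Suc i) (arr \<tau>1 4) (G_of \<tau>1)" unfolding G_of_def v1(5) .
      qed
      assume "0 \<le> ev ?c \<tau>1"
      then have far: "\<epsilon>\<^sup>2 \<le> (\<mu> * ?g - 1)\<^sup>2" unfolding ec by simp
      define t where "t = \<mu> - 1 / ?g"
      define \<tau>2 where "\<tau>2 = setv 11 t \<tau>1"
      define \<tau>3 where "\<tau>3 = seta 4 i (arr \<sigma> 4 i + t) \<tau>2"
      have a3: "agree {5, 6, 9, 10, 11} {2, 3, 4} \<sigma> \<tau>3" unfolding \<tau>3_def \<tau>2_def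
        by (intro agree_setv agree_seta a1) auto
      have v2: "vars \<tau>2 3 = real i" "vars \<tau>2 11 = t" "arr \<tau>2 = arr \<sigma>" using v1 by (simp_all add: \<tau>2_def)
      have v3: "vars \<tau>3 2 = real n" "vars \<tau>3 3 = real i" "vars \<tau>3 11 = t" "vars \<tau>3 10 = \<mu> * ?g" "arr \<tau>3 2 = arr \<sigma> 2"
        "arr \<tau>3 4 = (arr \<sigma> 4)(i := arr \<sigma> 4 i + t)"
        using v1 by (simp_all add: \<tau>3_def \<tau>2_def)
      have e2: "okE N (Bin Minus (Var 8) (Bin Divide (Lit 1) (Arr 2 (ix 3 3)))) \<tau>1"
        "ev (Bin Minus (Var 8) (Bin Divide (Lit 1) (Arr 2 (ix 3 3)))) \<tau>1 = t"
        using ev_matrix[OF v1(1,2,2) i i N_bounds(2), where A=2] v1 by (simp_all add: G_of_def t_def)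
      have e3: "okE N (Bin Plus (Arr 4 (Var 3)) (Var 11)) \<tau>2" "ev (Bin Plus (Arr 4 (Var 3)) (Var 11)) \<tau>2 = arr \<sigma> 4 i + t"
        using v2 iN by simp_all
      show "spc coordinate_update \<tau>1 Q"
        unfolding coordinate_update_def
      proof (rule spec_Seq, rule spec_Assign[OF e2(1)], unfold e2(2) \<tau>2_def[symmetric], rule spec_Seq,
          rule spec_Put[OF _ e3(1) _ iN], simp, simp add: v2, unfold e3(2) \<tau>3_def[symmetric], rule spec_Seq,
          rule spec_fill[where n=n and off=0 and F="\<lambda>a. G_of \<sigma> a i"])
        fix \<tau>4 assume 4: "agree {5} {3} \<tau>3 \<tau>4" "\<And>a. a < n \<Longrightarrow> arr \<tau>4 3 (0 + a) = G_of \<sigma> a i"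
        define \<tau>5 where "\<tau>5 = setv 9 (- (t / (\<mu> * ?g))) \<tau>4"
        have a4: "agree {5, 6, 9, 10, 11} {2, 3, 4} \<sigma> \<tau>4" using agree_trans[OF a3 4(1)] by (simp add: insert_commute)
        have a5: "agree {5, 6, 9, 10, 11} {2, 3, 4} \<sigma> \<tau>5" unfolding \<tau>5_def by (intro agree_setv a4) auto
        have v4: "vars \<tau>4 11 = t" "vars \<tau>4 10 = \<mu> * ?g" "arr \<tau>4 2 = arr \<sigma> 2" "arr \<tau>4 4 = (arr \<sigma> 4)(i := arr \<sigma> 4 i + t)"
          using agreeD[OF 4(1)] v3 by auto
        have e5: "ev (Bin Minus (Lit 0) (Bin Divide (Var 11) (Var 10))) \<tau>4 = - (t / (\<mu> * ?g))" using v4 by simp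
        show "spc (Assign 9 (Bin Minus (Lit 0) (Bin Divide (Var 11) (Var 10))) ;; rank_one) \<tau>4 Q"
        proof (rule spec_Seq, rule spec_Assign, simp, unfold e5 \<tau>5_def[symmetric], rule rank_one_spec)
          show "vars \<tau>5 2 = real n" using agreeD(1)[OF a5, of 2] v by simp
          fix \<tau> assume t': "agree {5, 6} {2} \<tau>5 \<tau>"
            "\<And>a b. a < n \<Longrightarrow> b < n \<Longrightarrow> arr \<tau> 2 (n * a + b) = arr \<tau>5 2 (n * a + b) + vars \<tau>5 9 * (arr \<tau>5 3 a * arr \<tau>5 3 b)"
          show "Q \<tau>"
          proof (rule Q)
            show "agree {5, 6, 9, 10, 11} {2, 3, 4} \<sigma> \<tau>" using agree_trans[OF a5 t'(1)] by (simp add: insert_commute)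
            show "sweep_inv \<epsilon> \<mu> k (Suc i) (arr \<tau> 4) (G_of \<tau>)"
            proof (rule sweep_inv_update[OF inv i \<mu> \<epsilon> far])
              have "arr \<tau> 4 = (arr \<sigma> 4)(i := arr \<sigma> 4 i + t)" using agreeD(2)[OF t'(1), of 4] v4 by (simp add: \<tau>5_def)
              then show "arr \<tau> 4 a = (if a = i then arr \<sigma> 4 i + (\<mu> - 1 / ?g) else arr \<sigma> 4 a)" for a
                by (simp add: t_def)
              show "G_of \<tau> a b = G_of \<sigma> a b - (\<mu> - 1 / ?g) / (\<mu> * ?g) * G_of \<sigma> a i * G_of \<sigma> b i" if "a < n" "b < n" for a b
              proof -
                have 5: "vars \<tau>5 9 = - (t / (\<mu> * ?g))" "arr \<tau>5 3 = arr \<tau>4 3" "arr \<tau>5 2 = arr \<sigma> 2"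
                  using v4(3) by (simp_all add: \<tau>5_def)
                have "arr \<tau> 2 (n * a + b) = arr \<sigma> 2 (n * a + b) + - (t / (\<mu> * ?g)) * (G_of \<sigma> a i * G_of \<sigma> b i)"
                  using t'(2)[OF that] 4(2)[OF that(1)] 4(2)[OF that(2)] unfolding 5 by simp
                then show ?thesis unfolding G_of_def[of \<tau>] G_of_def[of \<sigma> a b] t_def by simp
              qed
            qed
          qed
        qed
      next
        fix \<tau> a assume t: "agree {5} {3} \<tau>3 \<tau>" "vars \<tau> 5 = real a" "a < n"
        have vt: "vars \<tau> 2 = real n" "vars \<tau> 3 = real i" "arr \<tau> 2 = arr \<sigma> 2" using agreeD[OF t(1)] v3 by auto
        show "okE N (Arr 2 (ix 5 3)) \<tau> \<and> ev (Arr 2 (ix 5 3)) \<tau> = G_of \<sigma> a i"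
          using ev_matrix[OF vt(1) t(2) vt(2) t(3) i N_bounds(2), where A=2] vt by (simp add: G_of_def)
      qed (use v3 N_bounds in auto)
    qed simp
  qed
qed

lemma sweep_inv_cong:
  assumes "sweep_inv \<epsilon> \<mu> k i x G" "\<And>a. a < n \<Longrightarrow> x' a = x a" "\<And>a b. a < n \<Longrightarrow> b < n \<Longrightarrow> G' a b = G a b" "i \<le> n"
  shows "sweep_inv \<epsilon> \<mu> k i x' G'"
proof -
  have S: "S_of x' a b = S_of x a b" if "a < n" "b < n" for a b using assms(2) that by (simp add: shifted_laplacian_def)
  have m: "fmat n (S_of x') = fmat n (S_of x)" using S by (intro cong_mat refl) auto
  have q: "qform n (S_of x') v = qform n (S_of x) v" for v
    unfolding qform_def using S by (intro sum.cong refl) auto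
  have "(\<Sum>a<n. x' a) = (\<Sum>a<n. x a)" using assms(2) by (intro sum.cong) auto
  then have p: "potential \<mu> x' = potential \<mu> x" unfolding potential_def m by simp
  have "posdef n (S_of x)" "inverse_pair n (S_of x) G" using assms(1) by (auto simp: sweep_inv_def feasible_def)
  moreover have "posdef n (S_of x')"
    using calculation(1) shifted_laplacian_sym unfolding posdef_def q by blast
  moreover have "inverse_pair n (S_of x') G'"
    by (rule inverse_pair_cong[OF calculation(2)]) (use S assms(3) in auto)
  ultimately have f: "feasible x' G'" by (simp add: feasible_def)
  have g: "G' j j = G j j" if "j < n" for j using assms(3) that by simp
  have e: "(\<forall>j<n. (\<mu> * G' j j - 1)\<^sup>2 < \<epsilon>\<^sup>2) = (\<forall>j<n. (\<mu> * G j j - 1)\<^sup>2 < \<epsilon>\<^sup>2)"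
    "(\<forall>j<i. (\<mu> * G' j j - 1)\<^sup>2 < \<epsilon>\<^sup>2) = (\<forall>j<i. (\<mu> * G j j - 1)\<^sup>2 < \<epsilon>\<^sup>2)"
    using g assms(4) by auto
  show ?thesis using assms(1) f unfolding sweep_inv_def Let_def p e by blast
qed

lemma descent_spec:
  assumes v: "vars \<sigma> 2 = real n" "vars \<sigma> 7 = W" and \<epsilon>: "0 < \<epsilon>" "\<epsilon> \<le> 1 / 2"
    and K: "real n ^ 2 < real (K * (n * n)) * \<epsilon> * progress \<epsilon>" "K * (n * n) < N"
    and inv: "inverse_pair n (S_of (\<lambda>_. W)) (G_of \<sigma>)" and x: "\<And>a. a < n \<Longrightarrow> arr \<sigma> 4 a = W"
    and Q: "\<And>\<tau>. agree {3, 5, 6, 8, 9, 10, 11, 13} {2, 3, 4} \<sigma> \<tau> \<Longrightarrow> feasible (arr \<tau> 4) (G_of \<tau>) \<Longrightarrow>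
      (\<And>i. i < n \<Longrightarrow> (\<epsilon> * W / n * G_of \<tau> i i - 1)\<^sup>2 < \<epsilon>\<^sup>2) \<Longrightarrow> Q \<tau>"
  shows "spc (descent \<epsilon> K) \<sigma> Q"
proof -
  define \<mu> where "\<mu> = \<epsilon> * W / n"
  have \<mu>: "0 < \<mu>" using \<epsilon> W_pos n_pos by (simp add: \<mu>_def)
  let ?V = "{3, 5, 6, 8, 9, 10, 11, 13} :: nat set" and ?A = "{2, 3, 4} :: nat set"
  define I where "I k i \<tau> \<longleftrightarrow> agree ?V ?A \<sigma> \<tau> \<and> vars \<tau> 8 = \<mu> \<and> sweep_inv \<epsilon> \<mu> k i (arr \<tau> 4) (G_of \<tau>)" for k i \<tau>
  have I_setv: "I k i (setv c r \<tau>)" if "I k i \<tau>" "c \<in> {3, 13}" for k i c r \<tau>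
    using that unfolding I_def G_of_def by (auto intro: agree_setv)
  have n2: "vars \<tau> 2 = real n" if "I k i \<tau>" for k i \<tau> using that v by (simp add: I_def agree_def)
  show ?thesis
    unfolding descent_def
  proof (rule spec_Seq, rule spec_Assign, simp)
    let ?t = "setv 8 (ev (Bin Divide (Bin Times (Lit \<epsilon>) (Var 7)) (Var 2)) \<sigma>) \<sigma>"
    have s0: "sweep_inv \<epsilon> \<mu> 0 0 (arr \<sigma> 4) (G_of \<sigma>)"
      by (rule sweep_inv_cong[OF sweep_inv_start[OF inv \<mu>]]) (use x in auto)
    have I0: "I 0 0 ?t" using s0 v by (auto simp: I_def \<mu>_def G_of_def intro: agree_setv)
    show "spc (For 13 (Bin Times (Lit (real K)) (Bin Times (Var 2) (Var 2))) (For 3 (Var 2) (coordinate \<epsilon>))) ?t Q"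
    proof (rule spec_For[where m="K * (n * n)" and I="\<lambda>k. I k 0"])
      fix k \<tau> assume Ik: "I k 0 \<tau>"
      let ?u = "setv 13 (real k) \<tau>"
      have Iu: "I k 0 ?u" by (rule I_setv[OF Ik]) simp
      show "spc (For 3 (Var 2) (coordinate \<epsilon>)) ?u (I (Suc k) 0)"
      proof (rule spec_For[where m=n and I="I k"])
        show "I k 0 ?u" by (rule Iu)
        show "ev (Var 2) ?u = real n" using n2[OF Iu] by simp
        show "I (Suc k) 0 \<tau>'" if "I k n \<tau>'" for \<tau>' using that sweep_inv_next unfolding I_def by blast
        fix i \<tau>' assume i: "i < n" and Ii: "I k i \<tau>'"
        let ?w = "setv 3 (real i) \<tau>'"
        have Iw: "I k i ?w" by (rule I_setv[OF Ii]) simp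
        show "spc (coordinate \<epsilon>) ?w (I k (Suc i))"
        proof (rule coordinate_spec[where i=i and \<mu>=\<mu> and k=k])
          fix \<upsilon> assume t: "agree {5, 6, 9, 10, 11} {2, 3, 4} ?w \<upsilon>" "sweep_inv \<epsilon> \<mu> k (Suc i) (arr \<upsilon> 4) (G_of \<upsilon>)"
          have "agree ?V ?A \<sigma> ?w" using Iw by (simp add: I_def)
          from agree_trans[OF this t(1)] have "agree ?V ?A \<sigma> \<upsilon>" by (simp add: insert_commute)
          then show "I k (Suc i) \<upsilon>" using t(2) agreeD(1)[OF t(1), of 8] Iw by (simp add: I_def)
        qed (use Iw n2[OF Iw] i \<mu> \<epsilon> in \<open>auto simp: I_def\<close>)
      qed (use N_bounds in auto)
    next
      show "Q \<tau>" if "I (K * (n * n)) 0 \<tau>" for \<tau>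
      proof (rule Q)
        have s: "sweep_inv \<epsilon> \<mu> (K * (n * n)) 0 (arr \<tau> 4) (G_of \<tau>)" using that by (simp add: I_def)
        note d = sweep_inv_done[OF s \<epsilon> \<mu>_def K(1)[folded of_nat_power]]
        show "feasible (arr \<tau> 4) (G_of \<tau>)" by (rule d(1))
        show "(\<epsilon> * W / n * G_of \<tau> i i - 1)\<^sup>2 < \<epsilon>\<^sup>2" if "i < n" for i using d(2)[OF that] by (simp only: \<mu>_def)
      qed (use that in \<open>simp add: I_def\<close>)
      show "ev (Bin Times (Lit (real K)) (Bin Times (Var 2) (Var 2))) ?t = real (K * (n * n))" using v by simp
    qed (use K I0 in auto)
  qed
qed

lemma factorize_spec:
  assumes v: "vars \<sigma> 2 = real n"
    and Q: "\<And>\<tau>. agree {3, 12} {5, 8} \<sigma> \<tau> \<Longrightarrow> vars \<tau> 12 = (\<Sum>i<n. arr \<sigma> 4 i) \<Longrightarrow> arr \<tau> 8 0 = 0 \<Longrightarrow>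
      (\<And>i j. i < n \<Longrightarrow> j < n \<Longrightarrow> arr \<tau> 5 (n * i + j) = chol (fmat n (G_of \<sigma>)) $$ (i, j)) \<Longrightarrow> Q \<tau>"
  shows "spc factorize \<sigma> Q"
  unfolding factorize_def
proof (rule spec_Seq, rule spec_Assign, simp, rule spec_Seq)
  let ?t = "setv 12 (ev (Lit 0) \<sigma>) \<sigma>"
  have a: "agree {3, 12} {} \<sigma> ?t" by (intro agree_setv) auto
  show "spc (For 3 (Var 2) (Assign 12 (Bin Plus (Var 12) (Arr 4 (Var 3))))) ?t (\<lambda>\<tau>. spc (Factor 2 2 5 ;; Put 8 (Lit 0) (Lit 0)) \<tau> Q)"
  proof (rule spec_sum[where n=n and F="arr \<sigma> 4"])
    show "okE N (Arr 4 (Var 3)) \<tau> \<and> ev (Arr 4 (Var 3)) \<tau> = arr \<sigma> 4 i"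
      if "agree {3, 12} {} ?t \<tau>" "vars \<tau> 3 = real i" "i < n" for \<tau> i
      using that N_bounds agreeD(2)[OF that(1), of 4] by simp
    fix \<tau>1 assume 1: "agree {3, 12} {} ?t \<tau>1" "vars \<tau>1 12 = vars ?t 12 + sum (arr \<sigma> 4) {..<n}"
    have a1: "agree {3, 12} {} \<sigma> \<tau>1" using agree_trans[OF a 1(1)] by simp
    have v1: "vars \<tau>1 2 = real n" "arr \<tau>1 2 = arr \<sigma> 2" using agreeD[OF a1] v by auto
    define \<tau>2 where "\<tau>2 = sem chol \<omega> (Factor 2 2 5) \<tau>1"
    have okF: "ok chol \<omega> N (Factor 2 2 5) \<tau>1" using v1 n_pos N_bounds by auto
    have m: "mat n n (\<lambda>(i, j). arr \<tau>1 2 (i * n + j)) = fmat n (G_of \<sigma>)"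
      using v1 by (intro cong_mat refl) (auto simp: G_of_def mult.commute)
    have 2: "\<tau>2 = \<tau>1\<lparr>arr := (arr \<tau>1)(5 := (\<lambda>c. if c < n * n then chol (fmat n (G_of \<sigma>)) $$ (c div n, c mod n) else arr \<tau>1 5 c))\<rparr>"
      unfolding \<tau>2_def sem.simps Let_def v1(1) floor_of_nat nat_int m ..
    have "spc (Put 8 (Lit 0) (Lit 0)) \<tau>2 Q"
    proof (rule spec_Put[where k=0])
      show "Q (seta 8 0 (ev (Lit 0) \<tau>2) \<tau>2)"
      proof (rule Q)
        show "agree {3, 12} {5, 8} \<sigma> (seta 8 0 (ev (Lit 0) \<tau>2) \<tau>2)"
          using a1 unfolding 2 by (auto simp: agree_def)
        show "vars (seta 8 0 (ev (Lit 0) \<tau>2) \<tau>2) 12 = (\<Sum>i<n. arr \<sigma> 4 i)" using 1(2) by (simp add: 2)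
        show "arr (seta 8 0 (ev (Lit 0) \<tau>2) \<tau>2) 5 (n * i + j) = chol (fmat n (G_of \<sigma>)) $$ (i, j)" if "i < n" "j < n" for i j
          using index_less[OF that] that by (simp add: 2)
      qed simp
    qed (use N_bounds in auto)
    then show "spc (Factor 2 2 5 ;; Put 8 (Lit 0) (Lit 0)) \<tau>1 Q"
      using okF unfolding spec_def \<tau>2_def by simp
  qed (use v N_bounds in auto)
qed

lemma prepare_spec:
  assumes i: "inp n adj w \<sigma>" and \<epsilon>: "0 < \<epsilon>" "\<epsilon> \<le> 1 / 2"
    and K: "real n ^ 2 < real (K * (n * n)) * \<epsilon> * progress \<epsilon>" "K * (n * n) < N"
    and Q: "\<And>\<tau>. inp n adj w \<tau> \<Longrightarrow> cnt \<tau> = cnt \<sigma> \<Longrightarrow> arr \<tau> 8 0 = 0 \<Longrightarrow> feasible (arr \<tau> 4) (G_of \<tau>) \<Longrightarrow>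
      (\<And>i. i < n \<Longrightarrow> (\<epsilon> * W / n * G_of \<tau> i i - 1)\<^sup>2 < \<epsilon>\<^sup>2) \<Longrightarrow> vars \<tau> 12 = (\<Sum>i<n. arr \<tau> 4 i) \<Longrightarrow>
      (\<And>i j. i < n \<Longrightarrow> j < n \<Longrightarrow> arr \<tau> 5 (n * i + j) = chol (fmat n (G_of \<tau>)) $$ (i, j)) \<Longrightarrow> Q \<tau>"
  shows "spc (prepare \<epsilon> K) \<sigma> Q"
  unfolding prepare_def
proof (rule spec_Seq, rule total_weight_spec[OF i], rule spec_Seq)
  fix \<tau>1 assume 1: "agree {3, 4, 7} {} \<sigma> \<tau>1" "vars \<tau>1 7 = W"
  have i1: "inp n adj w \<tau>1" by (rule inp_agree[OF i 1(1)]) auto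
  show "spc init_inverse \<tau>1 (\<lambda>\<tau>. spc (For 3 (Var 2) (For 4 (Var 2) add_pair) ;; descent \<epsilon> K ;; factorize) \<tau> Q)"
  proof (rule init_inverse_spec[OF _ 1(2)], use i1 in \<open>simp add: inp_def\<close>, rule spec_Seq)
    fix \<tau>2 assume 2: "agree {3, 4} {2, 4} \<tau>1 \<tau>2"
      "\<And>a b. a < n \<Longrightarrow> b < n \<Longrightarrow> arr \<tau>2 2 (n * a + b) = of_bool (a = b) * (1 / W)" "\<And>a. a < n \<Longrightarrow> arr \<tau>2 4 a = W"
    have i2: "inp n adj w \<tau>2" by (rule inp_agree[OF i1 2(1)]) auto
    have inv2: "inverse_pair n (shifted_laplacian w {} (\<lambda>_. W)) (G_of \<tau>2)"
      by (rule inverse_pair_cong[OF inverse_start refl]) (simp add: G_of_def 2(2))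
    show "spc (For 3 (Var 2) (For 4 (Var 2) add_pair)) \<tau>2 (\<lambda>\<tau>. spc (descent \<epsilon> K ;; factorize) \<tau> Q)"
    proof (rule add_pairs_spec[OF i2 inv2], rule spec_Seq)
      fix \<tau>3 assume 3: "agree {3, 4, 5, 6, 9, 10} {2, 3} \<tau>2 \<tau>3" "inverse_pair n (S_of (\<lambda>_. W)) (G_of \<tau>3)"
      have i3: "inp n adj w \<tau>3" by (rule inp_agree[OF i2 3(1)]) auto
      have v3: "vars \<tau>3 7 = W" "\<And>a. a < n \<Longrightarrow> arr \<tau>3 4 a = W" "cnt \<tau>3 = cnt \<sigma>"
        using agreeD[OF 3(1)] agreeD[OF 2(1)] 1 agreeD(3)[OF 1(1)] 2(3) by auto
      show "spc (descent \<epsilon> K) \<tau>3 (\<lambda>\<tau>. spc factorize \<tau> Q)"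
      proof (rule descent_spec[OF _ v3(1) \<epsilon> K 3(2) v3(2)])
        show "vars \<tau>3 2 = real n" using i3 by (simp add: inp_def)
        fix \<tau>4 assume 4: "agree {3, 5, 6, 8, 9, 10, 11, 13} {2, 3, 4} \<tau>3 \<tau>4" "feasible (arr \<tau>4 4) (G_of \<tau>4)"
          "\<And>i. i < n \<Longrightarrow> (\<epsilon> * W / n * G_of \<tau>4 i i - 1)\<^sup>2 < \<epsilon>\<^sup>2"
        have i4: "inp n adj w \<tau>4" by (rule inp_agree[OF i3 4(1)]) auto
        show "spc factorize \<tau>4 Q"
        proof (rule factorize_spec)
          show "vars \<tau>4 2 = real n" using i4 by (simp add: inp_def)
          fix \<tau> assume t: "agree {3, 12} {5, 8} \<tau>4 \<tau>" "vars \<tau> 12 = (\<Sum>i<n. arr \<tau>4 4 i)" "arr \<tau> 8 0 = 0"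
            "\<And>i j. i < n \<Longrightarrow> j < n \<Longrightarrow> arr \<tau> 5 (n * i + j) = chol (fmat n (G_of \<tau>4)) $$ (i, j)"
          have e: "arr \<tau> 4 = arr \<tau>4 4" "G_of \<tau> = G_of \<tau>4"
            using agreeD(2)[OF t(1), of 4] agreeD(2)[OF t(1), of 2] by (auto simp: G_of_def fun_eq_iff)
          show "Q \<tau>"
          proof (rule Q)
            show "inp n adj w \<tau>" by (rule inp_agree[OF i4 t(1)]) auto
            show "cnt \<tau> = cnt \<sigma>" using agreeD(3)[OF t(1)] agreeD(3)[OF 4(1)] v3 by simp
          qed (use t 4 e in auto)
        qed
      qed
    qed
  qed
qed

end

definition push :: "expr \<Rightarrow> com" where
  "push e = Put 8 (Var 17) e ;; Assign 17 (Bin Plus (Var 17) (Lit 1))"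

definition emit :: com where
  "emit = Assign 17 (Lit 1) ;;
     For 3 (Var 2) (For 4 (Var 2) (push (Bin Times (Arr 1 (ix 3 4)) (sq_diff 3 4)))) ;;
     push (Var 12) ;; push (Bin Divide (Var 15) (Var 12)) ;;
     For 3 (Var 2) (push (Arr 7 (Var 3))) ;; For 3 (Var 2) (push (Arr 4 (Var 3))) ;;
     push (Lit 1) ;; push (Lit 1) ;; For 3 (Var 2) (push (Arr 7 (Var 3))) ;;
     Put 8 (Lit 0) (Bin Minus (Var 17) (Lit 1))"

definition draw_vector :: com where
  "draw_vector = For 3 (Var 2) (Draw 16 ;; Put 6 (Var 3) (Var 16))"

definition cut_bits :: com where
  "cut_bits = For 3 (Var 2) (Assign 14 (Lit 0) ;;
     For 4 (Var 2) (Assign 14 (Bin Plus (Var 14) (Bin Times (Arr 5 (ix 3 4)) (Arr 6 (Var 4))))) ;;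
     Put 7 (Var 3) (Lit 0) ;; IfNonneg (Var 14) (Put 7 (Var 3) (Lit 1)))"

definition cut_value :: com where
  "cut_value = Assign 15 (Lit 0) ;; For 3 (Var 2) (For 4 (Var 2)
     (Assign 15 (Bin Plus (Var 15) (Bin Times (wgt 3 4) (Bin Divide (sq_diff 3 4) (Lit 2))))))"

definition rounding :: "real \<Rightarrow> com" where
  "rounding \<beta> = draw_vector ;; cut_bits ;; cut_value ;;
     IfNonneg (Bin Minus (Var 15) (Bin Times (Lit \<beta>) (Var 12))) emit"

definition copy_output :: com where
  "copy_output = For 3 (Bin Plus (Bin Times (Var 2) (Var 2)) (Bin Plus (Bin Times (Lit 3) (Var 2)) (Lit 5)))
     (Put 0 (Var 3) (Arr 8 (Bin Plus (Lit 64) (Var 3))))"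

definition finish :: "real \<Rightarrow> nat \<Rightarrow> com" where
  "finish \<beta> R = For 13 (Bin Times (Lit (real R)) (Var 2)) (rounding \<beta>) ;; copy_output"

definition half_space :: "nat \<Rightarrow> (nat \<Rightarrow> nat \<Rightarrow> real) \<Rightarrow> (nat \<Rightarrow> real) \<Rightarrow> nat \<Rightarrow> nat \<Rightarrow> bool" where
  "half_space n V \<omega> k i \<longleftrightarrow> 0 \<le> (\<Sum>j<n. V i j * \<omega> (k * n + j))"

definition cut_sum :: "nat \<Rightarrow> (nat \<Rightarrow> nat \<Rightarrow> real) \<Rightarrow> (nat \<Rightarrow> bool) \<Rightarrow> real" where
  "cut_sum n w b = (\<Sum>i<n. \<Sum>j<n. w i j * (of_bool (b i \<noteq> b j) / 2))"

definition matrix_word :: "nat \<Rightarrow> (nat \<Rightarrow> nat \<Rightarrow> real) \<Rightarrow> real list" where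
  "matrix_word n f = concat (map (\<lambda>i. map (f i) [0..<n]) [0..<n])"

definition output_word ::
  "nat \<Rightarrow> (nat \<Rightarrow> nat \<Rightarrow> real) \<Rightarrow> (nat \<Rightarrow> real) \<Rightarrow> real \<Rightarrow> (nat \<Rightarrow> bool) \<Rightarrow> real \<Rightarrow> real list" where
  "output_word n adj x \<rho> b c = matrix_word n (\<lambda>i j. adj i j * of_bool (b i \<noteq> b j)) @ [\<rho>, c / \<rho>] @
     map (\<lambda>i. of_bool (b i)) [0..<n] @ map x [0..<n] @ [1, 1] @ map (\<lambda>i. of_bool (b i)) [0..<n]"

lemma length_matrix_word [simp]: "length (matrix_word n f) = n * n"
  by (simp add: matrix_word_def length_concat o_def sum_list_triv)

lemma matrix_word_nth:
  assumes "i < n" "j < n"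
  shows "matrix_word n f ! (n * i + j) = f i j"
proof -
  have "concat (map (\<lambda>i. map (f i) [0..<n]) [0..<m]) ! (n * i + j) = f i j" if "i < m" for m
    using that
  proof (induction m)
    case (Suc m)
    let ?c = "concat (map (\<lambda>i. map (f i) [0..<n]) [0..<m])"
    have l: "length ?c = n * m" by (simp add: length_concat o_def sum_list_triv)
    show ?case
    proof (cases "i = m")
      case True
      then show ?thesis using l assms by (simp add: nth_append)
    next
      case False
      then have i: "i < m" using Suc.prems by simp
      have "n * i + j < n * Suc i" using assms by simp
      also have "\<dots> \<le> n * m" using i by (intro mult_le_mono2) simp
      finally show ?thesis using Suc.IH[OF i] l by (simp add: nth_append)
    qed
  qed simp
  then show ?thesis using assms by (simp add: matrix_word_def)
qed

lemma length_output_word [simp]: "length (output_word n adj x \<rho> b c) = n * n + 3 * n + 4"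
  by (simp add: output_word_def)

definition pushed :: "store \<Rightarrow> real list \<Rightarrow> bool" where
  "pushed \<sigma> v \<longleftrightarrow> vars \<sigma> 17 = real (Suc (length v)) \<and> (\<forall>i<length v. arr \<sigma> 8 (Suc i) = v ! i)"

lemma pushed_setv: "c \<noteq> 17 \<Longrightarrow> pushed (setv c r \<sigma>) v = pushed \<sigma> v"
  by (simp add: pushed_def)

context program_spec
begin

lemma push_spec:
  assumes p: "pushed \<sigma> v" and l: "Suc (length v) < N" and e: "okE N e \<sigma>" "ev e \<sigma> = r"
    and Q: "\<And>\<tau>. agree {17} {8} \<sigma> \<tau> \<Longrightarrow> pushed \<tau> (v @ [r]) \<Longrightarrow> Q \<tau>"
  shows "spc (push e) \<sigma> Q"
  unfolding push_def
proof (rule spec_Seq, rule spec_Put[OF _ e(1) _ l])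
  show "spc (Assign 17 (Bin Plus (Var 17) (Lit 1))) (seta 8 (Suc (length v)) (ev e \<sigma>) \<sigma>) Q"
  proof (rule spec_Assign)
    let ?t = "seta 8 (Suc (length v)) (ev e \<sigma>) \<sigma>"
    let ?u = "setv 17 (ev (Bin Plus (Var 17) (Lit 1)) ?t) ?t"
    show "Q ?u"
    proof (rule Q)
      show "agree {17} {8} \<sigma> ?u" by (intro agree_setv agree_seta) auto
      show "pushed ?u (v @ [r])" using p e by (auto simp: pushed_def nth_append less_Suc_eq)
    qed
  qed simp
qed (use p in \<open>auto simp: pushed_def\<close>)

lemma push_vector_spec:
  assumes p: "pushed \<sigma> v" and l: "length v + n < N" and n: "vars \<sigma> 2 = real n" and c: "c \<noteq> 2" "c \<noteq> 17"
    and e: "\<And>\<tau> i. agree {c, 17} {8} \<sigma> \<tau> \<Longrightarrow> vars \<tau> c = real i \<Longrightarrow> i < n \<Longrightarrow> okE N e \<tau> \<and> ev e \<tau> = F i"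
    and Q: "\<And>\<tau>. agree {c, 17} {8} \<sigma> \<tau> \<Longrightarrow> pushed \<tau> (v @ map F [0..<n]) \<Longrightarrow> Q \<tau>"
  shows "spc (For c (Var 2) (push e)) \<sigma> Q"
proof (rule spec_For[where m=n and I="\<lambda>i \<tau>. agree {c, 17} {8} \<sigma> \<tau> \<and> pushed \<tau> (v @ map F [0..<i])"])
  fix i \<tau> assume i: "i < n" and I: "agree {c, 17} {8} \<sigma> \<tau> \<and> pushed \<tau> (v @ map F [0..<i])"
  let ?t = "setv c (real i) \<tau>"
  have a: "agree {c, 17} {8} \<sigma> ?t" using I by (auto intro: agree_setv)
  have e': "okE N e ?t" "ev e ?t = F i" using e[OF a] i by simp_all
  show "spc (push e) ?t (\<lambda>\<tau>. agree {c, 17} {8} \<sigma> \<tau> \<and> pushed \<tau> (v @ map F [0..<Suc i]))"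
  proof (rule push_spec[where v="v @ map F [0..<i]", OF _ _ e'])
    show "pushed ?t (v @ map F [0..<i])" using I c by (simp add: pushed_setv)
    fix \<tau>' assume t: "agree {17} {8} ?t \<tau>'" "pushed \<tau>' ((v @ map F [0..<i]) @ [F i])"
    show "agree {c, 17} {8} \<sigma> \<tau>' \<and> pushed \<tau>' (v @ map F [0..<Suc i])"
      using agree_trans[OF a t(1)] t(2) by (simp add: insert_commute)
  qed (use l i in simp)
qed (use p n N_bounds Q in auto)

lemma push_matrix_spec:
  assumes p: "pushed \<sigma> []" and n: "vars \<sigma> 2 = real n"
    and e: "\<And>\<tau> i j. agree {3, 4, 17} {8} \<sigma> \<tau> \<Longrightarrow> vars \<tau> 3 = real i \<Longrightarrow> vars \<tau> 4 = real j \<Longrightarrow> i < n \<Longrightarrow> j < n \<Longrightarrow>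
      okE N e \<tau> \<and> ev e \<tau> = F i j"
    and Q: "\<And>\<tau>. agree {3, 4, 17} {8} \<sigma> \<tau> \<Longrightarrow> pushed \<tau> (matrix_word n F) \<Longrightarrow> Q \<tau>"
  shows "spc (For 3 (Var 2) (For 4 (Var 2) (push e))) \<sigma> Q"
proof -
  define pre where "pre i = concat (map (\<lambda>i. map (F i) [0..<n]) [0..<i])" for i
  have len: "length (pre i) = n * i" for i by (simp add: pre_def length_concat o_def sum_list_triv)
  show ?thesis
  proof (rule spec_For[where m=n and I="\<lambda>i \<tau>. agree {3, 4, 17} {8} \<sigma> \<tau> \<and> pushed \<tau> (pre i)"])
    show "agree {3, 4, 17} {8} \<sigma> \<sigma> \<and> pushed \<sigma> (pre 0)" using p by (simp add: pre_def)
    show "Q \<tau>" if "agree {3, 4, 17} {8} \<sigma> \<tau> \<and> pushed \<tau> (pre n)" for \<tau>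
      by (rule Q) (use that in \<open>auto simp: pre_def matrix_word_def\<close>)
    fix i \<tau> assume i: "i < n" and I: "agree {3, 4, 17} {8} \<sigma> \<tau> \<and> pushed \<tau> (pre i)"
    let ?t = "setv 3 (real i) \<tau>"
    have a: "agree {3, 4, 17} {8} \<sigma> ?t" using I by (auto intro: agree_setv)
    show "spc (For 4 (Var 2) (push e)) ?t (\<lambda>\<tau>. agree {3, 4, 17} {8} \<sigma> \<tau> \<and> pushed \<tau> (pre (Suc i)))"
    proof (rule push_vector_spec[where v="pre i" and F="F i"])
      show "pushed ?t (pre i)" using I by (simp add: pushed_setv)
      have "n * i + n = n * Suc i" by simp
      also have "\<dots> \<le> n * n" using i by (intro mult_le_mono2) simp
      finally show "length (pre i) + n < N" using N_bounds len by simp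
      show "vars ?t 2 = real n" using agreeD(1)[OF a, of 2] n by simp
      show "okE N e \<upsilon> \<and> ev e \<upsilon> = F i j" if "agree {4, 17} {8} ?t \<upsilon>" "vars \<upsilon> 4 = real j" "j < n" for \<upsilon> j
      proof (rule e)
        show "agree {3, 4, 17} {8} \<sigma> \<upsilon>" using agree_trans[OF a that(1)] by (simp add: insert_commute)
        show "vars \<upsilon> 3 = real i" using agreeD(1)[OF that(1), of 3] by simp
      qed (use that i in auto)
      show "agree {3, 4, 17} {8} \<sigma> \<upsilon> \<and> pushed \<upsilon> (pre (Suc i))"
        if "agree {4, 17} {8} ?t \<upsilon>" "pushed \<upsilon> (pre i @ map (F i) [0..<n])" for \<upsilon>
        using agree_trans[OF a that(1)] that(2) by (simp add: insert_commute pre_def)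
    qed auto
  qed (use n N_bounds in auto)
qed

lemma ev_sq_diff:
  assumes "vars \<tau> a = real i" "vars \<tau> b = real j" "i < n" "j < n" "\<And>i. i < n \<Longrightarrow> arr \<tau> 7 i = of_bool (s i)"
  shows "okE N (sq_diff a b) \<tau>" "ev (sq_diff a b) \<tau> = of_bool (s i \<noteq> s j)"
  using assms N_bounds by (auto simp: sq_diff_def)

lemma emit_spec:
  assumes i: "inp n adj w \<sigma>" and s: "\<And>i. i < n \<Longrightarrow> arr \<sigma> 7 i = of_bool (s i)"
    and Q: "\<And>\<tau>. agree {3, 4, 17} {8} \<sigma> \<tau> \<Longrightarrow>
      holds_word (arr \<tau> 8) (output_word n adj (arr \<sigma> 4) (vars \<sigma> 12) s (vars \<sigma> 15)) \<Longrightarrow> Q \<tau>"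
  shows "spc emit \<sigma> Q"
proof -
  let ?V = "{3, 4, 17} :: nat set"
  have val: "vars \<tau> 2 = real n" "vars \<tau> 12 = vars \<sigma> 12" "vars \<tau> 15 = vars \<sigma> 15" "arr \<tau> 4 = arr \<sigma> 4"
      "arr \<tau> 7 = arr \<sigma> 7" "arr \<tau> 1 = arr \<sigma> 1" if "agree ?V {8} \<sigma> \<tau>" for \<tau>
    using agreeD[OF that] i by (auto simp: inp_def)
  have tr: "agree ?V {8} \<sigma> \<upsilon>" if "agree ?V {8} \<sigma> \<tau>" "agree V {8} \<tau> \<upsilon>" "V \<subseteq> ?V" for \<tau> \<upsilon> V
  proof -
    have "?V \<union> V = ?V" using that(3) by blast
    then show ?thesis using agree_trans[OF that(1,2)] by (simp only: Un_absorb)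
  qed
  let ?b = "\<lambda>i. of_bool (s i) :: real"
  let ?m = "matrix_word n (\<lambda>i j. adj i j * of_bool (s i \<noteq> s j))"
  have one: "spc (push e) \<tau> P" if "agree ?V {8} \<sigma> \<tau>" "pushed \<tau> v" "Suc (length v) < N" "okE N e \<tau>" "ev e \<tau> = r"
    "\<And>\<upsilon>. agree ?V {8} \<sigma> \<upsilon> \<Longrightarrow> pushed \<upsilon> (v @ [r]) \<Longrightarrow> P \<upsilon>" for e \<tau> P v r
    by (rule push_spec[OF that(2-5)], rule that(6)) (use tr[OF that(1)] in auto)
  have vec: "spc (For 3 (Var 2) (push (Arr A (Var 3)))) \<tau> P"
    if t0: "agree ?V {8} \<sigma> \<tau>" and p0: "pushed \<tau> v" "length v + n < N" and A: "A \<noteq> 8" "\<And>i. i < n \<Longrightarrow> arr \<sigma> A i = F i"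
    and P: "\<And>\<upsilon>. agree ?V {8} \<sigma> \<upsilon> \<Longrightarrow> pushed \<upsilon> (v @ map F [0..<n]) \<Longrightarrow> P \<upsilon>" for A \<tau> P v F
  proof (rule push_vector_spec[OF p0])
    show "vars \<tau> 2 = real n" by (rule val(1)[OF t0])
    show "okE N (Arr A (Var 3)) \<upsilon> \<and> ev (Arr A (Var 3)) \<upsilon> = F i"
      if t: "agree {3, 17} {8} \<tau> \<upsilon>" "vars \<upsilon> 3 = real i" "i < n" for \<upsilon> i
      using t agreeD(2)[OF t(1), of A] agreeD(2)[OF t0, of A] A N_bounds by simp
    show "P \<upsilon>" if t: "agree {3, 17} {8} \<tau> \<upsilon>" "pushed \<upsilon> (v @ map F [0..<n])" for \<upsilon>
      by (rule P[OF tr[OF t0 t(1)] t(2)]) auto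
  qed auto
  let ?t = "setv 17 (ev (Lit 1) \<sigma>) \<sigma>"
  have a0: "agree ?V {8} \<sigma> ?t" by (intro agree_setv) auto
  show ?thesis
    unfolding emit_def
  proof (rule spec_Seq, rule spec_Assign, simp, rule spec_Seq, rule push_matrix_spec[where F="\<lambda>i j. adj i j * of_bool (s i \<noteq> s j)"])
    show "pushed ?t []" by (simp add: pushed_def)
    show "vars ?t 2 = real n" by (rule val(1)[OF a0])
    show "okE N (Bin Times (Arr 1 (ix 3 4)) (sq_diff 3 4)) \<tau> \<and>
        ev (Bin Times (Arr 1 (ix 3 4)) (sq_diff 3 4)) \<tau> = adj i' j * of_bool (s i' \<noteq> s j)"
      if t: "agree ?V {8} ?t \<tau>" "vars \<tau> 3 = real i'" "vars \<tau> 4 = real j" "i' < n" "j < n" for \<tau> i' j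
    proof -
      have a: "agree ?V {8} \<sigma> \<tau>" by (rule tr[OF a0 t(1)]) simp
      show ?thesis
        using ev_matrix[OF val(1)[OF a] t(2-5) N_bounds(2), where A=1] ev_sq_diff[OF t(2-5), of s] s val(5,6)[OF a] i t(4,5)
        by (simp add: inp_def)
    qed
    fix \<tau>1 assume 1: "agree ?V {8} ?t \<tau>1" "pushed \<tau>1 ?m"
    have a1: "agree ?V {8} \<sigma> \<tau>1" by (rule tr[OF a0 1(1)]) simp
    note sq = spec_Seq
    show "spc (push (Var 12) ;; push (Bin Divide (Var 15) (Var 12)) ;;
     For 3 (Var 2) (push (Arr 7 (Var 3))) ;; For 3 (Var 2) (push (Arr 4 (Var 3))) ;;
     push (Lit 1) ;; push (Lit 1) ;; For 3 (Var 2) (push (Arr 7 (Var 3))) ;;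
     Put 8 (Lit 0) (Bin Minus (Var 17) (Lit 1))) \<tau>1 Q"
    proof (rule sq, rule one[OF a1 1(2), where r="vars \<sigma> 12"], goal_cases)
      case (4 \<tau>2) show ?case
      proof (rule sq, rule one[OF 4, where r="vars \<sigma> 15 / vars \<sigma> 12"], goal_cases)
        case (4 \<tau>3) show ?case
        proof (rule sq, rule vec[OF 4, where F="?b"], goal_cases)
          case (4 \<tau>4) show ?case
          proof (rule sq, rule vec[OF 4, where F="arr \<sigma> 4"], goal_cases)
            case (4 \<tau>5) show ?case
            proof (rule sq, rule one[OF 4, where r=1], goal_cases)
              case (4 \<tau>6) show ?case
              proof (rule sq, rule one[OF 4, where r=1], goal_cases)
                case (4 \<tau>7) show ?case
                proof (rule sq, rule vec[OF 4, where F="?b"], goal_cases)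
                  case (4 \<tau>8)
                  let ?o = "output_word n adj (arr \<sigma> 4) (vars \<sigma> 12) s (vars \<sigma> 15)"
                  have p: "pushed \<tau>8 ?o" using 4(2) by (simp add: output_word_def)
                  show ?case
                  proof (rule spec_Put[where k=0])
                    show "Q (seta 8 0 (ev (Bin Minus (Var 17) (Lit 1)) \<tau>8) \<tau>8)"
                    proof (rule Q)
                      show "agree ?V {8} \<sigma> (seta 8 0 (ev (Bin Minus (Var 17) (Lit 1)) \<tau>8) \<tau>8)"
                        by (intro agree_seta 4) simp
                    qed (use p in \<open>simp add: pushed_def holds_word_def\<close>)
                  qed (use N_bounds in auto)
                qed (use N s in auto)
              qed (use N in auto)
            qed (use N in auto)
          qed (use N in auto)
        qed (use N s in auto)
      qed (use N val[OF 4(1)] in auto)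
    qed (use N val[OF a1] in auto)
  qed
qed

lemma draw_vector_spec:
  assumes n: "vars \<sigma> 2 = real n"
    and Q: "\<And>\<tau>. agree {3, 16} {6} (\<sigma>\<lparr>cnt := cnt \<sigma> + n\<rparr>) \<tau> \<Longrightarrow> (\<And>j. j < n \<Longrightarrow> arr \<tau> 6 j = \<omega> (cnt \<sigma> + j)) \<Longrightarrow> Q \<tau>"
  shows "spc draw_vector \<sigma> Q"
  unfolding draw_vector_def
proof (rule spec_For[where m=n and I="\<lambda>i \<tau>. agree {3, 16} {6} (\<sigma>\<lparr>cnt := cnt \<sigma> + i\<rparr>) \<tau> \<and> (\<forall>j<i. arr \<tau> 6 j = \<omega> (cnt \<sigma> + j))"])
  fix i \<tau> assume i: "i < n" and I: "agree {3, 16} {6} (\<sigma>\<lparr>cnt := cnt \<sigma> + i\<rparr>) \<tau> \<and> (\<forall>j<i. arr \<tau> 6 j = \<omega> (cnt \<sigma> + j))"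
  let ?t = "setv 3 (real i) \<tau>"
  have c: "cnt \<tau> = cnt \<sigma> + i" using I by (simp add: agree_def)
  let ?u = "(setv 16 (\<omega> (cnt ?t)) ?t)\<lparr>cnt := Suc (cnt ?t)\<rparr>"
  have a: "agree {3, 16} {6} (\<sigma>\<lparr>cnt := cnt \<sigma> + Suc i\<rparr>) (seta 6 i (ev (Var 16) ?u) ?u)"
    using I c by (auto simp: agree_def seta_def setv_def)
  have "spc (Put 6 (Var 3) (Var 16)) ?u (\<lambda>\<tau>. agree {3, 16} {6} (\<sigma>\<lparr>cnt := cnt \<sigma> + Suc i\<rparr>) \<tau> \<and> (\<forall>j<Suc i. arr \<tau> 6 j = \<omega> (cnt \<sigma> + j)))"
  proof (rule spec_Put[where k=i])
    have "\<forall>j<Suc i. arr (seta 6 i (ev (Var 16) ?u) ?u) 6 j = \<omega> (cnt \<sigma> + j)"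
      using I c by (auto simp: less_Suc_eq)
    with a show "agree {3, 16} {6} (\<sigma>\<lparr>cnt := cnt \<sigma> + Suc i\<rparr>) (seta 6 i (ev (Var 16) ?u) ?u) \<and>
        (\<forall>j<Suc i. arr (seta 6 i (ev (Var 16) ?u) ?u) 6 j = \<omega> (cnt \<sigma> + j))" ..
  qed (use i N_bounds in auto)
  then show "spc (Draw 16 ;; Put 6 (Var 3) (Var 16)) ?t
      (\<lambda>\<tau>. agree {3, 16} {6} (\<sigma>\<lparr>cnt := cnt \<sigma> + Suc i\<rparr>) \<tau> \<and> (\<forall>j<Suc i. arr \<tau> 6 j = \<omega> (cnt \<sigma> + j)))"
    by (simp add: spec_def)
qed (use n N_bounds Q in auto)

lemma cut_bits_spec:
  assumes n: "vars \<sigma> 2 = real n" and V: "\<And>i j. i < n \<Longrightarrow> j < n \<Longrightarrow> arr \<sigma> 5 (n * i + j) = V i j"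
    and g: "\<And>j. j < n \<Longrightarrow> arr \<sigma> 6 j = g j"
    and Q: "\<And>\<tau>. agree {3, 4, 14} {7} \<sigma> \<tau> \<Longrightarrow> (\<And>i. i < n \<Longrightarrow> arr \<tau> 7 i = of_bool (0 \<le> (\<Sum>j<n. V i j * g j))) \<Longrightarrow> Q \<tau>"
  shows "spc cut_bits \<sigma> Q"
  unfolding cut_bits_def
proof (rule spec_For[where m=n and I="\<lambda>i \<tau>. agree {3, 4, 14} {7} \<sigma> \<tau> \<and> (\<forall>a<i. arr \<tau> 7 a = of_bool (0 \<le> (\<Sum>j<n. V a j * g j)))"])
  let ?A = "agree {3, 4, 14} {7} \<sigma>"
  let ?b = "\<lambda>i. of_bool (0 \<le> (\<Sum>j<n. V i j * g j)) :: real"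
  fix i \<tau> assume i: "i < n" and I: "?A \<tau> \<and> (\<forall>a<i. arr \<tau> 7 a = ?b a)"
  let ?t = "setv 3 (real i) \<tau>"
  let ?u = "setv 14 (ev (Lit 0) ?t) ?t"
  have a: "?A ?u" using I by (auto intro: agree_setv)
  show "spc (Assign 14 (Lit 0) ;; For 4 (Var 2) (Assign 14 (Bin Plus (Var 14) (Bin Times (Arr 5 (ix 3 4)) (Arr 6 (Var 4))))) ;;
     Put 7 (Var 3) (Lit 0) ;; IfNonneg (Var 14) (Put 7 (Var 3) (Lit 1))) ?t (\<lambda>\<tau>. ?A \<tau> \<and> (\<forall>a<Suc i. arr \<tau> 7 a = ?b a))"
  proof (rule spec_Seq, rule spec_Assign, simp, rule spec_Seq, rule spec_sum[where n=n and F="\<lambda>j. V i j * g j"])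
    show "vars ?u 2 = real n" using agreeD(1)[OF a, of 2] n by simp
    show "okE N (Bin Times (Arr 5 (ix 3 4)) (Arr 6 (Var 4))) \<upsilon> \<and> ev (Bin Times (Arr 5 (ix 3 4)) (Arr 6 (Var 4))) \<upsilon> = V i j * g j"
      if t: "agree {4, 14} {} ?u \<upsilon>" "vars \<upsilon> 4 = real j" "j < n" for \<upsilon> j
    proof -
      have a': "?A \<upsilon>" using agree_trans[OF a t(1)] by (simp add: insert_commute)
      have v: "vars \<upsilon> 2 = real n" "vars \<upsilon> 3 = real i" using agreeD(1)[OF t(1)] agreeD(1)[OF a, of 2] n by auto
      show ?thesis
        using ev_matrix[OF v(1,2) t(2) i t(3) N_bounds(2), where A=5] agreeD(2)[OF a', of 5] agreeD(2)[OF a', of 6]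
          V[OF i t(3)] g t(2,3) N_bounds by simp
    qed
    fix \<upsilon> assume t: "agree {4, 14} {} ?u \<upsilon>" "vars \<upsilon> 14 = vars ?u 14 + (\<Sum>j<n. V i j * g j)"
    have a': "?A \<upsilon>" using agree_trans[OF a t(1)] by (simp add: insert_commute)
    have v: "vars \<upsilon> 3 = real i" "arr \<upsilon> 7 = arr \<tau> 7" "vars \<upsilon> 14 = (\<Sum>j<n. V i j * g j)"
      using agreeD[OF t(1)] t(2) by auto
    have iN: "i < N" using i N_bounds by simp
    let ?w = "seta 7 i (ev (Lit 0) \<upsilon>) \<upsilon>"
    have w: "?A ?w" "vars ?w 3 = real i" "vars ?w 14 = (\<Sum>j<n. V i j * g j)"
      using v agree_seta[OF a'] by auto
    have w7: "arr ?w 7 = (arr \<tau> 7)(i := 0)" using v by simp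
    show "spc (Put 7 (Var 3) (Lit 0) ;; IfNonneg (Var 14) (Put 7 (Var 3) (Lit 1))) \<upsilon> (\<lambda>\<tau>. ?A \<tau> \<and> (\<forall>a<Suc i. arr \<tau> 7 a = ?b a))"
    proof (rule spec_Seq, rule spec_Put[OF _ _ _ iN])
      show "spc (IfNonneg (Var 14) (Put 7 (Var 3) (Lit 1))) ?w (\<lambda>\<tau>. ?A \<tau> \<and> (\<forall>a<Suc i. arr \<tau> 7 a = ?b a))"
      proof (rule spec_If)
        assume p: "0 \<le> ev (Var 14) ?w"
        show "spc (Put 7 (Var 3) (Lit 1)) ?w (\<lambda>\<tau>. ?A \<tau> \<and> (\<forall>a<Suc i. arr \<tau> 7 a = ?b a))"
        proof (rule spec_Put[OF _ _ _ iN])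
          let ?x = "seta 7 i (ev (Lit 1) ?w) ?w"
          have "?A ?x" by (rule agree_seta[OF w(1)]) simp
          moreover have "\<forall>a<Suc i. arr ?x 7 a = ?b a" using I p w(3) w7 by (auto simp: less_Suc_eq)
          ultimately show "?A ?x \<and> (\<forall>a<Suc i. arr ?x 7 a = ?b a)" ..
        qed (use w in auto)
      next
        assume p: "\<not> 0 \<le> ev (Var 14) ?w"
        have "\<forall>a<Suc i. arr ?w 7 a = ?b a" using I p w(3) w7 by (auto simp: less_Suc_eq)
        with w(1) show "?A ?w \<and> (\<forall>a<Suc i. arr ?w 7 a = ?b a)" ..
      qed simp
    qed (use v in auto)
  qed (use N_bounds in auto)
qed (use n N_bounds Q in auto)

lemma cut_value_spec:
  assumes i: "inp n adj w \<sigma>" and s: "\<And>i. i < n \<Longrightarrow> arr \<sigma> 7 i = of_bool (s i)"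
    and Q: "\<And>\<tau>. agree {3, 4, 15} {} \<sigma> \<tau> \<Longrightarrow> vars \<tau> 15 = cut_sum n w s \<Longrightarrow> Q \<tau>"
  shows "spc cut_value \<sigma> Q"
  unfolding cut_value_def
proof (rule spec_Seq, rule spec_Assign, simp)
  let ?t = "setv 15 (ev (Lit 0) \<sigma>) \<sigma>"
  have a: "agree {3, 4, 15} {} \<sigma> ?t" by (intro agree_setv) auto
  show "spc (For 3 (Var 2) (For 4 (Var 2) (Assign 15 (Bin Plus (Var 15) (Bin Times (wgt 3 4) (Bin Divide (sq_diff 3 4) (Lit 2))))))) ?t Q"
  proof (rule spec_sum_matrix[where n=n and F="\<lambda>i j. w i j * (of_bool (s i \<noteq> s j) / 2)"])
    show "vars ?t 2 = real n" using i by (simp add: inp_def)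
    show "okE N (Bin Times (wgt 3 4) (Bin Divide (sq_diff 3 4) (Lit 2))) \<tau> \<and>
        ev (Bin Times (wgt 3 4) (Bin Divide (sq_diff 3 4) (Lit 2))) \<tau> = w i' j * (of_bool (s i' \<noteq> s j) / 2)"
      if t: "agree {3, 4, 15} {} ?t \<tau>" "vars \<tau> 3 = real i'" "vars \<tau> 4 = real j" "i' < n" "j < n" for \<tau> i' j
    proof -
      have a': "agree {3, 4, 15} {} \<sigma> \<tau>" using agree_trans[OF a t(1)] by simp
      have "inp n adj w \<tau>" by (rule inp_agree[OF i a']) auto
      from ev_wgt[OF this t(2-5) N_bounds(3)] ev_sq_diff[OF t(2-5), of s] s agreeD(2)[OF a', of 7]
      show ?thesis by simp
    qed
    show "Q \<tau>" if "agree {3, 4, 15} {} ?t \<tau>"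
      "vars \<tau> 15 = vars ?t 15 + (\<Sum>i<n. \<Sum>j<n. w i j * (of_bool (s i \<noteq> s j) / 2))" for \<tau>
      by (rule Q) (use agree_trans[OF a that(1)] that(2) in \<open>simp_all add: cut_sum_def\<close>)
  qed (use N_bounds in auto)
qed

lemma rounding_spec:
  assumes i: "inp n adj w \<sigma>" and c: "cnt \<sigma> = k * n" and V: "\<And>i j. i < n \<Longrightarrow> j < n \<Longrightarrow> arr \<sigma> 5 (n * i + j) = V i j"
    and s: "s = half_space n V \<omega> k"
    and Q: "\<And>\<tau>. agree {3, 4, 14, 15, 16, 17} {6, 7, 8} (\<sigma>\<lparr>cnt := Suc k * n\<rparr>) \<tau> \<Longrightarrow>
      (if \<beta> * vars \<sigma> 12 \<le> cut_sum n w s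
       then holds_word (arr \<tau> 8) (output_word n adj (arr \<sigma> 4) (vars \<sigma> 12) s (cut_sum n w s))
       else arr \<tau> 8 = arr \<sigma> 8) \<Longrightarrow> Q \<tau>"
  shows "spc (rounding \<beta>) \<sigma> Q"
  unfolding rounding_def
proof (rule spec_Seq, rule draw_vector_spec)
  let ?V = "{3, 4, 14, 15, 16, 17} :: nat set" and ?A = "{6, 7, 8} :: nat set"
  let ?s = "\<sigma>\<lparr>cnt := Suc k * n\<rparr>"
  show n: "vars \<sigma> 2 = real n" using i by (simp add: inp_def)
  have iss: "inp n adj w ?s" using i by (simp add: inp_def)
  fix \<tau>1 assume 1: "agree {3, 16} {6} (\<sigma>\<lparr>cnt := cnt \<sigma> + n\<rparr>) \<tau>1" "\<And>j. j < n \<Longrightarrow> arr \<tau>1 6 j = \<omega> (cnt \<sigma> + j)"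
  have a1: "agree {3, 16} {6} ?s \<tau>1" using 1(1) c by (simp add: add.commute)
  show "spc (cut_bits ;; cut_value ;; IfNonneg (Bin Minus (Var 15) (Bin Times (Lit \<beta>) (Var 12))) emit) \<tau>1 Q"
  proof (rule spec_Seq, rule cut_bits_spec[where V=V])
    show "vars \<tau>1 2 = real n" using agreeD(1)[OF a1, of 2] n by simp
    show "arr \<tau>1 5 (n * a + b) = V a b" if "a < n" "b < n" for a b using agreeD(2)[OF a1, of 5] V[OF that] by simp
    fix \<tau>2 assume 2: "agree {3, 4, 14} {7} \<tau>1 \<tau>2"
      "\<And>i. i < n \<Longrightarrow> arr \<tau>2 7 i = of_bool (0 \<le> (\<Sum>j<n. V i j * \<omega> (cnt \<sigma> + j)))"
    have a2: "agree {3, 4, 14, 16} {6, 7} ?s \<tau>2" using agree_trans[OF a1 2(1)] by (simp add: insert_commute)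
    have i2: "inp n adj w \<tau>2" by (rule inp_agree[OF iss a2]) auto
    have b2: "arr \<tau>2 7 i = of_bool (s i)" if "i < n" for i using 2(2)[OF that] c by (simp add: s half_space_def)
    show "spc (cut_value ;; IfNonneg (Bin Minus (Var 15) (Bin Times (Lit \<beta>) (Var 12))) emit) \<tau>2 Q"
    proof (rule spec_Seq, rule cut_value_spec[where s=s, OF i2 b2])
      fix \<tau>3 assume 3: "agree {3, 4, 15} {} \<tau>2 \<tau>3" "vars \<tau>3 15 = cut_sum n w s"
      have a3: "agree {3, 4, 14, 15, 16} {6, 7} ?s \<tau>3" using agree_trans[OF a2 3(1)] by (simp add: insert_commute)
      have v3: "vars \<tau>3 12 = vars \<sigma> 12" "arr \<tau>3 4 = arr \<sigma> 4" "arr \<tau>3 8 = arr \<sigma> 8" "arr \<tau>3 7 = arr \<tau>2 7"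
        using agreeD[OF a3] agreeD(2)[OF 3(1)] by auto
      have i3: "inp n adj w \<tau>3" by (rule inp_agree[OF iss a3]) auto
      have b3: "arr \<tau>3 7 i = of_bool (s i)" if "i < n" for i using b2[OF that] v3 by simp
      have aa: "agree ?V ?A ?s \<upsilon>" if "agree {3, 4, 17} {8} \<tau>3 \<upsilon>" for \<upsilon>
        using agree_trans[OF a3 that] by (simp add: insert_commute)
      show "spc (IfNonneg (Bin Minus (Var 15) (Bin Times (Lit \<beta>) (Var 12))) emit) \<tau>3 Q"
      proof (rule spec_If)
        assume p: "0 \<le> ev (Bin Minus (Var 15) (Bin Times (Lit \<beta>) (Var 12))) \<tau>3"
        show "spc emit \<tau>3 Q"
        proof (rule emit_spec[where s=s, OF i3 b3])
          fix \<tau> assume t: "agree {3, 4, 17} {8} \<tau>3 \<tau>"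
            "holds_word (arr \<tau> 8) (output_word n adj (arr \<tau>3 4) (vars \<tau>3 12) s (vars \<tau>3 15))"
          show "Q \<tau>" by (rule Q[OF aa[OF t(1)]]) (use p t(2) v3 3(2) in simp)
        qed
      next
        assume p: "\<not> 0 \<le> ev (Bin Minus (Var 15) (Bin Times (Lit \<beta>) (Var 12))) \<tau>3"
        show "Q \<tau>3" by (rule Q[OF aa]) (use p v3 3(2) in auto)
      qed simp
    qed
  qed (use 1(2) in auto)
qed

lemma copy_output_spec:
  assumes n: "vars \<sigma> 2 = real n"
    and Q: "\<And>\<tau>. arr \<tau> 8 = arr \<sigma> 8 \<Longrightarrow> (\<And>j. j < n * n + 3 * n + 5 \<Longrightarrow> arr \<tau> 0 j = arr \<sigma> 8 (64 + j)) \<Longrightarrow> Q \<tau>"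
  shows "spc copy_output \<sigma> Q"
  unfolding copy_output_def
proof (rule spec_For[where m="n * n + 3 * n + 5" and I="\<lambda>i \<tau>. agree {3} {0} \<sigma> \<tau> \<and> (\<forall>j<i. arr \<tau> 0 j = arr \<sigma> 8 (64 + j))"])
  fix i \<tau> assume i: "i < n * n + 3 * n + 5" and I: "agree {3} {0} \<sigma> \<tau> \<and> (\<forall>j<i. arr \<tau> 0 j = arr \<sigma> 8 (64 + j))"
  let ?t = "setv 3 (real i) \<tau>"
  have e: "ev (Bin Plus (Lit 64) (Var 3)) ?t = real (64 + i)" by simp
  have iN: "64 + i < N" using i N by simp
  have a: "agree {3} {0} \<sigma> ?t" using I by (auto intro: agree_setv)
  show "spc (Put 0 (Var 3) (Arr 8 (Bin Plus (Lit 64) (Var 3)))) ?t (\<lambda>\<tau>. agree {3} {0} \<sigma> \<tau> \<and> (\<forall>j<Suc i. arr \<tau> 0 j = arr \<sigma> 8 (64 + j)))"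
  proof (rule spec_Put[where k=i])
    show "okE N (Arr 8 (Bin Plus (Lit 64) (Var 3))) ?t" unfolding okE.simps e index_ok_real using iN by simp
    have ee: "ev (Arr 8 (Bin Plus (Lit 64) (Var 3))) ?t = arr \<sigma> 8 (64 + i)"
      unfolding ev.simps(4) e floor_of_nat nat_int using I agreeD(2)[OF a, of 8] by simp
    show "agree {3} {0} \<sigma> (seta 0 i (ev (Arr 8 (Bin Plus (Lit 64) (Var 3))) ?t) ?t) \<and>
      (\<forall>j<Suc i. arr (seta 0 i (ev (Arr 8 (Bin Plus (Lit 64) (Var 3))) ?t) ?t) 0 j = arr \<sigma> 8 (64 + j))"
      unfolding ee using agree_seta[OF a] I by (auto simp: less_Suc_eq)
  qed (use iN in auto)
next
  show "Q \<tau>" if "agree {3} {0} \<sigma> \<tau> \<and> (\<forall>j<n * n + 3 * n + 5. arr \<tau> 0 j = arr \<sigma> 8 (64 + j))" for \<tau>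
    by (rule Q) (use that agreeD(2)[of "{3}" "{0}" \<sigma> \<tau> 8] in auto)
qed (use n N in auto)

lemma finish_spec:
  fixes x :: "nat \<Rightarrow> real" and \<rho> :: real
  assumes i: "inp n adj w \<sigma>" and c: "cnt \<sigma> = 0" and V: "\<And>i j. i < n \<Longrightarrow> j < n \<Longrightarrow> arr \<sigma> 5 (n * i + j) = V i j"
    and x: "arr \<sigma> 4 = x" and \<rho>: "vars \<sigma> 12 = \<rho>" and O: "arr \<sigma> 8 0 = 0" and R: "R * n < N"
    and Q: "\<And>\<tau>. (\<And>j. j < n * n + 3 * n + 5 \<Longrightarrow> arr \<tau> 0 j = arr \<tau> 8 (64 + j)) \<Longrightarrow>
      (\<forall>k<R * n. cut_sum n w (half_space n V \<omega> k) < \<beta> * \<rho>) \<and> arr \<tau> 8 0 = 0 \<or>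
      (\<exists>k<R * n. let s = half_space n V \<omega> k in \<beta> * \<rho> \<le> cut_sum n w s \<and>
         holds_word (arr \<tau> 8) (output_word n adj x \<rho> s (cut_sum n w s))) \<Longrightarrow> Q \<tau>"
  shows "spc (finish \<beta> R) \<sigma> Q"
proof -
  let ?V = "{3, 4, 13, 14, 15, 16, 17} :: nat set" and ?A = "{6, 7, 8} :: nat set"
  let ?s = "half_space n V \<omega>"
  let ?bad = "\<lambda>m. \<forall>k<m. cut_sum n w (?s k) < \<beta> * \<rho>"
  let ?ok = "\<lambda>k \<tau>. \<beta> * \<rho> \<le> cut_sum n w (?s k) \<and> holds_word (arr \<tau> 8) (output_word n adj x \<rho> (?s k) (cut_sum n w (?s k)))"
  define I where "I m \<tau> \<longleftrightarrow> agree ?V ?A (\<sigma>\<lparr>cnt := m * n\<rparr>) \<tau> \<and> (?bad m \<and> arr \<tau> 8 0 = 0 \<or> (\<exists>k<m. ?ok k \<tau>))" for m and \<tau> :: store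
  have n: "vars \<sigma> 2 = real n" using i by (simp add: inp_def)
  show ?thesis
    unfolding finish_def
  proof (rule spec_Seq, rule spec_For[where m="R * n" and I=I])
    show "I 0 \<sigma>" using c O by (auto simp: I_def agree_def)
    fix \<tau> assume I: "I (R * n) \<tau>"
    show "spc copy_output \<tau> Q"
    proof (rule copy_output_spec)
      show "vars \<tau> 2 = real n" using I n by (auto simp: I_def agree_def)
      fix \<tau>' :: store assume t: "arr \<tau>' 8 = arr \<tau> 8" "\<And>j. j < n * n + 3 * n + 5 \<Longrightarrow> arr \<tau>' 0 j = arr \<tau> 8 (64 + j)"
      show "Q \<tau>'"
      proof (rule Q)
        show "?bad (R * n) \<and> arr \<tau>' 8 0 = 0 \<or> (\<exists>k<R * n. let s = ?s k in \<beta> * \<rho> \<le> cut_sum n w s \<and>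
          holds_word (arr \<tau>' 8) (output_word n adj x \<rho> s (cut_sum n w s)))"
          using I unfolding I_def Let_def t(1) by blast
      qed (use t in simp)
    qed
  next
    fix m \<tau> assume m: "m < R * n" and I: "I m \<tau>"
    let ?t = "setv 13 (real m) \<tau>"
    have a: "agree ?V ?A (\<sigma>\<lparr>cnt := m * n\<rparr>) ?t" using I by (auto simp: I_def intro: agree_setv)
    have v: "arr ?t 5 = arr \<sigma> 5" "arr ?t 4 = x" "vars ?t 12 = \<rho>" "cnt ?t = m * n" using agreeD[OF a] x \<rho> by auto
    show "spc (rounding \<beta>) ?t (I (Suc m))"
    proof (rule rounding_spec[OF _ v(4) _ refl])
      show "inp n adj w ?t" by (rule inp_agree[OF _ a]) (use i in \<open>auto simp: inp_def\<close>)
      show "arr ?t 5 (n * a + b) = V a b" if "a < n" "b < n" for a b using v V[OF that] by simp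
      fix \<tau>' assume t: "agree {3, 4, 14, 15, 16, 17} ?A (?t\<lparr>cnt := Suc m * n\<rparr>) \<tau>'"
        "if \<beta> * vars ?t 12 \<le> cut_sum n w (?s m)
         then holds_word (arr \<tau>' 8) (output_word n adj (arr ?t 4) (vars ?t 12) (?s m) (cut_sum n w (?s m)))
         else arr \<tau>' 8 = arr ?t 8"
      have "agree ?V ?A (\<sigma>\<lparr>cnt := Suc m * n\<rparr>) (?t\<lparr>cnt := Suc m * n\<rparr>)" using a by (auto simp: agree_def)
      from agree_trans[OF this t(1)] have 1: "agree ?V ?A (\<sigma>\<lparr>cnt := Suc m * n\<rparr>) \<tau>'" by (simp add: insert_commute)
      have t8: "arr ?t 8 = arr \<tau> 8" by simp
      have 2: "?bad (Suc m) \<and> arr \<tau>' 8 0 = 0 \<or> (\<exists>k<Suc m. ?ok k \<tau>')"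
      proof (cases "\<beta> * \<rho> \<le> cut_sum n w (?s m)")
        case True
        then have "?ok m \<tau>'" using t(2) unfolding v by simp
        then show ?thesis by blast
      next
        case False
        then have e: "arr \<tau>' 8 = arr \<tau> 8" using t(2) unfolding v t8 by simp
        show ?thesis using I False unfolding I_def e by (auto simp: less_Suc_eq)
      qed
      show "I (Suc m) \<tau>'" unfolding I_def using 1 2 ..
    qed
  qed (use n R in auto)
qed

end

section \<open>Cuts and certificates\<close>

definition on_pairs :: "nat set set \<Rightarrow> (nat set \<Rightarrow> real) \<Rightarrow> nat \<Rightarrow> nat \<Rightarrow> real" where
  "on_pairs E f i j = (if {i, j} \<in> E then f {i, j} else 0)"

lemma edge_word_on_pairs: "edge_word n E f = matrix_word n (on_pairs E f)"
  by (simp add: edge_word_def matrix_word_def on_pairs_def[abs_def])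

lemma matrix_word_cong: "(\<And>i j. i < n \<Longrightarrow> j < n \<Longrightarrow> f i j = g i j) \<Longrightarrow> matrix_word n f = matrix_word n g"
  unfolding matrix_word_def by (intro arg_cong[where f=concat] map_cong refl) auto

lemma psd_of_posdef:
  assumes pd: "posdef n S" and dim: "dim_row A = n" "dim_col A = n"
    and idx: "\<And>a b. a < n \<Longrightarrow> b < n \<Longrightarrow> A $$ (a, b) = S a b"
  shows "psd A"
proof -
  have sym: "S a b = S b a" if "a < n" "b < n" for a b using pd that unfolding posdef_def by blast
  have "transpose_mat A = A"
    by (rule eq_matI) (use dim idx sym in auto)
  moreover have "0 \<le> v \<bullet> (A *\<^sub>v v)" if v: "v \<in> carrier_vec n" for v
  proof -
    have "v \<bullet> (A *\<^sub>v v) = (\<Sum>a<n. \<Sum>b<n. v $ a * A $$ (a, b) * v $ b)"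
      using v dim by (simp add: scalar_prod_def sum_distrib_left mult.assoc lessThan_atLeast0)
    also have "\<dots> = qform n S (\<lambda>a. v $ a)" unfolding qform_def using idx by (intro sum.cong refl) auto
    also have "0 \<le> \<dots>"
    proof (cases "\<exists>i<n. v $ i \<noteq> 0")
      case True
      then obtain i where i: "i < n" "v $ i \<noteq> 0" by blast
      show ?thesis using posdefD[OF pd i(1), of "\<lambda>a. v $ a"] i(2) by simp
    next
      case False
      then show ?thesis by (simp add: qform_def)
    qed
    finally show ?thesis .
  qed
  ultimately show ?thesis unfolding psd_def using dim by simp
qed

context
  fixes n :: nat and E :: "nat set set"
  assumes graph: "simple_graph n E"
begin

lemma edge_pair:
  assumes "{i, j} \<in> E"
  shows "i \<noteq> j" "i < n" "j < n"
  using assms graph by (auto simp: simple_graph_def subset_iff)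

lemma edge_obtain:
  assumes "e \<in> E"
  obtains i j where "e = {i, j}" "i < n" "j < n" "i \<noteq> j"
proof -
  have "card e = 2" "e \<subseteq> {..<n}" using assms graph by (auto simp: simple_graph_def)
  then show ?thesis using that by (auto simp: card_2_iff)
qed

lemma finite_edges: "finite E"
  by (rule finite_subset[of _ "Pow {..<n}"]) (use graph in \<open>auto simp: simple_graph_def\<close>)

lemma sum_edges:
  fixes f :: "nat set \<Rightarrow> real"
  shows "(\<Sum>(i, j)\<in>pairs n. on_pairs E f i j) = 2 * (\<Sum>e\<in>E. f e)"
proof -
  let ?P = "{p \<in> pairs n. {fst p, snd p} \<in> E}"
  have "(\<Sum>(i, j)\<in>pairs n. on_pairs E f i j) = (\<Sum>p\<in>?P. f {fst p, snd p})"
    by (rule sum.mono_neutral_cong_right) (auto simp: on_pairs_def split: if_splits)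
  also have "\<dots> = (\<Sum>e\<in>E. \<Sum>p | p \<in> ?P \<and> {fst p, snd p} = e. f {fst p, snd p})"
    by (rule sum.group[symmetric]) (auto simp: finite_edges)
  also have "\<dots> = (\<Sum>e\<in>E. 2 * f e)"
  proof (rule sum.cong[OF refl])
    fix e assume e: "e \<in> E"
    obtain i j where ij: "e = {i, j}" "i < n" "j < n" "i \<noteq> j" by (rule edge_obtain[OF e])
    have "{p. p \<in> ?P \<and> {fst p, snd p} = e} = {(i, j), (j, i)}"
      using e ij by (auto simp: doubleton_eq_iff insert_commute)
    then show "(\<Sum>p | p \<in> ?P \<and> {fst p, snd p} = e. f {fst p, snd p}) = 2 * f e"
      using ij by (simp add: insert_commute)
  qed
  finally show ?thesis by (simp add: sum_distrib_left)
qed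

lemma cut_vec_pair:
  assumes "{i, j} \<in> E"
  shows "cut_vec E S {i, j} = of_bool ((i \<in> S) \<noteq> (j \<in> S))"
  using edge_pair(1)[OF assms] assms by (auto simp: cut_vec_def cut_def indicator_def Int_insert_left)

lemma cut_sum_eq: "(\<Sum>e\<in>E. w e * cut_vec E {i. i < n \<and> s i} e) = cut_sum n (on_pairs E w) s"
proof -
  let ?S = "{i. i < n \<and> s i}"
  have "2 * (\<Sum>e\<in>E. w e * cut_vec E ?S e) = (\<Sum>(i, j)\<in>pairs n. on_pairs E (\<lambda>e. w e * cut_vec E ?S e) i j)"
    by (rule sum_edges[symmetric])
  also have "\<dots> = (\<Sum>(i, j)\<in>pairs n. on_pairs E w i j * of_bool (s i \<noteq> s j))"
    by (rule sum.cong) (auto simp: on_pairs_def cut_vec_pair)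
  also have "\<dots> = 2 * cut_sum n (on_pairs E w) s"
    by (simp add: cut_sum_def sum.cartesian_product sum_distrib_left split_beta)
  finally show ?thesis by simp
qed

lemma edge_vec_pair:
  assumes "i \<noteq> j" "a < n" "b < n"
  shows "edge_vec n {i, j} $ a * edge_vec n {i, j} $ b = pair_diff i j a * pair_diff i j b"
proof -
  have "Min {i, j} = i \<and> Max {i, j} = j \<or> Min {i, j} = j \<and> Max {i, j} = i" by (auto simp: min_def max_def)
  then have "(\<forall>a<n. edge_vec n {i, j} $ a = pair_diff i j a) \<or> (\<forall>a<n. edge_vec n {i, j} $ a = - pair_diff i j a)"
    by (auto simp: edge_vec_def pair_diff_def unit_vec_def)
  then show ?thesis using assms by auto
qed

lemma laplacian_index:
  assumes "a < n" "b < n"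
  shows "laplacian n E w $$ (a, b) = (\<Sum>(i, j)\<in>pairs n. on_pairs E w i j / 2 * (pair_diff i j a * pair_diff i j b))"
proof -
  let ?f = "\<lambda>e. w e * (edge_vec n e $ a * edge_vec n e $ b)"
  have "2 * (\<Sum>e\<in>E. ?f e) = (\<Sum>(i, j)\<in>pairs n. on_pairs E ?f i j)"
    by (rule sum_edges[symmetric])
  also have "\<dots> = (\<Sum>(i, j)\<in>pairs n. on_pairs E w i j * (pair_diff i j a * pair_diff i j b))"
    by (rule sum.cong) (auto simp: on_pairs_def edge_pair edge_vec_pair assms)
  also have "\<dots> = 2 * (\<Sum>(i, j)\<in>pairs n. on_pairs E w i j / 2 * (pair_diff i j a * pair_diff i j b))"
    by (simp add: sum_distrib_left split_beta)
  finally show ?thesis using assms by (simp add: laplacian_def)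
qed

lemma posdef_imp_loewner_ge:
  assumes pd: "posdef n (shifted_laplacian (on_pairs E w) (pairs n) x)"
  shows "mat_diag n x \<succeq> (1 / 4) \<cdot>\<^sub>m laplacian n E w"
proof -
  let ?S = "shifted_laplacian (on_pairs E w) (pairs n) x"
  let ?A = "mat_diag n x - (1 / 4) \<cdot>\<^sub>m laplacian n E w"
  have dim: "dim_row ?A = n" "dim_col ?A = n" by (simp_all add: laplacian_def)
  have idx: "?A $$ (a, b) = ?S a b" if "a < n" "b < n" for a b
  proof -
    have "1 / 4 * laplacian n E w $$ (a, b) = (\<Sum>(i, j)\<in>pairs n. on_pairs E w i j / 8 * (pair_diff i j a * pair_diff i j b))"
      unfolding laplacian_index[OF that] by (simp add: sum_distrib_left split_beta)
    moreover have "dim_row (laplacian n E w) = n" "dim_col (laplacian n E w) = n" by (simp_all add: laplacian_def)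
    ultimately show ?thesis using that by (simp add: shifted_laplacian_def mat_diag_def)
  qed
  show ?thesis unfolding loewner_ge_def by (rule psd_of_posdef[OF pd dim idx])
qed

lemma certificate_of_cut:
  assumes \<beta>: "0 < \<beta>" "\<beta> \<le> 1" and w: "\<forall>e\<in>E. 0 \<le> w e" "\<exists>e\<in>E. w e \<noteq> 0"
    and pd: "posdef n (shifted_laplacian (on_pairs E w) (pairs n) x)"
    and \<rho>: "\<rho> = (\<Sum>i<n. x i)" "0 < \<rho>" and c: "c = cut_sum n (on_pairs E w) s" "\<beta> * \<rho> \<le> c"
    and S: "S = {i. i < n \<and> s i}"
  shows "beta_certificate \<beta> n E w (cut_vec E S) \<rho> (c / \<rho>) S (\<lambda>U. of_bool (U = S)) x"
    "\<exists>e\<in>E. cut_vec E S e \<noteq> 0" "cover_support n (\<lambda>U. of_bool (U = S)) = {S}"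
    "output_word n (on_pairs E (\<lambda>_. 1)) x \<rho> s c \<in>
       certificate_words n E (cut_vec E S) \<rho> (c / \<rho>) S (\<lambda>U. of_bool (U = S)) x"
proof -
  have "0 < \<beta> * \<rho>" using \<beta>(1) \<rho>(2) by (rule mult_pos_pos)
  then have c0: "0 < c" using c(2) by linarith
  have cS: "(\<Sum>e\<in>E. w e * cut_vec E S e) = c" unfolding S c(1) by (rule cut_sum_eq)
  show z: "\<exists>e\<in>E. cut_vec E S e \<noteq> 0"
  proof (rule ccontr)
    assume "\<not> ?thesis"
    then have "(\<Sum>e\<in>E. w e * cut_vec E S e) = 0" by (intro sum.neutral) simp
    then show False using cS c0 by simp
  qed
  have Sn: "S \<subseteq> {..<n}" using S by auto
  have y: "(\<Sum>U\<in>Pow {..<n}. of_bool (U = S) * f U) = f S" for f :: "nat set \<Rightarrow> real"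
  proof -
    have "(\<Sum>U\<in>Pow {..<n}. of_bool (U = S) * f U) = (\<Sum>U\<in>Pow {..<n}. if U = S then f U else 0)"
      by (intro sum.cong) auto
    then show ?thesis using Sn by simp
  qed
  have "(\<Sum>U\<in>Pow {..<n}. of_bool (U = S) * 1 :: real) = 1" by (rule y)
  then have y1: "(\<Sum>U\<in>Pow {..<n}. of_bool (U = S) :: real) = 1" by simp
  have "1 \<le> 1 / \<beta> * (c / \<rho>)" using \<beta> \<rho> c(2) by (simp add: field_simps)
  moreover have "0 \<le> cut_vec E S e" for e by (simp add: cut_vec_def)
  ultimately show "beta_certificate \<beta> n E w (cut_vec E S) \<rho> (c / \<rho>) S (\<lambda>U. of_bool (U = S)) x"
    unfolding beta_certificate_def y y1 cS using \<beta> w(1) \<rho> c(2) Sn c0 z posdef_imp_loewner_ge[OF pd]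
    by (intro conjI) (simp_all, blast)
  show sup: "cover_support n (\<lambda>U. of_bool (U = S)) = {S}" using Sn by (auto simp: cover_support_def)
  have z': "edge_word n E (cut_vec E S) = matrix_word n (\<lambda>i j. on_pairs E (\<lambda>_. 1) i j * of_bool (s i \<noteq> s j))"
    unfolding edge_word_on_pairs by (rule matrix_word_cong) (auto simp: on_pairs_def cut_vec_pair S)
  have S': "set_word n S = map (\<lambda>i. of_bool (s i)) [0..<n]" by (simp add: set_word_def S)
  show "output_word n (on_pairs E (\<lambda>_. 1)) x \<rho> s c \<in>
       certificate_words n E (cut_vec E S) \<rho> (c / \<rho>) S (\<lambda>U. of_bool (U = S)) x"
    unfolding certificate_words_def output_word_def z' S' sup
    by (intro CollectI exI[of _ "[S]"]) (simp add: S')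
qed

lemma weights_on_pairs:
  assumes "\<forall>e\<in>E. 0 \<le> w e" "\<exists>e\<in>E. w e \<noteq> 0"
  shows "weights n (on_pairs E w) (\<Sum>(i, j)\<in>pairs n. on_pairs E w i j)"
proof
  show "0 \<le> on_pairs E w i j" "on_pairs E w i j = on_pairs E w j i" for i j
    using assms(1) by (auto simp: on_pairs_def insert_commute)
  show "on_pairs E w i i = 0" for i using edge_pair(1)[of i i] by (auto simp: on_pairs_def)
  obtain e where e: "e \<in> E" "w e \<noteq> 0" using assms(2) by blast
  then have "0 < w e" using assms(1) by (simp add: less_le)
  then have "0 < (\<Sum>e\<in>E. w e)" using sum_pos2[OF finite_edges e(1), of w] assms(1) by blast
  then show "0 < (\<Sum>(i, j)\<in>pairs n. on_pairs E w i j)" by (simp add: sum_edges)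
qed (rule refl)

end

lemma nonzero_instance_order: "nonzero_instance n E w \<Longrightarrow> 2 \<le> n"
proof -
  assume a: "nonzero_instance n E w"
  then obtain e where "e \<subseteq> {..<n}" "card e = 2" by (auto simp: nonzero_instance_def simple_graph_def)
  then show ?thesis using card_mono[of "{..<n}" e] by simp
qed

lemma instance_word_nth:
  assumes "i < n" "j < n"
  shows "instance_word n E w ! Suc (n * i + j) = on_pairs E (\<lambda>_. 1) i j"
    "instance_word n E w ! Suc (n * n + (n * i + j)) = on_pairs E w i j"
  using assms index_less[OF assms] by (simp_all add: instance_word_def edge_word_on_pairs nth_append matrix_word_nth)

lemma length_instance_word: "length (instance_word n E w) = 2 * n * n + 1"
  by (simp add: instance_word_def edge_word_on_pairs)

section \<open>Success probability\<close>

lemma one_minus_power_le: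
  fixes p :: real
  assumes "0 < p" "p \<le> 1"
  shows "(1 - p) ^ m \<le> 1 / (1 + real m * p)"
proof -
  have "(1 - p) ^ m * (1 + real m * p) \<le> (1 - p) ^ m * (1 + p) ^ m"
    using assms Bernoulli_inequality[of p m] by (intro mult_left_mono) auto
  also have "\<dots> = (1 - p\<^sup>2) ^ m" by (simp add: power_mult_distrib[symmetric] power2_eq_square algebra_simps)
  also have "\<dots> \<le> 1" using assms by (intro power_le_one) (auto simp: power_le_one)
  finally have "(1 - p) ^ m * (1 + real m * p) \<le> 1" .
  moreover have "0 < 1 + real m * p" using assms by (intro add_pos_nonneg) auto
  ultimately show ?thesis by (simp add: pos_le_divide_eq)
qed

lemma half_space_sum:
  fixes n k i :: nat and \<omega> :: "nat \<Rightarrow> real"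
  shows "(\<Sum>j<n. V i j * \<omega> (k * n + j)) = (\<Sum>l\<in>{k * n..<k * n + n}. V i (l - k * n) * \<omega> l)"
  by (rule sum.reindex_bij_witness[of _ "\<lambda>l. l - k * n" "\<lambda>j. k * n + j"]) auto

context weights
begin

lemma half_space_meas: "{\<omega>. half_space n V \<omega> k i \<noteq> half_space n V \<omega> k j} \<in> sets gaussian_sequences"
proof -
  have "{\<omega> \<in> space gaussian_sequences. half_space n V \<omega> k i \<noteq> half_space n V \<omega> k j} \<in> sets gaussian_sequences"
    unfolding half_space_def using measurable_gaussian_sequences[measurable] by measurable
  then show ?thesis by simp
qed

lemma half_space_prob:
  assumes G: "posdef n G" and V: "\<And>i j. i < n \<Longrightarrow> j < n \<Longrightarrow> (\<Sum>l<n. V i l * V j l) = G i j"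
    and ij: "i < n" "j < n" "i \<noteq> j"
  shows "alpha_GW * (1 - cosine G i j) / 2 \<le>
    measure gaussian_sequences {\<omega>. half_space n V \<omega> k i \<noteq> half_space n V \<omega> k j}"
proof -
  let ?I = "{k * n..<k * n + n}"
  have VV: "(\<Sum>l\<in>?I. V a (l - k * n) * V b (l - k * n)) = G a b" if "a < n" "b < n" for a b
    unfolding V[OF that, symmetric]
    by (rule sum.reindex_bij_witness[of _ "\<lambda>j. k * n + j" "\<lambda>l. l - k * n"]) auto
  have sq: "(\<Sum>l\<in>?I. (V a (l - k * n))\<^sup>2) = G a a" if "a < n" for a
    using VV[OF that that] by (simp add: power2_eq_square)
  show ?thesis
    using sign_disagreement_prob[of ?I "\<lambda>l. V i (l - k * n)" "\<lambda>l. V j (l - k * n)"] posdef_minor[OF G ij]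
    unfolding half_space_def half_space_sum VV[OF ij(1,2)] sq[OF ij(1)] sq[OF ij(2)] cosine_def by simp
qed

lemma cut_sum_bounds: "0 \<le> cut_sum n w s" "cut_sum n w s \<le> W / 2"
proof -
  show "0 \<le> cut_sum n w s" unfolding cut_sum_def using w_nonneg by (intro sum_nonneg) simp
  have "cut_sum n w s \<le> (\<Sum>i<n. \<Sum>j<n. w i j / 2)"
    unfolding cut_sum_def using w_nonneg by (intro sum_mono) (simp add: of_bool_def)
  also have "\<dots> = W / 2" by (simp add: W_def sum.cartesian_product sum_divide_distrib split_beta)
  finally show "cut_sum n w s \<le> W / 2" .
qed

lemma round_failure_prob:
  assumes G: "posdef n G" and V: "\<And>i j. i < n \<Longrightarrow> j < n \<Longrightarrow> (\<Sum>l<n. V i l * V j l) = G i j"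
    and \<rho>: "0 < \<rho>" "W \<le> 4 * \<rho>" and \<beta>: "0 < \<beta>"
    and opt: "(alpha_GW + \<beta>) / 2 * \<rho> \<le> alpha_GW * (\<Sum>(i, j)\<in>pairs n. w i j * (1 - cosine G i j) / 4)"
  shows "{\<omega>. cut_sum n w (half_space n V \<omega> k) < \<beta> * \<rho>} \<in> sets gaussian_sequences"
    "measure gaussian_sequences {\<omega>. cut_sum n w (half_space n V \<omega> k) < \<beta> * \<rho>} \<le> 1 - (alpha_GW - \<beta>) / 4"
proof -
  interpret prob_space gaussian_sequences by (rule prob_space_gaussian_sequences)
  let ?D = "\<lambda>i j. {\<omega>. half_space n V \<omega> k i \<noteq> half_space n V \<omega> k j}"
  let ?c = "\<lambda>\<omega>. cut_sum n w (half_space n V \<omega> k)"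
  have c: "?c = (\<lambda>\<omega>. \<Sum>i<n. \<Sum>j<n. w i j * (indicator (?D i j) \<omega> / 2))"
    by (simp add: cut_sum_def indicator_def of_bool_def fun_eq_iff)
  have int_D: "integrable gaussian_sequences (\<lambda>\<omega>. indicator (?D i j) \<omega> :: real)" for i j
    using half_space_meas by (simp add: emeasure_eq_measure)
  have int_c: "integrable gaussian_sequences ?c"
    unfolding c by (intro Bochner_Integration.integrable_sum integrable_mult_right integrable_divide int_D)
  then have [measurable]: "?c \<in> borel_measurable gaussian_sequences" by simp
  have "{\<omega> \<in> space gaussian_sequences. ?c \<omega> < \<beta> * \<rho>} \<in> sets gaussian_sequences" by measurable
  then show B: "{\<omega>. ?c \<omega> < \<beta> * \<rho>} \<in> sets gaussian_sequences" by simp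
  let ?B = "{\<omega>. ?c \<omega> < \<beta> * \<rho>}"
  have "expectation ?c = (\<Sum>i<n. \<Sum>j<n. w i j * (prob (?D i j) / 2))"
    unfolding c using int_D half_space_meas by (simp add: Bochner_Integration.integral_sum)
  also have "\<dots> \<ge> (\<Sum>i<n. \<Sum>j<n. w i j * (alpha_GW * (1 - cosine G i j) / 2 / 2))"
  proof (intro sum_mono)
    fix i j assume ij: "i \<in> {..<n}" "j \<in> {..<n}"
    show "w i j * (alpha_GW * (1 - cosine G i j) / 2 / 2) \<le> w i j * (prob (?D i j) / 2)"
    proof (cases "i = j")
      case False
      have "alpha_GW * (1 - cosine G i j) / 2 \<le> prob (?D i j)"
        by (rule half_space_prob[OF G V]) (use ij False in auto)
      then show ?thesis by (intro mult_left_mono divide_right_mono w_nonneg) auto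
    qed (simp add: w_diag)
  qed
  also have "(\<Sum>i<n. \<Sum>j<n. w i j * (alpha_GW * (1 - cosine G i j) / 2 / 2)) =
      alpha_GW * (\<Sum>(i, j)\<in>pairs n. w i j * (1 - cosine G i j) / 4)"
    by (simp add: sum.cartesian_product sum_distrib_left split_beta mult_ac)
  finally have low: "(alpha_GW + \<beta>) / 2 * \<rho> \<le> expectation ?c" using opt by linarith
  have "expectation ?c \<le> expectation (\<lambda>\<omega>. \<beta> * \<rho> + 2 * \<rho> * (1 - indicator ?B \<omega>))"
  proof (rule integral_mono[OF int_c])
    show "integrable gaussian_sequences (\<lambda>\<omega>. \<beta> * \<rho> + 2 * \<rho> * (1 - indicator ?B \<omega>))"
      using B by (intro Bochner_Integration.integrable_add integrable_mult_right Bochner_Integration.integrable_diff) (auto simp: emeasure_eq_measure)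
    show "?c \<omega> \<le> \<beta> * \<rho> + 2 * \<rho> * (1 - indicator ?B \<omega>)" for \<omega>
    proof (cases "?c \<omega> < \<beta> * \<rho>")
      case False
      have "?c \<omega> \<le> 2 * \<rho>" using cut_sum_bounds(2)[of "half_space n V \<omega> k"] \<rho>(2) by linarith
      moreover have "0 < \<beta> * \<rho>" using \<beta> \<rho>(1) by simp
      ultimately show ?thesis using False by simp
    qed simp
  qed
  also have "\<dots> = \<beta> * \<rho> + 2 * \<rho> * (1 - prob ?B)"
  proof -
    have i: "integrable gaussian_sequences (indicat_real ?B)" using B by (simp add: emeasure_eq_measure)
    have "expectation (\<lambda>\<omega>. \<beta> * \<rho> + 2 * \<rho> * (1 - indicator ?B \<omega>)) =
        expectation (\<lambda>\<omega>. (\<beta> * \<rho> + 2 * \<rho>) - 2 * \<rho> * indicator ?B \<omega>)"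
      by (simp add: algebra_simps)
    also have "\<dots> = (\<beta> * \<rho> + 2 * \<rho>) - 2 * \<rho> * prob ?B"
      using i by (subst Bochner_Integration.integral_diff) (auto simp: prob_space[unfolded space_gaussian_sequences])
    finally show ?thesis by (simp add: algebra_simps)
  qed
  also have "\<dots> = (\<beta> + 2 * (1 - prob ?B)) * \<rho>" by (simp add: algebra_simps)
  finally have "(alpha_GW + \<beta>) / 2 * \<rho> \<le> (\<beta> + 2 * (1 - prob ?B)) * \<rho>"
    using low by (rule order_trans[rotated])
  then have "(alpha_GW + \<beta>) / 2 \<le> \<beta> + 2 * (1 - prob ?B)" using \<rho>(1) by simp
  then show "prob ?B \<le> 1 - (alpha_GW - \<beta>) / 4" by (simp add: field_simps)
qed

lemma rounding_success_prob:
  assumes G: "posdef n G" and V: "\<And>i j. i < n \<Longrightarrow> j < n \<Longrightarrow> (\<Sum>l<n. V i l * V j l) = G i j"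
    and \<rho>: "0 < \<rho>" "W \<le> 4 * \<rho>"
    and opt: "(alpha_GW + \<beta>) / 2 * \<rho> \<le> alpha_GW * (\<Sum>(i, j)\<in>pairs n. w i j * (1 - cosine G i j) / 4)"
    and \<beta>: "0 < \<beta>" "\<beta> < alpha_GW" and R: "4 / (alpha_GW - \<beta>) \<le> real R"
  shows "{\<omega>. \<exists>k<R * n. \<beta> * \<rho> \<le> cut_sum n w (half_space n V \<omega> k)} \<in> sets gaussian_sequences" (is "?A \<in> _")
    "1 - 1 / n \<le> measure gaussian_sequences {\<omega>. \<exists>k<R * n. \<beta> * \<rho> \<le> cut_sum n w (half_space n V \<omega> k)}"
proof -
  interpret prob_space gaussian_sequences by (rule prob_space_gaussian_sequences)
  let ?Q = "\<lambda>k \<omega>. cut_sum n w (half_space n V \<omega> k) < \<beta> * \<rho>"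
  let ?p = "(alpha_GW - \<beta>) / 4"
  have A: "?A = UNIV - {\<omega>. \<forall>k<R * n. ?Q k \<omega>}" by (auto simp: not_less)
  note fail = round_failure_prob[OF G V \<rho> \<beta>(1) opt]
  have "{\<omega> \<in> space gaussian_sequences. \<forall>k\<in>{..<R * n}. ?Q k \<omega>} \<in> sets gaussian_sequences"
    by (rule sets.sets_Collect_finite_All) (use fail(1) in auto)
  then have S: "{\<omega>. \<forall>k<R * n. ?Q k \<omega>} \<in> sets gaussian_sequences" by (simp add: Ball_def)
  then show "?A \<in> sets gaussian_sequences" unfolding A using sets.compl_sets[OF S] by simp
  have J: "disjoint_family_on (\<lambda>k. {k * n..<k * n + n}) {..<R * n}"
    unfolding disjoint_family_on_def
  proof (intro ballI impI)
    fix k l :: nat assume "k \<noteq> l"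
    then have "k * n + n \<le> l * n \<or> l * n + n \<le> k * n"
      using mult_le_mono1[of "Suc k" l n] mult_le_mono1[of "Suc l" k n] by (cases "k < l") auto
    then show "{k * n..<k * n + n} \<inter> {l * n..<l * n + n} = {}" by auto
  qed
  have "prob {\<omega>. \<forall>k<R * n. ?Q k \<omega>} \<le> (1 - ?p) ^ (R * n)"
  proof (rule indep_blocks[OF _ J fail(1) _ fail(2)])
    fix k and \<omega> \<omega>' :: "nat \<Rightarrow> real" assume e: "\<forall>i\<in>{k * n..<k * n + n}. \<omega> i = \<omega>' i"
    have "half_space n V \<omega> k = half_space n V \<omega>' k"
      unfolding half_space_def fun_eq_iff using e by (auto intro!: arg_cong[where f="\<lambda>x. 0 \<le> x"] sum.cong)
    then show "?Q k \<omega> = ?Q k \<omega>'" by simp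
  qed simp_all
  also have "\<dots> \<le> 1 / (1 + real (R * n) * ?p)"
    using \<beta> alpha_GW_bounds by (intro one_minus_power_le) auto
  also have "\<dots> \<le> 1 / n"
  proof -
    have "4 \<le> real R * (alpha_GW - \<beta>)" using R \<beta>(2) by (simp add: field_simps)
    then have "1 \<le> real R * ?p" by simp
    then have "real n * 1 \<le> real n * (real R * ?p)" by (intro mult_left_mono) auto
    then have "real n \<le> 1 + real (R * n) * ?p" by (simp add: mult_ac)
    then show ?thesis using n_pos by (intro divide_left_mono) auto
  qed
  finally have "prob {\<omega>. \<forall>k<R * n. ?Q k \<omega>} \<le> 1 / n" .
  moreover have "prob ?A = 1 - prob {\<omega>. \<forall>k<R * n. ?Q k \<omega>}"
    unfolding A using prob_compl[OF S] by simp
  ultimately show "1 - 1 / n \<le> prob ?A" by simp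
qed

end

definition algorithm :: "real \<Rightarrow> real \<Rightarrow> nat \<Rightarrow> nat \<Rightarrow> com" where
  "algorithm \<beta> \<epsilon> K R = prepare \<epsilon> K ;; finish \<beta> R"

lemmas program_defs = prepare_def total_weight_def init_inverse_def add_pair_def rank_one_def descent_def coordinate_def
  coordinate_update_def factorize_def finish_def rounding_def draw_vector_def cut_bits_def cut_value_def emit_def push_def
  copy_output_def wgt_def ix_def sq_diff_def

lemma wf_algorithm: "wf_com (algorithm \<beta> \<epsilon> K R) 0"
  by (simp add: algorithm_def program_defs)

lemma draw_free_prepare: "draw_free (prepare \<epsilon> K)"
  by (simp add: program_defs)

context weights
begin

lemma algorithm_run:
  fixes \<beta> \<epsilon> :: real and K R c0 :: nat and chol
  defines "P \<equiv> whole_program c0 (algorithm \<beta> \<epsilon> K R) 8"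
  assumes \<epsilon>: "0 < \<epsilon>" "\<epsilon> \<le> 1 / 2" and K: "1 < real K * \<epsilon> * progress \<epsilon>" and c0: "100 + K + R \<le> c0"
    and u: "length u = 2 * n * n + 1" "u ! 0 = real n"
      "\<And>i j. i < n \<Longrightarrow> j < n \<Longrightarrow> u ! Suc (n * i + j) = adj i j"
      "\<And>i j. i < n \<Longrightarrow> j < n \<Longrightarrow> u ! Suc (n * n + (n * i + j)) = w i j"
  shows "\<exists>x G. feasible x G \<and> (\<forall>i<n. (\<epsilon> * W / n * G i i - 1)\<^sup>2 < \<epsilon>\<^sup>2) \<and>
    (\<forall>\<omega>. \<exists>t s. t \<le> poly (whole_time (algorithm \<beta> \<epsilon> K R) 8) (c0 * (n * n + 1)) \<and> run chol \<omega> P u t = s \<and> halted P s \<and>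
      (let \<rho> = (\<Sum>i<n. x i); h = half_space n (\<lambda>i j. chol (fmat n G) $$ (i, j)) \<omega> in
       (\<forall>k<R * n. cut_sum n w (h k) < \<beta> * \<rho>) \<and> holds_word (mem s) [] \<or>
       (\<exists>k<R * n. \<beta> * \<rho> \<le> cut_sum n w (h k) \<and>
          holds_word (mem s) (output_word n adj x \<rho> (h k) (cut_sum n w (h k))))))"
proof -
  define N where "N = c0 * (n * n + 1)"
  have n1: "1 \<le> n" using n_pos by simp
  have "(100 + K + R) * (n * n + 1) \<le> N" unfolding N_def using c0 by (rule mult_le_mono1)
  then have N0: "100 * (n * n) + K * (n * n) + R * (n * n) + (100 + K + R) \<le> N" by (simp add: algebra_simps)
  have nn: "n \<le> n * n" using n1 by simp
  have Rn: "R * n \<le> R * (n * n)" using nn by (rule mult_le_mono2)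
  have "2 * n * n = 2 * (n * n)" by simp
  then have N: "2 * n * n + 10 * n + 100 \<le> N" "K * (n * n) < N" "R * n < N" using N0 nn Rn by linarith+
  have c0': "64 \<le> c0" using c0 by simp
  obtain \<sigma> where \<sigma>: "vars \<sigma> 2 = real n" "\<forall>k<2 * n * n. arr \<sigma> 1 k = u ! Suc k" "cnt \<sigma> = 0"
    and run: "\<And>\<omega>. ok chol \<omega> N (algorithm \<beta> \<epsilon> K R) \<sigma> \<Longrightarrow>
      \<exists>t s. t \<le> poly (whole_time (algorithm \<beta> \<epsilon> K R) 8) N \<and> run chol \<omega> P u t = s \<and> halted P s \<and>
        (\<forall>j<64. mem s j = arr (sem chol \<omega> (algorithm \<beta> \<epsilon> K R) \<sigma>) 8 j) \<and>
        (\<forall>j<N. mem s (64 + j) = arr (sem chol \<omega> (algorithm \<beta> \<epsilon> K R) \<sigma>) 0 j)"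
    using whole_program_correct[OF wf_algorithm n_pos c0' u(1,2) N_def, of chol \<beta> \<epsilon> K R 8] unfolding P_def by blast
  have inp: "inp n adj w \<sigma>"
    unfolding inp_def
  proof (intro conjI allI impI)
    fix i j assume ij: "i < n" "j < n"
    have l: "n * i + j < n * n" by (rule index_less[OF ij])
    show "arr \<sigma> 1 (n * i + j) = adj i j" using \<sigma>(2) l u(3)[OF ij] by simp
    show "arr \<sigma> 1 (n * n + (n * i + j)) = w i j" using \<sigma>(2) l u(4)[OF ij] by simp
  qed (rule \<sigma>(1))
  define \<sigma>1 where "\<sigma>1 = sem chol (\<lambda>_. 0) (prepare \<epsilon> K) \<sigma>"
  define G where "G a b = arr \<sigma>1 2 (n * a + b)" for a b
  define x where "x = arr \<sigma>1 4"
  have "real n ^ 2 * 1 < real n ^ 2 * (real K * \<epsilon> * progress \<epsilon>)"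
    by (rule mult_strict_left_mono[OF K]) (use n_pos in simp)
  then have K': "real n ^ 2 < real (K * (n * n)) * \<epsilon> * progress \<epsilon>" by (simp add: power2_eq_square mult_ac)
  let ?V = "\<lambda>i j. chol (fmat n G) $$ (i, j)"
  let ?F = "\<lambda>\<tau>. inp n adj w \<tau> \<and> cnt \<tau> = 0 \<and> arr \<tau> 8 0 = 0 \<and> feasible (arr \<tau> 4) (\<lambda>a b. arr \<tau> 2 (n * a + b)) \<and>
      (\<forall>i<n. (\<epsilon> * W / n * arr \<tau> 2 (n * i + i) - 1)\<^sup>2 < \<epsilon>\<^sup>2) \<and> vars \<tau> 12 = (\<Sum>i<n. arr \<tau> 4 i) \<and>
      (\<forall>i<n. \<forall>j<n. arr \<tau> 5 (n * i + j) = chol (fmat n (\<lambda>a b. arr \<tau> 2 (n * a + b))) $$ (i, j))"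
  have prep: "ok chol \<omega> N (prepare \<epsilon> K) \<sigma> \<and> ?F \<sigma>1" for \<omega>
  proof -
    interpret P: program_spec n w W chol \<omega> N adj by standard (rule N(1))
    have g: "P.G_of \<tau> = (\<lambda>a b. arr \<tau> 2 (n * a + b))" for \<tau> by (simp add: P.G_of_def fun_eq_iff)
    have "P.spc (prepare \<epsilon> K) \<sigma> ?F"
      by (rule P.prepare_spec[OF inp \<epsilon> K' N(2)]) (use \<sigma>(3) in \<open>simp add: g\<close>)
    moreover have "sem chol \<omega> (prepare \<epsilon> K) \<sigma> = \<sigma>1"
      unfolding \<sigma>1_def using sem_draw_free[OF draw_free_prepare] by metis
    ultimately show ?thesis unfolding spec_def by simp
  qed
  have F: "?F \<sigma>1" using prep by blast
  have "\<exists>t s. t \<le> poly (whole_time (algorithm \<beta> \<epsilon> K R) 8) N \<and> run chol \<omega> P u t = s \<and> halted P s \<and>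
      (let \<rho> = (\<Sum>i<n. x i); h = half_space n ?V \<omega> in
       (\<forall>k<R * n. cut_sum n w (h k) < \<beta> * \<rho>) \<and> holds_word (mem s) [] \<or>
       (\<exists>k<R * n. \<beta> * \<rho> \<le> cut_sum n w (h k) \<and>
          holds_word (mem s) (output_word n adj x \<rho> (h k) (cut_sum n w (h k)))))" for \<omega>
  proof -
    interpret P: program_spec n w W chol \<omega> N adj by standard (rule N(1))
    let ?\<rho> = "\<Sum>i<n. x i" and ?h = "half_space n ?V \<omega>"
    let ?c = "\<lambda>k. cut_sum n w (?h k)"
    let ?w = "\<lambda>k. output_word n adj x ?\<rho> (?h k) (?c k)"
    have "P.spc (finish \<beta> R) \<sigma>1 (\<lambda>\<tau>. (\<forall>j<n * n + 3 * n + 5. arr \<tau> 0 j = arr \<tau> 8 (64 + j)) \<and>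
      ((\<forall>k<R * n. ?c k < \<beta> * ?\<rho>) \<and> arr \<tau> 8 0 = 0 \<or>
       (\<exists>k<R * n. \<beta> * ?\<rho> \<le> ?c k \<and> holds_word (arr \<tau> 8) (?w k))))"
      by (rule P.finish_spec[where V="?V" and x=x and \<rho>="?\<rho>"]) (use F N(3) in \<open>auto simp: x_def G_def[abs_def] Let_def\<close>)
    moreover define \<tau> where "\<tau> = sem chol \<omega> (algorithm \<beta> \<epsilon> K R) \<sigma>"
    moreover have "sem chol \<omega> (prepare \<epsilon> K) \<sigma> = \<sigma>1"
      unfolding \<sigma>1_def using sem_draw_free[OF draw_free_prepare] by metis
    ultimately have ok: "ok chol \<omega> N (algorithm \<beta> \<epsilon> K R) \<sigma>" and \<tau>: "\<forall>j<n * n + 3 * n + 5. arr \<tau> 0 j = arr \<tau> 8 (64 + j)"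
      "(\<forall>k<R * n. ?c k < \<beta> * ?\<rho>) \<and> arr \<tau> 8 0 = 0 \<or> (\<exists>k<R * n. \<beta> * ?\<rho> \<le> ?c k \<and> holds_word (arr \<tau> 8) (?w k))"
      using prep[of \<omega>] by (simp_all add: spec_def algorithm_def)
    obtain t s where ts: "t \<le> poly (whole_time (algorithm \<beta> \<epsilon> K R) 8) N" "run chol \<omega> P u t = s" "halted P s"
      and low: "\<forall>j<64. mem s j = arr \<tau> 8 j" and high: "\<forall>j<N. mem s (64 + j) = arr \<tau> 0 j"
      using run[OF ok] unfolding \<tau>_def by blast
    have mem: "mem s j = arr \<tau> 8 j" if "j < n * n + 3 * n + 5" for j
    proof (cases "j < 64")
      case False
      have "j - 64 < N" "j - 64 < n * n + 3 * n + 5" using that N(1) by simp_all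
      then have "mem s (64 + (j - 64)) = arr \<tau> 8 (64 + (j - 64))" using high \<tau>(1) by simp
      then show ?thesis using False by simp
    qed (use low in simp)
    have "holds_word (mem s) (?w k)" if "holds_word (arr \<tau> 8) (?w k)" for k
      using that unfolding holds_word_def length_output_word by (simp add: mem)
    moreover have "holds_word (mem s) []" if "arr \<tau> 8 0 = 0" using that by (simp add: holds_word_def mem)
    ultimately show ?thesis using ts \<tau>(2) unfolding Let_def by blast
  qed
  then show ?thesis using F unfolding N_def[symmetric] x_def[symmetric] G_def[abs_def, symmetric]
    by (intro exI[of _ x] exI[of _ G]) (simp add: G_def x_def)
qed

end

lemma outputs_unique:
  assumes "outputs chol \<omega> P u v" "halted P (run chol \<omega> P u t)" "holds_word (mem (run chol \<omega> P u t)) v'"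
  shows "v = v'"
proof -
  obtain t' where t': "halted P (run chol \<omega> P u t')" "holds_word (mem (run chol \<omega> P u t')) v"
    using assms(1) by (auto simp: outputs_def)
  have "run chol \<omega> P u t' = run chol \<omega> P u t"
    using run_halted_mono[OF t'(1), of t] run_halted_mono[OF assms(2), of t'] by (cases "t \<le> t'") auto
  then show ?thesis using t'(2) assms(3) by (auto simp: holds_word_def intro: nth_equalityI)
qed

theorem theorem25:
  fixes \<beta> \<tau> C :: real
  assumes "0 < \<beta>" and "\<beta> < alpha_GW"
    and "\<tau> = 1 - \<beta> / alpha_GW"
    and "C = 2187 * pi / (2 * alpha_GW ^ 2 * \<tau> ^ 3)"
  shows "\<exists>P :: program.
    polynomial_time_on {instance_word n E w | n E w. nonzero_instance n E w} P \<and>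
    (\<forall>chol n E w. cholesky_oracle chol \<longrightarrow> nonzero_instance n E w \<longrightarrow>
       outputs_with_prob chol P (instance_word n E w)
         {v. \<exists>z \<rho> \<mu> S y x.
            (\<exists>e\<in>E. z e \<noteq> 0) \<and>
            beta_certificate \<beta> n E w z \<rho> \<mu> S y x \<and>
            int (card (cover_support n y)) \<le> \<lceil>C * ln (real n)\<rceil> \<and>
            v \<in> certificate_words n E z \<rho> \<mu> S y x}
         (1 - 2 / real n))"
proof -
  define \<epsilon> where "\<epsilon> = \<tau> / 14"
  have \<alpha>: "0 < alpha_GW" "alpha_GW \<le> 1" by (rule alpha_GW_bounds)+
  have \<tau>: "0 < \<tau>" "\<tau> < 1" using assms(1-3) \<alpha> by simp_all
  have \<epsilon>: "0 < \<epsilon>" "\<epsilon> < 1" "\<epsilon> \<le> 1 / 2" using \<tau> by (simp_all add: \<epsilon>_def)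
  have \<epsilon>\<alpha>: "alpha_GW * (1 - 7 * \<epsilon>) = (alpha_GW + \<beta>) / 2" using \<alpha> by (simp add: \<epsilon>_def assms(3) field_simps)
  have C: "0 < C" unfolding assms(4) using \<alpha> \<tau> by simp
  define K where "K = Suc (nat \<lceil>1 / (\<epsilon> * progress \<epsilon>)\<rceil>)"
  have p: "0 < \<epsilon> * progress \<epsilon>" using \<epsilon> progress_pos[OF \<epsilon>(1)] by simp
  have "1 / (\<epsilon> * progress \<epsilon>) < real K" unfolding K_def by linarith
  then have K: "1 < real K * \<epsilon> * progress \<epsilon>" using p by (simp add: field_simps)
  define R where "R = nat \<lceil>4 / (alpha_GW - \<beta>)\<rceil>"
  have R: "4 / (alpha_GW - \<beta>) \<le> real R" unfolding R_def by linarith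
  define c0 where "c0 = 100 + K + R"
  define alg where "alg = algorithm \<beta> \<epsilon> K R"
  define P where "P = whole_program c0 alg 8"
  have run: "\<exists>x G. weights.feasible n (on_pairs E w) x G \<and>
    (\<forall>i<n. (\<epsilon> * (\<Sum>(i, j)\<in>pairs n. on_pairs E w i j) / n * G i i - 1)\<^sup>2 < \<epsilon>\<^sup>2) \<and>
    (\<forall>\<omega>. \<exists>t s. t \<le> poly (whole_time alg 8) (c0 * (n * n + 1)) \<and> run chol \<omega> P (instance_word n E w) t = s \<and> halted P s \<and>
      (let \<rho> = (\<Sum>i<n. x i); h = half_space n (\<lambda>i j. chol (fmat n G) $$ (i, j)) \<omega>; w' = on_pairs E w in
       (\<forall>k<R * n. cut_sum n w' (h k) < \<beta> * \<rho>) \<and> holds_word (mem s) [] \<or>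
       (\<exists>k<R * n. \<beta> * \<rho> \<le> cut_sum n w' (h k) \<and>
          holds_word (mem s) (output_word n (on_pairs E (\<lambda>_. 1)) x \<rho> (h k) (cut_sum n w' (h k))))))"
    if "nonzero_instance n E w" for chol n E w
  proof -
    have g: "simple_graph n E" "\<forall>e\<in>E. 0 \<le> w e" "\<exists>e\<in>E. w e \<noteq> 0" using that by (auto simp: nonzero_instance_def)
    interpret weights n "on_pairs E w" "\<Sum>(i, j)\<in>pairs n. on_pairs E w i j" by (rule weights_on_pairs[OF g])
    show ?thesis
      unfolding P_def alg_def Let_def
      by (rule algorithm_run[OF \<epsilon>(1,3) K _ length_instance_word _ instance_word_nth, unfolded Let_def])
        (simp_all add: c0_def instance_word_def)
  qed
  show ?thesis
  proof (intro exI[of _ P] conjI allI impI)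
    show "polynomial_time_on {instance_word n E w | n E w. nonzero_instance n E w} P"
      unfolding polynomial_time_on_def
    proof (intro exI[of _ "pcompose (whole_time alg 8) [:0, c0:]"] allI ballI impI)
      fix chol \<omega> u assume "u \<in> {instance_word n E w | n E w. nonzero_instance n E w}"
      then obtain n E w where u: "u = instance_word n E w" and i: "nonzero_instance n E w" by blast
      obtain t where t: "t \<le> poly (whole_time alg 8) (c0 * (n * n + 1))" "halted P (run chol \<omega> P u t)"
        using run[OF i, of chol] unfolding u by blast
      have "c0 * (n * n + 1) \<le> c0 * length u" unfolding u length_instance_word by (intro mult_le_mono2) simp
      then have "poly (whole_time alg 8) (c0 * (n * n + 1)) \<le> poly (whole_time alg 8) (c0 * length u)"
        by (rule poly_nat_mono)
      then have "t \<le> poly (pcompose (whole_time alg 8) [:0, c0:]) (length u)"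
        using t(1) by (simp add: poly_pcompose mult.commute)
      from run_halted_mono[OF t(2) this] t(2)
      show "halted P (run chol \<omega> P u (poly (pcompose (whole_time alg 8) [:0, c0:]) (length u)))" by simp
    qed
  next
    fix chol n E w assume chol: "cholesky_oracle chol" and i: "nonzero_instance n E w"
    let ?w = "on_pairs E w" and ?u = "instance_word n E w"
    let ?W = "\<Sum>(i, j)\<in>pairs n. ?w i j"
    let ?R = "{v. \<exists>z \<rho> \<mu> S y x. (\<exists>e\<in>E. z e \<noteq> 0) \<and> beta_certificate \<beta> n E w z \<rho> \<mu> S y x \<and>
            int (card (cover_support n y)) \<le> \<lceil>C * ln (real n)\<rceil> \<and> v \<in> certificate_words n E z \<rho> \<mu> S y x}"
    have n2: "2 \<le> n" by (rule nonzero_instance_order[OF i])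
    have g: "simple_graph n E" "\<forall>e\<in>E. 0 \<le> w e" "\<exists>e\<in>E. w e \<noteq> 0" using i by (auto simp: nonzero_instance_def)
    interpret weights n ?w ?W by (rule weights_on_pairs[OF g])
    obtain x G where fe: "feasible x G" and good: "\<forall>i<n. (\<epsilon> * ?W / n * G i i - 1)\<^sup>2 < \<epsilon>\<^sup>2"
      and runs: "\<And>\<omega>. \<exists>t s. t \<le> poly (whole_time alg 8) (c0 * (n * n + 1)) \<and> run chol \<omega> P ?u t = s \<and> halted P s \<and>
      (let \<rho> = (\<Sum>i<n. x i); h = half_space n (\<lambda>i j. chol (fmat n G) $$ (i, j)) \<omega>; w' = ?w in
       (\<forall>k<R * n. cut_sum n w' (h k) < \<beta> * \<rho>) \<and> holds_word (mem s) [] \<or>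
       (\<exists>k<R * n. \<beta> * \<rho> \<le> cut_sum n w' (h k) \<and>
          holds_word (mem s) (output_word n (on_pairs E (\<lambda>_. 1)) x \<rho> (h k) (cut_sum n w' (h k)))))"
      using run[OF i, of chol] by blast
    define \<rho> where "\<rho> = (\<Sum>i<n. x i)"
    define V where "V i j = chol (fmat n G) $$ (i, j)" for i j
    define A where "A = {\<omega>. \<exists>k<R * n. \<beta> * \<rho> \<le> cut_sum n ?w (half_space n V \<omega> k)}"
    have pd: "posdef n (S_of x)" "posdef n G" using fe posdef_inverse by (auto simp: feasible_def)
    have \<rho>: "?W \<le> 4 * \<rho>" unfolding \<rho>_def by (rule feasible_bounds(2)[OF fe])
    then have \<rho>0: "0 < \<rho>" using W_pos by linarith
    have V: "(\<Sum>l<n. V i l * V j l) = G i j" if "i < n" "j < n" for i j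
    proof -
      have "psd (fmat n G)" by (rule psd_of_posdef[OF pd(2)]) auto
      then have c: "cholesky_factor (fmat n G) (chol (fmat n G))" using chol by (simp add: cholesky_oracle_def)
      let ?L = "chol (fmat n G)"
      have L: "?L \<in> carrier_mat n n" "?L * transpose_mat ?L = fmat n G" using c by (auto simp: cholesky_factor_def)
      have "(?L * transpose_mat ?L) $$ (i, j) = (\<Sum>l<n. V i l * V j l)"
        using L(1) that by (simp add: V_def scalar_prod_def lessThan_atLeast0)
      then show ?thesis unfolding L(2) using that by simp
    qed
    have near: "\<bar>\<epsilon> * ?W / n * G i i - 1\<bar> \<le> \<epsilon>" if "i < n" for i
    proof (rule power2_le_imp_le)
      show "\<bar>\<epsilon> * ?W / n * G i i - 1\<bar>\<^sup>2 \<le> \<epsilon>\<^sup>2"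
        unfolding power2_abs using good[rule_format, OF that] by (rule less_imp_le)
    qed (use \<epsilon>(1) in simp)
    have "(1 - 7 * \<epsilon>) * \<rho> \<le> (\<Sum>(i, j)\<in>pairs n. ?w i j * (1 - cosine G i j) / 4)"
      unfolding \<rho>_def by (rule near_optimal[OF fe \<epsilon>(1,2) refl near])
    then have "alpha_GW * ((1 - 7 * \<epsilon>) * \<rho>) \<le> alpha_GW * (\<Sum>(i, j)\<in>pairs n. ?w i j * (1 - cosine G i j) / 4)"
      using \<alpha>(1) by (intro mult_left_mono) auto
    then have opt: "(alpha_GW + \<beta>) / 2 * \<rho> \<le> alpha_GW * (\<Sum>(i, j)\<in>pairs n. ?w i j * (1 - cosine G i j) / 4)"
      unfolding mult.assoc[symmetric] \<epsilon>\<alpha> .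
    note success = rounding_success_prob[OF pd(2) V \<rho>0 \<rho> opt assms(1,2) R, folded A_def]
    have "{\<omega> \<in> space gaussian_sequences. \<exists>v\<in>?R. outputs chol \<omega> P ?u v} = A"
    proof (intro equalityI subsetI)
      fix \<omega> assume "\<omega> \<in> {\<omega> \<in> space gaussian_sequences. \<exists>v\<in>?R. outputs chol \<omega> P ?u v}"
      then obtain v where v: "v \<in> ?R" "outputs chol \<omega> P ?u v" by blast
      have "v \<noteq> []" using v(1) by (auto simp: certificate_words_def)
      then show "\<omega> \<in> A"
        using runs[of \<omega>] outputs_unique[OF v(2)] unfolding A_def V_def \<rho>_def Let_def by blast
    next
      fix \<omega> assume "\<omega> \<in> A"
      then obtain t k where t: "halted P (run chol \<omega> P ?u t)" and k: "\<beta> * \<rho> \<le> cut_sum n ?w (half_space n V \<omega> k)"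
        and h: "holds_word (mem (run chol \<omega> P ?u t)) (output_word n (on_pairs E (\<lambda>_. 1)) x \<rho> (half_space n V \<omega> k)
          (cut_sum n ?w (half_space n V \<omega> k)))"
        using runs[of \<omega>] unfolding A_def V_def[abs_def] \<rho>_def Let_def by (auto simp: not_le[symmetric])
      let ?s = "half_space n V \<omega> k"
      have "\<beta> \<le> 1" using assms(2) \<alpha> by simp
      note cert = certificate_of_cut[OF g(1) assms(1) this g(2,3) pd(1) \<rho>_def \<rho>0 refl k refl]
      have "0 < C * ln (real n)" using C n2 by simp
      then have "1 \<le> \<lceil>C * ln (real n)\<rceil>" by linarith
      then have word: "output_word n (on_pairs E (\<lambda>_. 1)) x \<rho> ?s (cut_sum n ?w ?s) \<in> ?R"
        using cert by (intro CollectI exI conjI) (assumption | simp)+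
      have "outputs chol \<omega> P ?u (output_word n (on_pairs E (\<lambda>_. 1)) x \<rho> ?s (cut_sum n ?w ?s))"
        unfolding outputs_def using t h by blast
      then show "\<omega> \<in> {\<omega> \<in> space gaussian_sequences. \<exists>v\<in>?R. outputs chol \<omega> P ?u v}"
        by (intro CollectI conjI bexI[OF _ word]) simp_all
    qed
    moreover have "1 - 2 / real n \<le> measure gaussian_sequences A"
      using success(2) n2 by (simp add: field_simps)
    ultimately show "outputs_with_prob chol P ?u ?R (1 - 2 / real n)"
      using success(1) by (simp add: outputs_with_prob_def)
  qed
qed

end
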